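(* Let $A$ be the Hahn ring and let $\mathcal{M}$ be the full subcategory of the category of $A$-modules consisting of the multibasic modules. Then $\mathcal{M}$ is abelian and has enough projectives and enough injectives. The projective objects of $\mathcal{M}$ are exactly the multibasic modules that are flat as $A$-modules, and the injective objects of $\mathcal{M}$ are exactly the multibasic modules that are injective as $A$-modules. $\mathcal{M}$ is not a Frobenius category. Submodules, quotients and extensions of multibasic modules (as $A$-modules) are multibasic.
   Context: $\mathbb{F}$ is the field of order $2$. $K$ is the field of Hahn series with value group $\mathbb{R}$ and residue field $\mathbb{F}$: elements are maps $a:\mathbb{R}\to\mathbb{F}$ whose support $\operatorname{supp}(a)=\{q:a_q=1\}$ is a well-ordered subset of $\mathbb{R}$, thought of as formal series $\sum_q a_qt^q$, with pointwise addition and multiplication $(ab)_q=\sum_{u+v=q}a_ub_v$. The valuation is $\nu(a)=\min(\operatorname{supp}(a))$ for $a\ne0$, $\nu(0)=\infty$. The Hahn ring is $A=\{a\in K:\nu(a)\ge0\}$. An $A$-module $M$ is basic if it is non-zero and for all $x,y\in M$ we have $x\in Ay$ or $y\in Ax$; it is multibasic if it is the direct sum of a finite (possibly empty) list of basic submodules. A Frobenius category is an abelian category with enough projectives and enough injectives in which the projective objects and the injective objects coincide. *)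

theory Defs
  imports
    "HOL-Algebra.Module"
    "HOL-Algebra.AbelCoset"
    "HOL-Algebra.Generated_Groups"
    "HOL-Algebra.Free_Abelian_Groups"
    "HOL-Library.Equipollence"
    "HOL-Library.Extended_Real"
    "HOL-Library.Z2"
begin

section \<open>Hahn series over the field with two elements\<close>

definition well_ordered :: "'a::linorder set \<Rightarrow> bool" where
  "well_ordered S \<longleftrightarrow> (\<forall>T. T \<subseteq> S \<and> T \<noteq> {} \<longrightarrow> (\<exists>m\<in>T. \<forall>x\<in>T. m \<le> x))"

definition supp :: "(real \<Rightarrow> bit) \<Rightarrow> real set" where
  "supp a = {q. a q = 1}"

text \<open>The sum defining a product ranges over a finite set whenever the two supports are well
  ordered.\<close>

definition hahn_mult :: "(real \<Rightarrow> bit) \<Rightarrow> (real \<Rightarrow> bit) \<Rightarrow> (real \<Rightarrow> bit)" where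
  "hahn_mult a b = (\<lambda>q. \<Sum>(u, v) | u \<in> supp a \<and> v \<in> supp b \<and> u + v = q. a u * b v)"

definition hahn_field :: "(real \<Rightarrow> bit) ring" where
  "hahn_field =
    \<lparr>carrier = {a. well_ordered (supp a)},
     monoid.mult = hahn_mult,
     one = (\<lambda>q. if q = 0 then 1 else 0),
     ring.zero = (\<lambda>q. 0),
     ring.add = (\<lambda>a b q. a q + b q)\<rparr>"

definition hahn_valuation :: "(real \<Rightarrow> bit) \<Rightarrow> ereal" where
  "hahn_valuation a = (if supp a = {} then \<infinity> else ereal (LEAST q. q \<in> supp a))"

definition hahn_ring :: "(real \<Rightarrow> bit) ring" where
  "hahn_ring = hahn_field\<lparr>carrier := {a \<in> carrier hahn_field. 0 \<le> hahn_valuation a}\<rparr>"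


section \<open>Modules\<close>

definition module_homs ::
  "('a, 'r) ring_scheme \<Rightarrow> ('a, 'b, 'm) module_scheme \<Rightarrow> ('a, 'c, 'n) module_scheme \<Rightarrow> ('b \<Rightarrow> 'c) set"
  where
  "module_homs R M N =
    {f \<in> carrier M \<rightarrow> carrier N.
       (\<forall>x\<in>carrier M. \<forall>y\<in>carrier M. f (x \<oplus>\<^bsub>M\<^esub> y) = f x \<oplus>\<^bsub>N\<^esub> f y) \<and>
       (\<forall>r\<in>carrier R. \<forall>x\<in>carrier M. f (r \<odot>\<^bsub>M\<^esub> x) = r \<odot>\<^bsub>N\<^esub> f x)}"

definition submodule_as_module :: "('a, 'b) module \<Rightarrow> 'b set \<Rightarrow> ('a, 'b) module" where
  "submodule_as_module M N = M\<lparr>carrier := N\<rparr>"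

text \<open>The fields \<open>mult\<close> and \<open>one\<close> of a module record carry no information.\<close>

definition quotient_module :: "('a, 'b) module \<Rightarrow> 'b set \<Rightarrow> ('a, 'b set) module" where
  "quotient_module M N =
    \<lparr>carrier = a_rcosets\<^bsub>M\<^esub> N,
     monoid.mult = undefined,
     one = undefined,
     ring.zero = N,
     ring.add = (\<lambda>C D. C <+>\<^bsub>M\<^esub> D),
     smult = (\<lambda>r C. \<Union>x\<in>C. N +>\<^bsub>M\<^esub> (r \<odot>\<^bsub>M\<^esub> x))\<rparr>"

definition short_exact ::
  "('a, 'r) ring_scheme \<Rightarrow> ('a, 'x) module \<Rightarrow> ('x \<Rightarrow> 'y) \<Rightarrow> ('a, 'y) module \<Rightarrow> ('y \<Rightarrow> 'z)
    \<Rightarrow> ('a, 'z) module \<Rightarrow> bool" where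
  "short_exact R X f Y g Z \<longleftrightarrow>
    Module.module R X \<and> Module.module R Y \<and> Module.module R Z \<and>
    f \<in> module_homs R X Y \<and> g \<in> module_homs R Y Z \<and>
    inj_on f (carrier X) \<and>
    f ` carrier X = {y \<in> carrier Y. g y = \<zero>\<^bsub>Z\<^esub>} \<and>
    g ` carrier Y = carrier Z"

definition basic_module :: "('a, 'r) ring_scheme \<Rightarrow> ('a, 'b) module \<Rightarrow> bool" where
  "basic_module R M \<longleftrightarrow>
    Module.module R M \<and> carrier M \<noteq> {\<zero>\<^bsub>M\<^esub>} \<and>
    (\<forall>x\<in>carrier M. \<forall>y\<in>carrier M.
       (\<exists>r\<in>carrier R. x = r \<odot>\<^bsub>M\<^esub> y) \<or> (\<exists>r\<in>carrier R. y = r \<odot>\<^bsub>M\<^esub> x))"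

definition multibasic_module :: "('a, 'r) ring_scheme \<Rightarrow> ('a, 'b) module \<Rightarrow> bool" where
  "multibasic_module R M \<longleftrightarrow>
    Module.module R M \<and>
    (\<exists>(n::nat) N.
       (\<forall>i<n. submodule (N i) R M \<and> basic_module R (submodule_as_module M (N i))) \<and>
       (\<forall>x\<in>carrier M. \<exists>!c. c \<in> (\<Pi>\<^sub>E i\<in>{..<n}. N i) \<and> x = (\<Oplus>\<^bsub>M\<^esub>i\<in>{..<n}. c i)))"


subsection \<open>Flat and injective modules\<close>

text \<open>The abelian group underlying the tensor product of two modules over a commutative ring, as
  a quotient of the free abelian group on the product of the carriers.\<close>

definition tensor_relations ::
  "('a, 'r) ring_scheme \<Rightarrow> ('a, 'b) module \<Rightarrow> ('a, 'c) module \<Rightarrow> ('b \<times> 'c \<Rightarrow>\<^sub>0 int) set" where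
  "tensor_relations R M X =
    generate (free_Abelian_group (carrier M \<times> carrier X))
      ({frag_of (m \<oplus>\<^bsub>M\<^esub> m', x) - frag_of (m, x) - frag_of (m', x) | m m' x.
          m \<in> carrier M \<and> m' \<in> carrier M \<and> x \<in> carrier X} \<union>
       {frag_of (m, x \<oplus>\<^bsub>X\<^esub> x') - frag_of (m, x) - frag_of (m, x') | m x x'.
          m \<in> carrier M \<and> x \<in> carrier X \<and> x' \<in> carrier X} \<union>
       {frag_of (r \<odot>\<^bsub>M\<^esub> m, x) - frag_of (m, r \<odot>\<^bsub>X\<^esub> x) | r m x.
          r \<in> carrier R \<and> m \<in> carrier M \<and> x \<in> carrier X})"

definition tensor_product ::
  "('a, 'r) ring_scheme \<Rightarrow> ('a, 'b) module \<Rightarrow> ('a, 'c) module \<Rightarrow> ('b \<times> 'c \<Rightarrow>\<^sub>0 int) set monoid"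
  where
  "tensor_product R M X =
    free_Abelian_group (carrier M \<times> carrier X) Mod tensor_relations R M X"

text \<open>The map \<open>M \<otimes> f\<close> from \<open>M \<otimes> X\<close> to \<open>M \<otimes> Y\<close>, for \<open>f\<close> a homomorphism from \<open>X\<close> to \<open>Y\<close>:
  the class of a formal sum \<open>c\<close> is sent to the class of its image.\<close>

definition tensor_map ::
  "('a, 'r) ring_scheme \<Rightarrow> ('a, 'b) module \<Rightarrow> ('a, 'd) module \<Rightarrow> ('c \<Rightarrow> 'd)
    \<Rightarrow> ('b \<times> 'c \<Rightarrow>\<^sub>0 int) set \<Rightarrow> ('b \<times> 'd \<Rightarrow>\<^sub>0 int) set" where
  "tensor_map R M Y f C =
    the_elem ((\<lambda>c. tensor_relations R M Y
                     #>\<^bsub>free_Abelian_group (carrier M \<times> carrier Y)\<^esub>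
                   frag_extend (\<lambda>(m, x). frag_of (m, f x)) c) ` C)"

text \<open>A definition cannot quantify over all types, so flatness and injectivity are tested on
  modules whose elements come from one type \<open>'v\<close>. Testing on ideals is enough in both cases (for
  injectivity this is Baer's criterion), so neither notion depends on \<open>'v\<close> once \<open>'v\<close> contains a
  copy of the ring.\<close>

definition flat_module ::
  "'v itself \<Rightarrow> ('a, 'r) ring_scheme \<Rightarrow> ('a, 'b) module \<Rightarrow> bool" where
  "flat_module (_ :: 'v itself) R M \<longleftrightarrow>
    Module.module R M \<and>
    (\<forall>(X :: ('a, 'v) module) (Y :: ('a, 'v) module) f.
       Module.module R X \<and> Module.module R Y \<and> f \<in> module_homs R X Y \<and> inj_on f (carrier X) \<longrightarrow>
       inj_on (tensor_map R M Y f) (carrier (tensor_product R M X)))"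

definition injective_module ::
  "'v itself \<Rightarrow> ('a, 'r) ring_scheme \<Rightarrow> ('a, 'b) module \<Rightarrow> bool" where
  "injective_module (_ :: 'v itself) R M \<longleftrightarrow>
    Module.module R M \<and>
    (\<forall>(X :: ('a, 'v) module) (Y :: ('a, 'v) module) i f.
       Module.module R X \<and> Module.module R Y \<and> i \<in> module_homs R X Y \<and> inj_on i (carrier X) \<and>
       f \<in> module_homs R X M \<longrightarrow>
       (\<exists>g \<in> module_homs R Y M. \<forall>x\<in>carrier X. g (i x) = f x))"


section \<open>Categories\<close>

text \<open>Morphism sets are indexed by source and target and need not be disjoint. The composite of
  \<open>f \<in> arr C X Y\<close> with \<open>g \<in> arr C Y Z\<close> is \<open>cmp C X Y Z g f\<close>.\<close>

record ('o, 'm) category =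
  obj :: "'o set"
  arr :: "'o \<Rightarrow> 'o \<Rightarrow> 'm set"
  idn :: "'o \<Rightarrow> 'm"
  cmp :: "'o \<Rightarrow> 'o \<Rightarrow> 'o \<Rightarrow> 'm \<Rightarrow> 'm \<Rightarrow> 'm"

record ('o, 'm) preadd_category = "('o, 'm) category" +
  arr_add :: "'o \<Rightarrow> 'o \<Rightarrow> 'm \<Rightarrow> 'm \<Rightarrow> 'm"
  arr_zero :: "'o \<Rightarrow> 'o \<Rightarrow> 'm"

locale category =
  fixes C :: "('o, 'm, 'c) category_scheme"
  assumes idn_closed: "X \<in> obj C \<Longrightarrow> idn C X \<in> arr C X X"
    and cmp_closed:
      "\<lbrakk>X \<in> obj C; Y \<in> obj C; Z \<in> obj C; f \<in> arr C X Y; g \<in> arr C Y Z\<rbrakk>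
        \<Longrightarrow> cmp C X Y Z g f \<in> arr C X Z"
    and cmp_idn_right: "\<lbrakk>X \<in> obj C; Y \<in> obj C; f \<in> arr C X Y\<rbrakk> \<Longrightarrow> cmp C X X Y f (idn C X) = f"
    and cmp_idn_left: "\<lbrakk>X \<in> obj C; Y \<in> obj C; f \<in> arr C X Y\<rbrakk> \<Longrightarrow> cmp C X Y Y (idn C Y) f = f"
    and cmp_assoc:
      "\<lbrakk>W \<in> obj C; X \<in> obj C; Y \<in> obj C; Z \<in> obj C;
        f \<in> arr C W X; g \<in> arr C X Y; h \<in> arr C Y Z\<rbrakk>
        \<Longrightarrow> cmp C W X Z (cmp C X Y Z h g) f = cmp C W Y Z h (cmp C W X Y g f)"

definition arr_group :: "('o, 'm, 'c) preadd_category_scheme \<Rightarrow> 'o \<Rightarrow> 'o \<Rightarrow> 'm monoid" where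
  "arr_group C X Y = \<lparr>carrier = arr C X Y, monoid.mult = arr_add C X Y, one = arr_zero C X Y\<rparr>"

locale preadditive_category = category C
  for C :: "('o, 'm, 'c) preadd_category_scheme" +
  assumes arr_comm_group: "\<lbrakk>X \<in> obj C; Y \<in> obj C\<rbrakk> \<Longrightarrow> comm_group (arr_group C X Y)"
    and cmp_add_right:
      "\<lbrakk>X \<in> obj C; Y \<in> obj C; Z \<in> obj C; f \<in> arr C X Y; f' \<in> arr C X Y; g \<in> arr C Y Z\<rbrakk>
        \<Longrightarrow> cmp C X Y Z g (arr_add C X Y f f') =
            arr_add C X Z (cmp C X Y Z g f) (cmp C X Y Z g f')"
    and cmp_add_left:
      "\<lbrakk>X \<in> obj C; Y \<in> obj C; Z \<in> obj C; f \<in> arr C X Y; g \<in> arr C Y Z; g' \<in> arr C Y Z\<rbrakk>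
        \<Longrightarrow> cmp C X Y Z (arr_add C Y Z g g') f =
            arr_add C X Z (cmp C X Y Z g f) (cmp C X Y Z g' f)"

definition mono_arr :: "('o, 'm, 'c) category_scheme \<Rightarrow> 'o \<Rightarrow> 'o \<Rightarrow> 'm \<Rightarrow> bool" where
  "mono_arr C X Y f \<longleftrightarrow>
    f \<in> arr C X Y \<and>
    (\<forall>W\<in>obj C. \<forall>g\<in>arr C W X. \<forall>h\<in>arr C W X. cmp C W X Y f g = cmp C W X Y f h \<longrightarrow> g = h)"

definition epi_arr :: "('o, 'm, 'c) category_scheme \<Rightarrow> 'o \<Rightarrow> 'o \<Rightarrow> 'm \<Rightarrow> bool" where
  "epi_arr C X Y f \<longleftrightarrow>
    f \<in> arr C X Y \<and>
    (\<forall>Z\<in>obj C. \<forall>g\<in>arr C Y Z. \<forall>h\<in>arr C Y Z. cmp C X Y Z g f = cmp C X Y Z h f \<longrightarrow> g = h)"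

definition zero_object :: "('o, 'm, 'c) category_scheme \<Rightarrow> 'o \<Rightarrow> bool" where
  "zero_object C Z \<longleftrightarrow>
    Z \<in> obj C \<and> (\<forall>X\<in>obj C. (\<exists>!f. f \<in> arr C X Z) \<and> (\<exists>!f. f \<in> arr C Z X))"

definition is_kernel ::
  "('o, 'm, 'c) preadd_category_scheme \<Rightarrow> 'o \<Rightarrow> 'o \<Rightarrow> 'm \<Rightarrow> 'o \<Rightarrow> 'm \<Rightarrow> bool" where
  "is_kernel C X Y f K k \<longleftrightarrow>
    K \<in> obj C \<and> k \<in> arr C K X \<and> cmp C K X Y f k = arr_zero C K Y \<and>
    (\<forall>W\<in>obj C. \<forall>h\<in>arr C W X. cmp C W X Y f h = arr_zero C W Y \<longrightarrow>
       (\<exists>!u. u \<in> arr C W K \<and> cmp C W K X k u = h))"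

definition is_cokernel ::
  "('o, 'm, 'c) preadd_category_scheme \<Rightarrow> 'o \<Rightarrow> 'o \<Rightarrow> 'm \<Rightarrow> 'o \<Rightarrow> 'm \<Rightarrow> bool" where
  "is_cokernel C X Y f Q q \<longleftrightarrow>
    Q \<in> obj C \<and> q \<in> arr C Y Q \<and> cmp C X Y Q q f = arr_zero C X Q \<and>
    (\<forall>W\<in>obj C. \<forall>h\<in>arr C Y W. cmp C X Y W h f = arr_zero C X W \<longrightarrow>
       (\<exists>!u. u \<in> arr C Q W \<and> cmp C Y Q W u q = h))"

definition is_biproduct ::
  "('o, 'm, 'c) preadd_category_scheme \<Rightarrow> 'o \<Rightarrow> 'o \<Rightarrow> 'o \<Rightarrow> 'm \<Rightarrow> 'm \<Rightarrow> 'm \<Rightarrow> 'm \<Rightarrow> bool" where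
  "is_biproduct C X Y B i j p q \<longleftrightarrow>
    B \<in> obj C \<and> i \<in> arr C X B \<and> j \<in> arr C Y B \<and> p \<in> arr C B X \<and> q \<in> arr C B Y \<and>
    cmp C X B X p i = idn C X \<and> cmp C Y B Y q j = idn C Y \<and>
    cmp C Y B X p j = arr_zero C Y X \<and> cmp C X B Y q i = arr_zero C X Y \<and>
    arr_add C B B (cmp C B X B i p) (cmp C B Y B j q) = idn C B"

locale abelian_category = preadditive_category C
  for C :: "('o, 'm, 'c) preadd_category_scheme" +
  assumes has_zero_object: "\<exists>Z. zero_object C Z"
    and has_biproducts:
      "\<lbrakk>X \<in> obj C; Y \<in> obj C\<rbrakk> \<Longrightarrow> \<exists>B i j p q. is_biproduct C X Y B i j p q"
    and has_kernels:
      "\<lbrakk>X \<in> obj C; Y \<in> obj C; f \<in> arr C X Y\<rbrakk> \<Longrightarrow> \<exists>K k. is_kernel C X Y f K k"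
    and has_cokernels:
      "\<lbrakk>X \<in> obj C; Y \<in> obj C; f \<in> arr C X Y\<rbrakk> \<Longrightarrow> \<exists>Q q. is_cokernel C X Y f Q q"
    and mono_is_kernel:
      "\<lbrakk>X \<in> obj C; Y \<in> obj C; mono_arr C X Y f\<rbrakk>
        \<Longrightarrow> \<exists>Z\<in>obj C. \<exists>g\<in>arr C Y Z. is_kernel C Y Z g X f"
    and epi_is_cokernel:
      "\<lbrakk>X \<in> obj C; Y \<in> obj C; epi_arr C X Y f\<rbrakk>
        \<Longrightarrow> \<exists>W\<in>obj C. \<exists>g\<in>arr C W X. is_cokernel C W X g Y f"

definition projective_object :: "('o, 'm, 'c) category_scheme \<Rightarrow> 'o \<Rightarrow> bool" where
  "projective_object C P \<longleftrightarrow>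
    P \<in> obj C \<and>
    (\<forall>X\<in>obj C. \<forall>Y\<in>obj C. \<forall>e f. epi_arr C X Y e \<and> f \<in> arr C P Y \<longrightarrow>
       (\<exists>g\<in>arr C P X. cmp C P X Y e g = f))"

definition injective_object :: "('o, 'm, 'c) category_scheme \<Rightarrow> 'o \<Rightarrow> bool" where
  "injective_object C I \<longleftrightarrow>
    I \<in> obj C \<and>
    (\<forall>X\<in>obj C. \<forall>Y\<in>obj C. \<forall>i f. mono_arr C X Y i \<and> f \<in> arr C X I \<longrightarrow>
       (\<exists>g\<in>arr C Y I. cmp C X Y I g i = f))"

definition enough_projectives :: "('o, 'm, 'c) category_scheme \<Rightarrow> bool" where
  "enough_projectives C \<longleftrightarrow> (\<forall>X\<in>obj C. \<exists>P e. projective_object C P \<and> epi_arr C P X e)"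

definition enough_injectives :: "('o, 'm, 'c) category_scheme \<Rightarrow> bool" where
  "enough_injectives C \<longleftrightarrow> (\<forall>X\<in>obj C. \<exists>I i. injective_object C I \<and> mono_arr C X I i)"

definition frobenius_category :: "('o, 'm, 'c) preadd_category_scheme \<Rightarrow> bool" where
  "frobenius_category C \<longleftrightarrow>
    abelian_category C \<and> enough_projectives C \<and> enough_injectives C \<and>
    (\<forall>X\<in>obj C. projective_object C X \<longleftrightarrow> injective_object C X)"

definition full_subcategory ::
  "('o, 'm, 'c) category_scheme \<Rightarrow> ('o \<Rightarrow> bool) \<Rightarrow> ('o, 'm, 'c) category_scheme" where
  "full_subcategory C P = C\<lparr>obj := {X \<in> obj C. P X}\<rparr>"


subsection \<open>Categories of modules\<close>

text \<open>The type \<open>'u\<close> plays the part of a universe: the objects are the modules whose elements come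
  from \<open>'u\<close>. Morphisms are homomorphisms that are \<open>undefined\<close> outside the carrier of their source,
  so that morphisms are equal if and only if they agree on that carrier.\<close>

definition module_category ::
  "'u itself \<Rightarrow> ('a, 'r) ring_scheme \<Rightarrow> (('a, 'u) module, 'u \<Rightarrow> 'u) preadd_category" where
  "module_category (_ :: 'u itself) R =
    \<lparr>obj = {M. Module.module R M},
     arr = (\<lambda>M N. module_homs R M N \<inter> extensional (carrier M)),
     idn = (\<lambda>M. \<lambda>x\<in>carrier M. x),
     cmp = (\<lambda>L M N g f. compose (carrier L) g f),
     arr_add = (\<lambda>M N f g. \<lambda>x\<in>carrier M. f x \<oplus>\<^bsub>N\<^esub> g x),
     arr_zero = (\<lambda>M N. \<lambda>x\<in>carrier M. \<zero>\<^bsub>N\<^esub>)\<rparr>"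

definition multibasic_category ::
  "'u itself \<Rightarrow> ('a, 'r) ring_scheme \<Rightarrow> (('a, 'u) module, 'u \<Rightarrow> 'u) preadd_category" where
  "multibasic_category u R = full_subcategory (module_category u R) (multibasic_module R)"

end

theory Submission
  imports Defs "HOL-Algebra.Ideal"
begin

text \<open>
  The Hahn field \<open>K\<close> is spherically complete, so nested sequences of cosets of \<open>A\<close>-submodules of
  \<open>K\<^sup>n\<close> have non-empty intersection. Every basic module is the image of a submodule \<open>J\<close> of \<open>K\<close>,
  because the value group has countable cofinality; so a multibasic module is a finite sum of images
  of homomorphisms \<open>J\<^sub>i \<rightarrow> M\<close>. Such a sum inherits linear compactness from \<open>K\<^sup>n\<close>, and a Mittag-Leffler
  argument then gives \<open>Ext(J, M) = 0\<close>; hence finite sums of images of submodules of \<open>K\<close> are closed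
  under submodules, quotients and extensions. Conversely such a sum is multibasic: for a suitable
  index \<open>i\<close> the summand with index \<open>i\<close> can be twisted by a vector of \<open>K\<^sup>n\<close> so that it splits off.

  The vanishing of \<open>Ext(J, M)\<close> also makes torsion-free multibasic modules projective among the
  multibasic ones and, through Baer's criterion, every quotient of \<open>K\<^sup>n\<close> injective. A multibasic
  module has the form \<open>F/L\<close> with \<open>L \<subseteq> F \<subseteq> K\<^sup>n\<close>; it is a quotient of the projective module \<open>F\<close> and
  a submodule of the injective module \<open>K\<^sup>n/L\<close>.
\<close>

section \<open>The Hahn field as a type\<close>

text \<open>Sums of images are preferred to direct sums because an induction that adds one image at
  a time has no independence condition to preserve; independence is recovered once, by the
  splitting. There the modules J_i / I_i are compared through the scalars d that carry I_i into I_k,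
  since a submodule of K may be zero, all of K, or bounded by an attained or unattained value, and
  numerical lengths would not tell these apart. Ext(J, M) can be computed because J is the union of
  a chain of free cyclic modules A e_k: a homomorphism on J is a compatible sequence of values at
  the e_k. Flatness enters through torsion: tensoring with multiplication by a scalar shows that
  flat modules are torsion-free, and in a product of submodules of K any finite set of elements lies
  in a finitely generated free module. Quotients, products and covers have other element types than
  the objects of the category; a multibasic module has at most as many elements as A, so each of
  them has a copy in every universe that contains A.\<close>

declare add_bit_eq_xor [simp del] mult_bit_eq_and [simp del] minus_bit_def [simp del]

section \<open>Well-ordered sets of reals: sums and finiteness\<close>

lemma well_ordered_subset: "well_ordered S \<Longrightarrow> T \<subseteq> S \<Longrightarrow> well_ordered T"
  unfolding well_ordered_def by (meson subset_trans)

text \<open>Series are built below as limits whose coefficients up to any exponent of the support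
  are those of one approximant; this reduces well-orderedness of their support to that of the
  approximants.\<close>

lemma well_ordered_if_initial:
  assumes "\<And>q. q \<in> S \<Longrightarrow> well_ordered (S \<inter> {..q})"
  shows "well_ordered S"
  unfolding well_ordered_def
proof (intro allI impI)
  fix T assume T: "T \<subseteq> S \<and> T \<noteq> {}"
  then obtain t where t: "t \<in> T" by blast
  then have "well_ordered (S \<inter> {..t})" using T assms by blast
  moreover have "T \<inter> {..t} \<subseteq> S \<inter> {..t}" "T \<inter> {..t} \<noteq> {}" using T t by auto
  ultimately obtain m where "m \<in> T \<inter> {..t}" "\<forall>x\<in>T \<inter> {..t}. m \<le> x"
    unfolding well_ordered_def by meson
  then show "\<exists>m\<in>T. \<forall>x\<in>T. m \<le> x" by (intro bexI[of _ m]) (use linear in fastforce)+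
qed

lemma well_ordered_Un:
  assumes "well_ordered S" "well_ordered T"
  shows "well_ordered (S \<union> T)"
  unfolding well_ordered_def
proof (intro allI impI)
  fix X assume X: "X \<subseteq> S \<union> T \<and> X \<noteq> {}"
  show "\<exists>m\<in>X. \<forall>x\<in>X. m \<le> x"
  proof (cases "X \<inter> S = {} \<or> X \<inter> T = {}")
    case True
    then have "X \<subseteq> T \<or> X \<subseteq> S" using X by blast
    then show ?thesis using X assms unfolding well_ordered_def by blast
  next
    case False
    then obtain m n where mn: "m \<in> X \<inter> S" "\<forall>x\<in>X \<inter> S. m \<le> x" "n \<in> X \<inter> T" "\<forall>x\<in>X \<inter> T. n \<le> x"
      using assms unfolding well_ordered_def by (meson inf_le2)
    then have "min m n \<in> X" "min m n \<le> x" if "x \<in> X" for x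
    proof -
      have "x \<in> X \<inter> S \<or> x \<in> X \<inter> T" using X that by blast
      then show "min m n \<le> x" using mn by (meson min.coboundedI1 min.coboundedI2)
    qed (use mn in \<open>auto simp: min_def\<close>)
    then show ?thesis using X by blast
  qed
qed

lemma well_ordered_finite: "finite S \<Longrightarrow> well_ordered S"
  unfolding well_ordered_def by (metis Min_in Min_le finite_subset)

lemma well_ordered_no_descent:
  "well_ordered S \<longleftrightarrow> \<not> (\<exists>f :: nat \<Rightarrow> 'a::linorder. \<forall>n. f n \<in> S \<and> f (Suc n) < f n)"
proof
  assume S: "well_ordered S"
  show "\<not> (\<exists>f :: nat \<Rightarrow> 'a. \<forall>n. f n \<in> S \<and> f (Suc n) < f n)"
  proof
    assume "\<exists>f :: nat \<Rightarrow> 'a. \<forall>n. f n \<in> S \<and> f (Suc n) < f n"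
    then obtain f :: "nat \<Rightarrow> 'a" where f: "\<And>n. f n \<in> S" "\<And>n. f (Suc n) < f n" by blast
    then have "range f \<subseteq> S" "range f \<noteq> {}" by auto
    then obtain m where "m \<in> range f" "\<forall>x\<in>range f. m \<le> x" using S unfolding well_ordered_def by meson
    then show False using f(2) by (metis leD rangeE rangeI)
  qed
next
  assume no: "\<not> (\<exists>f :: nat \<Rightarrow> 'a. \<forall>n. f n \<in> S \<and> f (Suc n) < f n)"
  show "well_ordered S"
    unfolding well_ordered_def
  proof (intro allI impI, rule ccontr)
    fix T assume T: "T \<subseteq> S \<and> T \<noteq> {}" and n: "\<not> (\<exists>m\<in>T. \<forall>x\<in>T. m \<le> x)"
    have step: "\<exists>y. y \<in> T \<and> y < x" if "x \<in> T" for x using n that by (meson not_le)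
    obtain t where t: "t \<in> T" using T by blast
    obtain f where "\<And>n. f n \<in> T" "\<And>n. f (Suc n) < f n"
      using dependent_nat_choice[of "\<lambda>_ x. x \<in> T" "\<lambda>_ x y. y < x"] step t by blast
    then show False using no T by blast
  qed
qed

lemma well_ordered_descentD:
  fixes f :: "nat \<Rightarrow> 'a::linorder"
  shows "well_ordered S \<Longrightarrow> \<forall>n. f n \<in> S \<and> f (Suc n) < f n \<Longrightarrow> False"
  unfolding well_ordered_no_descent by blast

text \<open>Along a strictly decreasing sequence of sums u + v, pass to a monotone subsequence of
  the u. If it is nondecreasing, the v decrease strictly; otherwise it is nonincreasing, hence
  eventually constant by well-ordering, and the v again decrease strictly.\<close>

lemma well_ordered_sumset:
  fixes S T :: "real set"
  assumes "well_ordered S" "well_ordered T"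
  shows "well_ordered {u + v | u v. u \<in> S \<and> v \<in> T}"
  unfolding well_ordered_no_descent
proof
  assume "\<exists>f. \<forall>n. f n \<in> {u + v | u v. u \<in> S \<and> v \<in> T} \<and> f (Suc n) < f n"
  then obtain f :: "nat \<Rightarrow> real" where f: "\<And>n. \<exists>u v. u \<in> S \<and> v \<in> T \<and> f n = u + v" "\<And>n. f (Suc n) < f n"
    by blast
  then obtain u v where uv: "\<And>n. u n \<in> S" "\<And>n. v n \<in> T" "\<And>n. f n = u n + v n" by metis
  obtain r where r: "strict_mono r" "monoseq (\<lambda>n. u (r n))" using seq_monosub[of u] by blast
  have fm: "f n < f m" if "m < n" for m n :: nat
    using that f(2) by (induction rule: less_Suc_induct) auto
  show False
  proof (cases "\<forall>n. u (r n) \<le> u (r (Suc n))")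
    case True
    have "v (r (Suc n)) < v (r n)" for n
      using True[rule_format, of n] fm[of "r n" "r (Suc n)"] r(1) uv(3)[of "r n"] uv(3)[of "r (Suc n)"] by (simp add: strict_mono_less)
    then have "\<forall>n. v (r n) \<in> T \<and> v (r (Suc n)) < v (r n)" using uv(2) by blast
    then show False by (rule well_ordered_descentD[OF assms(2)])
  next
    case False
    then have dec: "u (r n) \<le> u (r m)" if "m \<le> n" for m n
      using r(2) that le_SucI[OF order_refl] unfolding monoseq_def by blast
    have "range (\<lambda>n. u (r n)) \<subseteq> S" "range (\<lambda>n. u (r n)) \<noteq> {}" using uv by auto
    then obtain m where "m \<in> range (\<lambda>n. u (r n))" "\<forall>x\<in>range (\<lambda>n. u (r n)). m \<le> x"
      using assms(1) unfolding well_ordered_def by meson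
    then obtain N where N: "\<And>n. u (r N) \<le> u (r n)" by auto
    then have eq: "u (r (N + n)) = u (r N)" for n using dec[of N "N + n"] by (simp add: antisym)
    have "v (r (N + Suc n)) < v (r (N + n))" for n
      using eq[of n] eq[of "Suc n"] fm[of "r (N + n)" "r (N + Suc n)"] r(1) uv(3)[of "r (N + n)"] uv(3)[of "r (N + Suc n)"] by (simp add: strict_mono_less)
    then have "\<forall>n. v (r (N + n)) \<in> T \<and> v (r (N + Suc n)) < v (r (N + n))" using uv(2) by blast
    then show False by (rule well_ordered_descentD[OF assms(2)])
  qed
qed

text \<open>If some initial segment were infinite, there would be a least end point \<open>m\<close>
  of such a segment; the elements below \<open>m\<close> have a largest one \<open>k\<close>, whose
  segment is finite, so that of \<open>m\<close> is finite after all. The segment ending at the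
  maximum of \<open>U\<close> is \<open>U\<close> itself.\<close>

lemma finite_if_well_ordered_both:
  fixes U :: "real set"
  assumes "well_ordered U" "well_ordered (uminus ` U)"
  shows "finite U"
proof -
  have mx: "\<exists>m\<in>X. \<forall>x\<in>X. x \<le> m" if "X \<subseteq> U" "X \<noteq> {}" for X
  proof -
    have "uminus ` X \<subseteq> uminus ` U" "uminus ` X \<noteq> {}" using that by auto
    then obtain m where "m \<in> uminus ` X" "\<forall>x\<in>uminus ` X. m \<le> x"
      using assms(2) unfolding well_ordered_def by meson
    then show ?thesis by (intro bexI[of _ "- m"]) auto
  qed
  have fin: "finite {y\<in>U. y \<le> x}" if "x \<in> U" for x
  proof (rule ccontr)
    assume "infinite {y\<in>U. y \<le> x}"
    then have "{x\<in>U. infinite {y\<in>U. y \<le> x}} \<noteq> {}" "{x\<in>U. infinite {y\<in>U. y \<le> x}} \<subseteq> U" using that by auto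
    then obtain m where "m \<in> {x\<in>U. infinite {y\<in>U. y \<le> x}}" "\<forall>x\<in>{x\<in>U. infinite {y\<in>U. y \<le> x}}. m \<le> x"
      using assms(1) unfolding well_ordered_def by meson
    then have m: "m \<in> U" "infinite {y\<in>U. y \<le> m}" "\<And>x. x \<in> U \<Longrightarrow> infinite {y\<in>U. y \<le> x} \<Longrightarrow> m \<le> x"
      by auto
    show False
    proof (cases "{y\<in>U. y < m} = {}")
      case True
      then have "{y\<in>U. y \<le> m} \<subseteq> {m}" by force
      then show False using m(2) finite_subset by blast
    next
      case False
      then obtain k where k: "k \<in> U" "k < m" "\<And>x. x \<in> U \<Longrightarrow> x < m \<Longrightarrow> x \<le> k" using mx[of "{y\<in>U. y < m}"] by auto
      then have "{y\<in>U. y \<le> m} \<subseteq> insert m {y\<in>U. y \<le> k}" by force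
      moreover have "finite {y\<in>U. y \<le> k}" using m(3)[of k] k by fastforce
      ultimately show False using m(2) finite_subset by blast
    qed
  qed
  show ?thesis
  proof (cases "U = {}")
    case False
    then obtain k where "k \<in> U" "\<And>x. x \<in> U \<Longrightarrow> x \<le> k" using mx[of U] by auto
    then have "U = {y\<in>U. y \<le> k}" by auto
    then show ?thesis using fin \<open>k \<in> U\<close> by metis
  qed simp
qed

lemma finite_sum_representations:
  fixes S T :: "real set"
  assumes "well_ordered S" "well_ordered T"
  shows "finite {u\<in>S. q - u \<in> T}"
proof (rule finite_if_well_ordered_both)
  show "well_ordered {u\<in>S. q - u \<in> T}" using assms(1) by (rule well_ordered_subset) auto
  \<comment> \<open>If u + v = q then - u = - q + v, so the negatives lie in the sum of {- q} and
    \<open>T\<close>.\<close>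
  have "well_ordered {u + v | u v. u \<in> {- q} \<and> v \<in> T}"
    by (rule well_ordered_sumset[OF well_ordered_finite assms(2)]) simp
  then show "well_ordered (uminus ` {u\<in>S. q - u \<in> T})"
    by (rule well_ordered_subset) force
qed

text \<open>Allowing any finite superset as range of summation lets several products be summed over
  one common index set, as distributivity and associativity require.\<close>

lemma hahn_mult_eq:
  assumes "finite U" "{u\<in>supp a. q - u \<in> supp b} \<subseteq> U"
  shows "hahn_mult a b q = (\<Sum>u\<in>U. a u * b (q - u))"
proof -
  have "hahn_mult a b q = (\<Sum>(u, v)\<in>(\<lambda>u. (u, q - u)) ` {u\<in>supp a. q - u \<in> supp b}. a u * b v)"
    unfolding hahn_mult_def by (rule sum.cong) auto
  also have "\<dots> = (\<Sum>u\<in>{u\<in>supp a. q - u \<in> supp b}. a u * b (q - u))"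
    by (subst sum.reindex) (auto simp: inj_on_def)
  also have "\<dots> = (\<Sum>u\<in>U. a u * b (q - u))"
    by (rule sum.mono_neutral_left) (use assms in \<open>auto simp: supp_def\<close>)
  finally show ?thesis .
qed

lemma supp_hahn_mult: "supp (hahn_mult a b) \<subseteq> {u + v | u v. u \<in> supp a \<and> v \<in> supp b}"
proof
  fix q assume "q \<in> supp (hahn_mult a b)"
  then have "hahn_mult a b q \<noteq> 0" by (simp add: supp_def)
  then show "q \<in> {u + v | u v. u \<in> supp a \<and> v \<in> supp b}"
    unfolding hahn_mult_def using sum.not_neutral_contains_not_neutral by fastforce
qed

text \<open>A type instead of the record \<open>hahn_field\<close> gives access to the
  simplification of commutative rings and fields; \<open>coeff\<close> leads back to the elements of
  the record.\<close>

typedef hahn = "{a :: real \<Rightarrow> bit. well_ordered (supp a)}" morphisms coeff Hahn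
  by (intro exI[of _ "\<lambda>_. 0"]) (simp add: supp_def well_ordered_finite)

lemma well_ordered_coeff [simp]: "well_ordered (supp (coeff a))"
  using coeff by simp

lemma hahn_eqI: "(\<And>q. coeff a q = coeff b q) \<Longrightarrow> a = b"
  by (metis coeff_inject ext)

lemma finite_coeff_pairs: "finite {u\<in>supp (coeff a). q - u \<in> supp (coeff b)}"
  by (intro finite_sum_representations) auto

instantiation hahn :: comm_ring_1
begin

definition zero_hahn where "0 = Hahn (\<lambda>_. 0)"
definition one_hahn where "1 = Hahn (\<lambda>q. if q = 0 then 1 else 0)"
definition plus_hahn where "a + b = Hahn (\<lambda>q. coeff a q + coeff b q)"
definition minus_hahn where "a - b = Hahn (\<lambda>q. coeff a q - coeff b q)"
definition uminus_hahn where "- a = Hahn (\<lambda>q. - coeff a q)"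
definition times_hahn where "a * b = Hahn (hahn_mult (coeff a) (coeff b))"

lemma coeff_0 [simp]: "coeff 0 q = 0"
  unfolding zero_hahn_def by (subst Hahn_inverse) (auto simp: supp_def well_ordered_finite)

lemma coeff_1: "coeff 1 q = (if q = 0 then 1 else 0)"
proof -
  have "supp (\<lambda>q. if q = 0 then 1 else 0) = {0}" by (auto simp: supp_def)
  then show ?thesis unfolding one_hahn_def by (subst Hahn_inverse) (auto simp: well_ordered_finite)
qed

lemma coeff_add [simp]: "coeff (a + b) q = coeff a q + coeff b q"
proof -
  have "supp (\<lambda>q. coeff a q + coeff b q) \<subseteq> supp (coeff a) \<union> supp (coeff b)"
    by (auto simp: supp_def)
  then have "well_ordered (supp (\<lambda>q. coeff a q + coeff b q))"
    by (rule well_ordered_subset[OF well_ordered_Un, rotated 2]) auto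
  then show ?thesis unfolding plus_hahn_def by (subst Hahn_inverse) auto
qed

lemma coeff_uminus [simp]: "coeff (- a) q = - coeff a q"
  unfolding uminus_hahn_def by (subst Hahn_inverse) auto

lemma coeff_diff [simp]: "coeff (a - b) q = coeff a q - coeff b q"
  using coeff_add[of a b q] unfolding plus_hahn_def minus_hahn_def by (simp add: minus_bit_def)

lemma coeff_times: "coeff (a * b) = hahn_mult (coeff a) (coeff b)"
  unfolding times_hahn_def
  by (subst Hahn_inverse) (auto intro: well_ordered_subset[OF well_ordered_sumset supp_hahn_mult])

lemma coeff_times_eq:
  assumes "finite U" "\<And>u. coeff a u = 1 \<Longrightarrow> coeff b (q - u) = 1 \<Longrightarrow> u \<in> U"
  shows "coeff (a * b) q = (\<Sum>u\<in>U. coeff a u * coeff b (q - u))"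
  unfolding coeff_times by (rule hahn_mult_eq) (use assms in \<open>auto simp: supp_def\<close>)

lemma hahn_mult_commute:
  fixes a b :: hahn
  shows "a * b = b * a"
proof (rule hahn_eqI)
  fix q
  let ?U = "{u\<in>supp (coeff a). q - u \<in> supp (coeff b)}"
  have "coeff (a * b) q = (\<Sum>u\<in>?U. coeff a u * coeff b (q - u))"
    by (rule coeff_times_eq) (use finite_coeff_pairs in \<open>auto simp: supp_def\<close>)
  also have "\<dots> = (\<Sum>u\<in>(\<lambda>u. q - u) ` ?U. coeff b u * coeff a (q - u))"
    by (subst sum.reindex) (auto simp: inj_on_def algebra_simps)
  also have "\<dots> = coeff (b * a) q"
    by (rule coeff_times_eq[symmetric]) (use finite_coeff_pairs in \<open>force simp: supp_def\<close>)+
  finally show "coeff (a * b) q = coeff (b * a) q" .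
qed

text \<open>Both sides become one double sum over finite sets: \<open>W\<close> holds the exponents
  u + v that meet the support of \<open>c\<close> at \<open>q\<close>, and \<open>U\<close> the
  first exponents u occurring in them. The two summations are then exchanged.\<close>

lemma hahn_mult_assoc:
  fixes a b c :: hahn
  shows "(a * b) * c = a * (b * c)"
proof (rule hahn_eqI)
  fix q
  define D where "D = {u + v | u v. u \<in> supp (coeff a) \<and> v \<in> supp (coeff b)}"
  define W where "W = {w\<in>D. q - w \<in> supp (coeff c)}"
  define U where "U = (\<Union>w\<in>W. {u\<in>supp (coeff a). w - u \<in> supp (coeff b)})"
  have "well_ordered D" unfolding D_def by (intro well_ordered_sumset) auto
  then have W: "finite W" unfolding W_def by (intro finite_sum_representations) auto
  have U: "finite U" unfolding U_def using W finite_coeff_pairs by blast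
  have "coeff (a * b * c) q = (\<Sum>w\<in>W. coeff (a * b) w * coeff c (q - w))"
    using supp_hahn_mult[of "coeff a" "coeff b"]
    by (intro coeff_times_eq W) (auto simp: W_def D_def coeff_times supp_def)
  also have "\<dots> = (\<Sum>w\<in>W. (\<Sum>u\<in>U. coeff a u * coeff b (w - u)) * coeff c (q - w))"
    by (intro sum.cong refl arg_cong2[of _ _ _ _ "(*)"] coeff_times_eq U) (auto simp: U_def supp_def)
  also have "\<dots> = (\<Sum>u\<in>U. coeff a u * (\<Sum>w\<in>W. coeff b (w - u) * coeff c (q - w)))"
    by (simp add: sum_distrib_right sum_distrib_left mult.assoc) (rule sum.swap)
  also have "\<dots> = (\<Sum>u\<in>U. coeff a u * coeff (b * c) (q - u))"
  proof (intro sum.cong refl arg_cong2[of _ _ _ _ "(*)"])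
    fix u assume "u \<in> U"
    then have u: "coeff a u = 1" by (auto simp: U_def supp_def)
    have "(\<Sum>w\<in>W. coeff b (w - u) * coeff c (q - w)) = (\<Sum>v\<in>(\<lambda>w. w - u) ` W. coeff b v * coeff c (q - u - v))"
      by (subst sum.reindex) (auto simp: inj_on_def)
    also have "\<dots> = coeff (b * c) (q - u)"
    proof (rule coeff_times_eq[symmetric])
      fix v assume "coeff b v = 1" "coeff c (q - u - v) = 1"
      then have "u + v \<in> W" using u by (auto simp: W_def D_def supp_def algebra_simps)
      then show "v \<in> (\<lambda>w. w - u) ` W" by force
    qed (use W in auto)
    finally show "(\<Sum>w\<in>W. coeff b (w - u) * coeff c (q - w)) = coeff (b * c) (q - u)" .
  qed
  also have "\<dots> = coeff (a * (b * c)) q"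
  proof (rule coeff_times_eq[symmetric, OF U])
    fix u assume u: "coeff a u = 1" "coeff (b * c) (q - u) = 1"
    then obtain v z where "v \<in> supp (coeff b)" "z \<in> supp (coeff c)" "q - u = v + z"
      using supp_hahn_mult[of "coeff b" "coeff c"] by (auto simp: coeff_times supp_def)
    then have "u + v \<in> W" "u \<in> {u'\<in>supp (coeff a). (u + v) - u' \<in> supp (coeff b)}"
      using u by (auto simp: W_def D_def supp_def algebra_simps)
    then show "u \<in> U" unfolding U_def by blast
  qed
  finally show "coeff (a * b * c) q = coeff (a * (b * c)) q" .
qed

instance
proof
  fix a b c :: hahn
  show "a + b + c = a + (b + c)" "a + b = b + a" "0 + a = a"
    by (auto intro!: hahn_eqI simp: add.assoc add.commute)
  show "- a + a = 0" by (rule hahn_eqI) (simp only: coeff_add coeff_uminus coeff_0 left_minus)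
  show "a - b = a + - b" by (rule hahn_eqI) (simp only: coeff_add coeff_uminus coeff_diff diff_conv_add_uminus)
  show "a * b * c = a * (b * c)" by (rule hahn_mult_assoc)
  show "a * b = b * a" by (rule hahn_mult_commute)
  show "1 * a = a"
  proof (rule hahn_eqI)
    fix q
    have "coeff (1 * a) q = (\<Sum>u\<in>{0}. coeff 1 u * coeff a (q - u))"
      by (rule coeff_times_eq) (auto simp: coeff_1 split: if_splits)
    then show "coeff (1 * a) q = coeff a q" by (simp add: coeff_1)
  qed
  show "(a + b) * c = a * c + b * c"
  proof (rule hahn_eqI)
    fix q
    let ?U = "{u\<in>supp (coeff a). q - u \<in> supp (coeff c)} \<union> {u\<in>supp (coeff b). q - u \<in> supp (coeff c)}"
    have U: "finite ?U" using finite_coeff_pairs by blast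
    have "coeff ((a + b) * c) q = (\<Sum>u\<in>?U. coeff (a + b) u * coeff c (q - u))"
      by (rule coeff_times_eq[OF U]) (auto simp: supp_def)
    also have "\<dots> = (\<Sum>u\<in>?U. coeff a u * coeff c (q - u)) + (\<Sum>u\<in>?U. coeff b u * coeff c (q - u))"
      by (simp add: distrib_right sum.distrib)
    also have "\<dots> = coeff (a * c + b * c) q"
      by (simp add: coeff_times_eq[OF U] supp_def)
    finally show "coeff ((a + b) * c) q = coeff (a * c + b * c) q" .
  qed
  show "(0::hahn) \<noteq> 1" by (metis coeff_0 coeff_1 zero_neq_one)
qed

end


text \<open>Characteristic 2: from here on differences may be written as sums.\<close>

lemma hahn_add_self [simp]: "a + a = (0 :: hahn)"
  by (rule hahn_eqI) (metis coeff_0 coeff_add coeff_diff diff_self minus_bit_def)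

lemma hahn_uminus [simp]: "- a = (a :: hahn)"
  by (simp add: minus_unique)

lemma supp_coeff_eq_empty: "supp (coeff a) = {} \<longleftrightarrow> a = 0"
  by (auto simp: supp_def intro: hahn_eqI)

subsection \<open>The valuation\<close>

text \<open>\<open>val 0\<close> is a junk value.\<close>

definition val :: "hahn \<Rightarrow> real" where
  "val a = (LEAST q. q \<in> supp (coeff a))"

definition integral :: "hahn \<Rightarrow> bool" where
  "integral a \<longleftrightarrow> a = 0 \<or> 0 \<le> val a"

lemma
  assumes "a \<noteq> 0"
  shows coeff_val: "coeff a (val a) = 1"
    and val_le: "coeff a q = 1 \<Longrightarrow> val a \<le> q"
proof -
  have "supp (coeff a) \<noteq> {}" using assms by (simp add: supp_coeff_eq_empty)
  then obtain m where "m \<in> supp (coeff a)" "\<forall>x\<in>supp (coeff a). m \<le> x"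
    using well_ordered_coeff[of a] unfolding well_ordered_def by (meson subset_refl)
  then have "val a \<in> supp (coeff a) \<and> (\<forall>x\<in>supp (coeff a). val a \<le> x)"
    unfolding val_def by (metis Least_equality)
  then show "coeff a (val a) = 1" "coeff a q = 1 \<Longrightarrow> val a \<le> q" by (auto simp: supp_def)
qed

lemma coeff_below_val: "a \<noteq> 0 \<Longrightarrow> q < val a \<Longrightarrow> coeff a q = 0"
  using val_le[of a q] by force

lemma val_greater:
  assumes "a \<noteq> 0" "\<And>p. p \<le> q \<Longrightarrow> coeff a p = 0"
  shows "q < val a"
  using coeff_val[OF assms(1)] assms(2)[of "val a"] by force

lemma
  assumes "a \<noteq> 0" "b \<noteq> (0::hahn)"
  shows hahn_mult_nonzero: "a * b \<noteq> 0"
    and val_mult: "val (a * b) = val a + val b"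
proof -
  \<comment> \<open>Exponents of the two supports are at least the valuations, so a pair with this
    sum consists of the valuations themselves and only one term contributes.\<close>
  have "coeff (a * b) (val a + val b) = (\<Sum>u\<in>{val a}. coeff a u * coeff b (val a + val b - u))"
  proof (rule coeff_times_eq)
    fix u assume "coeff a u = 1" "coeff b (val a + val b - u) = 1"
    then show "u \<in> {val a}" using val_le[OF assms(1)] val_le[OF assms(2)] by force
  qed simp
  then have 1: "coeff (a * b) (val a + val b) = 1" using assms by (simp add: coeff_val)
  then show nz: "a * b \<noteq> 0" by auto
  have "val a + val b \<le> q" if "coeff (a * b) q = 1" for q
  proof -
    have "q \<in> {u + v | u v. u \<in> supp (coeff a) \<and> v \<in> supp (coeff b)}"
      using that supp_hahn_mult[of "coeff a" "coeff b"] by (auto simp: coeff_times supp_def)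
    then show ?thesis using val_le[OF assms(1)] val_le[OF assms(2)] by (force simp: supp_def)
  qed
  then show "val (a * b) = val a + val b"
    using coeff_val[OF nz] val_le[OF nz 1] by (meson antisym)
qed

instance hahn :: idom
  by standard (rule hahn_mult_nonzero)

lemma val_one [simp]: "val 1 = 0"
  using coeff_val[of 1] by (simp add: coeff_1 split: if_splits)

section \<open>Monomials and multiplicative inverses\<close>

definition tpow :: "real \<Rightarrow> hahn" where
  "tpow q = Hahn (\<lambda>r. if r = q then 1 else 0)"

lemma coeff_tpow: "coeff (tpow q) r = (if r = q then 1 else 0)"
proof -
  have "supp (\<lambda>r. if r = q then 1 else 0) = {q}" by (auto simp: supp_def)
  then show ?thesis unfolding tpow_def by (subst Hahn_inverse) (auto simp: well_ordered_finite)
qed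

lemma tpow_nonzero [simp]: "tpow q \<noteq> 0"
  using coeff_tpow[of q q] by auto

lemma val_tpow [simp]: "val (tpow q) = q"
  using coeff_val[of "tpow q"] by (simp add: coeff_tpow split: if_splits)

lemma val_power:
  fixes x :: hahn
  shows "x \<noteq> 0 \<Longrightarrow> val (x ^ n) = n * val x"
  by (induction n) (auto simp: val_mult algebra_simps)

text \<open>The inverse of \<open>1 + x\<close> is the geometric series, which is a finite sum up to any given exponent.\<close>

lemma one_plus_invertible:
  assumes "x \<noteq> 0" "0 < val x"
  shows "\<exists>b. (1 + x) * b = 1"
proof -
  define s where "s m = (\<Sum>n\<le>m. x ^ n)" for m
  have geo: "(1 + x) * s m = 1 + x ^ Suc m" for m
  proof (induction m)
    case (Suc m)
    have "s (Suc m) = s m + x ^ Suc m" by (simp add: s_def)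
    then have "(1 + x) * s (Suc m) = (1 + x) * s m + (1 + x) * x ^ Suc m" by (simp only: distrib_left)
    also have "\<dots> = 1 + (x ^ Suc m + x ^ Suc m) + x ^ Suc (Suc m)"
      unfolding Suc by (simp only: distrib_right mult_1 power_Suc[of x "Suc m"] add.assoc)
    finally show ?case by (simp only: hahn_add_self add_0_right)
  qed (simp add: s_def)
  have low: "coeff (x ^ n) q = 0" if "q < n * val x" for n q
    using that assms(1) by (simp add: coeff_below_val val_power)
  have stable: "coeff (s m) q = coeff (s k) q" if "q < Suc k * val x" "k \<le> m" for m k q
    using that(2)
  proof (induction m rule: dec_induct)
    case (step n)
    have "Suc k * val x \<le> Suc n * val x" using step(1) assms(2) by (intro mult_right_mono) auto
    then have "coeff (x ^ Suc n) q = 0" using that(1) by (intro low) linarith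
    moreover have "s (Suc n) = s n + x ^ Suc n" by (simp add: s_def)
    ultimately show ?case using step.IH by (simp del: power_Suc)
  qed simp
  \<comment> \<open>Powers of \<open>x\<close> with exponent above \<open>N q\<close> have valuation
    above \<open>q\<close>, so coefficients at exponents up to \<open>q\<close> are final from the
    partial sum \<open>N q\<close> on.\<close>
  define N where "N q = nat \<lceil>q / val x\<rceil>" for q
  have N: "p < Suc (N q) * val x" if "p \<le> q" for p q
  proof -
    have "q / val x < Suc (N q)" unfolding N_def by linarith
    then have "q < Suc (N q) * val x" using assms(2) by (simp only: pos_divide_less_eq)
    then show ?thesis using that by linarith
  qed
  define f where "f q = coeff (s (N q)) q" for q
  have f: "f p = coeff (s (N q)) p" if "p \<le> q" for p q
    unfolding f_def using stable[OF N[OF that], of "N p"] stable[OF N[OF order_refl], of p "N q"]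
      stable[of p "N p" "N q"] stable[of p "N q" "N p"] N[OF that] N[of p p] by (metis linear order_refl)
  have "well_ordered (supp f)"
  proof (rule well_ordered_if_initial)
    fix q
    have "supp f \<inter> {..q} \<subseteq> supp (coeff (s (N q)))" using f by (auto simp: supp_def)
    then show "well_ordered (supp f \<inter> {..q})" by (rule well_ordered_subset[OF well_ordered_coeff])
  qed
  then have F: "coeff (Hahn f) = f" by (simp add: Hahn_inverse)
  have "(1 + x) * Hahn f = 1"
  proof (rule hahn_eqI)
    fix q
    \<comment> \<open>The limit and the partial sum agree up to \<open>q\<close>, so their
      difference has valuation above \<open>q\<close>; multiplication by 1 + x, whose valuation is
      nonnegative, leaves the coefficient at \<open>q\<close> zero.\<close>
    let ?d = "Hahn f - s (N q)"
    have "coeff ((1 + x) * ?d) q = 0"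
    proof (cases "?d = 0")
      case False
      have d: "q < val ?d" by (rule val_greater[OF False]) (simp add: F f)
      have x: "1 + x \<noteq> 0" using assms by (metis add_eq_0_iff hahn_uminus less_irrefl val_one)
      have "coeff (1 + x) p = 0" if "p < 0" for p
        using that assms by (simp add: coeff_1 coeff_below_val)
      then have "0 \<le> val (1 + x)" using coeff_val[OF x] by (metis not_le zero_neq_one)
      then show ?thesis using d x False by (intro coeff_below_val) (auto simp: val_mult)
    qed simp
    then have "coeff ((1 + x) * Hahn f) q = coeff ((1 + x) * s (N q)) q" by (simp add: right_diff_distrib)
    also have "\<dots> = coeff 1 q + coeff (x ^ Suc (N q)) q" by (simp only: geo coeff_add)
    also have "coeff (x ^ Suc (N q)) q = 0" by (rule low[OF N[OF order_refl]])
    finally show "coeff ((1 + x) * Hahn f) q = coeff 1 q" by simp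
  qed
  then show ?thesis by blast
qed

text \<open>After multiplication by a monomial the valuation is 0 and, the residue field having
  order 2, the leading coefficient is 1. So c = 1 + (1 + c), where 1 + c is zero or has positive
  valuation.\<close>

lemma hahn_invertible:
  fixes a :: hahn
  assumes "a \<noteq> 0"
  shows "\<exists>b. a * b = 1"
proof -
  define c where "c = tpow (- val a) * a"
  have t: "tpow (- val a) * tpow (val a) = 1"
  proof (rule hahn_eqI)
    fix q
    have "coeff (tpow (- val a) * tpow (val a)) q = (\<Sum>u\<in>{- val a}. coeff (tpow (- val a)) u * coeff (tpow (val a)) (q - u))"
      by (rule coeff_times_eq) (auto simp: coeff_tpow split: if_splits)
    then show "coeff (tpow (- val a) * tpow (val a)) q = coeff 1 q" by (simp add: coeff_tpow coeff_1)
  qed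
  have c: "c \<noteq> 0" "val c = 0" using assms by (simp_all add: c_def val_mult)
  have "\<exists>b. c * b = 1"
  proof (cases "1 + c = 0")
    case True
    then have "c = 1" by (metis add_eq_0_iff hahn_uminus)
    then show ?thesis by (intro exI[of _ 1]) simp
  next
    case False
    have "coeff (1 + c) p = 0" if "p \<le> 0" for p
      using that c coeff_val[of c] by (cases "p = 0") (auto simp: coeff_1 coeff_below_val)
    then have "0 < val (1 + c)" using val_greater[OF False] by blast
    then obtain b where "(1 + (1 + c)) * b = 1" using one_plus_invertible[OF False] by blast
    moreover have "1 + (1 + c) = c" by (metis add.assoc add_0 hahn_add_self)
    ultimately show ?thesis by auto
  qed
  then obtain b where "c * b = 1" by blast
  then have "a * (tpow (- val a) * b) = 1" unfolding c_def by (simp add: ac_simps)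
  then show ?thesis by blast
qed

instantiation hahn :: field
begin

definition inverse_hahn where
  "inverse (a :: hahn) = (if a = 0 then 0 else SOME b. a * b = 1)"

definition divide_hahn where
  "(a :: hahn) div b = a * inverse b"

instance
proof
  fix a :: hahn assume "a \<noteq> 0"
  then have "a * inverse a = 1" using someI_ex[OF hahn_invertible] by (simp add: inverse_hahn_def)
  then show "inverse a * a = 1" by (simp add: mult.commute)
qed (simp_all add: divide_hahn_def inverse_hahn_def)

end

lemma val_divide: "a \<noteq> 0 \<Longrightarrow> b \<noteq> 0 \<Longrightarrow> val (a / b) = val a - val b"
  using val_mult[of "a / b" b] by simp

lemma integral_0 [simp]: "integral 0" and integral_1 [simp]: "integral 1"
  by (auto simp: integral_def)

lemma integral_mult: "integral a \<Longrightarrow> integral b \<Longrightarrow> integral (a * b)"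
  unfolding integral_def by (cases "a = 0"; cases "b = 0") (auto simp: val_mult)

text \<open>In contrast to the definition, this form is visibly preserved by sums.\<close>

lemma integral_iff_coeff: "integral a \<longleftrightarrow> (\<forall>q<0. coeff a q = 0)"
proof (cases "a = 0")
  case False
  then show ?thesis
    using coeff_val[of a] coeff_below_val[of a] unfolding integral_def
    by (metis (no_types, opaque_lifting) not_le order_less_le_trans zero_neq_one)
qed simp

lemma integral_add: "integral a \<Longrightarrow> integral b \<Longrightarrow> integral (a + b)"
  by (simp add: integral_iff_coeff)

lemma integral_divide_iff: "b \<noteq> 0 \<Longrightarrow> integral (a / b) \<longleftrightarrow> a = 0 \<or> val b \<le> val a"
  by (cases "a = 0") (auto simp: integral_def val_divide)

lemma integral_divide_total: "a \<noteq> 0 \<Longrightarrow> b \<noteq> 0 \<Longrightarrow> integral (a / b) \<or> integral (b / a)"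
  by (auto simp: integral_divide_iff)

section \<open>Linear compactness of the Hahn field\<close>

text \<open>Cosets of submodules are described without naming the submodule, as the sets closed under the
  affine combinations \<open>x + r (y - z)\<close>.\<close>

definition affine_hahn :: "hahn set \<Rightarrow> bool" where
  "affine_hahn C \<longleftrightarrow> (\<forall>x\<in>C. \<forall>y\<in>C. \<forall>z\<in>C. \<forall>r. integral r \<longrightarrow> x + r * (y - z) \<in> C)"

definition affine_fun :: "('i \<Rightarrow> hahn) set \<Rightarrow> bool" where
  "affine_fun C \<longleftrightarrow>
    (\<forall>x\<in>C. \<forall>y\<in>C. \<forall>z\<in>C. \<forall>r. integral r \<longrightarrow> (\<lambda>i. x i + r * (y i - z i)) \<in> C)"

text \<open>An exponent is fixed by \<open>C m\<close> when all members agree up to it; the sought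
  series \<open>f\<close> copies these common coefficients. Its difference from a member of
  \<open>C m\<close> starts at an exponent that is not fixed, hence is an integral multiple of a
  difference of two members, and an affine combination reaches \<open>f\<close>.\<close>

lemma hahn_lin_compact:
  fixes C :: "nat \<Rightarrow> hahn set"
  assumes dec: "decseq C" and ne: "\<And>m. C m \<noteq> {}" and aff: "\<And>m. affine_hahn (C m)"
  shows "\<exists>c. \<forall>m. c \<in> C m"
proof -
  have "\<exists>z. z \<in> C m" for m using ne by blast
  then obtain y where y: "\<And>m. y m \<in> C m" by metis
  define fixed where "fixed m q \<longleftrightarrow> (\<forall>u\<in>C m. \<forall>v\<in>C m. \<forall>p\<le>q. coeff u p = coeff v p)" for m q
  \<comment> \<open>The default 0 at exponents that no \<open>C m\<close> fixes keeps the support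
    well ordered: up to any point of the support, \<open>f\<close> agrees with a single
    \<open>y m\<close>.\<close>
  define f where "f q = (if \<exists>m. fixed m q then coeff (y (SOME m. fixed m q)) q else 0)" for q
  have agree: "coeff (y m) q = coeff (y k) q" if "fixed m q" "fixed k q" for m k q
  proof -
    have "y (max m k) \<in> C m" "y (max m k) \<in> C k" using y dec unfolding decseq_def by (meson max.cobounded1 max.cobounded2 subsetD)+
    then show ?thesis using that y unfolding fixed_def by (metis order_refl)
  qed
  have f: "f q = coeff (y m) q" if "fixed m q" for m q
    unfolding f_def using agree[OF someI[of "\<lambda>m. fixed m q", OF that] that] that by auto
  have mono: "fixed m p" if "fixed m q" "p \<le> q" for m p q
    using that unfolding fixed_def by (meson order_trans)
  have "well_ordered (supp f)"
  proof (rule well_ordered_if_initial)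
    fix q assume "q \<in> supp f"
    then obtain m where "fixed m q" unfolding supp_def f_def by (auto split: if_splits)
    then have "supp f \<inter> {..q} \<subseteq> supp (coeff (y m))" using f[OF mono] by (auto simp: supp_def)
    then show "well_ordered (supp f \<inter> {..q})" by (rule well_ordered_subset[OF well_ordered_coeff])
  qed
  then have F: "coeff (Hahn f) = f" by (simp add: Hahn_inverse)
  have "Hahn f \<in> C m" for m
  proof (cases "Hahn f = y m")
    case False
    let ?d = "Hahn f - y m"
    have d: "?d \<noteq> 0" using False by simp
    \<comment> \<open>Where \<open>C m\<close> is fixed, \<open>f\<close> agrees with
      \<open>y m\<close>, so the leading exponent of their difference cannot be fixed.\<close>
    have "\<not> fixed m (val ?d)" using coeff_val[OF d] by (auto simp: F f)
    then obtain u v p where uv: "u \<in> C m" "v \<in> C m" "p \<le> val ?d" "coeff u p \<noteq> coeff v p"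
      unfolding fixed_def by blast
    then have n: "u - v \<noteq> 0" by auto
    have "coeff (u - v) p = 1" using uv(4) by (cases "coeff u p"; cases "coeff v p") (auto simp: minus_bit_def)
    then have "val (u - v) \<le> val ?d" using val_le[OF n] uv(3) by force
    then have "integral (?d / (u - v))" using n by (simp add: integral_divide_iff)
    then have "y m + ?d / (u - v) * (u - v) \<in> C m" using aff y uv unfolding affine_hahn_def by blast
    then show ?thesis using n by simp
  qed (use y in simp)
  then show ?thesis by blast
qed

text \<open>Coordinates are determined one at a time: the members of \<open>C m\<close> whose
  earlier coordinates are already given by \<open>c\<close> project to a nonempty affine set of
  values of the next one. Only coordinates in \<open>S\<close> become common to all
  \<open>C m\<close>, since nothing controls the functions elsewhere.\<close>

lemma fun_lin_compact:
  fixes C :: "nat \<Rightarrow> ('i \<Rightarrow> hahn) set"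
  assumes "finite S"
    and "decseq C" "\<And>m. C m \<noteq> {}" "\<And>m. affine_fun (C m)"
  shows "\<exists>c. \<forall>m. \<exists>x\<in>C m. \<forall>i\<in>S. x i = c i"
  using assms
proof (induction S rule: finite_induct)
  case (insert j S)
  then obtain c where c: "\<And>m. \<exists>x\<in>C m. \<forall>i\<in>S. x i = c i" by blast
  define D where "D m = {x j | x. x \<in> C m \<and> (\<forall>i\<in>S. x i = c i)}" for m
  have "\<exists>d. \<forall>m. d \<in> D m"
  proof (rule hahn_lin_compact)
    show "decseq D" using insert(4) unfolding decseq_def D_def by blast
    show "D m \<noteq> {}" for m using c unfolding D_def by blast
    show "affine_hahn (D m)" for m
      unfolding affine_hahn_def
    proof (intro ballI allI impI)
      fix a b d r assume r: "integral r" and "a \<in> D m" "b \<in> D m" "d \<in> D m"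
      then obtain x y z where "a = x j" "b = y j" "d = z j" "x \<in> C m" "y \<in> C m" "z \<in> C m"
        "\<forall>i\<in>S. x i = c i" "\<forall>i\<in>S. y i = c i" "\<forall>i\<in>S. z i = c i" unfolding D_def by auto
      moreover from this have "(\<lambda>i. x i + r * (y i - z i)) \<in> C m"
        using insert(6) r unfolding affine_fun_def by blast
      ultimately show "a + r * (b - d) \<in> D m" unfolding D_def by (intro CollectI exI[of _ "\<lambda>i. x i + r * (y i - z i)"]) auto
    qed
  qed
  then obtain d where d: "\<And>m. d \<in> D m" by blast
  show ?case
  proof (intro exI[of _ "c(j := d)"] allI)
    fix m
    from d[of m] obtain x where "x \<in> C m" "\<forall>i\<in>S. x i = c i" "x j = d" unfolding D_def by blast
    then show "\<exists>x\<in>C m. \<forall>i\<in>insert j S. x i = (c(j := d)) i" using insert(2) by (intro bexI[of _ x]) auto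
  qed
qed auto


subsection \<open>Submodules of the Hahn field\<close>

definition osub :: "hahn set \<Rightarrow> bool" where
  "osub J \<longleftrightarrow> 0 \<in> J \<and> (\<forall>x\<in>J. \<forall>y\<in>J. x + y \<in> J) \<and> (\<forall>r x. integral r \<longrightarrow> x \<in> J \<longrightarrow> r * x \<in> J)"

lemma
  assumes "osub J"
  shows osub_0: "0 \<in> J"
    and osub_add: "x \<in> J \<Longrightarrow> y \<in> J \<Longrightarrow> x + y \<in> J"
    and osub_smult: "integral r \<Longrightarrow> x \<in> J \<Longrightarrow> r * x \<in> J"
  using assms unfolding osub_def by blast+

lemma osub_divide: "osub J \<Longrightarrow> y \<in> J \<Longrightarrow> y \<noteq> 0 \<Longrightarrow> integral (x / y) \<Longrightarrow> x \<in> J"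
  using osub_smult[of J "x / y" y] by simp

lemma osub_UNIV: "osub UNIV" and osub_zero: "osub {0}"
  by (auto simp: osub_def)

text \<open>Without a least element it is enough to choose an element of \<open>W\<close> below each
  rational that has one, as the rationals are dense. Running minima make the sequence
  decreasing.\<close>

lemma real_coinitial:
  fixes W :: "real set"
  assumes "W \<noteq> {}"
  shows "\<exists>f. range f \<subseteq> W \<and> decseq f \<and> (\<forall>w\<in>W. \<exists>n::nat. f n \<le> w)"
proof -
  have "\<exists>g. range g \<subseteq> W \<and> (\<forall>w\<in>W. \<exists>n::nat. g n \<le> w)"
  proof (cases "\<exists>m\<in>W. \<forall>w\<in>W. m \<le> w")
    case True
    then obtain m where "m \<in> W" "\<forall>w\<in>W. m \<le> w" by blast
    then show ?thesis by (intro exI[of _ "\<lambda>_. m"]) auto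
  next
    case False
    obtain a where a: "a \<in> W" using assms by blast
    define g where "g n = (if \<exists>w\<in>W. w < of_rat (from_nat n) then SOME w. w \<in> W \<and> w < of_rat (from_nat n) else a)" for n
    have g: "g n \<in> W" "(\<exists>w\<in>W. w < of_rat (from_nat n)) \<Longrightarrow> g n < of_rat (from_nat n)" for n
      unfolding g_def using a someI_ex[of "\<lambda>w. w \<in> W \<and> w < of_rat (from_nat n)"] by auto
    have "\<exists>n. g n \<le> w" if "w \<in> W" for w
    proof -
      have "\<not> (\<forall>v\<in>W. w \<le> v)" using False that by blast
      then obtain v where v: "v \<in> W" "v < w" by (auto simp: not_le)
      then obtain r where r: "v < of_rat r" "of_rat r < w" using of_rat_dense by blast
      obtain n where "from_nat n = r" by (metis from_nat_to_nat)
      then have "g n < of_rat r" using g(2)[of n] v r by blast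
      then show ?thesis using r(2) by (intro exI[of _ n]) linarith
    qed
    then show ?thesis using g(1) by blast
  qed
  then obtain g where g: "range g \<subseteq> W" "\<forall>w\<in>W. \<exists>n::nat. g n \<le> w" by blast
  define f where "f n = Min (g ` {..n})" for n
  have "f n \<in> g ` {..n}" for n unfolding f_def by (intro Min_in) auto
  then have "range f \<subseteq> W" using g(1) by blast
  moreover have "decseq f" unfolding decseq_Suc_iff f_def by (auto intro!: Min_antimono)
  moreover have "f n \<le> g n" for n unfolding f_def by (intro Min_le) auto
  ultimately show ?thesis using g(2) by (meson order_trans)
qed

text \<open>The cyclic modules A e_k form an ascending chain, whose union is
  \<open>generated e\<close>.\<close>

definition gen_seq :: "(nat \<Rightarrow> hahn) \<Rightarrow> bool" where
  "gen_seq e \<longleftrightarrow> (\<forall>k. e k \<noteq> 0 \<and> integral (e k / e (Suc k)))"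

definition generated :: "(nat \<Rightarrow> hahn) \<Rightarrow> hahn set" where
  "generated e = {x. \<exists>k. integral (x / e k)}"

lemma gen_seq_mono:
  assumes "gen_seq e" "k \<le> m"
  shows "integral (e k / e m)"
  using assms(2)
proof (induction m rule: dec_induct)
  case base
  then show ?case using assms(1) by (simp add: gen_seq_def)
next
  case (step m)
  have "integral (e m / e (Suc m))" "e m \<noteq> 0" using assms(1) by (auto simp: gen_seq_def)
  then show ?case using integral_mult[OF step.IH, of "e m / e (Suc m)"] by simp
qed

lemma generated_mono:
  assumes "gen_seq e" "k \<le> m" "integral (x / e k)"
  shows "integral (x / e m)"
proof -
  have "e k \<noteq> 0" using assms(1) by (simp add: gen_seq_def)
  then show ?thesis using integral_mult[OF assms(3) gen_seq_mono[OF assms(1,2)]] by simp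
qed

lemma osub_generated:
  assumes "gen_seq e"
  shows "osub (generated e)"
  unfolding osub_def
proof (intro conjI ballI allI impI)
  show "0 \<in> generated e" by (simp add: generated_def)
  fix x y assume "x \<in> generated e" "y \<in> generated e"
  then obtain k m where "integral (x / e k)" "integral (y / e m)" by (auto simp: generated_def)
  then have "integral (x / e (max k m))" "integral (y / e (max k m))"
    using generated_mono[OF assms max.cobounded1] generated_mono[OF assms max.cobounded2] by blast+
  then show "x + y \<in> generated e" by (auto simp: generated_def add_divide_distrib intro!: integral_add)
next
  fix r x assume "integral r" "x \<in> generated e"
  then obtain k where "integral (x / e k)" by (auto simp: generated_def)
  from integral_mult[OF \<open>integral r\<close> this] have "integral (r * x / e k)" by simp
  then show "r * x \<in> generated e" by (auto simp: generated_def)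
qed

lemma generated_generators: "gen_seq e \<Longrightarrow> e k \<in> generated e"
  by (auto simp: generated_def gen_seq_def intro!: exI[of _ k])

text \<open>Countability comes from the valuations of the nonzero elements: a coinitial sequence of
  them is realised in \<open>J\<close>, and an element of K is an integral multiple of every nonzero
  element of no larger valuation.\<close>

lemma osub_generators:
  assumes J: "osub J" "J \<noteq> {0}"
  shows "\<exists>e. gen_seq e \<and> J = generated e"
proof -
  let ?W = "val ` (J - {0})"
  have "?W \<noteq> {}" using assms osub_0 by blast
  then obtain f :: "nat \<Rightarrow> real" where f: "range f \<subseteq> ?W" "decseq f" "\<And>w. w \<in> ?W \<Longrightarrow> \<exists>n. f n \<le> w"
    using real_coinitial by meson
  have "\<exists>x. x \<in> J - {0} \<and> val x = f k" for k using f(1) by (metis imageE range_subsetD)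
  then obtain e where e: "\<And>k. e k \<in> J - {0}" "\<And>k. val (e k) = f k" by metis
  have g: "gen_seq e"
    using e f(2) unfolding gen_seq_def by (auto simp: integral_divide_iff decseq_Suc_iff)
  moreover have "J = generated e"
  proof (intro Set.set_eqI iffI)
    fix x assume x: "x \<in> J"
    then show "x \<in> generated e"
      using f(3)[of "val x"] e by (cases "x = 0") (auto simp: generated_def integral_divide_iff)
  next
    fix x assume "x \<in> generated e"
    then show "x \<in> J" using e(1) J(1) osub_divide unfolding generated_def by blast
  qed
  ultimately show ?thesis by blast
qed

text \<open>The structure theory uses only here that the value group is archimedean.\<close>

lemma osub_expand:
  assumes I: "osub I" "I \<noteq> {0}" and d: "\<not> integral d" "\<And>x. x \<in> I \<Longrightarrow> d * x \<in> I"
  shows "I = UNIV"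
proof -
  obtain x where x: "x \<in> I" "x \<noteq> 0" using I osub_0 by blast
  have d0: "d \<noteq> 0" "val d < 0" using d(1) by (auto simp: integral_def)
  have pow: "d ^ n * x \<in> I" for n
    by (induction n) (use x d(2) in \<open>auto simp: mult.assoc\<close>)
  have "y \<in> I" for y
  proof (cases "y = 0")
    case False
    \<comment> \<open>Some power of \<open>d\<close> lowers the valuation of \<open>x\<close> at
      least to that of \<open>y\<close>.\<close>
    obtain n where "val x - val y < real n * (- val d)"
      using reals_Archimedean3[of "- val d"] d0(2) by auto
    then have "val (d ^ n * x) \<le> val y" using x d0 by (simp add: val_mult val_power)
    then show ?thesis using osub_divide[OF I(1) pow[of n], of y] x d0 by (simp add: integral_divide_iff)
  qed (use I osub_0 in blast)
  then show ?thesis by blast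
qed

section \<open>Modules over a commutative ring\<close>

lemma (in abelian_group) eq_if_diff_zero:
  "x \<oplus> \<ominus> y = \<zero> \<Longrightarrow> x \<in> carrier G \<Longrightarrow> y \<in> carrier G \<Longrightarrow> x = y"
  using minus_equality[of x "\<ominus> y"] by simp

lemma (in abelian_group) minus_add_add_cancel:
  assumes "a \<in> carrier G" "b \<in> carrier G" "c \<in> carrier G"
  shows "(a \<oplus> \<ominus> b) \<oplus> (b \<oplus> c) = a \<oplus> c"
  using assms by (simp add: a_assoc r_neg1 r_neg2)

section \<open>Homomorphisms, kernels and images\<close>

lemma module_homsI:
  assumes "\<And>x. x \<in> carrier M \<Longrightarrow> f x \<in> carrier N"
    and "\<And>x y. x \<in> carrier M \<Longrightarrow> y \<in> carrier M \<Longrightarrow> f (x \<oplus>\<^bsub>M\<^esub> y) = f x \<oplus>\<^bsub>N\<^esub> f y"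
    and "\<And>r x. r \<in> carrier R \<Longrightarrow> x \<in> carrier M \<Longrightarrow> f (r \<odot>\<^bsub>M\<^esub> x) = r \<odot>\<^bsub>N\<^esub> f x"
  shows "f \<in> module_homs R M N"
  using assms unfolding module_homs_def by auto

lemma
  assumes "f \<in> module_homs R M N"
  shows hom_closed: "x \<in> carrier M \<Longrightarrow> f x \<in> carrier N"
    and hom_add: "x \<in> carrier M \<Longrightarrow> y \<in> carrier M \<Longrightarrow> f (x \<oplus>\<^bsub>M\<^esub> y) = f x \<oplus>\<^bsub>N\<^esub> f y"
    and hom_smult: "r \<in> carrier R \<Longrightarrow> x \<in> carrier M \<Longrightarrow> f (r \<odot>\<^bsub>M\<^esub> x) = r \<odot>\<^bsub>N\<^esub> f x"
  using assms unfolding module_homs_def by auto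

lemma hom_zero:
  assumes "f \<in> module_homs R M N" "Module.module R M" "Module.module R N"
  shows "f \<zero>\<^bsub>M\<^esub> = \<zero>\<^bsub>N\<^esub>"
proof -
  interpret M: Module.module R M by fact
  interpret N: Module.module R N by fact
  have "f (\<zero>\<^bsub>R\<^esub> \<odot>\<^bsub>M\<^esub> \<zero>\<^bsub>M\<^esub>) = \<zero>\<^bsub>R\<^esub> \<odot>\<^bsub>N\<^esub> f \<zero>\<^bsub>M\<^esub>" by (rule hom_smult[OF assms(1)]) auto
  then show ?thesis using hom_closed[OF assms(1)] by simp
qed

lemma hom_minus:
  assumes f: "f \<in> module_homs R M N" and "Module.module R M" "Module.module R N" "x \<in> carrier M"
  shows "f (\<ominus>\<^bsub>M\<^esub> x) = \<ominus>\<^bsub>N\<^esub> f x"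
proof -
  interpret M: Module.module R M by fact
  interpret N: Module.module R N by fact
  have "f (\<ominus>\<^bsub>M\<^esub> x) \<oplus>\<^bsub>N\<^esub> f x = f (\<ominus>\<^bsub>M\<^esub> x \<oplus>\<^bsub>M\<^esub> x)" using hom_add[OF f] assms(4) by simp
  also have "\<dots> = \<zero>\<^bsub>N\<^esub>" using assms(4) hom_zero[OF f assms(2,3)] by (simp add: M.l_neg)
  finally show ?thesis using hom_closed[OF f] assms(4) by (simp add: N.minus_equality[symmetric])
qed

lemma hom_comp:
  assumes "f \<in> module_homs R L M" "g \<in> module_homs R M N"
  shows "(\<lambda>x. g (f x)) \<in> module_homs R L N"
  by (intro module_homsI) (auto simp: hom_add[OF assms(1)] hom_add[OF assms(2)] hom_smult[OF assms(1)]
      hom_smult[OF assms(2)] hom_closed[OF assms(1)] hom_closed[OF assms(2)])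

lemma hom_inj_iff:
  assumes f: "f \<in> module_homs R M N" and "Module.module R M" "Module.module R N"
  shows "inj_on f (carrier M) \<longleftrightarrow> (\<forall>x\<in>carrier M. f x = \<zero>\<^bsub>N\<^esub> \<longrightarrow> x = \<zero>\<^bsub>M\<^esub>)"
proof -
  interpret M: Module.module R M by fact
  interpret N: Module.module R N by fact
  show ?thesis
  proof
    assume "inj_on f (carrier M)"
    then show "\<forall>x\<in>carrier M. f x = \<zero>\<^bsub>N\<^esub> \<longrightarrow> x = \<zero>\<^bsub>M\<^esub>"
      using hom_zero[OF assms] by (metis M.zero_closed inj_onD)
  next
    assume k: "\<forall>x\<in>carrier M. f x = \<zero>\<^bsub>N\<^esub> \<longrightarrow> x = \<zero>\<^bsub>M\<^esub>"
    show "inj_on f (carrier M)"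
    proof (rule inj_onI)
      fix x y assume xy: "x \<in> carrier M" "y \<in> carrier M" "f x = f y"
      then have "f (x \<oplus>\<^bsub>M\<^esub> \<ominus>\<^bsub>M\<^esub> y) = \<zero>\<^bsub>N\<^esub>"
        using hom_closed[OF f] by (simp add: hom_add[OF f] hom_minus[OF assms] N.r_neg)
      then have "x \<oplus>\<^bsub>M\<^esub> \<ominus>\<^bsub>M\<^esub> y = \<zero>\<^bsub>M\<^esub>" using k xy by simp
      then show "x = y" by (rule M.eq_if_diff_zero[OF _ xy(1,2)])
    qed
  qed
qed

lemma hom_inverse:
  assumes f: "f \<in> module_homs R M N" and M: "Module.module R M" and bij: "bij_betw f (carrier M) (carrier N)"
  shows "inv_into (carrier M) f \<in> module_homs R N M"
proof (rule module_homsI)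
  interpret M: Module.module R M by fact
  let ?g = "inv_into (carrier M) f"
  have inj: "inj_on f (carrier M)" and im: "f ` carrier M = carrier N" using bij by (auto simp: bij_betw_def)
  have g: "?g y \<in> carrier M" "f (?g y) = y" if "y \<in> carrier N" for y
    using that im by (auto intro: inv_into_into f_inv_into_f)
  show "?g x \<in> carrier M" if "x \<in> carrier N" for x using g that by blast
  show "?g (x \<oplus>\<^bsub>N\<^esub> y) = ?g x \<oplus>\<^bsub>M\<^esub> ?g y" if "x \<in> carrier N" "y \<in> carrier N" for x y
    using that g inj by (intro inv_into_f_eq) (auto simp: hom_add[OF f])
  show "?g (r \<odot>\<^bsub>N\<^esub> x) = r \<odot>\<^bsub>M\<^esub> ?g x" if "r \<in> carrier R" "x \<in> carrier N" for r x
    using that g inj by (intro inv_into_f_eq) (auto simp: hom_smult[OF f])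
qed

text \<open>\<open>Q\<close> is only assumed to carry operations that \<open>p\<close> respects, so
  quotients and transported structures inherit all module laws from \<open>M\<close> at
  once.\<close>

lemma module_image:
  assumes M: "Module.module R M" and im: "p ` carrier M = carrier Q"
    and add: "\<And>x y. x \<in> carrier M \<Longrightarrow> y \<in> carrier M \<Longrightarrow> p (x \<oplus>\<^bsub>M\<^esub> y) = p x \<oplus>\<^bsub>Q\<^esub> p y"
    and zero: "p \<zero>\<^bsub>M\<^esub> = \<zero>\<^bsub>Q\<^esub>"
    and smult: "\<And>r x. r \<in> carrier R \<Longrightarrow> x \<in> carrier M \<Longrightarrow> p (r \<odot>\<^bsub>M\<^esub> x) = r \<odot>\<^bsub>Q\<^esub> p x"
  shows "Module.module R Q"
proof -
  interpret M: Module.module R M by fact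
  have ex: "\<exists>a\<in>carrier M. x = p a" if "x \<in> carrier Q" for x using that im by blast
  have cl: "p x \<in> carrier Q" if "x \<in> carrier M" for x using that im by blast
  note rew = add[symmetric] smult[symmetric] zero[symmetric]
  show ?thesis
  proof (rule moduleI)
    show "cring R" by (rule M.is_cring)
    show "abelian_group Q"
    proof (rule abelian_groupI)
      show "\<zero>\<^bsub>Q\<^esub> \<in> carrier Q" using cl[of "\<zero>\<^bsub>M\<^esub>"] zero by simp
      fix x assume "x \<in> carrier Q"
      then obtain a where a: "a \<in> carrier M" "x = p a" using ex by blast
      then show "\<zero>\<^bsub>Q\<^esub> \<oplus>\<^bsub>Q\<^esub> x = x" by (simp add: rew)
      show "\<exists>y\<in>carrier Q. y \<oplus>\<^bsub>Q\<^esub> x = \<zero>\<^bsub>Q\<^esub>"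
        using a by (intro bexI[of _ "p (\<ominus>\<^bsub>M\<^esub> a)"]) (auto simp: rew M.l_neg cl)
    next
      fix x y z assume "x \<in> carrier Q" "y \<in> carrier Q" "z \<in> carrier Q"
      then obtain a b c where "a \<in> carrier M" "x = p a" "b \<in> carrier M" "y = p b" "c \<in> carrier M" "z = p c"
        using ex by meson
      then show "x \<oplus>\<^bsub>Q\<^esub> y \<oplus>\<^bsub>Q\<^esub> z = x \<oplus>\<^bsub>Q\<^esub> (y \<oplus>\<^bsub>Q\<^esub> z)" by (simp add: rew M.a_assoc)
    next
      fix x y assume "x \<in> carrier Q" "y \<in> carrier Q"
      then obtain a b where ab: "a \<in> carrier M" "x = p a" "b \<in> carrier M" "y = p b" using ex by meson
      then show "x \<oplus>\<^bsub>Q\<^esub> y \<in> carrier Q" by (simp add: rew cl)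
      show "x \<oplus>\<^bsub>Q\<^esub> y = y \<oplus>\<^bsub>Q\<^esub> x" using ab by (simp add: rew M.a_comm)
    qed
    show "r \<odot>\<^bsub>Q\<^esub> x \<in> carrier Q" if "r \<in> carrier R" "x \<in> carrier Q" for r x
      using that ex[of x] by (auto simp: rew cl)
    show "\<one>\<^bsub>R\<^esub> \<odot>\<^bsub>Q\<^esub> x = x" if "x \<in> carrier Q" for x
      using that ex[of x] by (auto simp: rew)
    fix r s x y assume rs: "r \<in> carrier R" "s \<in> carrier R" and "x \<in> carrier Q" "y \<in> carrier Q"
    then obtain a b where ab: "a \<in> carrier M" "x = p a" "b \<in> carrier M" "y = p b" using ex by meson
    show "(r \<oplus>\<^bsub>R\<^esub> s) \<odot>\<^bsub>Q\<^esub> x = r \<odot>\<^bsub>Q\<^esub> x \<oplus>\<^bsub>Q\<^esub> s \<odot>\<^bsub>Q\<^esub> x"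
      using rs ab by (simp add: rew M.smult_l_distr)
    show "(r \<otimes>\<^bsub>R\<^esub> s) \<odot>\<^bsub>Q\<^esub> x = r \<odot>\<^bsub>Q\<^esub> (s \<odot>\<^bsub>Q\<^esub> x)"
      using rs ab by (simp add: rew M.smult_assoc1)
    show "r \<odot>\<^bsub>Q\<^esub> (x \<oplus>\<^bsub>Q\<^esub> y) = r \<odot>\<^bsub>Q\<^esub> x \<oplus>\<^bsub>Q\<^esub> r \<odot>\<^bsub>Q\<^esub> y"
      using rs ab by (simp add: rew M.smult_r_distr)
  qed
qed

lemma submodule_zero:
  assumes "Module.module R M" "submodule N R M"
  shows "\<zero>\<^bsub>M\<^esub> \<in> N"
  using assms subgroup.one_closed[OF submodule.axioms(1)[OF assms(2)]] by simp

lemma submodule_as_module_simps [simp]: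
  "carrier (submodule_as_module M N) = N"
  "\<zero>\<^bsub>submodule_as_module M N\<^esub> = \<zero>\<^bsub>M\<^esub>"
  "x \<oplus>\<^bsub>submodule_as_module M N\<^esub> y = x \<oplus>\<^bsub>M\<^esub> y"
  "r \<odot>\<^bsub>submodule_as_module M N\<^esub> x = r \<odot>\<^bsub>M\<^esub> x"
  by (simp_all add: submodule_as_module_def)

lemma module_submodule_as_module:
  "Module.module R M \<Longrightarrow> submodule N R M \<Longrightarrow> Module.module R (submodule_as_module M N)"
  unfolding submodule_as_module_def by (rule submodule.submodule_is_module)

lemma kernel_submodule:
  assumes f: "f \<in> module_homs R M N" and "Module.module R M" "Module.module R N"
  shows "submodule {x \<in> carrier M. f x = \<zero>\<^bsub>N\<^esub>} R M"
proof -
  interpret M: Module.module R M by fact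
  interpret N: Module.module R N by fact
  show ?thesis
    by (rule M.submoduleI)
      (auto simp: hom_zero[OF assms] hom_minus[OF assms] hom_add[OF f] hom_smult[OF f])
qed

lemma image_submodule:
  assumes f: "f \<in> module_homs R M N" and "Module.module R M" "Module.module R N"
  shows "submodule (f ` carrier M) R N"
proof -
  interpret M: Module.module R M by fact
  interpret N: Module.module R N by fact
  show ?thesis
  proof (rule N.submoduleI)
    show "f ` carrier M \<subseteq> carrier N" using hom_closed[OF f] by blast
    show "\<zero>\<^bsub>N\<^esub> \<in> f ` carrier M" using hom_zero[OF assms] by (metis M.zero_closed imageI)
    show "\<ominus>\<^bsub>N\<^esub> a \<in> f ` carrier M" if "a \<in> f ` carrier M" for a
      using that hom_minus[OF assms] by (metis (no_types, opaque_lifting) M.a_inv_closed image_iff)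
    show "a \<oplus>\<^bsub>N\<^esub> b \<in> f ` carrier M" if "a \<in> f ` carrier M" "b \<in> f ` carrier M" for a b
      using that hom_add[OF f] by (metis (no_types, opaque_lifting) M.a_closed image_iff)
    show "r \<odot>\<^bsub>N\<^esub> b \<in> f ` carrier M" if "r \<in> carrier R" "b \<in> f ` carrier M" for r b
      using that hom_smult[OF f] by (metis (no_types, opaque_lifting) M.smult_closed image_iff)
  qed
qed

subsection \<open>Quotients\<close>

lemma
  assumes M: "Module.module R M" and N: "submodule N R M"
  shows module_quotient: "Module.module R (quotient_module M N)"
    and quotient_hom: "(\<lambda>x. N +>\<^bsub>M\<^esub> x) \<in> module_homs R M (quotient_module M N)"
    and quotient_surj: "(\<lambda>x. N +>\<^bsub>M\<^esub> x) ` carrier M = carrier (quotient_module M N)"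
    and quotient_zero_iff: "x \<in> carrier M \<Longrightarrow> N +>\<^bsub>M\<^esub> x = \<zero>\<^bsub>quotient_module M N\<^esub> \<longleftrightarrow> x \<in> N"
proof -
  interpret M: Module.module R M by fact
  have sg: "subgroup N (add_monoid M)" using N by (simp add: submodule_def)
  interpret S: abelian_subgroup N M
    by (rule abelian_subgroupI3) (auto simp: additive_subgroup_def sg M.abelian_group_axioms)
  have NM: "N \<subseteq> carrier M" using M.submoduleE(1)[OF N] .
  show im: "(\<lambda>x. N +>\<^bsub>M\<^esub> x) ` carrier M = carrier (quotient_module M N)"
    by (auto simp: quotient_module_def A_RCOSETS_def')
  have add: "N +>\<^bsub>M\<^esub> (x \<oplus>\<^bsub>M\<^esub> y) = (N +>\<^bsub>M\<^esub> x) \<oplus>\<^bsub>quotient_module M N\<^esub> (N +>\<^bsub>M\<^esub> y)"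
    if "x \<in> carrier M" "y \<in> carrier M" for x y
    using that by (simp add: quotient_module_def S.a_rcos_sum)
  have smult: "N +>\<^bsub>M\<^esub> (r \<odot>\<^bsub>M\<^esub> x) = r \<odot>\<^bsub>quotient_module M N\<^esub> (N +>\<^bsub>M\<^esub> x)"
    if r: "r \<in> carrier R" and x: "x \<in> carrier M" for r x
  proof -
    \<comment> \<open>A scalar multiple of a coset is defined as a union over the members of the
      coset; all cosets in this union coincide.\<close>
    have "N +>\<^bsub>M\<^esub> (r \<odot>\<^bsub>M\<^esub> y) = N +>\<^bsub>M\<^esub> (r \<odot>\<^bsub>M\<^esub> x)" if y: "y \<in> N +>\<^bsub>M\<^esub> x" for y
    proof -
      obtain n where n: "n \<in> N" "y = n \<oplus>\<^bsub>M\<^esub> x" using y by (auto simp: a_r_coset_def')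
      have "r \<odot>\<^bsub>M\<^esub> y = r \<odot>\<^bsub>M\<^esub> n \<oplus>\<^bsub>M\<^esub> r \<odot>\<^bsub>M\<^esub> x" using n r x NM by (auto simp: M.smult_r_distr)
      moreover have "r \<odot>\<^bsub>M\<^esub> n \<in> N" using M.submoduleE(4)[OF N r] n by blast
      ultimately have "r \<odot>\<^bsub>M\<^esub> y \<in> N +>\<^bsub>M\<^esub> (r \<odot>\<^bsub>M\<^esub> x)" by (auto simp: a_r_coset_def')
      then show ?thesis using r x by (intro S.a_repr_independence'[symmetric]) auto
    qed
    then have "(\<Union>y\<in>N +>\<^bsub>M\<^esub> x. N +>\<^bsub>M\<^esub> (r \<odot>\<^bsub>M\<^esub> y)) = (\<Union>y\<in>N +>\<^bsub>M\<^esub> x. N +>\<^bsub>M\<^esub> (r \<odot>\<^bsub>M\<^esub> x))"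
      by (intro SUP_cong refl)
    also have "\<dots> = N +>\<^bsub>M\<^esub> (r \<odot>\<^bsub>M\<^esub> x)" using S.a_rcos_self[OF x] by (subst UN_constant) auto
    finally show ?thesis by (simp add: quotient_module_def)
  qed
  have zero: "N +>\<^bsub>M\<^esub> \<zero>\<^bsub>M\<^esub> = \<zero>\<^bsub>quotient_module M N\<^esub>"
    using NM by (simp add: quotient_module_def)
  show "Module.module R (quotient_module M N)" by (rule module_image[OF M im add zero smult])
  show "(\<lambda>x. N +>\<^bsub>M\<^esub> x) \<in> module_homs R M (quotient_module M N)"
    by (rule module_homsI) (use im add smult in auto)
  show "N +>\<^bsub>M\<^esub> x = \<zero>\<^bsub>quotient_module M N\<^esub> \<longleftrightarrow> x \<in> N" if "x \<in> carrier M"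
    using that S.a_rcos_const[of x] S.a_rcos_self[of x] by (auto simp: quotient_module_def)
qed

lemma factor_through_surjection:
  assumes "Module.module R M" "Module.module R Q" "Module.module R N"
    and p: "p \<in> module_homs R M Q" "p ` carrier M = carrier Q"
    and f: "f \<in> module_homs R M N"
    and ker: "\<And>x. x \<in> carrier M \<Longrightarrow> p x = \<zero>\<^bsub>Q\<^esub> \<Longrightarrow> f x = \<zero>\<^bsub>N\<^esub>"
  shows "\<exists>g\<in>module_homs R Q N. \<forall>x\<in>carrier M. g (p x) = f x"
proof -
  interpret M: Module.module R M by fact
  interpret Q: Module.module R Q by fact
  interpret N: Module.module R N by fact
  have eq: "f x = f y" if "x \<in> carrier M" "y \<in> carrier M" "p x = p y" for x y
  proof -
    have "p (x \<oplus>\<^bsub>M\<^esub> \<ominus>\<^bsub>M\<^esub> y) = \<zero>\<^bsub>Q\<^esub>"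
      using that hom_closed[OF p(1)] by (simp add: hom_add[OF p(1)] hom_minus[OF p(1) assms(1,2)] Q.r_neg)
    then have "f x \<oplus>\<^bsub>N\<^esub> \<ominus>\<^bsub>N\<^esub> f y = \<zero>\<^bsub>N\<^esub>"
      using ker[of "x \<oplus>\<^bsub>M\<^esub> \<ominus>\<^bsub>M\<^esub> y"] that by (simp add: hom_add[OF f] hom_minus[OF f assms(1,3)])
    then show ?thesis by (rule N.eq_if_diff_zero) (use that hom_closed[OF f] in blast)+
  qed
  define s where "s q = (SOME x. x \<in> carrier M \<and> p x = q)" for q
  have s: "s q \<in> carrier M" "p (s q) = q" if "q \<in> carrier Q" for q
  proof -
    have "\<exists>x. x \<in> carrier M \<and> p x = q" using that unfolding p(2)[symmetric] by blast
    then have "s q \<in> carrier M \<and> p (s q) = q" unfolding s_def by (rule someI_ex)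
    then show "s q \<in> carrier M" "p (s q) = q" by auto
  qed
  have g: "f (s (p x)) = f x" if "x \<in> carrier M" for x
    using that s[of "p x"] hom_closed[OF p(1)] by (intro eq) auto
  have "(\<lambda>q. f (s q)) \<in> module_homs R Q N"
  proof (rule module_homsI)
    show "f (s q) \<in> carrier N" if "q \<in> carrier Q" for q using that s hom_closed[OF f] by blast
    show "f (s (q \<oplus>\<^bsub>Q\<^esub> q')) = f (s q) \<oplus>\<^bsub>N\<^esub> f (s q')" if "q \<in> carrier Q" "q' \<in> carrier Q" for q q'
      using that s g[of "s q \<oplus>\<^bsub>M\<^esub> s q'"] by (simp add: hom_add[OF f] hom_add[OF p(1)])
    show "f (s (r \<odot>\<^bsub>Q\<^esub> q)) = r \<odot>\<^bsub>N\<^esub> f (s q)" if "r \<in> carrier R" "q \<in> carrier Q" for r q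
      using that s g[of "r \<odot>\<^bsub>M\<^esub> s q"] by (simp add: hom_smult[OF f] hom_smult[OF p(1)])
  qed
  then show ?thesis by (rule bexI[rotated]) (use g in simp)
qed

subsection \<open>Transport along a bijection and products\<close>

text \<open>Changes the type of the elements. Modules built as quotients, products or tuples are
  brought into the universe of the category in this way.\<close>

lemma transport_module:
  fixes M :: "('a, 'b) module"
  assumes M: "Module.module R M" and "carrier M \<lesssim> (UNIV :: 'u set)"
  shows "\<exists>(M' :: ('a, 'u) module) \<phi>. Module.module R M' \<and> \<phi> \<in> module_homs R M M' \<and>
    bij_betw \<phi> (carrier M) (carrier M')"
proof -
  interpret M: Module.module R M by fact
  obtain \<phi> :: "'b \<Rightarrow> 'u" where inj: "inj_on \<phi> (carrier M)" using assms(2) by (auto simp: lepoll_def)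
  let ?g = "inv_into (carrier M) \<phi>"
  define M' :: "('a, 'u) module" where
    "M' = \<lparr>carrier = \<phi> ` carrier M, monoid.mult = undefined, one = undefined, ring.zero = \<phi> \<zero>\<^bsub>M\<^esub>,
      ring.add = (\<lambda>x y. \<phi> (?g x \<oplus>\<^bsub>M\<^esub> ?g y)), smult = (\<lambda>r x. \<phi> (r \<odot>\<^bsub>M\<^esub> ?g x))\<rparr>"
  have add: "\<phi> (x \<oplus>\<^bsub>M\<^esub> y) = \<phi> x \<oplus>\<^bsub>M'\<^esub> \<phi> y" if "x \<in> carrier M" "y \<in> carrier M" for x y
    using that inj by (simp add: M'_def)
  have sm: "\<phi> (r \<odot>\<^bsub>M\<^esub> x) = r \<odot>\<^bsub>M'\<^esub> \<phi> x" if "r \<in> carrier R" "x \<in> carrier M" for r x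
    using that inj by (simp add: M'_def)
  have car: "carrier M' = \<phi> ` carrier M" "\<zero>\<^bsub>M'\<^esub> = \<phi> \<zero>\<^bsub>M\<^esub>" by (simp_all add: M'_def)
  have "Module.module R M'" by (rule module_image[OF M, where p = \<phi>]) (use car add sm in auto)
  moreover have "\<phi> \<in> module_homs R M M'" by (rule module_homsI) (use car add sm in auto)
  moreover have "bij_betw \<phi> (carrier M) (carrier M')" using inj car by (simp add: bij_betw_def)
  ultimately show ?thesis by blast
qed

definition prod_module :: "('a, 'b) module \<Rightarrow> ('a, 'c) module \<Rightarrow> ('a, 'b \<times> 'c) module" where
  "prod_module M N =
    \<lparr>carrier = carrier M \<times> carrier N, monoid.mult = undefined, one = undefined,
     ring.zero = (\<zero>\<^bsub>M\<^esub>, \<zero>\<^bsub>N\<^esub>),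
     ring.add = (\<lambda>x y. (fst x \<oplus>\<^bsub>M\<^esub> fst y, snd x \<oplus>\<^bsub>N\<^esub> snd y)),
     smult = (\<lambda>r x. (r \<odot>\<^bsub>M\<^esub> fst x, r \<odot>\<^bsub>N\<^esub> snd x))\<rparr>"

lemma prod_module_simps [simp]:
  "carrier (prod_module M N) = carrier M \<times> carrier N"
  "\<zero>\<^bsub>prod_module M N\<^esub> = (\<zero>\<^bsub>M\<^esub>, \<zero>\<^bsub>N\<^esub>)"
  "x \<oplus>\<^bsub>prod_module M N\<^esub> y = (fst x \<oplus>\<^bsub>M\<^esub> fst y, snd x \<oplus>\<^bsub>N\<^esub> snd y)"
  "r \<odot>\<^bsub>prod_module M N\<^esub> x = (r \<odot>\<^bsub>M\<^esub> fst x, r \<odot>\<^bsub>N\<^esub> snd x)"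
  by (simp_all add: prod_module_def)

lemma module_prod:
  assumes "Module.module R M" "Module.module R N"
  shows "Module.module R (prod_module M N)"
proof -
  interpret M: Module.module R M by fact
  interpret N: Module.module R N by fact
  show ?thesis
  proof (rule moduleI)
    show "abelian_group (prod_module M N)"
    proof (rule abelian_groupI)
      fix x assume "x \<in> carrier (prod_module M N)"
      then show "\<exists>y\<in>carrier (prod_module M N). y \<oplus>\<^bsub>prod_module M N\<^esub> x = \<zero>\<^bsub>prod_module M N\<^esub>"
        by (intro bexI[of _ "(\<ominus>\<^bsub>M\<^esub> fst x, \<ominus>\<^bsub>N\<^esub> snd x)"]) (auto simp: M.l_neg N.l_neg)
    qed (auto simp: M.a_ac N.a_ac)
  qed (auto simp: M.is_cring M.smult_l_distr N.smult_l_distr M.smult_r_distr N.smult_r_distr M.smult_assoc1 N.smult_assoc1)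
qed

subsection \<open>Baer's criterion\<close>

text \<open>Zorn's lemma on partial extensions of \<open>f\<close>, encoded as graphs in Y x E so
  that the union of a chain is again a candidate. The hypothesis \<open>ideals\<close> says that a
  homomorphism from an ideal to \<open>E\<close> multiplies a fixed element, that is, extends to the
  whole ring; it enlarges any graph that misses some \<open>y\<close>.\<close>

lemma Baer_criterion:
  fixes E :: "('a, 'b) module"
  assumes E: "Module.module R E"
    and ideals: "\<And>I f. \<lbrakk>ideal I R; f \<in> I \<rightarrow> carrier E;
      \<And>a b. a \<in> I \<Longrightarrow> b \<in> I \<Longrightarrow> f (a \<oplus>\<^bsub>R\<^esub> b) = f a \<oplus>\<^bsub>E\<^esub> f b;
      \<And>r a. r \<in> carrier R \<Longrightarrow> a \<in> I \<Longrightarrow> f (r \<otimes>\<^bsub>R\<^esub> a) = r \<odot>\<^bsub>E\<^esub> f a\<rbrakk>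
      \<Longrightarrow> \<exists>e\<in>carrier E. \<forall>a\<in>I. f a = a \<odot>\<^bsub>E\<^esub> e"
  shows "injective_module TYPE('v) R E"
  unfolding injective_module_def
proof (intro conjI allI impI E)
  fix X Y :: "('a, 'v) module" and i f
  assume "Module.module R X \<and> Module.module R Y \<and> i \<in> module_homs R X Y \<and> inj_on i (carrier X) \<and>
    f \<in> module_homs R X E"
  then have X: "Module.module R X" and Y: "Module.module R Y" and i: "i \<in> module_homs R X Y"
    and inj: "inj_on i (carrier X)" and f: "f \<in> module_homs R X E" by auto
  interpret R: cring R by (rule Module.module.axioms(1)[OF Y])
  interpret X: Module.module R X by fact
  interpret Y: Module.module R Y by fact
  interpret E: Module.module R E by fact
  \<comment> \<open>A candidate is the graph of a linear map into \<open>E\<close> whose domain is a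
    submodule of \<open>Y\<close> containing the image of \<open>i\<close>, and which extends
    \<open>f\<close> from there.\<close>
  define P where "P G \<longleftrightarrow> G \<subseteq> carrier Y \<times> carrier E \<and> (\<forall>x\<in>carrier X. (i x, f x) \<in> G) \<and>
    (\<forall>y e y' e'. (y, e) \<in> G \<longrightarrow> (y', e') \<in> G \<longrightarrow> (y \<oplus>\<^bsub>Y\<^esub> y', e \<oplus>\<^bsub>E\<^esub> e') \<in> G) \<and>
    (\<forall>r y e. r \<in> carrier R \<longrightarrow> (y, e) \<in> G \<longrightarrow> (r \<odot>\<^bsub>Y\<^esub> y, r \<odot>\<^bsub>E\<^esub> e) \<in> G) \<and>
    (\<forall>y e e'. (y, e) \<in> G \<longrightarrow> (y, e') \<in> G \<longrightarrow> e = e')" for G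
  have Pc: "y \<in> carrier Y \<and> e \<in> carrier E" if "P G" "(y, e) \<in> G" for G y e using that by (auto simp: P_def)
  have Px: "(i x, f x) \<in> G" if "P G" "x \<in> carrier X" for G x using that by (simp add: P_def)
  have Pa: "(y \<oplus>\<^bsub>Y\<^esub> y', e \<oplus>\<^bsub>E\<^esub> e') \<in> G" if "P G" "(y, e) \<in> G" "(y', e') \<in> G" for G y e y' e'
    using that by (simp add: P_def)
  have Ps: "(r \<odot>\<^bsub>Y\<^esub> y, r \<odot>\<^bsub>E\<^esub> e) \<in> G" if "P G" "r \<in> carrier R" "(y, e) \<in> G" for G r y e
    using that by (simp add: P_def)
  have Pu: "e = e'" if "P G" "(y, e) \<in> G" "(y, e') \<in> G" for G y e e'
  proof -
    have "\<forall>y e e'. (y, e) \<in> G \<longrightarrow> (y, e') \<in> G \<longrightarrow> e = e'" using that(1) unfolding P_def by (elim conjE)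
    then show ?thesis using that(2,3) by blast
  qed
  have "\<exists>G\<in>{G. P G}. \<forall>H\<in>{G. P G}. G \<subseteq> H \<longrightarrow> H = G"
  proof (rule subset_Zorn_nonempty)
    have "P ((\<lambda>x. (i x, f x)) ` carrier X)"
      unfolding P_def
    proof (intro conjI allI impI)
      fix y e y' e' assume "(y, e) \<in> (\<lambda>x. (i x, f x)) ` carrier X" "(y', e') \<in> (\<lambda>x. (i x, f x)) ` carrier X"
      then obtain x x' where "x \<in> carrier X" "x' \<in> carrier X" "y = i x" "e = f x" "y' = i x'" "e' = f x'" by auto
      then show "(y \<oplus>\<^bsub>Y\<^esub> y', e \<oplus>\<^bsub>E\<^esub> e') \<in> (\<lambda>x. (i x, f x)) ` carrier X"
        by (intro image_eqI[of _ _ "x \<oplus>\<^bsub>X\<^esub> x'"]) (auto simp: hom_add[OF i] hom_add[OF f])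
    next
      fix r y e assume "r \<in> carrier R" "(y, e) \<in> (\<lambda>x. (i x, f x)) ` carrier X"
      then obtain x where "x \<in> carrier X" "y = i x" "e = f x" by auto
      then show "(r \<odot>\<^bsub>Y\<^esub> y, r \<odot>\<^bsub>E\<^esub> e) \<in> (\<lambda>x. (i x, f x)) ` carrier X"
        using \<open>r \<in> carrier R\<close> by (intro image_eqI[of _ _ "r \<odot>\<^bsub>X\<^esub> x"]) (auto simp: hom_smult[OF i] hom_smult[OF f])
    qed (use inj hom_closed[OF i] hom_closed[OF f] in \<open>auto dest: inj_onD\<close>)
    then show "{G. P G} \<noteq> {}" by blast
  next
    fix \<C> assume ne: "\<C> \<noteq> {}" and ch: "subset.chain {G. P G} \<C>"
    have PC: "P G" if "G \<in> \<C>" for G using ch that by (auto simp: subset.chain_def)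
    have two: "\<exists>G\<in>\<C>. a \<in> G \<and> b \<in> G" if ab: "a \<in> \<Union>\<C>" "b \<in> \<Union>\<C>" for a b
    proof -
      obtain A B where AB: "A \<in> \<C>" "a \<in> A" "B \<in> \<C>" "b \<in> B" using ab by blast
      then have "A \<subseteq> B \<or> B \<subseteq> A" using ch unfolding subset_chain_def by blast
      then show ?thesis using AB by blast
    qed
    show "\<Union>\<C> \<in> {G. P G}"
      unfolding mem_Collect_eq P_def
    proof (intro conjI allI impI ballI)
      show "\<Union>\<C> \<subseteq> carrier Y \<times> carrier E" using Pc PC by (intro subsetI) (force dest: Pc[OF PC])
      show "(i x, f x) \<in> \<Union>\<C>" if "x \<in> carrier X" for x
      proof -
        obtain G where G: "G \<in> \<C>" using ne by blast
        then show ?thesis using Px[OF PC[OF G] \<open>x \<in> carrier X\<close>] by blast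
      qed
    next
      fix y e y' e' assume "(y, e) \<in> \<Union>\<C>" "(y', e') \<in> \<Union>\<C>"
      then obtain G where G: "G \<in> \<C>" "(y, e) \<in> G" "(y', e') \<in> G" using two by meson
      show "(y \<oplus>\<^bsub>Y\<^esub> y', e \<oplus>\<^bsub>E\<^esub> e') \<in> \<Union>\<C>" by (rule UnionI[OF G(1) Pa[OF PC[OF G(1)] G(2,3)]])
    next
      fix r y e assume r: "r \<in> carrier R" "(y, e) \<in> \<Union>\<C>"
      then obtain G where G: "G \<in> \<C>" "(y, e) \<in> G" by blast
      show "(r \<odot>\<^bsub>Y\<^esub> y, r \<odot>\<^bsub>E\<^esub> e) \<in> \<Union>\<C>" by (rule UnionI[OF G(1) Ps[OF PC[OF G(1)] r(1) G(2)]])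
    next
      fix y e e' assume "(y, e) \<in> \<Union>\<C>" "(y, e') \<in> \<Union>\<C>"
      then obtain G where G: "G \<in> \<C>" "(y, e) \<in> G" "(y, e') \<in> G" using two by meson
      then show "e = e'" using Pu[OF PC[OF G(1)] G(2,3)] by simp
    qed
  qed
  then obtain G where G: "P G" and max: "\<And>H. P H \<Longrightarrow> G \<subseteq> H \<Longrightarrow> H = G" by blast
  have Gc: "y \<in> carrier Y" "e \<in> carrier E" if "(y, e) \<in> G" for y e using Pc[OF G that] by auto
  note Gx = Px[OF G] and Ga = Pa[OF G] and Gs = Ps[OF G] and Gu = Pu[OF G]
  have G0: "(\<zero>\<^bsub>Y\<^esub>, \<zero>\<^bsub>E\<^esub>) \<in> G" using Gx[of "\<zero>\<^bsub>X\<^esub>"] hom_zero[OF i X Y] hom_zero[OF f X E] by simp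
  have Gm: "(\<ominus>\<^bsub>Y\<^esub> y, \<ominus>\<^bsub>E\<^esub> e) \<in> G" if "(y, e) \<in> G" for y e
    using Gs[OF _ that, of "\<ominus>\<^bsub>R\<^esub> \<one>\<^bsub>R\<^esub>"] Gc[OF that] by (simp add: Y.smult_l_minus E.smult_l_minus)
  have total: "\<exists>e. (y, e) \<in> G" if y: "y \<in> carrier Y" for y
  proof -
    \<comment> \<open>The ideal of scalars that carry \<open>y\<close> into the domain of
      \<open>G\<close>, with the map \<open>h\<close> induced by \<open>G\<close>. Once
      \<open>h r\<close> is \<open>r\<close> times a fixed \<open>e\<close>, sending
      \<open>y\<close> to \<open>e\<close> is consistent with \<open>G\<close>.\<close>
    define I where "I = {r \<in> carrier R. \<exists>e. (r \<odot>\<^bsub>Y\<^esub> y, e) \<in> G}"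
    define h where "h r = (THE e. (r \<odot>\<^bsub>Y\<^esub> y, e) \<in> G)" for r
    have h: "h r = e" if "(r \<odot>\<^bsub>Y\<^esub> y, e) \<in> G" for r e
      unfolding h_def using that Gu by (intro the_equality) auto
    have hI: "(r \<odot>\<^bsub>Y\<^esub> y, h r) \<in> G" if "r \<in> I" for r using that h unfolding I_def by auto
    have hadd: "((r \<oplus>\<^bsub>R\<^esub> s) \<odot>\<^bsub>Y\<^esub> y, h r \<oplus>\<^bsub>E\<^esub> h s) \<in> G" if "r \<in> I" "s \<in> I" for r s
      using Ga[OF hI[OF that(1)] hI[OF that(2)]] that y by (simp add: I_def Y.smult_l_distr)
    have hsm: "((s \<otimes>\<^bsub>R\<^esub> r) \<odot>\<^bsub>Y\<^esub> y, s \<odot>\<^bsub>E\<^esub> h r) \<in> G" if "r \<in> I" "s \<in> carrier R" for r s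
      using Gs[OF that(2) hI[OF that(1)]] that y by (simp add: I_def Y.smult_assoc1)
    have "ideal I R"
    proof (rule idealI)
      show "ring R" by (rule cring.axioms(1)[OF Module.module.axioms(1)[OF Y]])
      show "subgroup I (add_monoid R)"
      proof (rule R.add.subgroupI)
        show "I \<subseteq> carrier R" by (auto simp: I_def)
        show "I \<noteq> {}" using G0 y by (auto simp: I_def intro!: exI[of _ "\<zero>\<^bsub>R\<^esub>"])
        show "\<ominus>\<^bsub>R\<^esub> a \<in> I" if "a \<in> I" for a
          using that Gm[OF hI[OF that]] y by (auto simp: I_def Y.smult_l_minus)
        show "a \<oplus>\<^bsub>R\<^esub> b \<in> I" if "a \<in> I" "b \<in> I" for a b using hadd[OF that] that by (auto simp: I_def)
      qed
      show "x \<otimes>\<^bsub>R\<^esub> a \<in> I" if "a \<in> I" "x \<in> carrier R" for a x using hsm[OF that] that by (auto simp: I_def)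
      then show "a \<otimes>\<^bsub>R\<^esub> x \<in> I" if "a \<in> I" "x \<in> carrier R" for a x
        using that by (subst R.m_comm) (auto simp: I_def)
    qed
    then have "\<exists>e\<in>carrier E. \<forall>a\<in>I. h a = a \<odot>\<^bsub>E\<^esub> e"
    proof (rule ideals)
      show "h \<in> I \<rightarrow> carrier E" using hI Gc by blast
      show "h (a \<oplus>\<^bsub>R\<^esub> b) = h a \<oplus>\<^bsub>E\<^esub> h b" if "a \<in> I" "b \<in> I" for a b using h hadd that by blast
      show "h (r \<otimes>\<^bsub>R\<^esub> a) = r \<odot>\<^bsub>E\<^esub> h a" if "r \<in> carrier R" "a \<in> I" for a r using h hsm that by blast
    qed
    then obtain e where e: "e \<in> carrier E" "\<And>a. a \<in> I \<Longrightarrow> h a = a \<odot>\<^bsub>E\<^esub> e" by blast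
    define H where "H = {(d \<oplus>\<^bsub>Y\<^esub> r \<odot>\<^bsub>Y\<^esub> y, c \<oplus>\<^bsub>E\<^esub> r \<odot>\<^bsub>E\<^esub> e) | d c r. (d, c) \<in> G \<and> r \<in> carrier R}"
    have HI: "(u, v) \<in> H" if "(d, c) \<in> G" "r \<in> carrier R" "u = d \<oplus>\<^bsub>Y\<^esub> r \<odot>\<^bsub>Y\<^esub> y" "v = c \<oplus>\<^bsub>E\<^esub> r \<odot>\<^bsub>E\<^esub> e" for u v d c r
      using that unfolding H_def by blast
    have GH: "G \<subseteq> H"
    proof
      fix p assume "p \<in> G"
      then obtain d c where "p = (d, c)" "(d, c) \<in> G" by (cases p) auto
      then show "p \<in> H" using Gc[of d c] y e(1) by (auto intro!: HI[of d c "\<zero>\<^bsub>R\<^esub>"])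
    qed
    have "P H"
      unfolding P_def
    proof (intro conjI allI impI ballI)
      show "H \<subseteq> carrier Y \<times> carrier E" using Gc y e(1) by (auto simp: H_def)
      show "(i x, f x) \<in> H" if "x \<in> carrier X" for x using GH Gx that by blast
    next
      fix u v u' v' assume "(u, v) \<in> H" "(u', v') \<in> H"
      then obtain d c r d' c' r' where *: "(d, c) \<in> G" "r \<in> carrier R" "u = d \<oplus>\<^bsub>Y\<^esub> r \<odot>\<^bsub>Y\<^esub> y" "v = c \<oplus>\<^bsub>E\<^esub> r \<odot>\<^bsub>E\<^esub> e"
        "(d', c') \<in> G" "r' \<in> carrier R" "u' = d' \<oplus>\<^bsub>Y\<^esub> r' \<odot>\<^bsub>Y\<^esub> y" "v' = c' \<oplus>\<^bsub>E\<^esub> r' \<odot>\<^bsub>E\<^esub> e" unfolding H_def by blast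
      show "(u \<oplus>\<^bsub>Y\<^esub> u', v \<oplus>\<^bsub>E\<^esub> v') \<in> H"
        by (rule HI[OF Ga[OF *(1,5)], of "r \<oplus>\<^bsub>R\<^esub> r'"])
          (use * Gc y e(1) in \<open>auto simp: Y.smult_l_distr E.smult_l_distr Y.a_ac E.a_ac\<close>)
    next
      fix s u v assume s: "s \<in> carrier R" and "(u, v) \<in> H"
      then obtain d c r where *: "(d, c) \<in> G" "r \<in> carrier R" "u = d \<oplus>\<^bsub>Y\<^esub> r \<odot>\<^bsub>Y\<^esub> y" "v = c \<oplus>\<^bsub>E\<^esub> r \<odot>\<^bsub>E\<^esub> e"
        unfolding H_def by blast
      show "(s \<odot>\<^bsub>Y\<^esub> u, s \<odot>\<^bsub>E\<^esub> v) \<in> H"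
        by (rule HI[OF Gs[OF s *(1)], of "s \<otimes>\<^bsub>R\<^esub> r"])
          (use * s Gc y e(1) in \<open>auto simp: Y.smult_r_distr E.smult_r_distr Y.smult_assoc1 E.smult_assoc1\<close>)
    next
      fix u v v' assume "(u, v) \<in> H" "(u, v') \<in> H"
      then obtain d c r d' c' r' where *: "(d, c) \<in> G" "r \<in> carrier R" "u = d \<oplus>\<^bsub>Y\<^esub> r \<odot>\<^bsub>Y\<^esub> y" "v = c \<oplus>\<^bsub>E\<^esub> r \<odot>\<^bsub>E\<^esub> e"
        "(d', c') \<in> G" "r' \<in> carrier R" "u = d' \<oplus>\<^bsub>Y\<^esub> r' \<odot>\<^bsub>Y\<^esub> y" "v' = c' \<oplus>\<^bsub>E\<^esub> r' \<odot>\<^bsub>E\<^esub> e" unfolding H_def by blast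
      \<comment> \<open>Two expressions of one element differ by \<open>?s\<close> times
        \<open>y\<close>, which therefore lies in the domain of \<open>G\<close>; there the value is
        \<open>?s\<close> times \<open>e\<close>, so both expressions receive the same
        value.\<close>
      let ?s = "r' \<ominus>\<^bsub>R\<^esub> r"
      have dc: "d \<in> carrier Y" "d' \<in> carrier Y" "c \<in> carrier E" "c' \<in> carrier E" using * Gc by auto
      have "?s \<odot>\<^bsub>Y\<^esub> y \<oplus>\<^bsub>Y\<^esub> d' = (d' \<oplus>\<^bsub>Y\<^esub> r' \<odot>\<^bsub>Y\<^esub> y) \<oplus>\<^bsub>Y\<^esub> \<ominus>\<^bsub>Y\<^esub> (r \<odot>\<^bsub>Y\<^esub> y)"
        using *(2,6) y dc by (simp add: a_minus_def Y.smult_l_distr Y.smult_l_minus Y.a_ac)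
      also have "\<dots> = (d \<oplus>\<^bsub>Y\<^esub> r \<odot>\<^bsub>Y\<^esub> y) \<oplus>\<^bsub>Y\<^esub> \<ominus>\<^bsub>Y\<^esub> (r \<odot>\<^bsub>Y\<^esub> y)" using *(3,7) by simp
      also have "\<dots> = d" using *(2,6) y dc by (simp add: Y.a_assoc Y.r_neg)
      finally have d: "?s \<odot>\<^bsub>Y\<^esub> y \<oplus>\<^bsub>Y\<^esub> d' = d" .
      have "?s \<odot>\<^bsub>Y\<^esub> y = d \<oplus>\<^bsub>Y\<^esub> \<ominus>\<^bsub>Y\<^esub> d'" unfolding d[symmetric] using * y dc by (simp add: Y.a_assoc Y.r_neg)
      then have sG: "(?s \<odot>\<^bsub>Y\<^esub> y, c \<oplus>\<^bsub>E\<^esub> \<ominus>\<^bsub>E\<^esub> c') \<in> G" using Ga[OF *(1) Gm[OF *(5)]] by simp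
      then have "?s \<in> I" using * unfolding I_def by auto
      then have "c \<oplus>\<^bsub>E\<^esub> \<ominus>\<^bsub>E\<^esub> c' = ?s \<odot>\<^bsub>E\<^esub> e" using e(2) h[OF sG] by simp
      then have "c \<oplus>\<^bsub>E\<^esub> \<ominus>\<^bsub>E\<^esub> c' = r' \<odot>\<^bsub>E\<^esub> e \<oplus>\<^bsub>E\<^esub> \<ominus>\<^bsub>E\<^esub> (r \<odot>\<^bsub>E\<^esub> e)"
        using * e(1) by (simp add: a_minus_def E.smult_l_distr E.smult_l_minus)
      then have "(c \<oplus>\<^bsub>E\<^esub> \<ominus>\<^bsub>E\<^esub> c') \<oplus>\<^bsub>E\<^esub> (c' \<oplus>\<^bsub>E\<^esub> r \<odot>\<^bsub>E\<^esub> e) = (r' \<odot>\<^bsub>E\<^esub> e \<oplus>\<^bsub>E\<^esub> \<ominus>\<^bsub>E\<^esub> (r \<odot>\<^bsub>E\<^esub> e)) \<oplus>\<^bsub>E\<^esub> (c' \<oplus>\<^bsub>E\<^esub> r \<odot>\<^bsub>E\<^esub> e)" by simp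
      moreover have "(c \<oplus>\<^bsub>E\<^esub> \<ominus>\<^bsub>E\<^esub> c') \<oplus>\<^bsub>E\<^esub> (c' \<oplus>\<^bsub>E\<^esub> r \<odot>\<^bsub>E\<^esub> e) = c \<oplus>\<^bsub>E\<^esub> r \<odot>\<^bsub>E\<^esub> e"
        using *(2) dc e(1) by (intro E.minus_add_add_cancel) auto
      moreover have "(r' \<odot>\<^bsub>E\<^esub> e \<oplus>\<^bsub>E\<^esub> \<ominus>\<^bsub>E\<^esub> (r \<odot>\<^bsub>E\<^esub> e)) \<oplus>\<^bsub>E\<^esub> (c' \<oplus>\<^bsub>E\<^esub> r \<odot>\<^bsub>E\<^esub> e) = c' \<oplus>\<^bsub>E\<^esub> r' \<odot>\<^bsub>E\<^esub> e"
        using *(2,6) dc e(1) E.minus_add_add_cancel[of "r' \<odot>\<^bsub>E\<^esub> e" "r \<odot>\<^bsub>E\<^esub> e" c'] by (simp add: E.a_comm)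
      ultimately show "v = v'" using * by simp
    qed
    then have "H = G" using max GH by blast
    moreover have "(y, e) \<in> H" using y e(1) by (intro HI[OF G0, of "\<one>\<^bsub>R\<^esub>"]) auto
    ultimately show ?thesis by blast
  qed
  define g where "g y = (THE e. (y, e) \<in> G)" for y
  have g: "g y = e" if "(y, e) \<in> G" for y e unfolding g_def using that Gu by (intro the_equality) auto
  have gG: "(y, g y) \<in> G" if "y \<in> carrier Y" for y using total[OF that] g by auto
  have "g \<in> module_homs R Y E"
  proof (rule module_homsI)
    show "g y \<in> carrier E" if "y \<in> carrier Y" for y using Gc(2)[OF gG[OF that]] .
    show "g (y \<oplus>\<^bsub>Y\<^esub> y') = g y \<oplus>\<^bsub>E\<^esub> g y'" if "y \<in> carrier Y" "y' \<in> carrier Y" for y y'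
      by (rule g[OF Ga[OF gG[OF that(1)] gG[OF that(2)]]])
    show "g (r \<odot>\<^bsub>Y\<^esub> y) = r \<odot>\<^bsub>E\<^esub> g y" if "r \<in> carrier R" "y \<in> carrier Y" for r y
      by (rule g[OF Gs[OF that(1) gG[OF that(2)]]])
  qed
  moreover have "\<forall>x\<in>carrier X. g (i x) = f x" using g[OF Gx] by simp
  ultimately show "\<exists>g\<in>module_homs R Y E. \<forall>x\<in>carrier X. g (i x) = f x" by blast
qed

section \<open>Modules over the Hahn ring\<close>

lemma carrier_hahn_ring: "carrier hahn_ring = coeff ` {a. integral a}"
proof -
  have v: "0 \<le> hahn_valuation (coeff a) \<longleftrightarrow> integral a" for a
    by (simp add: hahn_valuation_def supp_coeff_eq_empty integral_def val_def)
  have "carrier hahn_ring = {r. well_ordered (supp r) \<and> 0 \<le> hahn_valuation r}"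
    by (simp add: hahn_ring_def hahn_field_def)
  also have "\<dots> = {r \<in> range coeff. 0 \<le> hahn_valuation r}"
    using type_definition.Rep_range[OF type_definition_hahn] by auto
  also have "\<dots> = coeff ` {a. integral a}" using v by auto
  finally show ?thesis .
qed

lemma coeff_in_hahn_ring [simp]: "coeff a \<in> carrier hahn_ring \<longleftrightarrow> integral a"
  by (auto simp: carrier_hahn_ring coeff_inject)

lemma hahn_ring_elem: "r \<in> carrier hahn_ring \<Longrightarrow> \<exists>a. integral a \<and> r = coeff a"
  by (auto simp: carrier_hahn_ring)

lemma hahn_ring_simps:
  "coeff a \<oplus>\<^bsub>hahn_ring\<^esub> coeff b = coeff (a + b)"
  "coeff a \<otimes>\<^bsub>hahn_ring\<^esub> coeff b = coeff (a * b)"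
  "\<zero>\<^bsub>hahn_ring\<^esub> = coeff 0" "\<one>\<^bsub>hahn_ring\<^esub> = coeff 1"
  by (auto simp: hahn_ring_def hahn_field_def coeff_times coeff_1)

lemma cring_hahn_ring: "cring hahn_ring"
proof (rule cringI)
  show "abelian_group hahn_ring"
  proof (rule abelian_groupI)
    fix x assume "x \<in> carrier hahn_ring"
    then show "\<exists>y\<in>carrier hahn_ring. y \<oplus>\<^bsub>hahn_ring\<^esub> x = \<zero>\<^bsub>hahn_ring\<^esub>"
      by (intro bexI[of _ x]) (auto simp: hahn_ring_simps dest: hahn_ring_elem)
  qed (auto simp: carrier_hahn_ring hahn_ring_simps integral_add ac_simps)
  show "Group.comm_monoid hahn_ring"
    by (rule Group.comm_monoidI) (auto simp: carrier_hahn_ring hahn_ring_simps integral_mult ac_simps)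
qed (auto simp: carrier_hahn_ring hahn_ring_simps distrib_right)

text \<open>Scalars are written \<open>coeff a\<close> with \<open>a\<close> integral, so that ring
  arithmetic takes place in the type \<open>hahn\<close>; additive inverses disappear because x + x
  = 0.\<close>

locale hmodule = Module.module hahn_ring M for M :: "(real \<Rightarrow> bit, 'b) module" (structure)
begin

lemma hs_closed [simp, intro]: "integral a \<Longrightarrow> x \<in> carrier M \<Longrightarrow> coeff a \<odot> x \<in> carrier M"
  by (rule smult_closed) simp_all

lemma hs_add: "integral a \<Longrightarrow> integral b \<Longrightarrow> x \<in> carrier M \<Longrightarrow> coeff (a + b) \<odot> x = coeff a \<odot> x \<oplus> coeff b \<odot> x"
  using smult_l_distr[of "coeff a" "coeff b" x] by (simp add: hahn_ring_simps)

lemma hs_mult: "integral a \<Longrightarrow> integral b \<Longrightarrow> x \<in> carrier M \<Longrightarrow> coeff (a * b) \<odot> x = coeff a \<odot> (coeff b \<odot> x)"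
  using smult_assoc1[of "coeff a" "coeff b" x] by (simp add: hahn_ring_simps)

lemma hs_one [simp]: "x \<in> carrier M \<Longrightarrow> coeff 1 \<odot> x = x"
  using smult_one[of x] by (simp add: hahn_ring_simps)

lemma hs_zero [simp]: "x \<in> carrier M \<Longrightarrow> coeff 0 \<odot> x = \<zero>"
  using smult_l_null[of x] by (simp add: hahn_ring_simps)

lemma hs_radd: "integral a \<Longrightarrow> x \<in> carrier M \<Longrightarrow> y \<in> carrier M \<Longrightarrow> coeff a \<odot> (x \<oplus> y) = coeff a \<odot> x \<oplus> coeff a \<odot> y"
  by (rule smult_r_distr) simp_all

lemma hs_rzero [simp]: "integral a \<Longrightarrow> coeff a \<odot> \<zero> = \<zero>"
  by (rule smult_r_null) simp

lemma add_self [simp]: "x \<in> carrier M \<Longrightarrow> x \<oplus> x = \<zero>"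
  using hs_add[of 1 1 x] by simp

lemma minus_self [simp]: "x \<in> carrier M \<Longrightarrow> \<ominus> x = x"
  by (rule M.minus_equality) auto

lemma add_self_left [simp]: "x \<in> carrier M \<Longrightarrow> y \<in> carrier M \<Longrightarrow> x \<oplus> (x \<oplus> y) = y"
  by (simp add: M.a_assoc[symmetric])

lemma eq_if_add_zero: "x \<oplus> y = \<zero> \<Longrightarrow> x \<in> carrier M \<Longrightarrow> y \<in> carrier M \<Longrightarrow> x = y"
  using M.eq_if_diff_zero[of x y] by simp

lemma submodule_facts:
  assumes "submodule N hahn_ring M"
  shows "N \<subseteq> carrier M" "\<zero> \<in> N" "x \<in> N \<Longrightarrow> y \<in> N \<Longrightarrow> x \<oplus> y \<in> N"
    "integral r \<Longrightarrow> x \<in> N \<Longrightarrow> coeff r \<odot> x \<in> N"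
  using submoduleE(1,4,5)[OF assms] submodule_zero[OF module_axioms assms] by auto

lemma hsubmoduleI:
  assumes "N \<subseteq> carrier M" "\<zero> \<in> N" "\<And>x y. x \<in> N \<Longrightarrow> y \<in> N \<Longrightarrow> x \<oplus> y \<in> N"
    "\<And>r x. integral r \<Longrightarrow> x \<in> N \<Longrightarrow> coeff r \<odot> x \<in> N"
  shows "submodule N hahn_ring M"
proof (rule submoduleI)
  show "\<ominus> a \<in> N" if "a \<in> N" for a
  proof -
    have "a \<in> carrier M" using assms(1) that by blast
    then show ?thesis using that by simp
  qed
  show "a \<odot> x \<in> N" if "a \<in> carrier hahn_ring" "x \<in> N" for a x
    using hahn_ring_elem[OF that(1)] assms(4)[OF _ that(2)] by auto
qed (use assms in auto)

end

lemma hmoduleI: "Module.module hahn_ring M \<Longrightarrow> hmodule M"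
  by (rule hmodule.intro)

text \<open>Homomorphisms from a submodule \<open>J\<close> of K, without a module record for
  \<open>J\<close>; the values outside \<open>J\<close> are arbitrary.\<close>

definition hahn_hom :: "(real \<Rightarrow> bit, 'b) module \<Rightarrow> hahn set \<Rightarrow> (hahn \<Rightarrow> 'b) \<Rightarrow> bool" where
  "hahn_hom M J h \<longleftrightarrow>
    (\<forall>x\<in>J. h x \<in> carrier M) \<and> (\<forall>x\<in>J. \<forall>y\<in>J. h (x + y) = h x \<oplus>\<^bsub>M\<^esub> h y) \<and>
    (\<forall>r. \<forall>x\<in>J. integral r \<longrightarrow> h (r * x) = coeff r \<odot>\<^bsub>M\<^esub> h x)"

lemma
  assumes "hahn_hom M J h"
  shows hahn_hom_closed: "x \<in> J \<Longrightarrow> h x \<in> carrier M"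
    and hahn_hom_add: "x \<in> J \<Longrightarrow> y \<in> J \<Longrightarrow> h (x + y) = h x \<oplus>\<^bsub>M\<^esub> h y"
    and hahn_hom_smult: "integral r \<Longrightarrow> x \<in> J \<Longrightarrow> h (r * x) = coeff r \<odot>\<^bsub>M\<^esub> h x"
  using assms unfolding hahn_hom_def by auto

lemma hahn_homI:
  assumes "\<And>x. x \<in> J \<Longrightarrow> h x \<in> carrier M"
    and "\<And>x y. x \<in> J \<Longrightarrow> y \<in> J \<Longrightarrow> h (x + y) = h x \<oplus>\<^bsub>M\<^esub> h y"
    and "\<And>r x. integral r \<Longrightarrow> x \<in> J \<Longrightarrow> h (r * x) = coeff r \<odot>\<^bsub>M\<^esub> h x"
  shows "hahn_hom M J h"
  using assms unfolding hahn_hom_def by auto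

lemma hahn_hom_comp:
  assumes "hahn_hom M J h" "f \<in> module_homs hahn_ring M N"
  shows "hahn_hom N J (\<lambda>x. f (h x))"
  by (rule hahn_homI)
    (simp_all add: hahn_hom_closed[OF assms(1)] hahn_hom_add[OF assms(1)] hahn_hom_smult[OF assms(1)]
      hom_closed[OF assms(2)] hom_add[OF assms(2)] hom_smult[OF assms(2)])

context hmodule
begin

lemma hahn_hom_zero: "hahn_hom M J h \<Longrightarrow> osub J \<Longrightarrow> h 0 = \<zero>"
  using hahn_hom_smult[of M J h 0 0] osub_0[of J] hahn_hom_closed[of M J h 0] by simp

lemma hahn_hom_image_submodule:
  assumes "hahn_hom M J h" "osub J"
  shows "submodule (h ` J) hahn_ring M"
proof (rule hsubmoduleI)
  show "h ` J \<subseteq> carrier M" using hahn_hom_closed[OF assms(1)] by auto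
  show "\<zero> \<in> h ` J" using hahn_hom_zero[OF assms] osub_0[OF assms(2)] by (intro image_eqI[of _ _ 0]) auto
  show "x \<oplus> y \<in> h ` J" if xy: "x \<in> h ` J" "y \<in> h ` J" for x y
  proof -
    obtain a b where "a \<in> J" "b \<in> J" "x = h a" "y = h b" using xy by blast
    then show ?thesis using assms by (intro image_eqI[of _ _ "a + b"]) (auto simp: hahn_hom_add osub_add)
  qed
  show "coeff r \<odot> x \<in> h ` J" if r: "integral r" "x \<in> h ` J" for r x
  proof -
    obtain a where "a \<in> J" "x = h a" using r by blast
    then show ?thesis using assms r by (intro image_eqI[of _ _ "r * a"]) (auto simp: hahn_hom_smult osub_smult)
  qed
qed

text \<open>Of two nonzero elements of K one is an integral multiple of the other, and
  \<open>h\<close> preserves this. Zero elements are treated apart because the multiple is found by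
  division.\<close>

lemma hahn_hom_image_basic:
  assumes h: "hahn_hom M J h" and J: "osub J" and "h ` J \<noteq> {\<zero>}"
  shows "basic_module hahn_ring (submodule_as_module M (h ` J))"
proof -
  have main: "\<exists>r\<in>carrier hahn_ring. h a = r \<odot> h b" if "a \<in> J" "b \<in> J" "b \<noteq> 0" "integral (a / b)" for a b
    using hahn_hom_smult[OF h that(4) that(2)] that by (intro bexI[of _ "coeff (a / b)"]) auto
  have tot: "(\<exists>r\<in>carrier hahn_ring. h a = r \<odot> h b) \<or> (\<exists>r\<in>carrier hahn_ring. h b = r \<odot> h a)"
    if ab: "a \<in> J" "b \<in> J" for a b
  proof (cases "b = 0")
    case True
    have "h b = coeff 0 \<odot> h a" using hahn_hom_zero[OF h J] hahn_hom_closed[OF h ab(1)] True by simp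
    then show ?thesis by (intro disjI2 bexI[of _ "coeff 0"]) auto
  next
    case b: False
    show ?thesis
    proof (cases "a = 0")
      case True
      then show ?thesis using main[OF ab b] by simp
    next
      case False
      show ?thesis using integral_divide_total[OF False b]
      proof
        assume "integral (a / b)"
        then show ?thesis using main[OF ab b] by (intro disjI1)
      next
        assume "integral (b / a)"
        then show ?thesis using main[OF ab(2,1) False] by (intro disjI2)
      qed
    qed
  qed
  show ?thesis
    unfolding basic_module_def submodule_as_module_simps
    using module_submodule_as_module[OF module_axioms hahn_hom_image_submodule[OF h J]] assms(3) tot by auto
qed

subsection \<open>Directed unions of cyclic submodules\<close>

text \<open>Each A e_k is free on e_k, so a homomorphism on the union amounts to a sequence of
  values compatible with the inclusions. The value at \<open>a\<close> is computed from any
  \<open>k\<close> for which a / e_k is integral.\<close>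

lemma hahn_hom_generated:
  assumes e: "gen_seq e" and y: "\<And>k. y k \<in> carrier M" "\<And>k. y k = coeff (e k / e (Suc k)) \<odot> y (Suc k)"
  shows "\<exists>h. hahn_hom M (generated e) h \<and> (\<forall>k. h (e k) = y k)"
proof -
  have e0: "e k \<noteq> 0" for k using e by (simp add: gen_seq_def)
  have ee: "integral (e k / e (Suc k))" for k using e by (simp add: gen_seq_def)
  have up: "y k = coeff (e k / e m) \<odot> y m" if "k \<le> m" for k m
    using that
  proof (induction m rule: dec_induct)
    case base
    then show ?case using e0 y(1) by simp
  next
    case (step m)
    have "y k = coeff (e k / e m) \<odot> (coeff (e m / e (Suc m)) \<odot> y (Suc m))" using step.IH y(2)[of m] by simp
    also have "\<dots> = coeff (e k / e m * (e m / e (Suc m))) \<odot> y (Suc m)"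
      using gen_seq_mono[OF e step(1)] ee y(1) by (simp only: hs_mult)
    finally show ?case using e0[of m] by simp
  qed
  define h where "h a = coeff (a / e (SOME k. integral (a / e k))) \<odot> y (SOME k. integral (a / e k))" for a
  have same: "coeff (a / e k) \<odot> y k = coeff (a / e m) \<odot> y m" if "integral (a / e k)" "k \<le> m" for a k m
  proof -
    have "coeff (a / e k) \<odot> y k = coeff (a / e k) \<odot> (coeff (e k / e m) \<odot> y m)" using up[OF that(2)] by simp
    also have "\<dots> = coeff (a / e k * (e k / e m)) \<odot> y m"
      using gen_seq_mono[OF e that(2)] that(1) y(1) by (simp only: hs_mult)
    finally show ?thesis using e0[of k] by simp
  qed
  have h: "h a = coeff (a / e k) \<odot> y k" if k: "integral (a / e k)" for a k
  proof -
    define m where "m = (SOME k. integral (a / e k))"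
    have m: "integral (a / e m)" unfolding m_def by (rule someI[of _ k]) (rule k)
    have "h a = coeff (a / e m) \<odot> y m" by (simp add: h_def m_def)
    also have "\<dots> = coeff (a / e k) \<odot> y k"
      using same[OF m, of "max m k"] same[OF k, of "max m k"] by simp
    finally show ?thesis .
  qed
  have ex: "\<exists>k. integral (a / e k)" if "a \<in> generated e" for a using that by (simp add: generated_def)
  have "hahn_hom M (generated e) h"
  proof (rule hahn_homI)
    show "h x \<in> carrier M" if "x \<in> generated e" for x
      using ex[OF that] h y(1) by auto
    show "h (x + z) = h x \<oplus> h z" if xz: "x \<in> generated e" "z \<in> generated e" for x z
    proof -
      obtain k m where "integral (x / e k)" "integral (z / e m)" using ex xz by blast
      then have i: "integral (x / e (max k m))" "integral (z / e (max k m))"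
        using generated_mono[OF e max.cobounded1] generated_mono[OF e max.cobounded2] by blast+
      then have "integral ((x + z) / e (max k m))" by (simp add: add_divide_distrib integral_add)
      then have "h (x + z) = coeff (x / e (max k m) + z / e (max k m)) \<odot> y (max k m)"
        using h by (simp add: add_divide_distrib)
      then show ?thesis using i y(1) by (simp add: hs_add h)
    qed
    show "h (r * x) = coeff r \<odot> h x" if r: "integral r" and x: "x \<in> generated e" for r x
    proof -
      obtain k where k: "integral (x / e k)" using ex[OF x] by blast
      have "integral (r * x / e k)" using integral_mult[OF r k] by simp
      then have "h (r * x) = coeff (r * (x / e k)) \<odot> y k" using h by simp
      then show ?thesis using k r y(1) by (simp only: hs_mult h)
    qed
  qed
  moreover have "h (e k) = y k" for k using h[of "e k" k] e0 y(1) by simp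
  ultimately show ?thesis by blast
qed

text \<open>Elements above a fixed nonzero \<open>u0\<close> are measured by the valuation of a
  scalar carrying them to \<open>u0\<close>; a sequence on which this valuation is cofinal generates
  the module. The submodule of K is generated by elements with the same successive ratios.\<close>

lemma basic_is_image:
  assumes "basic_module hahn_ring M"
  shows "\<exists>J h. osub J \<and> hahn_hom M J h \<and> h ` J = carrier M"
proof -
  have "carrier M \<noteq> {\<zero>}" using assms by (simp add: basic_module_def)
  then obtain u0 where u0: "u0 \<in> carrier M" "u0 \<noteq> \<zero>" using M.zero_closed by fastforce
  have comp: "(\<exists>r. integral r \<and> x = coeff r \<odot> y) \<or> (\<exists>r. integral r \<and> y = coeff r \<odot> x)"
    if "x \<in> carrier M" "y \<in> carrier M" for x y
  proof -
    have "(\<exists>r\<in>carrier hahn_ring. x = r \<odot> y) \<or> (\<exists>r\<in>carrier hahn_ring. y = r \<odot> x)"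
      using assms that unfolding basic_module_def by blast
    then show ?thesis using hahn_ring_elem by blast
  qed
  define D where "D a u \<longleftrightarrow> integral a \<and> u \<in> carrier M \<and> u0 = coeff a \<odot> u" for a u
  have D0: "a \<noteq> 0" if "D a u" for a u using that u0 by (auto simp: D_def)
  have D1: "D 1 u0" using u0 by (simp add: D_def)
  \<comment> \<open>Elements with u0 = a u = b v are ordered like \<open>val a\<close> and
    \<open>val b\<close>. Otherwise v = r u with \<open>r\<close> of positive valuation and (a + b
    r) u = u0 + u0 = 0; but a + b r is a unit multiple of \<open>a\<close>, so a u = 0,
    contradicting the choice of \<open>u0\<close>.\<close>
  have key: "\<exists>r. integral r \<and> u = coeff r \<odot> v" if uv: "D a u" "D b v" "val a \<le> val b" for a u b v
  proof (rule ccontr)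
    assume no: "\<not> ?thesis"
    have c: "u \<in> carrier M" "v \<in> carrier M" "integral a" "integral b" "u0 = coeff a \<odot> u" "u0 = coeff b \<odot> v"
      using uv by (auto simp: D_def)
    obtain r where r: "integral r" "v = coeff r \<odot> u" using comp[OF c(1,2)] no by blast
    have r0: "r \<noteq> 0" using r c u0 by auto
    have "val r \<noteq> 0"
    proof
      assume "val r = 0"
      then have i: "integral (1 / r)" using r0 by (simp add: integral_divide_iff)
      have "coeff (1 / r) \<odot> v = coeff (1 / r * r) \<odot> u" using r i c by (simp only: hs_mult)
      then have "u = coeff (1 / r) \<odot> v" using r0 c by simp
      then show False using no i by blast
    qed
    then have vr: "0 < val r" using r(1) r0 by (simp add: integral_def)
    define x where "x = b * r / a"
    have a0: "a \<noteq> 0" "b \<noteq> 0" using D0 uv by blast+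
    have vx: "0 < val x" "x \<noteq> 0" using a0 r0 vr uv(3) by (auto simp: x_def val_divide val_mult)
    have c1: "coeff (1 + x) 0 = 1" using vx by (simp add: coeff_1 coeff_below_val)
    then have x0: "1 + x \<noteq> 0" by (metis coeff_0 zero_neq_one)
    have s: "integral (1 / (1 + x))" using val_le[OF x0 c1] x0 by (simp add: integral_divide_iff)
    have br: "integral (b * r)" using c r by (simp add: integral_mult)
    have "coeff (a + b * r) \<odot> u = coeff a \<odot> u \<oplus> coeff b \<odot> (coeff r \<odot> u)"
      using c r br by (simp add: hs_add hs_mult)
    also have "\<dots> = u0 \<oplus> u0" using c r by metis
    also have "\<dots> = \<zero>" using u0 by simp
    finally have z: "coeff (a + b * r) \<odot> u = \<zero>" .
    have ai: "integral (a + b * r)" using c br by (simp add: integral_add)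
    have "a = 1 / (1 + x) * (a + b * r)" using x0 a0 by (simp add: x_def field_simps)
    then have "coeff a \<odot> u = coeff (1 / (1 + x)) \<odot> (coeff (a + b * r) \<odot> u)"
      using hs_mult[OF s ai c(1)] by simp
    then show False using z s c(5) u0(2) by simp
  qed
  \<comment> \<open>Negated because \<open>real_coinitial\<close> produces decreasing sequences,
    whereas larger valuations of \<open>a\<close> mean elements higher above
    \<open>u0\<close>.\<close>
  let ?V = "{- val a | a u. D a u}"
  have "?V \<noteq> {}" using D1 by blast
  then obtain f :: "nat \<Rightarrow> real" where f: "range f \<subseteq> ?V" "decseq f" "\<And>w. w \<in> ?V \<Longrightarrow> \<exists>n. f n \<le> w"
    using real_coinitial by meson
  have "\<exists>a u. D a u \<and> val a = - f k" for k
  proof -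
    have "f k \<in> ?V" using f(1) by (rule range_subsetD)
    then show ?thesis by force
  qed
  then obtain a u where au: "\<And>k. D (a k) (u k)" "\<And>k. val (a k) = - f k" by metis
  have uc: "u k \<in> carrier M" for k using au(1) by (simp add: D_def)
  have "\<exists>r. integral r \<and> u k = coeff r \<odot> u (Suc k)" for k
    using f(2) by (intro key[OF au(1) au(1)]) (simp add: au(2) decseq_Suc_iff)
  then obtain r where r: "\<And>k. integral (r k)" "\<And>k. u k = coeff (r k) \<odot> u (Suc k)" by metis
  have un: "u k \<noteq> \<zero>" for k using au(1)[of k] u0(2) by (auto simp: D_def)
  have r0: "r k \<noteq> 0" for k using r(2)[of k] un[of k] uc by auto
  \<comment> \<open>Chosen to make e_k / e_(k+1) equal to r_k; the starting value could be any
    nonzero element of K.\<close>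
  define e where "e = rec_nat 1 (\<lambda>k x. x / r k)"
  have es: "e (Suc k) = e k / r k" for k by (simp add: e_def)
  have en: "e k \<noteq> 0" for k by (induction k) (auto simp: es r0 e_def[THEN fun_cong, of 0])
  have eq: "e k / e (Suc k) = r k" for k using en[of k] r0[of k] by (simp add: es)
  have e: "gen_seq e" using en eq r(1) by (simp add: gen_seq_def)
  obtain h where h: "hahn_hom M (generated e) h" "\<And>k. h (e k) = u k"
    using hahn_hom_generated[of e u, OF e uc] r(2) unfolding eq by blast
  \<comment> \<open>Every \<open>x\<close> is comparable with \<open>u0\<close>. If it lies below,
    it is already a multiple of \<open>u 0\<close>; if above, cofinality gives some
    \<open>u k\<close> of which it is a multiple.\<close>
  have gen: "\<exists>k s. integral s \<and> x = coeff s \<odot> u k" if x: "x \<in> carrier M" for x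
    using comp[OF x u0(1)]
  proof
    assume "\<exists>s. integral s \<and> x = coeff s \<odot> u0"
    then obtain s where s: "integral s" "x = coeff s \<odot> u0" by blast
    have "u0 = coeff (a 0) \<odot> u 0" "integral (a 0)" using au(1)[of 0] by (auto simp: D_def)
    then have "x = coeff (s * a 0) \<odot> u 0" using s uc by (simp add: hs_mult)
    then show ?thesis using integral_mult[OF s(1) \<open>integral (a 0)\<close>] by blast
  next
    assume "\<exists>s. integral s \<and> u0 = coeff s \<odot> x"
    then obtain s where s: "D s x" using x by (auto simp: D_def)
    then obtain k where "f k \<le> - val s" using f(3)[of "- val s"] by blast
    then have "val s \<le> val (a k)" by (simp add: au(2))
    then show ?thesis using key[OF s au(1)] by blast
  qed
  have "h ` generated e = carrier M"
  proof (intro Set.set_eqI iffI)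
    fix x assume "x \<in> carrier M"
    then obtain k s where s: "integral s" "x = coeff s \<odot> u k" using gen by blast
    then have "x = h (s * e k)" using hahn_hom_smult[OF h(1) s(1) generated_generators[OF e]] h(2) by simp
    then show "x \<in> h ` generated e" using osub_smult[OF osub_generated[OF e] s(1) generated_generators[OF e]] by blast
  qed (use hahn_hom_closed[OF h(1)] in auto)
  then show ?thesis using osub_generated[OF e] h(1) by blast
qed

end

subsection \<open>Finite sums of images of submodules of the Hahn field\<close>

definition comb :: "(real \<Rightarrow> bit, 'b) module \<Rightarrow> 'i set \<Rightarrow> ('i \<Rightarrow> hahn \<Rightarrow> 'b) \<Rightarrow> ('i \<Rightarrow> hahn) \<Rightarrow> 'b" where
  "comb M S h x = (\<Oplus>\<^bsub>M\<^esub>i\<in>S. h i (x i))"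

definition tuples :: "'i set \<Rightarrow> ('i \<Rightarrow> hahn set) \<Rightarrow> ('i \<Rightarrow> hahn) set" where
  "tuples S J = {x. \<forall>i\<in>S. x i \<in> J i}"

definition homs_on :: "(real \<Rightarrow> bit, 'b) module \<Rightarrow> 'i set \<Rightarrow> ('i \<Rightarrow> hahn set) \<Rightarrow> ('i \<Rightarrow> hahn \<Rightarrow> 'b) \<Rightarrow> bool" where
  "homs_on M S J h \<longleftrightarrow> finite S \<and> (\<forall>i\<in>S. osub (J i) \<and> hahn_hom M (J i) (h i))"

text \<open>Refers to a subset of \<open>M\<close> rather than to a module of its own, so that sums
  can grow inside one module. Index sets of natural numbers avoid a quantifier over types.\<close>

definition presented :: "(real \<Rightarrow> bit, 'b) module \<Rightarrow> 'b set \<Rightarrow> bool" where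
  "presented M T \<longleftrightarrow> (\<exists>(S :: nat set) J h. homs_on M S J h \<and> T = comb M S h ` tuples S J)"

lemma homs_onD:
  assumes "homs_on M S J h"
  shows "finite S" "i \<in> S \<Longrightarrow> osub (J i)" "i \<in> S \<Longrightarrow> hahn_hom M (J i) (h i)"
  using assms by (auto simp: homs_on_def)

lemma homs_on_subset: "homs_on M S J h \<Longrightarrow> S' \<subseteq> S \<Longrightarrow> homs_on M S' J h"
  by (auto simp: homs_on_def intro: finite_subset)

lemma
  assumes "homs_on M S J h"
  shows tuples_add: "x \<in> tuples S J \<Longrightarrow> y \<in> tuples S J \<Longrightarrow> (\<lambda>i. x i + y i) \<in> tuples S J"
    and tuples_smult: "integral r \<Longrightarrow> x \<in> tuples S J \<Longrightarrow> (\<lambda>i. r * x i) \<in> tuples S J"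
    and tuples_zero: "(\<lambda>i. 0) \<in> tuples S J"
  using homs_onD(2)[OF assms] by (auto simp: tuples_def osub_add osub_smult osub_0)

context hmodule
begin

lemma comb_empty [simp]: "comb M {} h x = \<zero>"
  by (simp add: comb_def)

lemma comb_terms_closed: "homs_on M S J h \<Longrightarrow> x \<in> tuples S J \<Longrightarrow> i \<in> S \<Longrightarrow> h i (x i) \<in> carrier M"
  using homs_onD(3)[of M S J h i] hahn_hom_closed by (fastforce simp: tuples_def)

lemma comb_closed: "homs_on M S J h \<Longrightarrow> x \<in> tuples S J \<Longrightarrow> comb M S h x \<in> carrier M"
  unfolding comb_def by (rule M.finsum_closed) (auto intro: comb_terms_closed)

lemma comb_insert:
  assumes "homs_on M (insert k S) J h" "x \<in> tuples (insert k S) J" "k \<notin> S"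
  shows "comb M (insert k S) h x = h k (x k) \<oplus> comb M S h x"
  unfolding comb_def
  using comb_terms_closed[OF assms(1,2)] homs_onD(1)[OF assms(1)] assms(3) by (intro M.finsum_insert) auto

lemma comb_cong:
  assumes "homs_on M S J h" "x \<in> tuples S J" "\<And>i. i \<in> S \<Longrightarrow> x i = y i"
  shows "comb M S h x = comb M S h y"
  unfolding comb_def
  by (rule M.finsum_cong') (use assms comb_terms_closed[OF assms(1), of y] in \<open>auto simp: tuples_def\<close>)

lemma comb_add:
  assumes "homs_on M S J h" "x \<in> tuples S J" "y \<in> tuples S J"
  shows "comb M S h (\<lambda>i. x i + y i) = comb M S h x \<oplus> comb M S h y"
proof -
  have "comb M S h (\<lambda>i. x i + y i) = (\<Oplus>i\<in>S. h i (x i) \<oplus> h i (y i))"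
    unfolding comb_def
    by (rule M.finsum_cong')
      (use assms comb_terms_closed[OF assms(1)] in \<open>auto simp: tuples_def intro!: hahn_hom_add homs_onD(3)[OF assms(1)]\<close>)
  also have "\<dots> = comb M S h x \<oplus> comb M S h y"
    unfolding comb_def using comb_terms_closed[OF assms(1)] assms by (intro M.finsum_addf) auto
  finally show ?thesis .
qed

lemma comb_smult:
  assumes "homs_on M S J h" "x \<in> tuples S J" "integral r"
  shows "comb M S h (\<lambda>i. r * x i) = coeff r \<odot> comb M S h x"
proof -
  have "comb M S h (\<lambda>i. r * x i) = (\<Oplus>i\<in>S. coeff r \<odot> h i (x i))"
    unfolding comb_def
    by (rule M.finsum_cong')
      (use assms comb_terms_closed[OF assms(1,2)] in \<open>auto simp: tuples_def intro!: hahn_hom_smult homs_onD(3)[OF assms(1)]\<close>)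
  also have "\<dots> = coeff r \<odot> comb M S h x"
    unfolding comb_def using comb_terms_closed[OF assms(1,2)] homs_onD(1)[OF assms(1)] assms(3)
    by (intro finsum_smult_ldistr[symmetric]) auto
  finally show ?thesis .
qed

lemma comb_zero: "homs_on M S J h \<Longrightarrow> comb M S h (\<lambda>i. 0) = \<zero>"
  using comb_smult[of S J h "\<lambda>i. 0" 0] tuples_zero[of M S J h] comb_closed[of S J h "\<lambda>i. 0"] by simp

lemma comb_submodule:
  assumes "homs_on M S J h"
  shows "submodule (comb M S h ` tuples S J) hahn_ring M"
proof (rule hsubmoduleI)
  show "comb M S h ` tuples S J \<subseteq> carrier M" using comb_closed[OF assms] by auto
  show "\<zero> \<in> comb M S h ` tuples S J"
    using comb_zero[OF assms] tuples_zero[OF assms] by (intro image_eqI[of _ _ "\<lambda>i. 0"]) auto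
  show "x \<oplus> y \<in> comb M S h ` tuples S J" if xy: "x \<in> comb M S h ` tuples S J" "y \<in> comb M S h ` tuples S J" for x y
  proof -
    obtain a b where ab: "a \<in> tuples S J" "b \<in> tuples S J" "x = comb M S h a" "y = comb M S h b" using xy by blast
    then show ?thesis using comb_add[OF assms ab(1,2)] tuples_add[OF assms ab(1,2)]
      by (intro image_eqI[of _ _ "\<lambda>i. a i + b i"]) auto
  qed
  show "coeff r \<odot> x \<in> comb M S h ` tuples S J" if r: "integral r" "x \<in> comb M S h ` tuples S J" for r x
  proof -
    obtain a where a: "a \<in> tuples S J" "x = comb M S h a" using r by blast
    then show ?thesis using comb_smult[OF assms a(1) r(1)] tuples_smult[OF assms r(1) a(1)]
      by (intro image_eqI[of _ _ "\<lambda>i. r * a i"]) auto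
  qed
qed

lemma presented_submodule: "presented M T \<Longrightarrow> submodule T hahn_ring M"
  unfolding presented_def using comb_submodule by blast

lemma presented_zero: "presented M {\<zero>}"
  unfolding presented_def homs_on_def
  by (intro exI[of _ "{}"]) (auto simp: tuples_def)

lemma comb_image_insert:
  assumes "homs_on M (insert k S) J h" "k \<notin> S"
  shows "comb M (insert k S) h ` tuples (insert k S) J = {t \<oplus> h k a | t a. t \<in> comb M S h ` tuples S J \<and> a \<in> J k}"
proof (intro Set.set_eqI iffI)
  have S: "homs_on M S J h" by (rule homs_on_subset[OF assms(1)]) auto
  have hk: "h k a \<in> carrier M" if "a \<in> J k" for a using homs_onD(3)[OF assms(1), of k] hahn_hom_closed that by fast
  {
    fix y assume "y \<in> comb M (insert k S) h ` tuples (insert k S) J"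
    then obtain x where x: "x \<in> tuples (insert k S) J" "y = comb M (insert k S) h x" by blast
    then have "x \<in> tuples S J" "x k \<in> J k" by (auto simp: tuples_def)
    moreover from this have "y = comb M S h x \<oplus> h k (x k)"
      using comb_insert[OF assms(1) x(1) assms(2)] x(2) comb_closed[OF S] hk by (simp add: M.a_comm)
    ultimately show "y \<in> {t \<oplus> h k a | t a. t \<in> comb M S h ` tuples S J \<and> a \<in> J k}"
      by blast
  }
  fix y assume "y \<in> {t \<oplus> h k a | t a. t \<in> comb M S h ` tuples S J \<and> a \<in> J k}"
  then obtain x a where x: "x \<in> tuples S J" "a \<in> J k" "y = comb M S h x \<oplus> h k a" by blast
  let ?x = "x(k := a)"
  have t: "?x \<in> tuples (insert k S) J" using x by (auto simp: tuples_def)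
  have "comb M S h ?x = comb M S h x"
    by (rule comb_cong[OF S, symmetric]) (use x(1) assms(2) in auto)
  then have "y = comb M (insert k S) h ?x"
    using comb_insert[OF assms(1) t assms(2)] x comb_closed[OF S x(1)] hk by (simp add: M.a_comm)
  then show "y \<in> comb M (insert k S) h ` tuples (insert k S) J" using t by blast
qed

lemma presented_add:
  assumes "presented M T" "osub J" "hahn_hom M J h"
  shows "presented M {t \<oplus> h a | t a. t \<in> T \<and> a \<in> J}"
proof -
  obtain S :: "nat set" and J' h' where *: "homs_on M S J' h'" "T = comb M S h' ` tuples S J'"
    using assms(1) unfolding presented_def by blast
  obtain k where k: "k \<notin> S" using ex_new_if_finite[OF infinite_UNIV_nat homs_onD(1)[OF *(1)]] by blast
  let ?J = "J'(k := J)" and ?h = "h'(k := h)"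
  have "\<forall>i\<in>S. ?J i = J' i \<and> ?h i = h' i" using k by auto
  then have H: "homs_on M (insert k S) ?J ?h" using *(1) assms(2,3) by (auto simp: homs_on_def)
  have t: "tuples S ?J = tuples S J'" using k by (auto simp: tuples_def)
  have c: "comb M S ?h x = comb M S h' x" if "x \<in> tuples S J'" for x
    unfolding comb_def by (rule M.finsum_cong') (use k comb_terms_closed[OF *(1) that] in auto)
  have "comb M S ?h ` tuples S ?J = T" unfolding t *(2) using c by (intro image_cong) auto
  then have "comb M (insert k S) ?h ` tuples (insert k S) ?J = {t \<oplus> h a | t a. t \<in> T \<and> a \<in> J}"
    using comb_image_insert[OF H k] by simp
  then show ?thesis unfolding presented_def using H by metis
qed

lemma presented_induct [consumes 1, case_names zero add]:
  assumes "presented M T"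
    and "P {\<zero>}"
    and "\<And>T J h. presented M T \<Longrightarrow> P T \<Longrightarrow> osub J \<Longrightarrow> hahn_hom M J h \<Longrightarrow>
      P {t \<oplus> h a | t a. t \<in> T \<and> a \<in> J}"
  shows "P T"
proof -
  obtain S :: "nat set" and J h where *: "homs_on M S J h" "T = comb M S h ` tuples S J"
    using assms(1) unfolding presented_def by blast
  have "finite S" using homs_onD(1)[OF *(1)] .
  then have "homs_on M S J h \<Longrightarrow> P (comb M S h ` tuples S J)"
  proof (induction S rule: finite_induct)
    case empty
    have "comb M {} h ` tuples {} J = {\<zero>}" by (auto simp: tuples_def)
    then show ?case using assms(2) by simp
  next
    case (insert k S)
    have S: "homs_on M S J h" by (rule homs_on_subset[OF insert.prems]) auto
    have "presented M (comb M S h ` tuples S J)" unfolding presented_def using S by blast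
    then show ?case
      unfolding comb_image_insert[OF insert.prems insert.hyps(2)]
      using insert.IH[OF S] homs_onD(2,3)[OF insert.prems, of k] by (intro assms(3)) auto
  qed
  then show ?thesis using * by blast
qed

end

lemma presented_hom_image:
  assumes M: "Module.module hahn_ring M" and N: "Module.module hahn_ring N"
    and f: "f \<in> module_homs hahn_ring M N" and T: "presented M T"
  shows "presented N (f ` T)"
proof -
  interpret M: hmodule M by (rule hmoduleI[OF M])
  interpret N: hmodule N by (rule hmoduleI[OF N])
  show ?thesis
    using T
  proof (induction rule: M.presented_induct)
    case zero
    then show ?case using N.presented_zero hom_zero[OF f M N] by simp
  next
    case (add T J h)
    have T: "t \<in> carrier M" if "t \<in> T" for t using M.submodule_facts(1)[OF M.presented_submodule[OF add.hyps(1)]] that by blast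
    have eq: "f (t \<oplus>\<^bsub>M\<^esub> h a) = f t \<oplus>\<^bsub>N\<^esub> f (h a)" if "t \<in> T" "a \<in> J" for t a
      using hom_add[OF f T[OF that(1)] hahn_hom_closed[OF add.hyps(3) that(2)]] .
    have "f ` {t \<oplus>\<^bsub>M\<^esub> h a | t a. t \<in> T \<and> a \<in> J} = {f (t \<oplus>\<^bsub>M\<^esub> h a) | t a. t \<in> T \<and> a \<in> J}" by blast
    also have "\<dots> = {t \<oplus>\<^bsub>N\<^esub> f (h a) | t a. t \<in> f ` T \<and> a \<in> J}"
    proof (intro Set.set_eqI iffI)
      fix y assume "y \<in> {f (t \<oplus>\<^bsub>M\<^esub> h a) | t a. t \<in> T \<and> a \<in> J}"
      then obtain t a where ta: "t \<in> T" "a \<in> J" "y = f (t \<oplus>\<^bsub>M\<^esub> h a)" by blast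
      then have "y = f t \<oplus>\<^bsub>N\<^esub> f (h a)" using eq by simp
      then show "y \<in> {t \<oplus>\<^bsub>N\<^esub> f (h a) | t a. t \<in> f ` T \<and> a \<in> J}" using ta(1,2) by blast
    next
      fix y assume "y \<in> {t \<oplus>\<^bsub>N\<^esub> f (h a) | t a. t \<in> f ` T \<and> a \<in> J}"
      then obtain t a where ta: "t \<in> T" "a \<in> J" "y = f t \<oplus>\<^bsub>N\<^esub> f (h a)" by blast
      then have "y = f (t \<oplus>\<^bsub>M\<^esub> h a)" using eq by simp
      then show "y \<in> {f (t \<oplus>\<^bsub>M\<^esub> h a) | t a. t \<in> T \<and> a \<in> J}" using ta(1,2) by blast
    qed
    finally show ?case using N.presented_add[OF add.IH add.hyps(2) hahn_hom_comp[OF add.hyps(3) f]] by simp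
  qed
qed

subsection \<open>Linear compactness of modules\<close>

text \<open>Since \<open>1 + 1 = 0\<close> in the Hahn ring, \<open>y + z\<close> stands for \<open>y - z\<close> here.\<close>

definition affine_in :: "(real \<Rightarrow> bit, 'b) module \<Rightarrow> 'b set \<Rightarrow> bool" where
  "affine_in M C \<longleftrightarrow> (\<forall>x\<in>C. \<forall>y\<in>C. \<forall>z\<in>C. \<forall>r. integral r \<longrightarrow> x \<oplus>\<^bsub>M\<^esub> coeff r \<odot>\<^bsub>M\<^esub> (y \<oplus>\<^bsub>M\<^esub> z) \<in> C)"

text \<open>Decreasing sequences are enough: a submodule of K is generated by a sequence, so the
  systems of equations to be solved are countable.\<close>

definition lin_compact :: "(real \<Rightarrow> bit, 'b) module \<Rightarrow> 'b set \<Rightarrow> bool" where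
  "lin_compact M T \<longleftrightarrow>
    (\<forall>C :: nat \<Rightarrow> 'b set. decseq C \<and> (\<forall>m. C m \<noteq> {} \<and> C m \<subseteq> T \<and> affine_in M (C m)) \<longrightarrow> (\<exists>c. \<forall>m. c \<in> C m))"

context hmodule
begin

text \<open>The sets are pulled back along \<open>comb\<close> to tuples, where
  \<open>fun_lin_compact\<close> finds common coordinates \<open>c\<close>. The value of
  \<open>comb\<close> depends only on the coordinates in \<open>S\<close>, so the value at
  \<open>c\<close> lies in every set.\<close>

lemma presented_lin_compact:
  assumes "presented M T"
  shows "lin_compact M T"
proof -
  obtain S :: "nat set" and J h where H: "homs_on M S J h" and T: "T = comb M S h ` tuples S J"
    using assms(1) unfolding presented_def by blast
  show ?thesis
    unfolding lin_compact_def
  proof (intro allI impI, elim conjE)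
    fix C :: "nat \<Rightarrow> 'b set" assume dec: "decseq C" and C: "\<forall>m. C m \<noteq> {} \<and> C m \<subseteq> T \<and> affine_in M (C m)"
    define D where "D m = {x \<in> tuples S J. comb M S h x \<in> C m}" for m
    have "\<exists>c. \<forall>m. \<exists>x\<in>D m. \<forall>i\<in>S. x i = c i"
    proof (rule fun_lin_compact)
      show "finite S" using homs_onD(1)[OF H] .
      show "decseq D" using dec by (auto simp: D_def decseq_def)
      show "D m \<noteq> {}" for m
      proof -
        obtain y where "y \<in> C m" using C by blast
        moreover from this have "y \<in> comb M S h ` tuples S J" using C T by blast
        ultimately show ?thesis unfolding D_def by blast
      qed
      show "affine_fun (D m)" for m
        unfolding affine_fun_def
      proof (intro ballI allI impI)
        fix x y z r assume xyz: "x \<in> D m" "y \<in> D m" "z \<in> D m" and r: "integral r"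
        then have t: "x \<in> tuples S J" "y \<in> tuples S J" "z \<in> tuples S J"
          and c: "comb M S h x \<in> C m" "comb M S h y \<in> C m" "comb M S h z \<in> C m" by (auto simp: D_def)
        note t2 = tuples_add[OF H t(2,3)] and t3 = tuples_smult[OF H r tuples_add[OF H t(2,3)]]
        have "comb M S h (\<lambda>i. x i + r * (y i + z i)) = comb M S h x \<oplus> coeff r \<odot> (comb M S h y \<oplus> comb M S h z)"
          using comb_add[OF H t(1) t3] comb_smult[OF H t2 r] comb_add[OF H t(2,3)] by simp
        also have "\<dots> \<in> C m" using C c r unfolding affine_in_def by blast
        finally have "(\<lambda>i. x i + r * (y i + z i)) \<in> D m" using tuples_add[OF H t(1) t3] by (simp add: D_def)
        then show "(\<lambda>i. x i + r * (y i - z i)) \<in> D m" by (simp add: diff_conv_add_uminus)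
      qed
    qed
    then obtain c where c: "\<And>m. \<exists>x\<in>D m. \<forall>i\<in>S. x i = c i" by blast
    have "comb M S h c \<in> C m" for m
    proof -
      obtain x where x: "x \<in> tuples S J" "comb M S h x \<in> C m" "\<forall>i\<in>S. x i = c i" using c[of m] by (auto simp: D_def)
      then show ?thesis using comb_cong[OF H x(1), of c] by simp
    qed
    then show "\<exists>c. \<forall>m. c \<in> C m" by blast
  qed
qed

text \<open>The Mittag-Leffler argument behind \<open>Ext(J, X) = 0\<close>: the lifts of the generators \<open>e k\<close> have to be
  made compatible, and linear compactness of \<open>X\<close> solves the resulting infinite system.\<close>

lemma lift_hahn_hom:
  assumes X: "submodule X hahn_ring M" "lin_compact M X" and J: "osub J"
    and hc: "\<And>x. x \<in> J \<Longrightarrow> h x \<in> carrier M"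
    and ha: "\<And>x y. x \<in> J \<Longrightarrow> y \<in> J \<Longrightarrow> h (x + y) \<oplus> (h x \<oplus> h y) \<in> X"
    and hs: "\<And>r x. integral r \<Longrightarrow> x \<in> J \<Longrightarrow> h (r * x) \<oplus> coeff r \<odot> h x \<in> X"
  shows "\<exists>h'. hahn_hom M J h' \<and> (\<forall>x\<in>J. h' x \<oplus> h x \<in> X)"
proof (cases "J = {0}")
  case True
  have "h 0 \<in> X" using hs[of 0 0] hc[of 0] True by simp
  then have "hahn_hom M J (\<lambda>_. \<zero>) \<and> (\<forall>x\<in>J. \<zero> \<oplus> h x \<in> X)"
    using True submodule_facts(1)[OF X(1)] by (auto simp: hahn_hom_def)
  then show ?thesis by (intro exI[of _ "\<lambda>_. \<zero>"])
next
  case False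
  note Xf = submodule_facts[OF X(1)]
  have Xc: "x \<in> carrier M" if "x \<in> X" for x using Xf(1) that by blast
  obtain e where e: "gen_seq e" and Je: "J = generated e" using osub_generators[OF J False] by blast
  have eJ: "e k \<in> J" for k using generated_generators[OF e] Je by simp
  define d where "d k = e k / e (Suc k)" for k
  have d: "integral (d k)" "e k = d k * e (Suc k)" for k using e by (auto simp: d_def gen_seq_def)
  \<comment> \<open>The defect of compatibility at step \<open>k\<close>. Corrections y_k in
    \<open>X\<close> have to satisfy y_k = z_k + d_k y_(k+1).\<close>
  define z where "z k = h (e k) \<oplus> coeff (d k) \<odot> h (e (Suc k))" for k
  have zX: "z k \<in> X" for k using hs[OF d(1)[of k] eJ[of "Suc k"]] d(2)[of k] by (simp add: z_def)
  \<comment> \<open>\<open>G m k\<close> consists of the values of y_k from which the next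
    \<open>m\<close> equations can be solved in \<open>X\<close>; it shrinks as \<open>m\<close>
    grows.\<close>
  define G where "G = rec_nat (\<lambda>k::nat. X) (\<lambda>m F k. {x. \<exists>x'\<in>F (Suc k). x = z k \<oplus> coeff (d k) \<odot> x'})"
  have G0: "G 0 k = X" for k by (simp add: G_def)
  have GS: "G (Suc m) k = {x. \<exists>x'\<in>G m (Suc k). x = z k \<oplus> coeff (d k) \<odot> x'}" for m k by (simp add: G_def)
  have GX: "G m k \<subseteq> X" for m k
  proof (induction m arbitrary: k)
    case (Suc m)
    then show ?case using zX d(1) Xf(3,4) unfolding GS by blast
  qed (simp add: G0)
  have Gne: "G m k \<noteq> {}" for m k
  proof (induction m arbitrary: k)
    case (Suc m)
    obtain x' where "x' \<in> G m (Suc k)" using Suc[of "Suc k"] by blast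
    then show ?case unfolding GS by blast
  qed (use Xf(2) in \<open>auto simp: G0\<close>)
  have Gdec: "G (Suc m) k \<subseteq> G m k" for m k
  proof (induction m arbitrary: k)
    case (Suc m)
    then show ?case unfolding GS[of "Suc m"] GS[of m] by blast
  qed (use GX in \<open>simp add: G0\<close>)
  have dist: "(z k \<oplus> coeff (d k) \<odot> x) \<oplus> coeff r \<odot> ((z k \<oplus> coeff (d k) \<odot> y) \<oplus> (z k \<oplus> coeff (d k) \<odot> w))
      = z k \<oplus> coeff (d k) \<odot> (x \<oplus> coeff r \<odot> (y \<oplus> w))" if "x \<in> X" "y \<in> X" "w \<in> X" "integral r" for x y w r k
  proof -
    have c: "x \<in> carrier M" "y \<in> carrier M" "w \<in> carrier M" "z k \<in> carrier M" "integral r" "integral (d k)"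
      using that Xc zX d(1) by auto
    have "(z k \<oplus> coeff (d k) \<odot> y) \<oplus> (z k \<oplus> coeff (d k) \<odot> w) = coeff (d k) \<odot> (y \<oplus> w)"
      using c by (simp add: M.a_ac hs_radd)
    moreover have "coeff r \<odot> (coeff (d k) \<odot> (y \<oplus> w)) = coeff (d k) \<odot> (coeff r \<odot> (y \<oplus> w))"
      using c hs_mult[of r "d k" "y \<oplus> w"] hs_mult[of "d k" r "y \<oplus> w"] by (simp add: mult.commute)
    ultimately show ?thesis using c by (simp add: M.a_assoc hs_radd)
  qed
  have Xaff: "x \<oplus> coeff r \<odot> (y \<oplus> w) \<in> X" if "x \<in> X" "y \<in> X" "w \<in> X" "integral r" for x y w r
    using that Xf(3,4) by blast
  have Gaff: "affine_in M (G m k)" for m k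
  proof (induction m arbitrary: k)
    case 0
    then show ?case using Xaff by (simp add: G0 affine_in_def)
  next
    case (Suc m)
    show ?case
      unfolding affine_in_def
    proof (intro ballI allI impI)
      fix x y w r assume "x \<in> G (Suc m) k" "y \<in> G (Suc m) k" "w \<in> G (Suc m) k" and r: "integral r"
      then obtain x' y' w' where *: "x' \<in> G m (Suc k)" "y' \<in> G m (Suc k)" "w' \<in> G m (Suc k)"
        "x = z k \<oplus> coeff (d k) \<odot> x'" "y = z k \<oplus> coeff (d k) \<odot> y'" "w = z k \<oplus> coeff (d k) \<odot> w'" unfolding GS by blast
      have "x' \<oplus> coeff r \<odot> (y' \<oplus> w') \<in> G m (Suc k)" using Suc[of "Suc k"] * r unfolding affine_in_def by blast
      moreover have "x' \<in> X" "y' \<in> X" "w' \<in> X" using * GX by blast+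
      ultimately show "x \<oplus> coeff r \<odot> (y \<oplus> w) \<in> G (Suc m) k" unfolding GS *(4-6) using dist r by blast
    qed
  qed
  have lc: "\<exists>c. \<forall>m. c \<in> C m"
    if "decseq C" "\<And>m. C m \<noteq> {}" "\<And>m. C m \<subseteq> X" "\<And>m. affine_in M (C m)" for C :: "nat \<Rightarrow> 'b set"
    using X(2) that unfolding lin_compact_def by blast
  \<comment> \<open>The solution is chosen inside the intersections over \<open>m\<close>. A value
    at \<open>k\<close> that permits every finite number of further steps needs a successor with the
    same property; linear compactness, applied to the admissible successors, provides it.\<close>
  have "\<exists>y. \<forall>k. (\<forall>m. y k \<in> G m k) \<and> y k = z k \<oplus> coeff (d k) \<odot> y (Suc k)"
  proof (rule dependent_nat_choice)
    show "\<exists>x. \<forall>m. x \<in> G m 0"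
      by (rule lc) (use Gdec Gne GX Gaff in \<open>auto simp: decseq_Suc_iff\<close>)
  next
    fix x k assume x: "\<forall>m. x \<in> G m k"
    define C where "C m = {x' \<in> G m (Suc k). x = z k \<oplus> coeff (d k) \<odot> x'}" for m
    have "\<exists>c. \<forall>m. c \<in> C m"
    proof (rule lc)
      show "decseq C" using Gdec by (auto simp: decseq_Suc_iff C_def)
      show "C m \<noteq> {}" for m using x[rule_format, of "Suc m"] unfolding GS C_def by blast
      show "C m \<subseteq> X" for m using GX by (auto simp: C_def)
      show "affine_in M (C m)" for m
        unfolding affine_in_def
      proof (intro ballI allI impI)
        fix u v w r assume r: "integral r" and "u \<in> C m" "v \<in> C m" "w \<in> C m"
        then have *: "u \<in> G m (Suc k)" "v \<in> G m (Suc k)" "w \<in> G m (Suc k)" "x = z k \<oplus> coeff (d k) \<odot> u"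
          "z k \<oplus> coeff (d k) \<odot> v = x" "z k \<oplus> coeff (d k) \<odot> w = x" by (auto simp: C_def)
        then have uX: "u \<in> X" "v \<in> X" "w \<in> X" using GX by blast+
        have xc: "x \<in> carrier M" using GX x Xc by blast
        have "u \<oplus> coeff r \<odot> (v \<oplus> w) \<in> G m (Suc k)" using Gaff * r unfolding affine_in_def by blast
        moreover have "z k \<oplus> coeff (d k) \<odot> (u \<oplus> coeff r \<odot> (v \<oplus> w)) = x"
          unfolding dist[OF uX r, symmetric] *(4)[symmetric] *(5,6) using xc r by simp
        ultimately show "u \<oplus> coeff r \<odot> (v \<oplus> w) \<in> C m" by (simp add: C_def)
      qed
    qed
    then show "\<exists>y. (\<forall>m. y \<in> G m (Suc k)) \<and> x = z k \<oplus> coeff (d k) \<odot> y" unfolding C_def by blast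
  qed
  then obtain y where y: "\<And>k m. y k \<in> G m k" "\<And>k. y k = z k \<oplus> coeff (d k) \<odot> y (Suc k)" by blast
  have yX: "y k \<in> X" for k using y(1)[of k 0] by (simp add: G0)
  \<comment> \<open>The corrections cancel the defects, so these values are exactly compatible and
    define a homomorphism on \<open>J\<close>.\<close>
  define g where "g k = h (e k) \<oplus> y k" for k
  have gc: "g k \<in> carrier M" for k using hc[OF eJ] Xc[OF yX] by (simp add: g_def)
  have "g k = coeff (d k) \<odot> g (Suc k)" for k
  proof -
    have c: "h (e k) \<in> carrier M" "h (e (Suc k)) \<in> carrier M" "y (Suc k) \<in> carrier M" using hc eJ Xc yX by auto
    have "g k = h (e k) \<oplus> ((h (e k) \<oplus> coeff (d k) \<odot> h (e (Suc k))) \<oplus> coeff (d k) \<odot> y (Suc k))"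
      unfolding g_def by (subst y(2)) (simp add: z_def)
    also have "\<dots> = coeff (d k) \<odot> h (e (Suc k)) \<oplus> coeff (d k) \<odot> y (Suc k)"
      using c d(1) by (simp add: M.a_assoc)
    also have "\<dots> = coeff (d k) \<odot> g (Suc k)" using c d(1) by (simp add: g_def hs_radd)
    finally show ?thesis .
  qed
  then obtain h' where h': "hahn_hom M J h'" "\<And>k. h' (e k) = g k"
    using hahn_hom_generated[of e g, OF e gc] unfolding Je d_def by blast
  have "h' x \<oplus> h x \<in> X" if x: "x \<in> J" for x
  proof -
    obtain k where k: "integral (x / e k)" using x unfolding Je generated_def by blast
    define r where "r = x / e k"
    have r: "integral r" "x = r * e k" using k e by (auto simp: r_def gen_seq_def)
    have c: "h (e k) \<in> carrier M" "y k \<in> carrier M" "h x \<in> carrier M" using hc eJ Xc yX x by auto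
    have "h' x = coeff r \<odot> h (e k) \<oplus> coeff r \<odot> y k"
      using hahn_hom_smult[OF h'(1) r(1) eJ[of k]] h'(2)[of k] r c by (simp add: g_def hs_radd)
    then have "h' x \<oplus> h x = (h x \<oplus> coeff r \<odot> h (e k)) \<oplus> coeff r \<odot> y k"
      using c r(1) by (simp add: M.a_ac)
    moreover have "h x \<oplus> coeff r \<odot> h (e k) \<in> X" using hs[OF r(1) eJ[of k]] r(2) by simp
    ultimately show ?thesis using Xf(3,4) yX r(1) by simp
  qed
  then show ?thesis using h'(1) by blast
qed

end

subsection \<open>Closure properties of presented submodules\<close>

context hmodule
begin

text \<open>When the image of \<open>h\<close> is added to \<open>T\<close>, the part of
  \<open>N\<close> in the sum grows by the image of a submodule J' of \<open>J\<close>. Elements t a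
  + h a of \<open>N\<close> are first chosen arbitrarily; they are linear in \<open>a\<close> modulo
  the intersection of \<open>N\<close> and \<open>T\<close>, which is presented by induction and
  hence linearly compact, so they can be corrected to a homomorphism.\<close>

lemma presented_sub:
  assumes "presented M T" "submodule N hahn_ring M" "N \<subseteq> T"
  shows "presented M N"
  using assms
proof (induction arbitrary: N rule: presented_induct)
  case zero
  then have "N = {\<zero>}" using submodule_facts(2) by blast
  then show ?case using presented_zero by simp
next
  case (add T J h)
  note h = add.hyps(3) and J = add.hyps(2)
  note Tf = submodule_facts[OF presented_submodule[OF add.hyps(1)]]
  note Nf = submodule_facts[OF add.prems(1)]
  have Tc: "t \<in> carrier M" if "t \<in> T" for t using Tf(1) that by blast
  have Nc: "t \<in> carrier M" if "t \<in> N" for t using Nf(1) that by blast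
  have sub: "submodule (N \<inter> T) hahn_ring M" by (rule hsubmoduleI) (use Nf Tf in auto)
  have pres: "presented M (N \<inter> T)" by (rule add.IH[OF sub]) simp
  \<comment> \<open>The elements of \<open>J\<close> that occur as the last component of an element
    of \<open>N\<close>.\<close>
  define J' where "J' = {a \<in> J. \<exists>t\<in>T. t \<oplus> h a \<in> N}"
  have J'J: "a \<in> J" if "a \<in> J'" for a using that by (simp add: J'_def)
  have hc: "h a \<in> carrier M" if "a \<in> J" for a using hahn_hom_closed[OF h that] .
  obtain t where t: "\<And>a. a \<in> J' \<Longrightarrow> t a \<in> T" "\<And>a. a \<in> J' \<Longrightarrow> t a \<oplus> h a \<in> N"
  proof -
    have "\<forall>a\<in>J'. \<exists>t. t \<in> T \<and> t \<oplus> h a \<in> N" by (auto simp: J'_def)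
    then show thesis using that by metis
  qed
  have sum: "(t a \<oplus> h a) \<oplus> (t b \<oplus> h b) = (t a \<oplus> t b) \<oplus> h (a + b)" if "a \<in> J'" "b \<in> J'" for a b
    using that t(1)[THEN Tc] hc J'J hahn_hom_add[OF h] by (simp add: M.a_ac)
  have sm: "coeff r \<odot> (t a \<oplus> h a) = coeff r \<odot> t a \<oplus> h (r * a)" if "a \<in> J'" "integral r" for a r
    using that t(1)[THEN Tc] hc J'J hahn_hom_smult[OF h] by (simp add: hs_radd)
  have J'add: "a + b \<in> J'" if "a \<in> J'" "b \<in> J'" for a b
  proof -
    have "(t a \<oplus> t b) \<oplus> h (a + b) \<in> N" using sum[OF that] Nf(3) t(2) that by metis
    then show ?thesis using Tf(3)[OF t(1) t(1)] that osub_add[OF J] by (auto simp: J'_def)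
  qed
  have J'sm: "r * a \<in> J'" if "a \<in> J'" "integral r" for a r
  proof -
    have "coeff r \<odot> t a \<oplus> h (r * a) \<in> N" using sm[OF that] Nf(4) t(2) that by metis
    then show ?thesis using Tf(4)[OF that(2) t(1)] that osub_smult[OF J] by (auto simp: J'_def)
  qed
  have "h 0 = \<zero>" by (rule hahn_hom_zero[OF h J])
  then have "0 \<in> J'" using osub_0[OF J] Tf(2) Nf(2) by (auto simp: J'_def intro!: bexI[of _ "\<zero>"])
  then have J': "osub J'" using J'add J'sm by (auto simp: osub_def)
  let ?g = "\<lambda>a. t a \<oplus> h a"
  have gc: "?g a \<in> carrier M" if "a \<in> J'" for a using t(2)[OF that] Nc by blast
  have "\<exists>g'. hahn_hom M J' g' \<and> (\<forall>x\<in>J'. g' x \<oplus> ?g x \<in> N \<inter> T)"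
  proof (rule lift_hahn_hom[OF sub presented_lin_compact[OF pres] J' gc])
    fix a b assume ab: "a \<in> J'" "b \<in> J'"
    have "?g (a + b) \<oplus> (?g a \<oplus> ?g b) \<in> N" using Nf(3) t(2) ab J'add by blast
    moreover have "?g (a + b) \<oplus> (?g a \<oplus> ?g b) = t (a + b) \<oplus> (t a \<oplus> t b)"
      unfolding sum[OF ab] using t(1)[THEN Tc] ab J'add hc J'J by (simp add: M.a_ac)
    moreover have "t (a + b) \<oplus> (t a \<oplus> t b) \<in> T" using Tf(3) t(1) ab J'add by blast
    ultimately show "?g (a + b) \<oplus> (?g a \<oplus> ?g b) \<in> N \<inter> T" by simp
  next
    fix r a assume r: "integral r" and a: "a \<in> J'"
    have "?g (r * a) \<oplus> coeff r \<odot> ?g a \<in> N" using Nf(3,4) t(2) a r J'sm by blast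
    moreover have "?g (r * a) \<oplus> coeff r \<odot> ?g a = t (r * a) \<oplus> coeff r \<odot> t a"
      unfolding sm[OF a r] using t(1)[THEN Tc] a r J'sm hc J'J by (simp add: M.a_ac)
    moreover have "t (r * a) \<oplus> coeff r \<odot> t a \<in> T" using Tf(3,4) t(1) a r J'sm by blast
    ultimately show "?g (r * a) \<oplus> coeff r \<odot> ?g a \<in> N \<inter> T" by simp
  qed
  then obtain g where g: "hahn_hom M J' g" "\<And>x. x \<in> J' \<Longrightarrow> g x \<oplus> ?g x \<in> N \<inter> T" by blast
  have gN: "g x \<in> N" if x: "x \<in> J'" for x
  proof -
    have "(g x \<oplus> ?g x) \<oplus> ?g x \<in> N" using Nf(3) g(2)[OF x] t(2)[OF x] by blast
    then show ?thesis using gc[OF x] hahn_hom_closed[OF g(1) x] by (simp add: M.a_assoc)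
  qed
  have "N = {n \<oplus> g a | n a. n \<in> N \<inter> T \<and> a \<in> J'}"
  proof (intro Set.set_eqI iffI)
    fix y assume y: "y \<in> N"
    then obtain s a where sa: "s \<in> T" "a \<in> J" "y = s \<oplus> h a" using add.prems(2) by blast
    then have a: "a \<in> J'" using y by (auto simp: J'_def)
    have c: "s \<in> carrier M" "h a \<in> carrier M" "g a \<in> carrier M" "t a \<in> carrier M" "y \<in> carrier M"
      using sa Tc hc hahn_hom_closed[OF g(1) a] t(1)[OF a] Nc[OF y] by auto
    have "y \<oplus> g a = (s \<oplus> t a) \<oplus> (g a \<oplus> ?g a)" using sa(3) c by (simp add: M.a_ac)
    also have "\<dots> \<in> T" using Tf(3) sa(1) t(1)[OF a] g(2)[OF a] by blast
    finally have "y \<oplus> g a \<in> N \<inter> T" using Nf(3)[OF y gN[OF a]] by simp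
    moreover have "y = (y \<oplus> g a) \<oplus> g a" using c by (simp add: M.a_assoc)
    ultimately show "y \<in> {n \<oplus> g a | n a. n \<in> N \<inter> T \<and> a \<in> J'}" using a by blast
  next
    fix y assume "y \<in> {n \<oplus> g a | n a. n \<in> N \<inter> T \<and> a \<in> J'}"
    then show "y \<in> N" using Nf(3) gN by blast
  qed
  then show ?case using presented_add[OF pres J' g(1)] by simp
qed

end

text \<open>\<open>J\<close> is projective relative to surjections with linearly compact kernel:
  lifts chosen pointwise are linear modulo the kernel, and \<open>lift_hahn_hom\<close> corrects
  them.\<close>

lemma lift_along_surjection:
  assumes mY: "Module.module hahn_ring Y" and mZ: "Module.module hahn_ring Z"
    and g: "g \<in> module_homs hahn_ring Y Z" and im: "g ` carrier Y = carrier Z"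
    and K: "lin_compact Y {y \<in> carrier Y. g y = \<zero>\<^bsub>Z\<^esub>}" and J: "osub J" and h: "hahn_hom Z J h"
  shows "\<exists>q. hahn_hom Y J q \<and> (\<forall>a\<in>J. g (q a) = h a)"
proof -
  interpret Y: hmodule Y by (rule hmoduleI[OF mY])
  interpret Z: hmodule Z by (rule hmoduleI[OF mZ])
  let ?K = "{y \<in> carrier Y. g y = \<zero>\<^bsub>Z\<^esub>}"
  have hc: "h a \<in> carrier Z" if "a \<in> J" for a using hahn_hom_closed[OF h that] .
  have "\<exists>y. y \<in> carrier Y \<and> g y = h a" if "a \<in> J" for a
  proof -
    have "h a \<in> g ` carrier Y" using hc[OF that] im by simp
    then show ?thesis by (metis imageE)
  qed
  then obtain q where q: "\<And>a. a \<in> J \<Longrightarrow> q a \<in> carrier Y" "\<And>a. a \<in> J \<Longrightarrow> g (q a) = h a" by metis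
  have "\<exists>q'. hahn_hom Y J q' \<and> (\<forall>x\<in>J. q' x \<oplus>\<^bsub>Y\<^esub> q x \<in> ?K)"
  proof (rule Y.lift_hahn_hom[OF kernel_submodule[OF g mY mZ] K J q(1)])
    show "q (x + y) \<oplus>\<^bsub>Y\<^esub> (q x \<oplus>\<^bsub>Y\<^esub> q y) \<in> ?K" if "x \<in> J" "y \<in> J" for x y
      using that q hc osub_add[OF J that] by (simp add: hom_add[OF g] hahn_hom_add[OF h])
    show "q (r * x) \<oplus>\<^bsub>Y\<^esub> coeff r \<odot>\<^bsub>Y\<^esub> q x \<in> ?K" if "integral r" "x \<in> J" for r x
      using that q hc osub_smult[OF J that] by (simp add: hom_add[OF g] hom_smult[OF g] hahn_hom_smult[OF h])
  qed
  then obtain q' where q': "hahn_hom Y J q'" "\<And>x. x \<in> J \<Longrightarrow> q' x \<oplus>\<^bsub>Y\<^esub> q x \<in> ?K" by blast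
  have q'c: "q' a \<in> carrier Y" if "a \<in> J" for a using hahn_hom_closed[OF q'(1) that] .
  have gq': "g (q' a) = h a" if "a \<in> J" for a
  proof -
    have "g (q' a) \<oplus>\<^bsub>Z\<^esub> h a = \<zero>\<^bsub>Z\<^esub>" using q'(2)[OF that] q'c[OF that] q[OF that] by (simp add: hom_add[OF g])
    then show ?thesis using Z.eq_if_add_zero hom_closed[OF g q'c[OF that]] hc[OF that] by blast
  qed
  with q'(1) show ?thesis by blast
qed

text \<open>Induction on the presentation of \<open>Z\<close>, applied to the preimages of its
  partial sums. The preimage of zero is the image of \<open>X\<close>; every further image in
  \<open>Z\<close> lifts to \<open>Y\<close> because this kernel is linearly compact.\<close>

lemma presented_extension:
  assumes se: "short_exact hahn_ring X f Y g Z"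
    and X: "presented X (carrier X)" and Z: "presented Z (carrier Z)"
  shows "presented Y (carrier Y)"
proof -
  have mX: "Module.module hahn_ring X" and mY: "Module.module hahn_ring Y" and mZ: "Module.module hahn_ring Z"
    and f: "f \<in> module_homs hahn_ring X Y" and g: "g \<in> module_homs hahn_ring Y Z"
    and ker: "f ` carrier X = {y \<in> carrier Y. g y = \<zero>\<^bsub>Z\<^esub>}" and im: "g ` carrier Y = carrier Z"
    using se unfolding short_exact_def by auto
  interpret Y: hmodule Y by (rule hmoduleI[OF mY])
  interpret Z: hmodule Z by (rule hmoduleI[OF mZ])
  let ?K = "{y \<in> carrier Y. g y = \<zero>\<^bsub>Z\<^esub>}"
  have K: "presented Y ?K" using presented_hom_image[OF mX mY f X] by (simp add: ker)
  have "presented Y {y \<in> carrier Y. g y \<in> carrier Z}"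
    using Z
  proof (induction rule: Z.presented_induct)
    case zero
    then show ?case using K by simp
  next
    case (add T J h)
    note h = add.hyps(3) and J = add.hyps(2)
    note Tf = Z.submodule_facts[OF Z.presented_submodule[OF add.hyps(1)]]
    have hc: "h a \<in> carrier Z" if "a \<in> J" for a using hahn_hom_closed[OF h that] .
    obtain q' where q': "hahn_hom Y J q'" and gq': "\<And>a. a \<in> J \<Longrightarrow> g (q' a) = h a"
      using lift_along_surjection[OF mY mZ g im Y.presented_lin_compact[OF K] J h] by blast
    have q'c: "q' a \<in> carrier Y" if "a \<in> J" for a using hahn_hom_closed[OF q' that] .
    have "{y \<in> carrier Y. g y \<in> {t \<oplus>\<^bsub>Z\<^esub> h a | t a. t \<in> T \<and> a \<in> J}}
      = {y \<oplus>\<^bsub>Y\<^esub> q' a | y a. y \<in> {y \<in> carrier Y. g y \<in> T} \<and> a \<in> J}"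
    proof (intro Set.set_eqI iffI)
      fix y assume "y \<in> {y \<in> carrier Y. g y \<in> {t \<oplus>\<^bsub>Z\<^esub> h a | t a. t \<in> T \<and> a \<in> J}}"
      then obtain t a where y: "y \<in> carrier Y" "t \<in> T" "a \<in> J" "g y = t \<oplus>\<^bsub>Z\<^esub> h a" by blast
      have tc: "t \<in> carrier Z" using y(2) Tf(1) by blast
      have "g (y \<oplus>\<^bsub>Y\<^esub> q' a) = t" using y tc q'c gq' hc by (simp add: hom_add[OF g] Z.a_assoc)
      moreover have "y = (y \<oplus>\<^bsub>Y\<^esub> q' a) \<oplus>\<^bsub>Y\<^esub> q' a" using y(1) q'c[OF y(3)] by (simp add: Y.a_assoc)
      moreover have "y \<oplus>\<^bsub>Y\<^esub> q' a \<in> carrier Y" using y(1) q'c[OF y(3)] by simp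
      ultimately show "y \<in> {y \<oplus>\<^bsub>Y\<^esub> q' a | y a. y \<in> {y \<in> carrier Y. g y \<in> T} \<and> a \<in> J}" using y(2,3) by blast
    next
      fix y assume "y \<in> {y \<oplus>\<^bsub>Y\<^esub> q' a | y a. y \<in> {y \<in> carrier Y. g y \<in> T} \<and> a \<in> J}"
      then obtain u a where y: "u \<in> carrier Y" "g u \<in> T" "a \<in> J" "y = u \<oplus>\<^bsub>Y\<^esub> q' a" by blast
      then have "y \<in> carrier Y" "g y = g u \<oplus>\<^bsub>Z\<^esub> h a" using q'c gq' by (auto simp: hom_add[OF g])
      then show "y \<in> {y \<in> carrier Y. g y \<in> {t \<oplus>\<^bsub>Z\<^esub> h a | t a. t \<in> T \<and> a \<in> J}}" using y(2,3) by blast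
    qed
    then show ?case using Y.presented_add[OF add.IH J q'] by simp
  qed
  moreover have "{y \<in> carrier Y. g y \<in> carrier Z} = carrier Y" using hom_closed[OF g] by blast
  ultimately show ?thesis by simp
qed

subsection \<open>Splitting off a summand\<close>

context hmodule
begin

text \<open>In the generic case the summand is the one for which the quotient of \<open>J i\<close> by the submodule \<open>I i\<close> of
  \<open>i\<close>-th coordinates of relations is shortest. Linear compactness yields \<open>c\<close> with \<open>c i = 1\<close> such that
  \<open>I i\<close> times \<open>c\<close> consists of relations, and minimality ensures that \<open>J i\<close> times \<open>c\<close> consists of tuples.\<close>

lemma exists_split_direction:
  fixes S :: "'i set"
  assumes H: "homs_on M S J h" and "S \<noteq> {}"
  shows "\<exists>i\<in>S. \<exists>c. c i = 1 \<and> (\<forall>k\<in>S. \<forall>a\<in>J i. a * c k \<in> J k) \<and>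
    (\<forall>x\<in>tuples S J. comb M S h x = \<zero> \<longrightarrow> comb M S h (\<lambda>k. x i * c k) = \<zero>)"
proof -
  have J: "osub (J i)" if "i \<in> S" for i using homs_onD(2)[OF H that] .
  \<comment> \<open>The relations among the summands; \<open>I i\<close> below collects their
    coordinates at \<open>i\<close>.\<close>
  define L where "L = {x \<in> tuples S J. comb M S h x = \<zero>}"
  have Ladd: "(\<lambda>i. x i + y i) \<in> L" if "x \<in> L" "y \<in> L" for x y
    using that tuples_add[OF H] comb_add[OF H] by (simp add: L_def)
  have Lsm: "(\<lambda>i. r * x i) \<in> L" if "x \<in> L" "integral r" for x r
    using that tuples_smult[OF H] comb_smult[OF H] by (simp add: L_def)
  have L0: "(\<lambda>i. 0) \<in> L" using tuples_zero[OF H] comb_zero[OF H] by (simp add: L_def)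
  have Lcong: "y \<in> L" if "x \<in> L" "\<And>i. i \<in> S \<Longrightarrow> x i = y i" for x y
    using that comb_cong[OF H, of x y] by (auto simp: L_def tuples_def)
  define I where "I i = (\<lambda>x. x i) ` L" for i
  have I: "osub (I i)" for i
    unfolding osub_def
  proof (intro conjI ballI allI impI)
    show "0 \<in> I i" unfolding I_def using L0 by (rule rev_image_eqI) simp
    fix x y assume "x \<in> I i" "y \<in> I i"
    then obtain u v where "u \<in> L" "v \<in> L" "x = u i" "y = v i" unfolding I_def by blast
    then show "x + y \<in> I i" unfolding I_def using Ladd[of u v] by (intro rev_image_eqI[of "\<lambda>k. u k + v k"]) auto
  next
    fix r x assume r: "integral r" "x \<in> I i"
    then obtain u where "u \<in> L" "x = u i" unfolding I_def by blast
    then show "r * x \<in> I i" unfolding I_def using Lsm[of u r] r(1) by (intro rev_image_eqI[of "\<lambda>k. r * u k"]) auto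
  qed
  have IJ: "I i \<subseteq> J i" if "i \<in> S" for i using that by (auto simp: I_def L_def tuples_def)
  show ?thesis
  proof (cases "\<exists>i\<in>S. I i = {0}")
    case True
    \<comment> \<open>No relation involves coordinate \<open>i\<close>, so the standard vector at
      \<open>i\<close> splits off.\<close>
    then obtain i where i: "i \<in> S" "I i = {0}" by blast
    have "comb M S h (\<lambda>k. x i * of_bool (k = i)) = \<zero>" if "x \<in> tuples S J" "comb M S h x = \<zero>" for x
    proof -
      have "x i \<in> I i" using that unfolding I_def L_def by blast
      then show ?thesis using i(2) comb_zero[OF H] by simp
    qed
    then show ?thesis using i(1) J osub_0
      by (intro bexI[of _ i] exI[of _ "\<lambda>k. of_bool (k = i)"]) auto
  next
    case False
    \<comment> \<open>\<open>R k i\<close> expresses that J_k / I_k is strictly shorter than J_i /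
      I_i: a scalar \<open>d\<close> carries I_i into I_k but not J_i into J_k.\<close>
    define R where "R k i \<longleftrightarrow> (\<exists>d. (\<forall>x\<in>I i. d * x \<in> I k) \<and> (\<exists>x\<in>J i. d * x \<notin> J k))" for k i
    have irr: "\<not> R i i" if i: "i \<in> S" for i
    proof
      assume "R i i"
      then obtain d x where d: "\<And>x. x \<in> I i \<Longrightarrow> d * x \<in> I i" "x \<in> J i" "d * x \<notin> J i" unfolding R_def by blast
      have "\<not> integral d" using osub_smult[OF J[OF i]] d by blast
      \<comment> \<open>A nonintegral scalar that preserves I_i forces I_i, and with it J_i, to be
        all of K.\<close>
      then have "I i = UNIV" using osub_expand[OF I _ _ d(1)] False i by blast
      then show False using IJ[OF i] d(3) by blast
    qed
    have tr: "R l i" if ikl: "i \<in> S" "k \<in> S" "l \<in> S" "R l k" "R k i" for i k l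
    proof -
      obtain d x where d: "\<forall>x\<in>I i. d * x \<in> I k" "x \<in> J i" "d * x \<notin> J k" using ikl unfolding R_def by blast
      obtain d' y where d': "\<forall>x\<in>I k. d' * x \<in> I l" "y \<in> J k" "d' * y \<notin> J l" using ikl unfolding R_def by blast
      have x0: "d * x \<noteq> 0" using d(3) osub_0[OF J[OF ikl(2)]] by auto
      have y0: "y \<noteq> 0" using d'(3) osub_0[OF J[OF ikl(3)]] by auto
      \<comment> \<open>The product d' d witnesses transitivity: d x lies outside J_k and y inside,
        so y is an integral multiple of d x. The corresponding multiple of x lies in J_i, and d' d
        carries it to d' y, outside J_l.\<close>
      have "\<not> integral (d * x / y)" using osub_divide[OF J[OF ikl(2)] d'(2) y0] d(3) by blast
      then have i: "integral (y / (d * x))" using integral_divide_total[OF x0 y0] by blast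
      then have "y / (d * x) * x \<in> J i" using osub_smult[OF J[OF ikl(1)]] d(2) by blast
      moreover have "d' * d * (y / (d * x) * x) = d' * y" using x0 by simp
      ultimately have "\<exists>x\<in>J i. d' * d * x \<notin> J l" using d'(3) by metis
      moreover have "\<forall>x\<in>I i. d' * d * x \<in> I l" using d(1) d'(1) by (simp add: mult.assoc)
      ultimately show ?thesis unfolding R_def by blast
    qed
    have "\<exists>i\<in>S. \<forall>k\<in>S. k \<noteq> i \<longrightarrow> \<not> R k i"
    proof (rule Finite_Set.bex_min_element[OF homs_onD(1)[OF H] _ _ assms(2)])
      show "transp_on S R" by (rule transp_onI) (metis tr)
      show "asymp_on S R" by (rule asymp_onI) (metis tr irr)
    qed
    then obtain i where i': "i \<in> S" "\<forall>k\<in>S. k \<noteq> i \<longrightarrow> \<not> R k i" by (rule bexE)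
    have i: "i \<in> S" "\<And>k. k \<in> S \<Longrightarrow> \<not> R k i" using i' irr[OF i'(1)] by metis+
    have "I i \<noteq> {0}" using False i by blast
    then obtain e where e: "gen_seq e" "I i = generated e" using osub_generators[OF I] by blast
    have e0: "e m \<noteq> 0" for m using e(1) by (simp add: gen_seq_def)
    \<comment> \<open>Directions with coordinate 1 at \<open>i\<close> whose multiple by e_m is a
      relation; a relation with coordinate e_m at \<open>i\<close> yields one after division. Linear
      compactness finds a direction that serves all \<open>m\<close>.\<close>
    define C where "C m = {c. (\<lambda>k. e m * c k) \<in> L \<and> c i = 1}" for m
    have "\<exists>c. \<forall>m. \<exists>x\<in>C m. \<forall>k\<in>S. x k = c k"
    proof (rule fun_lin_compact)
      show "finite S" using homs_onD(1)[OF H] .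
      show "decseq C"
        unfolding decseq_Suc_iff
      proof (intro allI subsetI)
        fix m c assume c: "c \<in> C (Suc m)"
        have "integral (e m / e (Suc m))" using e(1) by (simp add: gen_seq_def)
        moreover have "(\<lambda>k. e (Suc m) * c k) \<in> L" using c by (simp add: C_def)
        ultimately have "(\<lambda>k. e m / e (Suc m) * (e (Suc m) * c k)) \<in> L" using Lsm by blast
        then show "c \<in> C m" using e0[of "Suc m"] c by (simp add: C_def)
      qed
      show "C m \<noteq> {}" for m
      proof -
        have "e m \<in> I i" using generated_generators[OF e(1)] e(2) by simp
        then obtain x where x: "x \<in> L" "e m = x i" unfolding I_def by blast
        then have "(\<lambda>k. x k / e m) \<in> C m" using e0[of m] by (simp add: C_def)
        then show ?thesis by blast
      qed
      show "affine_fun (C m)" for m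
        unfolding affine_fun_def
      proof (intro ballI allI impI)
        fix x y z r assume xyz: "x \<in> C m" "y \<in> C m" "z \<in> C m" and r: "integral r"
        then have l: "(\<lambda>k. e m * x k) \<in> L" "(\<lambda>k. e m * y k) \<in> L" "(\<lambda>k. e m * z k) \<in> L" by (auto simp: C_def)
        have "(\<lambda>k. e m * x k + r * (e m * y k + e m * z k)) \<in> L" using Ladd[OF l(1) Lsm[OF Ladd[OF l(2,3)] r]] .
        moreover have "(\<lambda>k. e m * x k + r * (e m * y k + e m * z k)) = (\<lambda>k. e m * (x k + r * (y k - z k)))"
          by (simp add: diff_conv_add_uminus algebra_simps)
        ultimately show "(\<lambda>k. x k + r * (y k - z k)) \<in> C m" using xyz by (simp add: C_def)
      qed
    qed
    then obtain c where c: "\<And>m. \<exists>x\<in>C m. \<forall>k\<in>S. x k = c k" by blast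
    have cL: "(\<lambda>k. e m * c k) \<in> L" for m
    proof -
      obtain x where x: "x \<in> C m" "\<forall>k\<in>S. x k = c k" using c by blast
      then show ?thesis by - (rule Lcong[of "\<lambda>k. e m * x k"], auto simp: C_def)
    qed
    have ci: "c i = 1" using c[of 0] i(1) by (auto simp: C_def)
    have aL: "(\<lambda>k. a * c k) \<in> L" if a: "a \<in> I i" for a
    proof -
      obtain m where m: "integral (a / e m)" using a e(2) by (auto simp: generated_def)
      then have "(\<lambda>k. a / e m * (e m * c k)) \<in> L" using Lsm[OF cL] by blast
      then show ?thesis using e0[of m] by simp
    qed
    \<comment> \<open>Minimality of \<open>i\<close>: multiplication by c_k carries I_i into I_k,
      hence also J_i into J_k.\<close>
    have "a * c k \<in> J k" if "k \<in> S" "a \<in> J i" for k a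
    proof -
      have "\<forall>x\<in>I i. c k * x \<in> I k" using aL unfolding I_def[of k] by (auto simp: mult.commute)
      then have "c k * a \<in> J k" using i(2)[OF that(1)] that(2) unfolding R_def by blast
      then show ?thesis by (simp add: mult.commute)
    qed
    moreover have "comb M S h (\<lambda>k. x i * c k) = \<zero>" if "x \<in> tuples S J" "comb M S h x = \<zero>" for x
    proof -
      have "x i \<in> I i" using that unfolding I_def L_def by blast
      then show ?thesis using aL by (simp add: L_def)
    qed
    ultimately show ?thesis using i(1) ci by blast
  qed
qed

text \<open>Internal direct sums of basic submodules grown one summand at a time, which fits an
  induction on the number of images; the indexed form is extracted afterwards.\<close>

inductive decomposed :: "'b set \<Rightarrow> bool" where
  decomposed_zero: "decomposed {\<zero>}"
| decomposed_add: "decomposed T \<Longrightarrow> submodule U hahn_ring M \<Longrightarrow>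
    basic_module hahn_ring (submodule_as_module M U) \<Longrightarrow> U \<inter> T = {\<zero>} \<Longrightarrow>
    decomposed {u \<oplus> t | u t. u \<in> U \<and> t \<in> T}"

text \<open>Induction on the number of images: with a split direction \<open>c\<close> at
  \<open>i\<close>, the image of J_i under \<open>g\<close>, which sends \<open>a\<close> to the
  value at the tuple a c, is a complement of the sum over the other indices.\<close>

lemma comb_decomposed:
  fixes S :: "'i set"
  assumes "homs_on M S J h"
  shows "decomposed (comb M S h ` tuples S J)"
  using assms
proof (induction "card S" arbitrary: S)
  case 0
  then have "S = {}" using homs_onD(1)[OF 0(2)] by simp
  then have "comb M S h ` tuples S J = {\<zero>}" by (auto simp: tuples_def)
  then show ?case using decomposed_zero by simp
next
  case (Suc n)
  note H = Suc.prems
  have "S \<noteq> {}" using Suc(2) by auto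
  then obtain i c where i: "i \<in> S" and ci: "c i = 1" and cJ: "\<And>k a. k \<in> S \<Longrightarrow> a \<in> J i \<Longrightarrow> a * c k \<in> J k"
    and cL: "\<And>x. x \<in> tuples S J \<Longrightarrow> comb M S h x = \<zero> \<Longrightarrow> comb M S h (\<lambda>k. x i * c k) = \<zero>"
    using exists_split_direction[OF H] by blast
  define S' where "S' = S - {i}"
  have S: "S = insert i S'" "i \<notin> S'" using i by (auto simp: S'_def)
  have H': "homs_on M S' J h" by (rule homs_on_subset[OF H]) (auto simp: S'_def)
  have card: "n = card S'" using Suc(2) homs_onD(1)[OF H'] S by simp
  define T' where "T' = comb M S' h ` tuples S' J"
  have T': "decomposed T'" unfolding T'_def by (rule Suc(1)[OF card H'])
  note T'f = submodule_facts[OF comb_submodule[OF H', folded T'_def]]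
  define g where "g a = comb M S h (\<lambda>k. a * c k)" for a
  have gt: "(\<lambda>k. a * c k) \<in> tuples S J" if "a \<in> J i" for a using cJ that by (auto simp: tuples_def)
  have g: "hahn_hom M (J i) g"
  proof (rule hahn_homI)
    show "g x \<in> carrier M" if "x \<in> J i" for x unfolding g_def by (rule comb_closed[OF H gt[OF that]])
    show "g (x + y) = g x \<oplus> g y" if "x \<in> J i" "y \<in> J i" for x y
      unfolding g_def using comb_add[OF H gt[OF that(1)] gt[OF that(2)]] by (simp add: distrib_right)
    show "g (r * x) = coeff r \<odot> g x" if "integral r" "x \<in> J i" for r x
      unfolding g_def using comb_smult[OF H gt[OF that(2)] that(1)] by (simp add: mult.assoc)
  qed
  have Ji: "osub (J i)" using homs_onD(2)[OF H i] .
  let ?U = "g ` J i"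
  \<comment> \<open>Since c_i = 1 and signs vanish, adding x_i c to \<open>x\<close> removes
    coordinate \<open>i\<close> and leaves a tuple over the other indices.\<close>
  have sum: "comb M S h x = g (x i) \<oplus> comb M S' h (\<lambda>k. x k + x i * c k)"
    and tup: "(\<lambda>k. x k + x i * c k) \<in> tuples S' J" if x: "x \<in> tuples S J" for x
  proof -
    have xi: "x i \<in> J i" using x i by (simp add: tuples_def)
    let ?y = "\<lambda>k. x k + x i * c k"
    have y: "?y \<in> tuples S J" by (rule tuples_add[OF H x gt[OF xi]])
    then show "?y \<in> tuples S' J" by (auto simp: tuples_def S'_def)
    then have yc: "comb M S' h ?y \<in> carrier M" by (rule comb_closed[OF H'])
    have "comb M S h ?y = h i (?y i) \<oplus> comb M S' h ?y"
      using comb_insert[of i S' J h ?y] H y S by simp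
    also have "h i (?y i) = \<zero>" using ci hahn_hom_zero[OF homs_onD(3)[OF H i] Ji] by simp
    finally have e: "comb M S h ?y = comb M S' h ?y" using yc by simp
    have "comb M S h ?y = comb M S h x \<oplus> g (x i)" unfolding g_def by (rule comb_add[OF H x gt[OF xi]])
    then show "comb M S h x = g (x i) \<oplus> comb M S' h ?y"
      using e comb_closed[OF H x] hahn_hom_closed[OF g xi] by (simp add: M.a_ac)
  qed
  have T: "comb M S h ` tuples S J = {u \<oplus> t | u t. u \<in> ?U \<and> t \<in> T'}"
  proof (intro Set.set_eqI iffI)
    fix y assume "y \<in> comb M S h ` tuples S J"
    then obtain x where x: "x \<in> tuples S J" "y = comb M S h x" by blast
    then have "x i \<in> J i" using i by (simp add: tuples_def)
    then show "y \<in> {u \<oplus> t | u t. u \<in> ?U \<and> t \<in> T'}" using sum[OF x(1)] tup[OF x(1)] x(2) unfolding T'_def by blast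
  next
    fix y assume "y \<in> {u \<oplus> t | u t. u \<in> ?U \<and> t \<in> T'}"
    then obtain a x where ax: "a \<in> J i" "x \<in> tuples S' J" "y = g a \<oplus> comb M S' h x" unfolding T'_def by blast
    \<comment> \<open>The sum of a c and of \<open>x\<close> with its coordinate at \<open>i\<close>
      removed.\<close>
    let ?z = "\<lambda>k. if k = i then a else x k + a * c k"
    have z: "?z \<in> tuples S J" using ax cJ i by (auto simp: tuples_def S'_def intro!: osub_add homs_onD(2)[OF H])
    have "comb M S' h (\<lambda>k. ?z k + ?z i * c k) = comb M S' h x"
      by (rule comb_cong[OF H', symmetric, OF ax(2)]) (auto simp: S'_def add.assoc)
    then have "y = comb M S h ?z" using sum[OF z] ax(3) by simp
    then show "y \<in> comb M S h ` tuples S J" using z by blast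
  qed
  have disj: "?U \<inter> T' = {\<zero>}"
  proof (intro Set.set_eqI iffI)
    fix y assume "y \<in> ?U \<inter> T'"
    then obtain a x where ax: "a \<in> J i" "y = g a" "x \<in> tuples S' J" "y = comb M S' h x" unfolding T'_def by blast
    \<comment> \<open>If g a equals a sum over the other indices, then \<open>?z\<close> is a
      relation with coordinate \<open>a\<close> at \<open>i\<close>; the choice of \<open>c\<close>
      makes a c a relation too, that is, g a = 0.\<close>
    let ?z = "\<lambda>k. if k = i then a else x k + a * c k"
    have z: "?z \<in> tuples S J" using ax cJ i by (auto simp: tuples_def S'_def intro!: osub_add homs_onD(2)[OF H])
    have "comb M S' h (\<lambda>k. ?z k + ?z i * c k) = comb M S' h x"
      by (rule comb_cong[OF H', symmetric, OF ax(3)]) (auto simp: S'_def add.assoc)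
    then have "comb M S h ?z = y \<oplus> y" using sum[OF z] ax(2,4) by simp
    also have "\<dots> = \<zero>" using ax(2) hahn_hom_closed[OF g ax(1)] by simp
    finally have "comb M S h (\<lambda>k. ?z i * c k) = \<zero>" by (rule cL[OF z])
    then show "y \<in> {\<zero>}" using ax(2) by (simp add: g_def)
  qed (use T'f(2) submodule_facts(2)[OF hahn_hom_image_submodule[OF g Ji]] in auto)
  \<comment> \<open>Basic modules are nonzero, so a zero image is dropped instead of being counted
    as a summand.\<close>
  show ?case
  proof (cases "?U = {\<zero>}")
    case True
    have "{u \<oplus> t | u t. u \<in> ?U \<and> t \<in> T'} = T'"
    proof (intro Set.set_eqI iffI)
      fix y assume y: "y \<in> T'"
      then have "y = \<zero> \<oplus> y" using T'f(1) by auto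
      then show "y \<in> {u \<oplus> t | u t. u \<in> ?U \<and> t \<in> T'}" unfolding True using y by blast
    next
      fix y assume "y \<in> {u \<oplus> t | u t. u \<in> ?U \<and> t \<in> T'}"
      then obtain t where "t \<in> T'" "y = \<zero> \<oplus> t" unfolding True by blast
      then show "y \<in> T'" using T'f(1) by auto
    qed
    then show ?thesis using T T' by simp
  next
    case False
    show ?thesis
      unfolding T
      by (rule decomposed_add[OF T' hahn_hom_image_submodule[OF g Ji] hahn_hom_image_basic[OF g Ji False] disj])
  qed
qed

lemma decomposed_submodule: "decomposed T \<Longrightarrow> submodule T hahn_ring M"
proof (induction rule: decomposed.induct)
  case decomposed_zero
  show ?case by (rule hsubmoduleI) auto
next
  case (decomposed_add T U)
  note U = submodule_facts[OF decomposed_add.hyps(2)] and T = submodule_facts[OF decomposed_add.IH]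
  have c: "u \<in> U \<Longrightarrow> u \<in> carrier M" "t \<in> T \<Longrightarrow> t \<in> carrier M" for u t using U(1) T(1) by auto
  show ?case
  proof (rule hsubmoduleI)
    show "{u \<oplus> t | u t. u \<in> U \<and> t \<in> T} \<subseteq> carrier M" using c by auto
    show "\<zero> \<in> {u \<oplus> t | u t. u \<in> U \<and> t \<in> T}" using U(2) T(2) by force
  next
    fix x y assume "x \<in> {u \<oplus> t | u t. u \<in> U \<and> t \<in> T}" "y \<in> {u \<oplus> t | u t. u \<in> U \<and> t \<in> T}"
    then obtain u t u' t' where *: "u \<in> U" "t \<in> T" "x = u \<oplus> t" "u' \<in> U" "t' \<in> T" "y = u' \<oplus> t'" by blast
    then have "x \<oplus> y = (u \<oplus> u') \<oplus> (t \<oplus> t')" using c by (simp add: M.a_ac)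
    then show "x \<oplus> y \<in> {u \<oplus> t | u t. u \<in> U \<and> t \<in> T}" using U(3) T(3) * by blast
  next
    fix r x assume r: "integral r" and "x \<in> {u \<oplus> t | u t. u \<in> U \<and> t \<in> T}"
    then obtain u t where *: "u \<in> U" "t \<in> T" "x = u \<oplus> t" by blast
    then have "coeff r \<odot> x = coeff r \<odot> u \<oplus> coeff r \<odot> t" using c r by (simp add: hs_radd)
    then show "coeff r \<odot> x \<in> {u \<oplus> t | u t. u \<in> U \<and> t \<in> T}" using U(4) T(4) * r by blast
  qed
qed

lemma decomposed_direct_sum:
  assumes "decomposed T"
  shows "\<exists>(n::nat) N. (\<forall>i<n. submodule (N i) hahn_ring M \<and> basic_module hahn_ring (submodule_as_module M (N i))) \<and>
    bij_betw (\<lambda>c. \<Oplus>i\<in>{..<n}. c i) (\<Pi>\<^sub>E i\<in>{..<n}. N i) T"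
  using assms
proof (induction rule: decomposed.induct)
  case decomposed_zero
  show ?case by (intro exI[of _ 0]) (simp add: bij_betw_def)
next
  case (decomposed_add T U)
  then obtain n :: nat and N where N: "\<And>i. i < n \<Longrightarrow> submodule (N i) hahn_ring M"
    "\<And>i. i < n \<Longrightarrow> basic_module hahn_ring (submodule_as_module M (N i))"
    and bij: "bij_betw (\<lambda>c. \<Oplus>i\<in>{..<n}. c i) (\<Pi>\<^sub>E i\<in>{..<n}. N i) T" by blast
  note inj = bij_betw_imp_inj_on[OF bij] and im = bij_betw_imp_surj_on[OF bij]
  note U = submodule_facts[OF decomposed_add.hyps(2)]
    and T = submodule_facts[OF decomposed_submodule[OF decomposed_add.hyps(1)]]
  let ?N = "N(n := U)"
  let ?s = "\<lambda>n c. \<Oplus>i\<in>{..<n}. c i"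
  have cl: "c i \<in> carrier M" if "c \<in> (\<Pi>\<^sub>E i\<in>{..<Suc n}. ?N i)" "i < Suc n" for c i
  proof -
    have "c i \<in> ?N i" using that by blast
    then show ?thesis using submodule_facts(1)[OF N(1)[of i]] U(1) that(2) by (cases "i = n") auto
  qed
  have sum: "?s (Suc n) c = c n \<oplus> ?s n (restrict c {..<n})" if c: "c \<in> (\<Pi>\<^sub>E i\<in>{..<Suc n}. ?N i)" for c
  proof -
    have "?s (Suc n) c = c n \<oplus> ?s n c"
      unfolding lessThan_Suc using cl[OF c] by (intro M.finsum_insert) auto
    also have "?s n c = ?s n (restrict c {..<n})" using cl[OF c] by (intro M.finsum_cong') auto
    finally show ?thesis .
  qed
  have res: "restrict c {..<n} \<in> (\<Pi>\<^sub>E i\<in>{..<n}. N i)" if c: "c \<in> (\<Pi>\<^sub>E i\<in>{..<Suc n}. ?N i)" for c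
  proof (rule restrict_PiE_iff[THEN iffD2], rule ballI)
    fix i assume "i \<in> {..<n}"
    then show "c i \<in> N i" using PiE_mem[OF c, of i] by (cases "i = n") auto
  qed
  have cn: "c n \<in> U" if c: "c \<in> (\<Pi>\<^sub>E i\<in>{..<Suc n}. ?N i)" for c
    using PiE_mem[OF c, of n] by simp
  have resT: "?s n (restrict c {..<n}) \<in> T" if c: "c \<in> (\<Pi>\<^sub>E i\<in>{..<Suc n}. ?N i)" for c
    using imageI[OF res[OF c], of "?s n"] unfolding im .
  have "bij_betw (?s (Suc n)) (\<Pi>\<^sub>E i\<in>{..<Suc n}. ?N i) {u \<oplus> t | u t. u \<in> U \<and> t \<in> T}"
  proof (rule bij_betw_imageI)
    show "inj_on (?s (Suc n)) (\<Pi>\<^sub>E i\<in>{..<Suc n}. ?N i)"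
    proof (rule inj_onI)
      fix c c' assume c: "c \<in> (\<Pi>\<^sub>E i\<in>{..<Suc n}. ?N i)" and c': "c' \<in> (\<Pi>\<^sub>E i\<in>{..<Suc n}. ?N i)"
        and eq: "?s (Suc n) c = ?s (Suc n) c'"
      let ?t = "?s n (restrict c {..<n})" and ?t' = "?s n (restrict c' {..<n})"
      have e: "c n \<oplus> ?t = c' n \<oplus> ?t'" using eq sum[OF c] sum[OF c'] by simp
      have car: "c n \<in> carrier M" "c' n \<in> carrier M" "?t \<in> carrier M" "?t' \<in> carrier M"
        using cn[OF c] cn[OF c'] resT[OF c] resT[OF c'] U(1) T(1) by auto
      have "c n \<oplus> c' n = (c n \<oplus> ?t) \<oplus> (c' n \<oplus> ?t)" using car by (simp add: M.a_ac)
      also have "\<dots> = (c' n \<oplus> ?t') \<oplus> (c' n \<oplus> ?t)" unfolding e ..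
      also have "\<dots> = ?t' \<oplus> ?t" using car by (simp add: M.a_ac)
      finally have s: "c n \<oplus> c' n = ?t' \<oplus> ?t" .
      have "c n \<oplus> c' n \<in> U" "?t' \<oplus> ?t \<in> T" using U(3) T(3) cn[OF c] cn[OF c'] resT[OF c] resT[OF c'] by blast+
      then have "c n \<oplus> c' n \<in> U \<inter> T" using s by simp
      then have z: "c n \<oplus> c' n = \<zero>" "?t' \<oplus> ?t = \<zero>" using decomposed_add.hyps(4) s by auto
      have n: "c n = c' n" by (rule eq_if_add_zero[OF z(1) car(1,2)])
      have "?t' = ?t" by (rule eq_if_add_zero[OF z(2) car(4,3)])
      then have r: "restrict c' {..<n} = restrict c {..<n}" by (rule inj_onD[OF inj _ res[OF c'] res[OF c]])
      show "c = c'"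
      proof (rule PiE_ext[OF c c'])
        fix i assume "i \<in> {..<Suc n}"
        then show "c i = c' i" using n fun_cong[OF r, of i] by (cases "i = n") auto
      qed
    qed
    show "?s (Suc n) ` (\<Pi>\<^sub>E i\<in>{..<Suc n}. ?N i) = {u \<oplus> t | u t. u \<in> U \<and> t \<in> T}"
    proof (intro Set.set_eqI iffI)
      fix y assume "y \<in> ?s (Suc n) ` (\<Pi>\<^sub>E i\<in>{..<Suc n}. ?N i)"
      then obtain c where c: "c \<in> (\<Pi>\<^sub>E i\<in>{..<Suc n}. ?N i)" "y = ?s (Suc n) c" by blast
      then show "y \<in> {u \<oplus> t | u t. u \<in> U \<and> t \<in> T}" using sum[OF c(1)] cn[OF c(1)] resT[OF c(1)] by blast
    next
      fix y assume "y \<in> {u \<oplus> t | u t. u \<in> U \<and> t \<in> T}"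
      then obtain u t where ut: "u \<in> U" "t \<in> T" "y = u \<oplus> t" by blast
      then obtain c where c: "c \<in> (\<Pi>\<^sub>E i\<in>{..<n}. N i)" "t = ?s n c" unfolding im[symmetric] by blast
      let ?c = "c(n := u)"
      have c': "?c \<in> (\<Pi>\<^sub>E i\<in>{..<Suc n}. ?N i)"
      proof (rule PiE_I)
        show "?c i \<in> ?N i" if "i \<in> {..<Suc n}" for i using that ut(1) PiE_mem[OF c(1), of i] by (cases "i = n") auto
        show "?c i = undefined" if "i \<notin> {..<Suc n}" for i using that PiE_arb[OF c(1), of i] by auto
      qed
      have "restrict ?c {..<n} = c"
        by (rule ext) (use PiE_arb[OF c(1)] in auto)
      then have "y = ?s (Suc n) ?c" using sum[OF c'] ut(3) c(2) by simp
      then show "y \<in> ?s (Suc n) ` (\<Pi>\<^sub>E i\<in>{..<Suc n}. ?N i)" using c' by blast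
    qed
  qed
  moreover have "\<forall>i<Suc n. submodule (?N i) hahn_ring M \<and> basic_module hahn_ring (submodule_as_module M (?N i))"
    using N decomposed_add.hyps(2,3) by (auto simp: less_Suc_eq)
  ultimately show ?case by blast
qed

lemma multibasic_if_presented:
  assumes "presented M (carrier M)"
  shows "multibasic_module hahn_ring M"
proof -
  have "decomposed (carrier M)" using assms comb_decomposed unfolding presented_def by metis
  then obtain n :: nat and N where N: "\<forall>i<n. submodule (N i) hahn_ring M \<and> basic_module hahn_ring (submodule_as_module M (N i))"
    and bij: "bij_betw (\<lambda>c. \<Oplus>i\<in>{..<n}. c i) (\<Pi>\<^sub>E i\<in>{..<n}. N i) (carrier M)" using decomposed_direct_sum by blast
  have "\<exists>!c. c \<in> (\<Pi>\<^sub>E i\<in>{..<n}. N i) \<and> x = (\<Oplus>i\<in>{..<n}. c i)" if x: "x \<in> carrier M" for x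
  proof -
    obtain c where c: "c \<in> (\<Pi>\<^sub>E i\<in>{..<n}. N i)" "x = (\<Oplus>i\<in>{..<n}. c i)"
      using x unfolding bij_betw_imp_surj_on[OF bij, symmetric] by blast
    show ?thesis
    proof (rule ex1I[of _ c])
      fix c' assume c': "c' \<in> (\<Pi>\<^sub>E i\<in>{..<n}. N i) \<and> x = (\<Oplus>i\<in>{..<n}. c' i)"
      show "c' = c"
        by (rule inj_onD[OF bij_betw_imp_inj_on[OF bij] _ conjunct1[OF c'] c(1)])
          (simp only: conjunct2[OF c', symmetric] c(2)[symmetric])
    qed (use c in blast)
  qed
  then show ?thesis
    unfolding multibasic_module_def by (intro conjI exI[of _ n] exI[of _ N] module_axioms N ballI)
qed

text \<open>Keeps uniqueness of the decomposition together with parametrisations of the summands by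
  submodules of K; the torsion-free case uses both.\<close>

lemma multibasic_summands:
  assumes "multibasic_module hahn_ring M"
  shows "\<exists>(n::nat) J h. homs_on M {..<n} J h \<and> (\<forall>x\<in>carrier M. \<exists>!c. c \<in> (\<Pi>\<^sub>E i\<in>{..<n}. h i ` J i) \<and> x = (\<Oplus>i\<in>{..<n}. c i))"
proof -
  obtain n :: nat and N where N: "\<And>i. i < n \<Longrightarrow> submodule (N i) hahn_ring M"
    "\<And>i. i < n \<Longrightarrow> basic_module hahn_ring (submodule_as_module M (N i))"
    and ex: "\<forall>x\<in>carrier M. \<exists>!c. c \<in> (\<Pi>\<^sub>E i\<in>{..<n}. N i) \<and> x = (\<Oplus>i\<in>{..<n}. c i)"
    using assms unfolding multibasic_module_def by blast
  have "\<exists>J h. osub J \<and> hahn_hom M J h \<and> h ` J = N i" if i: "i < n" for i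
  proof -
    interpret N: hmodule "submodule_as_module M (N i)"
      by (rule hmoduleI[OF module_submodule_as_module[OF module_axioms N(1)[OF i]]])
    obtain J h where *: "osub J" "hahn_hom (submodule_as_module M (N i)) J h" "h ` J = N i"
      using N.basic_is_image[OF N(2)[OF i]] by auto
    then have "hahn_hom M J h" using submodule_facts(1)[OF N(1)[OF i]] by (auto simp: hahn_hom_def)
    then show ?thesis using * by blast
  qed
  then have "\<forall>i. \<exists>J h. i < n \<longrightarrow> osub J \<and> hahn_hom M J h \<and> h ` J = N i" by blast
  then obtain J h where Jh: "\<And>i. i < n \<Longrightarrow> osub (J i) \<and> hahn_hom M (J i) (h i) \<and> h i ` J i = N i" by metis
  have "(\<Pi>\<^sub>E i\<in>{..<n}. h i ` J i) = (\<Pi>\<^sub>E i\<in>{..<n}. N i)" using Jh by (intro PiE_cong) simp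
  then show ?thesis using Jh ex unfolding homs_on_def by (intro exI[of _ n] exI[of _ J] exI[of _ h]) simp
qed

lemma presented_if_multibasic:
  assumes "multibasic_module hahn_ring M"
  shows "presented M (carrier M)"
proof -
  obtain n :: nat and J h where H: "homs_on M {..<n} J h"
    and ex: "\<forall>x\<in>carrier M. \<exists>!c. c \<in> (\<Pi>\<^sub>E i\<in>{..<n}. h i ` J i) \<and> x = (\<Oplus>i\<in>{..<n}. c i)"
    using multibasic_summands[OF assms] by blast
  have "x \<in> comb M {..<n} h ` tuples {..<n} J" if x: "x \<in> carrier M" for x
  proof -
    obtain c where c: "c \<in> (\<Pi>\<^sub>E i\<in>{..<n}. h i ` J i)" "x = (\<Oplus>i\<in>{..<n}. c i)" using ex x by blast
    have "\<forall>i\<in>{..<n}. \<exists>a. a \<in> J i \<and> c i = h i a" using PiE_mem[OF c(1)] by blast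
    then obtain a where a: "\<forall>i\<in>{..<n}. a i \<in> J i \<and> c i = h i (a i)" by metis
    then have t: "a \<in> tuples {..<n} J" by (simp add: tuples_def)
    have "x = comb M {..<n} h a"
      unfolding c(2) comb_def by (rule M.finsum_cong') (use a comb_terms_closed[OF H t] in auto)
    then show ?thesis using t by blast
  qed
  then have "carrier M = comb M {..<n} h ` tuples {..<n} J" using comb_closed[OF H] by blast
  then show ?thesis unfolding presented_def using H by blast
qed

text \<open>\<open>presented\<close> refers to an ambient module, so replacing \<open>M\<close> by
  \<open>T\<close> requires every single image to lie in \<open>T\<close>. This is seen on tuples
  that vanish at all other indices.\<close>

lemma presented_submodule_as_module:
  assumes "presented M T"
  shows "presented (submodule_as_module M T) T"
proof -
  note T = presented_submodule[OF assms]
  obtain S :: "nat set" and J h where H: "homs_on M S J h" and TT: "T = comb M S h ` tuples S J"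
    using assms(1) unfolding presented_def by blast
  interpret T: hmodule "submodule_as_module M T" by (rule hmoduleI[OF module_submodule_as_module[OF module_axioms T]])
  have hT: "h i a \<in> T" if i: "i \<in> S" "a \<in> J i" for i a
  proof -
    let ?S = "S - {i}" and ?x = "\<lambda>k. if k = i then a else 0"
    have ins: "insert i ?S = S" using i by blast
    have H': "homs_on M ?S J h" by (rule homs_on_subset[OF H]) auto
    have x: "?x \<in> tuples S J" using i osub_0[OF homs_onD(2)[OF H]] by (auto simp: tuples_def)
    have "comb M S h ?x = h i a \<oplus> comb M ?S h ?x"
      using comb_insert[of i ?S J h ?x] H x unfolding ins by simp
    also have "comb M ?S h ?x = comb M ?S h (\<lambda>k. 0)"
      by (rule comb_cong[OF H', of "\<lambda>k. 0", symmetric]) (use tuples_zero[OF H'] in auto)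
    also have "\<dots> = \<zero>" by (rule comb_zero[OF H'])
    finally have "comb M S h ?x = h i a" using hahn_hom_closed[OF homs_onD(3)[OF H i(1)] i(2)] by simp
    then show ?thesis using x unfolding TT by (metis imageI)
  qed
  have H': "homs_on (submodule_as_module M T) S J h"
    using H hT by (auto simp: homs_on_def hahn_hom_def)
  have "comb (submodule_as_module M T) S h x = comb M S h x" if x: "x \<in> tuples S J" for x
  proof -
    have "finite S" using homs_onD(1)[OF H] .
    then have "homs_on M S J h \<Longrightarrow> homs_on (submodule_as_module M T) S J h \<Longrightarrow> x \<in> tuples S J \<Longrightarrow> ?thesis"
    proof (induction S rule: finite_induct)
      case (insert k S)
      have *: "homs_on M S J h" "homs_on (submodule_as_module M T) S J h" "x \<in> tuples S J"
        using homs_on_subset[OF insert.prems(1)] homs_on_subset[OF insert.prems(2)] insert.prems(3) by (auto simp: tuples_def)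
      show ?case
        using comb_insert[OF insert.prems(1,3) insert.hyps(2)] T.comb_insert[OF insert.prems(2,3) insert.hyps(2)]
          insert.IH[OF *] by simp
    qed simp
    then show ?thesis using H H' x by blast
  qed
  then have "T = comb (submodule_as_module M T) S h ` tuples S J" unfolding TT by (intro image_cong) auto
  then show ?thesis unfolding presented_def using H' by blast
qed

end

section \<open>Submodules, quotients and extensions of multibasic modules\<close>

lemma multibasic_module_module: "multibasic_module R M \<Longrightarrow> Module.module R M"
  by (simp add: multibasic_module_def)

lemma multibasic_submodule:
  assumes "multibasic_module hahn_ring M" "submodule N hahn_ring M"
  shows "multibasic_module hahn_ring (submodule_as_module M N)"
proof -
  interpret M: hmodule M by (rule hmoduleI[OF multibasic_module_module[OF assms(1)]])
  have "presented M N"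
    using M.presented_sub[OF M.presented_if_multibasic[OF assms(1)] assms(2)] M.submodule_facts(1)[OF assms(2)] .
  then have p: "presented (submodule_as_module M N) N" by (rule M.presented_submodule_as_module)
  interpret N: hmodule "submodule_as_module M N"
    by (rule hmoduleI[OF module_submodule_as_module[OF M.module_axioms assms(2)]])
  show ?thesis using N.multibasic_if_presented p by simp
qed

lemma multibasic_surjective_image:
  assumes M: "multibasic_module hahn_ring M" and N: "Module.module hahn_ring N"
    and f: "f \<in> module_homs hahn_ring M N" "f ` carrier M = carrier N"
  shows "multibasic_module hahn_ring N"
proof -
  interpret M: hmodule M by (rule hmoduleI[OF multibasic_module_module[OF M]])
  interpret N: hmodule N by (rule hmoduleI[OF N])
  show ?thesis
    using N.multibasic_if_presented presented_hom_image[OF M.module_axioms N f(1) M.presented_if_multibasic[OF M]] f(2)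
    by simp
qed

lemma multibasic_quotient:
  assumes "multibasic_module hahn_ring M" "submodule N hahn_ring M"
  shows "multibasic_module hahn_ring (quotient_module M N)"
  using multibasic_surjective_image[OF assms(1)] module_quotient quotient_hom quotient_surj
    multibasic_module_module[OF assms(1)] assms(2) by blast

lemma multibasic_extension:
  assumes se: "short_exact hahn_ring X f Y g Z"
    and "multibasic_module hahn_ring X" "multibasic_module hahn_ring Z"
  shows "multibasic_module hahn_ring Y"
proof -
  interpret X: hmodule X by (rule hmoduleI[OF multibasic_module_module[OF assms(2)]])
  interpret Z: hmodule Z by (rule hmoduleI[OF multibasic_module_module[OF assms(3)]])
  interpret Y: hmodule Y by (rule hmoduleI) (use se in \<open>simp add: short_exact_def\<close>)
  show ?thesis
    by (rule Y.multibasic_if_presented[OF presented_extension[OF se X.presented_if_multibasic[OF assms(2)]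
      Z.presented_if_multibasic[OF assms(3)]]])
qed

section \<open>Flatness and torsion\<close>

locale tensor_setup = M: Module.module R M + X: Module.module R X
  for R :: "('a, 'r) ring_scheme" and M :: "('a, 'b) module" and X :: "('a, 'c) module"
begin

abbreviation "\<S> \<equiv> carrier M \<times> carrier X"
abbreviation "\<N> \<equiv> tensor_relations R M X"

lemma rel_add_left: "m \<in> carrier M \<Longrightarrow> m' \<in> carrier M \<Longrightarrow> x \<in> carrier X \<Longrightarrow>
    frag_of (m \<oplus>\<^bsub>M\<^esub> m', x) - frag_of (m, x) - frag_of (m', x) \<in> \<N>"
  unfolding tensor_relations_def by (rule generate.incl) blast

lemma rel_add_right: "m \<in> carrier M \<Longrightarrow> x \<in> carrier X \<Longrightarrow> x' \<in> carrier X \<Longrightarrow>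
    frag_of (m, x \<oplus>\<^bsub>X\<^esub> x') - frag_of (m, x) - frag_of (m, x') \<in> \<N>"
  unfolding tensor_relations_def by (rule generate.incl) blast

lemma rel_smult: "r \<in> carrier R \<Longrightarrow> m \<in> carrier M \<Longrightarrow> x \<in> carrier X \<Longrightarrow>
    frag_of (r \<odot>\<^bsub>M\<^esub> m, x) - frag_of (m, r \<odot>\<^bsub>X\<^esub> x) \<in> \<N>"
  unfolding tensor_relations_def by (rule generate.incl) blast

lemma rel_zero: "0 \<in> \<N>"
  using generate.one[of "free_Abelian_group \<S>"] unfolding tensor_relations_def by simp

lemma rel_add: "c \<in> \<N> \<Longrightarrow> d \<in> \<N> \<Longrightarrow> c + d \<in> \<N>"
  using generate.eng[of c "free_Abelian_group \<S>"] unfolding tensor_relations_def by simp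

text \<open>The cases for negatives and sums also supply bounds on supports, because homomorphisms
  out of the free abelian group are controlled only on combinations supported in its basis.\<close>

lemma rel_induct [consumes 1, case_names add_left add_right smult zero minus add]:
  assumes c: "c \<in> \<N>"
    and "\<And>m m' x. \<lbrakk>m \<in> carrier M; m' \<in> carrier M; x \<in> carrier X\<rbrakk> \<Longrightarrow>
      P (frag_of (m \<oplus>\<^bsub>M\<^esub> m', x) - frag_of (m, x) - frag_of (m', x))"
    and "\<And>m x x'. \<lbrakk>m \<in> carrier M; x \<in> carrier X; x' \<in> carrier X\<rbrakk> \<Longrightarrow>
      P (frag_of (m, x \<oplus>\<^bsub>X\<^esub> x') - frag_of (m, x) - frag_of (m, x'))"
    and "\<And>r m x. \<lbrakk>r \<in> carrier R; m \<in> carrier M; x \<in> carrier X\<rbrakk> \<Longrightarrow>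
      P (frag_of (r \<odot>\<^bsub>M\<^esub> m, x) - frag_of (m, r \<odot>\<^bsub>X\<^esub> x))"
    and zero: "P 0"
    and minus: "\<And>c. Poly_Mapping.keys c \<subseteq> \<S> \<Longrightarrow> P c \<Longrightarrow> P (- c)"
    and add: "\<And>c d. Poly_Mapping.keys c \<subseteq> \<S> \<Longrightarrow> Poly_Mapping.keys d \<subseteq> \<S> \<Longrightarrow> P c \<Longrightarrow> P d \<Longrightarrow> P (c + d)"
  shows "P c"
proof -
  have keys3: "Poly_Mapping.keys (frag_of p - frag_of q - frag_of s) \<subseteq> \<S>" if "p \<in> \<S>" "q \<in> \<S>" "s \<in> \<S>" for p q s
    using that keys_diff[of "frag_of p - frag_of q" "frag_of s"] keys_diff[of "frag_of p" "frag_of q"]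
    by (auto simp: keys_frag_of)
  have keys2: "Poly_Mapping.keys (frag_of p - frag_of q) \<subseteq> \<S>" if "p \<in> \<S>" "q \<in> \<S>" for p q
    using that keys_diff[of "frag_of p" "frag_of q"] by (auto simp: keys_frag_of)
  define B where "B = {frag_of (m \<oplus>\<^bsub>M\<^esub> m', x) - frag_of (m, x) - frag_of (m', x) | m m' x.
          m \<in> carrier M \<and> m' \<in> carrier M \<and> x \<in> carrier X} \<union>
       {frag_of (m, x \<oplus>\<^bsub>X\<^esub> x') - frag_of (m, x) - frag_of (m, x') | m x x'.
          m \<in> carrier M \<and> x \<in> carrier X \<and> x' \<in> carrier X} \<union>
       {frag_of (r \<odot>\<^bsub>M\<^esub> m, x) - frag_of (m, r \<odot>\<^bsub>X\<^esub> x) | r m x.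
          r \<in> carrier R \<and> m \<in> carrier M \<and> x \<in> carrier X}"
  have B: "Poly_Mapping.keys b \<subseteq> \<S> \<and> P b" if "b \<in> B" for b
    using that unfolding B_def
  proof (elim UnE CollectE exE conjE)
    fix m m' x assume "b = frag_of (m \<oplus>\<^bsub>M\<^esub> m', x) - frag_of (m, x) - frag_of (m', x)" "m \<in> carrier M" "m' \<in> carrier M" "x \<in> carrier X"
    then show ?thesis using assms(2)[of m m' x] keys3[of "(m \<oplus>\<^bsub>M\<^esub> m', x)" "(m, x)" "(m', x)"] by simp
  next
    fix m x x' assume "b = frag_of (m, x \<oplus>\<^bsub>X\<^esub> x') - frag_of (m, x) - frag_of (m, x')" "m \<in> carrier M" "x \<in> carrier X" "x' \<in> carrier X"
    then show ?thesis using assms(3)[of m x x'] keys3[of "(m, x \<oplus>\<^bsub>X\<^esub> x')" "(m, x)" "(m, x')"] by simp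
  next
    fix r m x assume "b = frag_of (r \<odot>\<^bsub>M\<^esub> m, x) - frag_of (m, r \<odot>\<^bsub>X\<^esub> x)" "r \<in> carrier R" "m \<in> carrier M" "x \<in> carrier X"
    then show ?thesis using assms(4)[of r m x] keys2[of "(r \<odot>\<^bsub>M\<^esub> m, x)" "(m, r \<odot>\<^bsub>X\<^esub> x)"] by simp
  qed
  have "c \<in> generate (free_Abelian_group \<S>) B" using c unfolding tensor_relations_def B_def .
  then have "Poly_Mapping.keys c \<subseteq> \<S> \<and> P c"
  proof (induction rule: generate.induct)
    case one
    then show ?case using zero by simp
  next
    case (incl h)
    then show ?case by (rule B)
  next
    case (inv h)
    then show ?case using B[OF inv] minus[of h] by (simp add: keys_minus)
  next
    case (eng h1 h2)
    then show ?case using add[of h1 h2] keys_add[of h1 h2] by auto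
  qed
  then show ?thesis by blast
qed

lemma rel_keys: "c \<in> \<N> \<Longrightarrow> Poly_Mapping.keys c \<subseteq> \<S>"
proof (induction rule: rel_induct)
  case (add_left m m' x)
  then show ?case using keys_diff[of "frag_of (m \<oplus>\<^bsub>M\<^esub> m', x) - frag_of (m, x)" "frag_of (m', x)"]
      keys_diff[of "frag_of (m \<oplus>\<^bsub>M\<^esub> m', x)" "frag_of (m, x)"] by (auto simp: keys_frag_of dest!: subsetD)
next
  case (add_right m x x')
  then show ?case using keys_diff[of "frag_of (m, x \<oplus>\<^bsub>X\<^esub> x') - frag_of (m, x)" "frag_of (m, x')"]
      keys_diff[of "frag_of (m, x \<oplus>\<^bsub>X\<^esub> x')" "frag_of (m, x)"] by (auto simp: keys_frag_of dest!: subsetD)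
next
  case (smult r m x)
  then show ?case using keys_diff[of "frag_of (r \<odot>\<^bsub>M\<^esub> m, x)" "frag_of (m, r \<odot>\<^bsub>X\<^esub> x)"]
    by (auto simp: keys_frag_of dest!: subsetD)
next
  case (add c d)
  then show ?case using keys_add[of c d] by blast
qed (simp_all add: keys_minus)

lemma rel_minus: "c \<in> \<N> \<Longrightarrow> - c \<in> \<N>"
proof -
  assume c: "c \<in> \<N>"
  have neg: "- b \<in> \<N>" if "b \<in> B" "\<N> = generate (free_Abelian_group \<S>) B" "Poly_Mapping.keys b \<subseteq> \<S>" for b B
    using generate.inv[OF that(1), of "free_Abelian_group \<S>"] that(2,3) by simp
  have "c \<in> \<N> \<and> - c \<in> \<N>"
    using c
  proof (induction rule: rel_induct)
    case (add_left m m' x)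
    note in_N = rel_add_left[OF add_left]
    show ?case by (rule conjI[OF in_N], rule neg[OF _ tensor_relations_def rel_keys[OF in_N]]) (use add_left in blast)
  next
    case (add_right m x x')
    note in_N = rel_add_right[OF add_right]
    show ?case by (rule conjI[OF in_N], rule neg[OF _ tensor_relations_def rel_keys[OF in_N]]) (use add_right in blast)
  next
    case (smult r m x)
    note in_N = rel_smult[OF smult]
    show ?case by (rule conjI[OF in_N], rule neg[OF _ tensor_relations_def rel_keys[OF in_N]]) (use smult in blast)
  next
    case (add c d)
    then show ?case using rel_add[of c d] rel_add[of "- c" "- d"] by simp
  qed (simp_all add: rel_zero)
  then show ?thesis by blast
qed

lemma rel_diff: "c \<in> \<N> \<Longrightarrow> d \<in> \<N> \<Longrightarrow> c - d \<in> \<N>"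
  using rel_add[of c "- d"] rel_minus[of d] by simp

lemma rel_cong_trans: "c - d \<in> \<N> \<Longrightarrow> d - e \<in> \<N> \<Longrightarrow> c - e \<in> \<N>"
  using rel_add[of "c - d" "d - e"] by simp

lemma coset_eq_iff:
  "\<N> #>\<^bsub>free_Abelian_group \<S>\<^esub> c = \<N> #>\<^bsub>free_Abelian_group \<S>\<^esub> d \<longleftrightarrow> c - d \<in> \<N>"
proof
  assume eq: "\<N> #>\<^bsub>free_Abelian_group \<S>\<^esub> c = \<N> #>\<^bsub>free_Abelian_group \<S>\<^esub> d"
  have "0 + c \<in> \<N> #>\<^bsub>free_Abelian_group \<S>\<^esub> c" using rel_zero by (force simp: r_coset_def)
  then have "c \<in> \<N> #>\<^bsub>free_Abelian_group \<S>\<^esub> d" unfolding eq by simp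
  then obtain n where "n \<in> \<N>" "c = n + d" by (auto simp: r_coset_def)
  then show "c - d \<in> \<N>" by simp
next
  have sub: "\<N> #>\<^bsub>free_Abelian_group \<S>\<^esub> c \<subseteq> \<N> #>\<^bsub>free_Abelian_group \<S>\<^esub> d" if cd: "c - d \<in> \<N>" for c d
  proof
    fix y assume "y \<in> \<N> #>\<^bsub>free_Abelian_group \<S>\<^esub> c"
    then obtain n where n: "n \<in> \<N>" "y = n + c" by (auto simp: r_coset_def)
    then have "y = (n + (c - d)) + d" by simp
    then show "y \<in> \<N> #>\<^bsub>free_Abelian_group \<S>\<^esub> d" using rel_add[OF n(1) cd] by (auto simp: r_coset_def intro!: bexI[of _ "n + (c - d)"])
  qed
  assume "c - d \<in> \<N>"
  moreover from rel_minus[OF this] have "d - c \<in> \<N>" by simp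
  ultimately show "\<N> #>\<^bsub>free_Abelian_group \<S>\<^esub> c = \<N> #>\<^bsub>free_Abelian_group \<S>\<^esub> d"
    using sub by blast
qed

lemma tensor_product_elem:
  "C \<in> carrier (tensor_product R M X) \<longleftrightarrow>
    (\<exists>c. Poly_Mapping.keys c \<subseteq> \<S> \<and> C = \<N> #>\<^bsub>free_Abelian_group \<S>\<^esub> c)"
  by (simp only: tensor_product_def FactGroup_def RCOSETS_def partial_object.select_convs UN_iff
      singleton_iff Bex_def carrier_free_Abelian_group_iff)

end

text \<open>The homomorphism on the free abelian group over \<open>S\<close> that extends
  \<open>\<psi>\<close>, expressed in the arithmetic of finitely supported functions instead of the
  group record.\<close>

definition free_hom :: "'p set \<Rightarrow> ('a, 'c) module \<Rightarrow> ('p \<Rightarrow> 'c) \<Rightarrow> (('p \<Rightarrow>\<^sub>0 int) \<Rightarrow> 'c) \<Rightarrow> bool" where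
  "free_hom S Y \<psi> \<Phi> \<longleftrightarrow> (\<forall>c. Poly_Mapping.keys c \<subseteq> S \<longrightarrow> \<Phi> c \<in> carrier Y) \<and> \<Phi> 0 = \<zero>\<^bsub>Y\<^esub> \<and>
    (\<forall>c d. Poly_Mapping.keys c \<subseteq> S \<longrightarrow> Poly_Mapping.keys d \<subseteq> S \<longrightarrow> \<Phi> (c + d) = \<Phi> c \<oplus>\<^bsub>Y\<^esub> \<Phi> d) \<and>
    (\<forall>c. Poly_Mapping.keys c \<subseteq> S \<longrightarrow> \<Phi> (- c) = \<ominus>\<^bsub>Y\<^esub> \<Phi> c) \<and>
    (\<forall>p\<in>S. \<Phi> (frag_of p) = \<psi> p)"

lemma
  assumes "free_hom S Y \<psi> \<Phi>"
  shows free_hom_closed: "Poly_Mapping.keys c \<subseteq> S \<Longrightarrow> \<Phi> c \<in> carrier Y"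
    and free_hom_zero: "\<Phi> 0 = \<zero>\<^bsub>Y\<^esub>"
    and free_hom_add: "Poly_Mapping.keys c \<subseteq> S \<Longrightarrow> Poly_Mapping.keys d \<subseteq> S \<Longrightarrow> \<Phi> (c + d) = \<Phi> c \<oplus>\<^bsub>Y\<^esub> \<Phi> d"
    and free_hom_minus: "Poly_Mapping.keys c \<subseteq> S \<Longrightarrow> \<Phi> (- c) = \<ominus>\<^bsub>Y\<^esub> \<Phi> c"
    and free_hom_of: "p \<in> S \<Longrightarrow> \<Phi> (frag_of p) = \<psi> p"
  using assms unfolding free_hom_def by blast+

lemma free_hom_diff:
  assumes "free_hom S Y \<psi> \<Phi>" "Poly_Mapping.keys c \<subseteq> S" "Poly_Mapping.keys d \<subseteq> S"
  shows "\<Phi> (c - d) = \<Phi> c \<oplus>\<^bsub>Y\<^esub> \<ominus>\<^bsub>Y\<^esub> \<Phi> d"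
  using free_hom_add[OF assms(1,2), of "- d"] free_hom_minus[OF assms(1,3)] assms(3) by (simp add: keys_minus)

lemma free_hom_exists:
  assumes Y: "Module.module R Y" and \<psi>: "\<And>p. p \<in> S \<Longrightarrow> \<psi> p \<in> carrier Y"
  shows "\<exists>\<Phi>. free_hom S Y \<psi> \<Phi>"
proof -
  interpret Y: Module.module R Y by fact
  have "\<psi> ` S \<subseteq> carrier (add_monoid Y)" using \<psi> by auto
  then obtain \<Phi> where h: "\<Phi> \<in> hom (free_Abelian_group S) (add_monoid Y)" and of: "\<And>x. x \<in> S \<Longrightarrow> \<Phi> (frag_of x) = \<psi> x"
    using comm_group.free_Abelian_group_universal[OF Y.M.a_comm_group] by metis
  interpret h: group_hom "free_Abelian_group S" "add_monoid Y" \<Phi>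
    using h by (intro group_hom.intro group_free_Abelian_group Y.M.a_group group_hom_axioms.intro)
  have cl: "\<Phi> c \<in> carrier Y" if "Poly_Mapping.keys c \<subseteq> S" for c using h.hom_closed[of c] that by simp
  have ad: "\<Phi> (c + d) = \<Phi> c \<oplus>\<^bsub>Y\<^esub> \<Phi> d" if "Poly_Mapping.keys c \<subseteq> S" "Poly_Mapping.keys d \<subseteq> S" for c d
    using h.hom_mult[of c d] that by simp
  have z: "\<Phi> 0 = \<zero>\<^bsub>Y\<^esub>" using h.hom_one by simp
  have "\<Phi> (- c) = \<ominus>\<^bsub>Y\<^esub> \<Phi> c" if k: "Poly_Mapping.keys c \<subseteq> S" for c
  proof -
    have k': "Poly_Mapping.keys (- c) \<subseteq> S" using k by (simp add: keys_minus)
    have "\<Phi> (- c) \<oplus>\<^bsub>Y\<^esub> \<Phi> c = \<zero>\<^bsub>Y\<^esub>" using ad[OF k' k] z by simp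
    then show ?thesis using Y.minus_equality[of "\<Phi> (- c)" "\<Phi> c"] cl[OF k] cl[OF k'] by simp
  qed
  then show ?thesis using cl ad z of unfolding free_hom_def by blast
qed

text \<open>A relation involves only finitely many elements of \<open>M\<close>, so it is respected by every map that is
  linear on a set containing these.\<close>

definition linear_on :: "('a, 'r) ring_scheme \<Rightarrow> ('a, 'b) module \<Rightarrow> 'b set \<Rightarrow> ('b \<Rightarrow> 'a) \<Rightarrow> bool" where
  "linear_on R M T l \<longleftrightarrow> (\<forall>m\<in>T. l m \<in> carrier R) \<and>
    (\<forall>m\<in>T. \<forall>m'\<in>T. m \<oplus>\<^bsub>M\<^esub> m' \<in> T \<longrightarrow> l (m \<oplus>\<^bsub>M\<^esub> m') = l m \<oplus>\<^bsub>R\<^esub> l m') \<and>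
    (\<forall>r\<in>carrier R. \<forall>m\<in>T. r \<odot>\<^bsub>M\<^esub> m \<in> T \<longrightarrow> l (r \<odot>\<^bsub>M\<^esub> m) = r \<otimes>\<^bsub>R\<^esub> l m)"

context tensor_setup
begin

text \<open>\<open>T\<close> collects the elements of \<open>M\<close> that occur in the defining
  relations making up \<open>c\<close>. It depends on \<open>c\<close> alone, so M' and its
  coordinates can be chosen afterwards.\<close>

lemma rel_finite_support:
  assumes "c \<in> \<N>"
  shows "\<exists>T. finite T \<and> T \<subseteq> carrier M \<and> (\<forall>M' l \<psi> \<Phi>. T \<subseteq> M' \<longrightarrow> linear_on R M M' l \<longrightarrow>
    free_hom \<S> X \<psi> \<Phi> \<longrightarrow> (\<forall>m\<in>M'. \<forall>x\<in>carrier X. \<psi> (m, x) = l m \<odot>\<^bsub>X\<^esub> x) \<longrightarrow> \<Phi> c = \<zero>\<^bsub>X\<^esub>)"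
  using assms
proof (induction rule: rel_induct)
  case (add_left m m' x)
  show ?case
  proof (intro exI[of _ "{m, m', m \<oplus>\<^bsub>M\<^esub> m'}"] conjI allI impI)
    fix M' l \<psi> \<Phi> assume T: "{m, m', m \<oplus>\<^bsub>M\<^esub> m'} \<subseteq> M'" and l: "linear_on R M M' l" and F: "free_hom \<S> X \<psi> \<Phi>"
      and \<psi>: "\<forall>m\<in>M'. \<forall>x\<in>carrier X. \<psi> (m, x) = l m \<odot>\<^bsub>X\<^esub> x"
    have k: "Poly_Mapping.keys (frag_of (m \<oplus>\<^bsub>M\<^esub> m', x)) \<subseteq> \<S>" "Poly_Mapping.keys (frag_of (m, x)) \<subseteq> \<S>"
      "Poly_Mapping.keys (frag_of (m', x)) \<subseteq> \<S>" using add_left by auto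
    then have k2: "Poly_Mapping.keys (frag_of (m \<oplus>\<^bsub>M\<^esub> m', x) - frag_of (m, x)) \<subseteq> \<S>"
      using keys_diff[of "frag_of (m \<oplus>\<^bsub>M\<^esub> m', x)" "frag_of (m, x)"] by blast
    have lc: "l m \<in> carrier R" "l m' \<in> carrier R" "l (m \<oplus>\<^bsub>M\<^esub> m') = l m \<oplus>\<^bsub>R\<^esub> l m'"
      using l T unfolding linear_on_def by auto
    show "\<Phi> (frag_of (m \<oplus>\<^bsub>M\<^esub> m', x) - frag_of (m, x) - frag_of (m', x)) = \<zero>\<^bsub>X\<^esub>"
      using add_left T \<psi> lc unfolding free_hom_diff[OF F k2 k(3)] free_hom_diff[OF F k(1,2)]
      by (simp add: free_hom_of[OF F] X.smult_l_distr X.a_ac X.r_neg X.r_neg1 X.r_neg2)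
  qed (use add_left in auto)
next
  case (add_right m x x')
  show ?case
  proof (intro exI[of _ "{m}"] conjI allI impI)
    fix M' l \<psi> \<Phi> assume T: "{m} \<subseteq> M'" and l: "linear_on R M M' l" and F: "free_hom \<S> X \<psi> \<Phi>"
      and \<psi>: "\<forall>m\<in>M'. \<forall>x\<in>carrier X. \<psi> (m, x) = l m \<odot>\<^bsub>X\<^esub> x"
    have k: "Poly_Mapping.keys (frag_of (m, x \<oplus>\<^bsub>X\<^esub> x')) \<subseteq> \<S>" "Poly_Mapping.keys (frag_of (m, x)) \<subseteq> \<S>"
      "Poly_Mapping.keys (frag_of (m, x')) \<subseteq> \<S>" using add_right by auto
    then have k2: "Poly_Mapping.keys (frag_of (m, x \<oplus>\<^bsub>X\<^esub> x') - frag_of (m, x)) \<subseteq> \<S>"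
      using keys_diff[of "frag_of (m, x \<oplus>\<^bsub>X\<^esub> x')" "frag_of (m, x)"] by blast
    have lc: "l m \<in> carrier R" using l T unfolding linear_on_def by auto
    show "\<Phi> (frag_of (m, x \<oplus>\<^bsub>X\<^esub> x') - frag_of (m, x) - frag_of (m, x')) = \<zero>\<^bsub>X\<^esub>"
      using add_right T \<psi> lc unfolding free_hom_diff[OF F k2 k(3)] free_hom_diff[OF F k(1,2)]
      by (simp add: free_hom_of[OF F] X.smult_r_distr X.a_ac X.r_neg X.r_neg1 X.r_neg2)
  qed (use add_right in auto)
next
  case (smult r m x)
  show ?case
  proof (intro exI[of _ "{m, r \<odot>\<^bsub>M\<^esub> m}"] conjI allI impI)
    fix M' l \<psi> \<Phi> assume T: "{m, r \<odot>\<^bsub>M\<^esub> m} \<subseteq> M'" and l: "linear_on R M M' l" and F: "free_hom \<S> X \<psi> \<Phi>"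
      and \<psi>: "\<forall>m\<in>M'. \<forall>x\<in>carrier X. \<psi> (m, x) = l m \<odot>\<^bsub>X\<^esub> x"
    have k: "Poly_Mapping.keys (frag_of (r \<odot>\<^bsub>M\<^esub> m, x)) \<subseteq> \<S>" "Poly_Mapping.keys (frag_of (m, r \<odot>\<^bsub>X\<^esub> x)) \<subseteq> \<S>"
      using smult by auto
    have lc: "l m \<in> carrier R" "l (r \<odot>\<^bsub>M\<^esub> m) = r \<otimes>\<^bsub>R\<^esub> l m" using l T smult unfolding linear_on_def by auto
    have "(r \<otimes>\<^bsub>R\<^esub> l m) \<odot>\<^bsub>X\<^esub> x = l m \<odot>\<^bsub>X\<^esub> (r \<odot>\<^bsub>X\<^esub> x)"
      using lc smult by (simp add: X.smult_assoc1[symmetric] M.R.m_comm)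
    then show "\<Phi> (frag_of (r \<odot>\<^bsub>M\<^esub> m, x) - frag_of (m, r \<odot>\<^bsub>X\<^esub> x)) = \<zero>\<^bsub>X\<^esub>"
      using smult T \<psi> lc unfolding free_hom_diff[OF F k] by (simp add: free_hom_of[OF F] X.r_neg)
  qed (use smult in auto)
next
  case zero
  show ?case by (intro exI[of _ "{}"]) (auto intro: free_hom_zero)
next
  case (minus c)
  then obtain T where T: "finite T" "T \<subseteq> carrier M" "\<And>M' l \<psi> \<Phi>. T \<subseteq> M' \<Longrightarrow> linear_on R M M' l \<Longrightarrow>
    free_hom \<S> X \<psi> \<Phi> \<Longrightarrow> \<forall>m\<in>M'. \<forall>x\<in>carrier X. \<psi> (m, x) = l m \<odot>\<^bsub>X\<^esub> x \<Longrightarrow> \<Phi> c = \<zero>\<^bsub>X\<^esub>" by blast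
  have "\<Phi> (- c) = \<zero>\<^bsub>X\<^esub>" if "T \<subseteq> M'" "linear_on R M M' l" "free_hom \<S> X \<psi> \<Phi>"
    "\<forall>m\<in>M'. \<forall>x\<in>carrier X. \<psi> (m, x) = l m \<odot>\<^bsub>X\<^esub> x" for M' l \<psi> \<Phi>
    using T(3)[OF that] free_hom_minus[OF that(3) minus(1)] by simp
  then show ?case using T(1,2) by blast
next
  case (add c d)
  obtain T where T: "finite T" "T \<subseteq> carrier M" "\<And>M' l \<psi> \<Phi>. T \<subseteq> M' \<Longrightarrow> linear_on R M M' l \<Longrightarrow>
    free_hom \<S> X \<psi> \<Phi> \<Longrightarrow> \<forall>m\<in>M'. \<forall>x\<in>carrier X. \<psi> (m, x) = l m \<odot>\<^bsub>X\<^esub> x \<Longrightarrow> \<Phi> c = \<zero>\<^bsub>X\<^esub>" using add.IH(1) by blast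
  obtain U where U: "finite U" "U \<subseteq> carrier M" "\<And>M' l \<psi> \<Phi>. U \<subseteq> M' \<Longrightarrow> linear_on R M M' l \<Longrightarrow>
    free_hom \<S> X \<psi> \<Phi> \<Longrightarrow> \<forall>m\<in>M'. \<forall>x\<in>carrier X. \<psi> (m, x) = l m \<odot>\<^bsub>X\<^esub> x \<Longrightarrow> \<Phi> d = \<zero>\<^bsub>X\<^esub>" using add.IH(2) by blast
  have "\<Phi> (c + d) = \<zero>\<^bsub>X\<^esub>" if "T \<union> U \<subseteq> M'" "linear_on R M M' l" "free_hom \<S> X \<psi> \<Phi>"
    "\<forall>m\<in>M'. \<forall>x\<in>carrier X. \<psi> (m, x) = l m \<odot>\<^bsub>X\<^esub> x" for M' l \<psi> \<Phi>
    using T(3)[OF _ that(2-4)] U(3)[OF _ that(2-4)] that(1) free_hom_add[OF that(3) add.hyps(1,2)] by simp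
  then show ?case using T(1,2) U(1,2) by (intro exI[of _ "T \<union> U"]) blast
qed

lemma rel_zero_right: "m \<in> carrier M \<Longrightarrow> frag_of (m, \<zero>\<^bsub>X\<^esub>) \<in> \<N>"
  using rel_minus[OF rel_add_right[of m "\<zero>\<^bsub>X\<^esub>" "\<zero>\<^bsub>X\<^esub>"]] by simp

lemma rel_zero_left: "x \<in> carrier X \<Longrightarrow> frag_of (\<zero>\<^bsub>M\<^esub>, x) \<in> \<N>"
  using rel_minus[OF rel_add_left[of "\<zero>\<^bsub>M\<^esub>" "\<zero>\<^bsub>M\<^esub>" x]] by simp

lemma rel_minus_right: "m \<in> carrier M \<Longrightarrow> x \<in> carrier X \<Longrightarrow> frag_of (m, \<ominus>\<^bsub>X\<^esub> x) + frag_of (m, x) \<in> \<N>"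
  using rel_diff[OF rel_zero_right rel_add_right[of m "\<ominus>\<^bsub>X\<^esub> x" x], of m] by (simp add: X.l_neg algebra_simps)

lemma rel_sum_left:
  assumes "finite S" "\<And>i. i \<in> S \<Longrightarrow> u i \<in> carrier M" "x \<in> carrier X"
  shows "frag_of (\<Oplus>\<^bsub>M\<^esub>i\<in>S. u i, x) - (\<Sum>i\<in>S. frag_of (u i, x)) \<in> \<N>"
  using assms
proof (induction S rule: finite_induct)
  case empty
  then show ?case by (simp add: rel_zero_left)
next
  case (insert k S)
  have c: "u k \<in> carrier M" "(\<Oplus>\<^bsub>M\<^esub>i\<in>S. u i) \<in> carrier M" using insert.prems by (auto intro!: M.finsum_closed)
  have "frag_of (u k \<oplus>\<^bsub>M\<^esub> (\<Oplus>\<^bsub>M\<^esub>i\<in>S. u i), x) - frag_of (u k, x) - frag_of (\<Oplus>\<^bsub>M\<^esub>i\<in>S. u i, x)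
    + (frag_of (\<Oplus>\<^bsub>M\<^esub>i\<in>S. u i, x) - (\<Sum>i\<in>S. frag_of (u i, x))) \<in> \<N>"
    by (rule rel_add[OF rel_add_left insert.IH]) (use c insert.prems in auto)
  moreover have "(\<Oplus>\<^bsub>M\<^esub>i\<in>insert k S. u i) = u k \<oplus>\<^bsub>M\<^esub> (\<Oplus>\<^bsub>M\<^esub>i\<in>S. u i)"
    using insert by (intro M.finsum_insert) auto
  ultimately show ?case using insert.hyps by (simp add: algebra_simps)
qed

lemma rel_sum: "(\<And>i. i \<in> S \<Longrightarrow> c i \<in> \<N>) \<Longrightarrow> (\<Sum>i\<in>S. c i) \<in> \<N>"
  by (induction S rule: infinite_finite_induct) (auto simp: rel_zero rel_add)

text \<open>Every pair (m, x) expands through the coordinates of \<open>m\<close>, so a tensor with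
  left components in M' is determined by its coordinates \<open>\<Phi> i c\<close> in
  \<open>X\<close>, and vanishes when they do.\<close>

lemma tensor_coordinates:
  assumes S: "finite S" and M': "M' \<subseteq> carrier M" and e: "\<And>i. i \<in> S \<Longrightarrow> e i \<in> carrier M"
    and l: "\<And>i. i \<in> S \<Longrightarrow> linear_on R M M' (l i)"
    and exp: "\<And>m. m \<in> M' \<Longrightarrow> m = (\<Oplus>\<^bsub>M\<^esub>i\<in>S. l i m \<odot>\<^bsub>M\<^esub> e i)"
    and F: "\<And>i. i \<in> S \<Longrightarrow> free_hom \<S> X (\<psi> i) (\<Phi> i)"
    and \<psi>: "\<And>i m x. i \<in> S \<Longrightarrow> m \<in> M' \<Longrightarrow> x \<in> carrier X \<Longrightarrow> \<psi> i (m, x) = l i m \<odot>\<^bsub>X\<^esub> x"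
    and c: "Poly_Mapping.keys c \<subseteq> M' \<times> carrier X"
  shows "c - (\<Sum>i\<in>S. frag_of (e i, \<Phi> i c)) \<in> \<N>"
  using c
proof (induction c rule: free_Abelian_group_induct[consumes 1, case_names zero diff single])
  case zero
  have "(\<Sum>i\<in>S. frag_of (e i, \<Phi> i 0)) \<in> \<N>"
  proof (rule rel_sum)
    show "frag_of (e i, \<Phi> i 0) \<in> \<N>" if "i \<in> S" for i
      using rel_zero_right[OF e[OF that]] free_hom_zero[OF F[OF that]] by simp
  qed
  then show ?case using rel_minus by fastforce
next
  case (diff c d)
  have k: "Poly_Mapping.keys c \<subseteq> \<S>" "Poly_Mapping.keys d \<subseteq> \<S>" using diff(1,2) M' by auto
  have part: "frag_of (e i, \<Phi> i (c - d)) - frag_of (e i, \<Phi> i c) + frag_of (e i, \<Phi> i d) \<in> \<N>" if i: "i \<in> S" for i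
  proof -
    have cl: "\<Phi> i c \<in> carrier X" "\<Phi> i d \<in> carrier X" using free_hom_closed[OF F[OF i]] k by auto
    have "(frag_of (e i, \<Phi> i c \<oplus>\<^bsub>X\<^esub> \<ominus>\<^bsub>X\<^esub> \<Phi> i d) - frag_of (e i, \<Phi> i c) - frag_of (e i, \<ominus>\<^bsub>X\<^esub> \<Phi> i d))
      + (frag_of (e i, \<ominus>\<^bsub>X\<^esub> \<Phi> i d) + frag_of (e i, \<Phi> i d)) \<in> \<N>"
      by (rule rel_add[OF rel_add_right rel_minus_right]) (use cl e i in auto)
    then show ?thesis by (simp add: free_hom_diff[OF F[OF i] k])
  qed
  have "(c - (\<Sum>i\<in>S. frag_of (e i, \<Phi> i c))) - (d - (\<Sum>i\<in>S. frag_of (e i, \<Phi> i d)))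
    - (\<Sum>i\<in>S. frag_of (e i, \<Phi> i (c - d)) - frag_of (e i, \<Phi> i c) + frag_of (e i, \<Phi> i d)) \<in> \<N>"
    by (rule rel_diff[OF rel_diff[OF diff(3,4)] rel_sum[OF part]])
  then show ?case by (simp add: sum.distrib sum_subtractf algebra_simps)
next
  case (single p)
  then obtain m x where p: "p = (m, x)" "m \<in> M'" "x \<in> carrier X" by auto
  have lc: "l i m \<in> carrier R" if "i \<in> S" for i using l[OF that] p unfolding linear_on_def by blast
  have "frag_of (m, x) - (\<Sum>i\<in>S. frag_of (l i m \<odot>\<^bsub>M\<^esub> e i, x)) \<in> \<N>"
    by (subst exp[OF p(2)], rule rel_sum_left[OF S]) (use lc e p in auto)
  moreover have "(\<Sum>i\<in>S. frag_of (l i m \<odot>\<^bsub>M\<^esub> e i, x) - frag_of (e i, l i m \<odot>\<^bsub>X\<^esub> x)) \<in> \<N>"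
    by (rule rel_sum) (use lc e p rel_smult in auto)
  ultimately have "frag_of (m, x) - (\<Sum>i\<in>S. frag_of (e i, l i m \<odot>\<^bsub>X\<^esub> x)) \<in> \<N>"
    unfolding sum_subtractf by (rule rel_cong_trans)
  moreover have "\<Phi> i (frag_of p) = l i m \<odot>\<^bsub>X\<^esub> x" if "i \<in> S" for i
    using free_hom_of[OF F[OF that], of p] \<psi>[OF that p(2,3)] p M' by auto
  ultimately show ?case using p by simp
qed

end

section \<open>Maps induced on tensor products\<close>

locale tensor_map_setup = X: tensor_setup R M X + Y: tensor_setup R M Y
  for R :: "('a, 'r) ring_scheme" and M :: "('a, 'b) module" and X :: "('a, 'c) module" and Y :: "('a, 'd) module" +
  fixes f assumes f: "f \<in> module_homs R X Y"
begin

abbreviation F where "F \<equiv> frag_extend (\<lambda>(m, x). frag_of (m, f x))"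

lemma F_rel: "c \<in> X.\<N> \<Longrightarrow> F c \<in> Y.\<N>"
proof (induction rule: X.rel_induct)
  case (add_left m m' x)
  then show ?case using Y.rel_add_left hom_closed[OF f] by (simp add: frag_extend_diff)
next
  case (add_right m x x')
  then show ?case using Y.rel_add_right hom_closed[OF f] by (simp add: frag_extend_diff hom_add[OF f])
next
  case (smult r m x)
  then show ?case using Y.rel_smult hom_closed[OF f] by (simp add: frag_extend_diff hom_smult[OF f])
qed (simp_all add: Y.rel_zero frag_extend_minus frag_extend_add Y.rel_minus Y.rel_add)

lemma F_keys: "Poly_Mapping.keys c \<subseteq> X.\<S> \<Longrightarrow> Poly_Mapping.keys (F c) \<subseteq> Y.\<S>"
proof
  fix p assume k: "Poly_Mapping.keys c \<subseteq> X.\<S>" and "p \<in> Poly_Mapping.keys (F c)"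
  then obtain q where q: "q \<in> Poly_Mapping.keys c" "p \<in> Poly_Mapping.keys ((\<lambda>(m, x). frag_of (m, f x)) q)"
    using keys_frag_extend[of "\<lambda>(m, x). frag_of (m, f x)" c] by blast
  then obtain m x where "q = (m, x)" "m \<in> carrier M" "x \<in> carrier X" using k by blast
  then show "p \<in> Y.\<S>" using q(2) hom_closed[OF f] by (simp add: keys_frag_of)
qed

lemma tensor_map_coset:
  assumes "Poly_Mapping.keys c \<subseteq> X.\<S>"
  shows "tensor_map R M Y f (X.\<N> #>\<^bsub>free_Abelian_group X.\<S>\<^esub> c) = Y.\<N> #>\<^bsub>free_Abelian_group Y.\<S>\<^esub> F c"
proof -
  have eq: "Y.\<N> #>\<^bsub>free_Abelian_group Y.\<S>\<^esub> F d = Y.\<N> #>\<^bsub>free_Abelian_group Y.\<S>\<^esub> F c"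
    if d: "d \<in> X.\<N> #>\<^bsub>free_Abelian_group X.\<S>\<^esub> c" for d
  proof -
    obtain n where n: "n \<in> X.\<N>" "d = n + c" using d by (auto simp: r_coset_def)
    then show ?thesis using F_rel[OF n(1)] unfolding Y.coset_eq_iff by (simp add: frag_extend_add)
  qed
  have c: "c \<in> X.\<N> #>\<^bsub>free_Abelian_group X.\<S>\<^esub> c" using X.rel_zero by (force simp: r_coset_def)
  have "(\<lambda>c. Y.\<N> #>\<^bsub>free_Abelian_group Y.\<S>\<^esub> F c) ` (X.\<N> #>\<^bsub>free_Abelian_group X.\<S>\<^esub> c)
    = {Y.\<N> #>\<^bsub>free_Abelian_group Y.\<S>\<^esub> F c}"
  proof (rule subset_antisym)
    show "(\<lambda>c. Y.\<N> #>\<^bsub>free_Abelian_group Y.\<S>\<^esub> F c) ` (X.\<N> #>\<^bsub>free_Abelian_group X.\<S>\<^esub> c)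
      \<subseteq> {Y.\<N> #>\<^bsub>free_Abelian_group Y.\<S>\<^esub> F c}"
    proof (rule image_subsetI)
      fix d assume "d \<in> X.\<N> #>\<^bsub>free_Abelian_group X.\<S>\<^esub> c"
      from eq[OF this] show "Y.\<N> #>\<^bsub>free_Abelian_group Y.\<S>\<^esub> F d \<in> {Y.\<N> #>\<^bsub>free_Abelian_group Y.\<S>\<^esub> F c}"
        by (rule ssubst) (rule singletonI)
    qed
    show "{Y.\<N> #>\<^bsub>free_Abelian_group Y.\<S>\<^esub> F c}
      \<subseteq> (\<lambda>c. Y.\<N> #>\<^bsub>free_Abelian_group Y.\<S>\<^esub> F c) ` (X.\<N> #>\<^bsub>free_Abelian_group X.\<S>\<^esub> c)"
      by (rule subsetI, erule singletonE, erule ssubst, rule imageI, rule c)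
  qed
  then show ?thesis unfolding tensor_map_def by simp
qed

lemma inj_tensor_map:
  assumes "\<And>d. Poly_Mapping.keys d \<subseteq> X.\<S> \<Longrightarrow> F d \<in> Y.\<N> \<Longrightarrow> d \<in> X.\<N>"
  shows "inj_on (tensor_map R M Y f) (carrier (tensor_product R M X))"
proof (rule inj_onI)
  fix C D assume "C \<in> carrier (tensor_product R M X)" "D \<in> carrier (tensor_product R M X)"
    and eq: "tensor_map R M Y f C = tensor_map R M Y f D"
  then obtain c d where c: "Poly_Mapping.keys c \<subseteq> X.\<S>" "C = X.\<N> #>\<^bsub>free_Abelian_group X.\<S>\<^esub> c"
    and d: "Poly_Mapping.keys d \<subseteq> X.\<S>" "D = X.\<N> #>\<^bsub>free_Abelian_group X.\<S>\<^esub> d"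
    unfolding X.tensor_product_elem by blast
  have "F c - F d \<in> Y.\<N>"
    using eq unfolding c(2) d(2) tensor_map_coset[OF c(1)] tensor_map_coset[OF d(1)] Y.coset_eq_iff .
  then have "F (c - d) \<in> Y.\<N>" by (simp add: frag_extend_diff)
  then have "c - d \<in> X.\<N>" using c(1) d(1) keys_diff[of c d] by (intro assms) auto
  then show "C = D" unfolding c(2) d(2) X.coset_eq_iff .
qed

end

text \<open>If the image of \<open>d\<close> is a relation, the finitely many elements of
  \<open>M\<close> involved in it and in \<open>d\<close> lie in a set with coordinates. The
  coordinates of the image vanish and are the images under \<open>f\<close> of those of
  \<open>d\<close>; as \<open>f\<close> is injective, the latter vanish, and \<open>d\<close> is
  zero in the tensor product.\<close>

lemma flat_if_locally_free:
  fixes M :: "('a, 'b) module"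
  assumes M: "Module.module R M"
    and loc: "\<And>T. finite T \<Longrightarrow> T \<subseteq> carrier M \<Longrightarrow> \<exists>(S :: 'i set) e l M'. finite S \<and> T \<subseteq> M' \<and> M' \<subseteq> carrier M \<and>
      (\<forall>i\<in>S. e i \<in> carrier M \<and> linear_on R M M' (l i)) \<and> (\<forall>m\<in>M'. m = (\<Oplus>\<^bsub>M\<^esub>i\<in>S. l i m \<odot>\<^bsub>M\<^esub> e i))"
  shows "flat_module TYPE('v) R M"
  unfolding flat_module_def
proof (intro conjI allI impI M)
  fix X Y :: "('a, 'v) module" and f
  assume "Module.module R X \<and> Module.module R Y \<and> f \<in> module_homs R X Y \<and> inj_on f (carrier X)"
  then have X: "Module.module R X" and Y: "Module.module R Y" and f: "f \<in> module_homs R X Y"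
    and inj: "inj_on f (carrier X)" by auto
  interpret tensor_map_setup R M X Y f
    by (intro tensor_map_setup.intro tensor_setup.intro M X Y tensor_map_setup_axioms.intro f)
  show "inj_on (tensor_map R M Y f) (carrier (tensor_product R M X))"
  proof (rule inj_tensor_map)
    fix d assume d: "Poly_Mapping.keys d \<subseteq> X.\<S>" and Fd: "F d \<in> Y.\<N>"
    obtain T where T: "finite T" "T \<subseteq> carrier M" and ker: "\<And>M' l \<psi> \<Phi>. T \<subseteq> M' \<Longrightarrow> linear_on R M M' l \<Longrightarrow>
      free_hom Y.\<S> Y \<psi> \<Phi> \<Longrightarrow> \<forall>m\<in>M'. \<forall>x\<in>carrier Y. \<psi> (m, x) = l m \<odot>\<^bsub>Y\<^esub> x \<Longrightarrow> \<Phi> (F d) = \<zero>\<^bsub>Y\<^esub>"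
      using Y.rel_finite_support[OF Fd] by blast
    have "finite (T \<union> fst ` Poly_Mapping.keys d)" "T \<union> fst ` Poly_Mapping.keys d \<subseteq> carrier M" using T d by auto
    from loc[OF this] obtain S :: "'i set" and e l M' where S: "finite S" and TM: "T \<union> fst ` Poly_Mapping.keys d \<subseteq> M'"
      and M': "M' \<subseteq> carrier M" and e: "\<And>i. i \<in> S \<Longrightarrow> e i \<in> carrier M" and l: "\<And>i. i \<in> S \<Longrightarrow> linear_on R M M' (l i)"
      and exp: "\<And>m. m \<in> M' \<Longrightarrow> m = (\<Oplus>\<^bsub>M\<^esub>i\<in>S. l i m \<odot>\<^bsub>M\<^esub> e i)" by blast
    have lc: "l i m \<in> carrier R" if "i \<in> S" "m \<in> M'" for i m using l[OF that(1)] that(2) unfolding linear_on_def by blast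
    \<comment> \<open>Off M' there are no coordinates; the value 0 used there is respected by
      \<open>f\<close>, as the comparison of the two coordinate maps requires.\<close>
    define \<psi> where "\<psi> Z i p = (if fst p \<in> M' then l i (fst p) \<odot>\<^bsub>Z\<^esub> snd p else \<zero>\<^bsub>Z\<^esub>)" for Z :: "('a, 'v) module" and i and p :: "'b \<times> 'v"
    have "\<exists>\<Phi>. free_hom X.\<S> X (\<psi> X i) \<Phi>" if "i \<in> S" for i
      by (rule free_hom_exists[OF X]) (use lc[OF that] in \<open>auto simp: \<psi>_def\<close>)
    then obtain \<Phi> where P: "\<And>i. i \<in> S \<Longrightarrow> free_hom X.\<S> X (\<psi> X i) (\<Phi> i)" by metis
    have Q: "\<exists>\<Phi>. free_hom Y.\<S> Y (\<psi> Y i) \<Phi>" if "i \<in> S" for i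
      by (rule free_hom_exists[OF Y]) (use lc[OF that] in \<open>auto simp: \<psi>_def\<close>)
    have zero: "\<Phi> i d = \<zero>\<^bsub>X\<^esub>" if i: "i \<in> S" for i
    proof -
      obtain Q where Q: "free_hom Y.\<S> Y (\<psi> Y i) Q" using Q[OF i] by blast
      have "Q (F d) = \<zero>\<^bsub>Y\<^esub>" by (rule ker[OF _ l[OF i] Q]) (use TM in \<open>auto simp: \<psi>_def\<close>)
      moreover have "Q (F d) = f (\<Phi> i d)"
        using d
      proof (induction d rule: free_Abelian_group_induct[consumes 1, case_names zero diff single])
        case zero
        then show ?case using free_hom_zero[OF Q] free_hom_zero[OF P[OF i]] hom_zero[OF f X Y] by simp
      next
        case (diff a b)
        then show ?case
          using hom_add[OF f] hom_minus[OF f X Y] free_hom_closed[OF P[OF i]]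
          by (simp add: frag_extend_diff free_hom_diff[OF Q F_keys F_keys] free_hom_diff[OF P[OF i]])
      next
        case (single p)
        then show ?case
          using hom_closed[OF f] lc[OF i] hom_zero[OF f X Y]
          by (cases p) (auto simp: free_hom_of[OF Q] free_hom_of[OF P[OF i]] \<psi>_def hom_smult[OF f])
      qed
      ultimately show ?thesis
        using inj free_hom_closed[OF P[OF i] d] unfolding hom_inj_iff[OF f X Y] by metis
    qed
    have "d - (\<Sum>i\<in>S. frag_of (e i, \<Phi> i d)) \<in> X.\<N>"
    proof (rule X.tensor_coordinates[OF S M' e l exp P])
      show "Poly_Mapping.keys d \<subseteq> M' \<times> carrier X" using d TM by force
    qed (auto simp: \<psi>_def)
    moreover have "(\<Sum>i\<in>S. frag_of (e i, \<Phi> i d)) \<in> X.\<N>"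
      by (rule X.rel_sum) (use zero e X.rel_zero_right in auto)
    ultimately show "d \<in> X.\<N>" using X.rel_add by fastforce
  qed
qed

definition ring_as_module :: "('a, 'r) ring_scheme \<Rightarrow> ('a, 'a) module" where
  "ring_as_module R = \<lparr>carrier = carrier R, monoid.mult = mult R, one = one R, ring.zero = \<zero>\<^bsub>R\<^esub>,
    ring.add = add R, smult = mult R\<rparr>"

lemma ring_as_module_simps [simp]:
  "carrier (ring_as_module R) = carrier R" "\<zero>\<^bsub>ring_as_module R\<^esub> = \<zero>\<^bsub>R\<^esub>"
  "x \<oplus>\<^bsub>ring_as_module R\<^esub> y = x \<oplus>\<^bsub>R\<^esub> y" "r \<odot>\<^bsub>ring_as_module R\<^esub> x = r \<otimes>\<^bsub>R\<^esub> x"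
  by (simp_all add: ring_as_module_def)

lemma module_ring_as_module:
  assumes "cring R"
  shows "Module.module R (ring_as_module R)"
proof -
  interpret cring R by fact
  show ?thesis
  proof (rule moduleI[OF assms])
    show "abelian_group (ring_as_module R)"
    proof (rule abelian_groupI)
      show "\<exists>y\<in>carrier (ring_as_module R). y \<oplus>\<^bsub>ring_as_module R\<^esub> x = \<zero>\<^bsub>ring_as_module R\<^esub>"
        if "x \<in> carrier (ring_as_module R)" for x
        using that by (intro bexI[of _ "\<ominus>\<^bsub>R\<^esub> x"]) (auto simp: l_neg)
    qed (auto simp: a_ac)
  qed (auto simp: l_distr r_distr m_assoc)
qed

text \<open>Tensor \<open>M\<close> with multiplication by \<open>a\<close> on the ring, which is
  injective. The class of (m, 1) goes to that of (m, a), which equals that of (a m, 1) and is zero;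
  so (m, 1) is already zero, and evaluation (m, r) to r m gives m = 0. A copy of the ring in
  \<open>'v\<close> is used because flatness is tested on modules of that type.\<close>

lemma flat_torsion_free:
  fixes M :: "('a, 'b) module"
  assumes flat: "flat_module TYPE('v) R M" and small: "carrier R \<lesssim> (UNIV :: 'v set)"
    and a: "a \<in> carrier R" "\<And>r. r \<in> carrier R \<Longrightarrow> a \<otimes>\<^bsub>R\<^esub> r = \<zero>\<^bsub>R\<^esub> \<Longrightarrow> r = \<zero>\<^bsub>R\<^esub>"
    and m: "m \<in> carrier M" "a \<odot>\<^bsub>M\<^esub> m = \<zero>\<^bsub>M\<^esub>"
  shows "m = \<zero>\<^bsub>M\<^esub>"
proof -
  have M: "Module.module R M" using flat by (simp add: flat_module_def)
  interpret M: Module.module R M by fact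
  have R: "cring R" by (rule Module.module.axioms(1)[OF M])
  note RM = module_ring_as_module[OF R]
  obtain X :: "('a, 'v) module" and \<phi> where X: "Module.module R X" and \<phi>: "\<phi> \<in> module_homs R (ring_as_module R) X"
    and bij: "bij_betw \<phi> (carrier R) (carrier X)"
    using transport_module[OF RM, where 'u = 'v] small by auto
  interpret X: Module.module R X by fact
  define g where "g = inv_into (carrier R) \<phi>"
  have g: "g \<in> module_homs R X (ring_as_module R)" unfolding g_def using hom_inverse[OF \<phi> RM] bij by simp
  have g\<phi>: "g (\<phi> r) = r" if "r \<in> carrier R" for r
    unfolding g_def by (rule inv_into_f_f[OF bij_betw_imp_inj_on[OF bij] that])
  have ginj: "inj_on g (carrier X)" unfolding g_def by (rule inj_on_inv_into) (use bij in \<open>simp add: bij_betw_def\<close>)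
  define f where "f = (\<lambda>x. a \<odot>\<^bsub>X\<^esub> x)"
  have f: "f \<in> module_homs R X X"
    by (rule module_homsI) (use a(1) in \<open>auto simp: f_def X.smult_r_distr X.smult_assoc1[symmetric] M.R.m_comm\<close>)
  have finj: "inj_on f (carrier X)"
    unfolding hom_inj_iff[OF f X X]
  proof (intro ballI impI)
    fix x assume x: "x \<in> carrier X" "f x = \<zero>\<^bsub>X\<^esub>"
    then have "a \<otimes>\<^bsub>R\<^esub> g x = g \<zero>\<^bsub>X\<^esub>" using a(1) hom_smult[OF g a(1) x(1)] by (simp add: f_def)
    then have "g x = \<zero>\<^bsub>R\<^esub>" using a(2) hom_closed[OF g x(1)] hom_zero[OF g X RM] by simp
    then have "g x = g \<zero>\<^bsub>X\<^esub>" using hom_zero[OF g X RM] by simp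
    then show "x = \<zero>\<^bsub>X\<^esub>" using inj_onD[OF ginj _ x(1)] by simp
  qed
  interpret tensor_map_setup R M X X f
    by (intro tensor_map_setup.intro tensor_setup.intro M X tensor_map_setup_axioms.intro f)
  have inj: "inj_on (tensor_map R M X f) (carrier (tensor_product R M X))"
    using flat X f finj unfolding flat_module_def by blast
  let ?c = "frag_of (m, \<phi> \<one>\<^bsub>R\<^esub>)"
  have p1: "\<phi> \<one>\<^bsub>R\<^esub> \<in> carrier X" using hom_closed[OF \<phi>, of "\<one>\<^bsub>R\<^esub>"] by simp
  have k: "Poly_Mapping.keys ?c \<subseteq> X.\<S>" using m p1 by (simp add: keys_frag_of)
  have "frag_of (\<zero>\<^bsub>M\<^esub>, \<phi> \<one>\<^bsub>R\<^esub>) - (frag_of (a \<odot>\<^bsub>M\<^esub> m, \<phi> \<one>\<^bsub>R\<^esub>) - frag_of (m, a \<odot>\<^bsub>X\<^esub> \<phi> \<one>\<^bsub>R\<^esub>)) \<in> X.\<N>"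
    by (rule X.rel_diff[OF X.rel_zero_left X.rel_smult]) (use p1 m a in auto)
  then have "F ?c - F 0 \<in> X.\<N>" using m(2) by (simp add: f_def)
  then have "tensor_map R M X f (X.\<N> #>\<^bsub>free_Abelian_group X.\<S>\<^esub> ?c) = tensor_map R M X f (X.\<N> #>\<^bsub>free_Abelian_group X.\<S>\<^esub> 0)"
    using tensor_map_coset[OF k] tensor_map_coset[of 0] X.coset_eq_iff by simp
  then have "X.\<N> #>\<^bsub>free_Abelian_group X.\<S>\<^esub> ?c = X.\<N> #>\<^bsub>free_Abelian_group X.\<S>\<^esub> 0"
    by (rule inj_onD[OF inj]; unfold X.tensor_product_elem) (rule exI[of _ ?c], use k in simp, rule exI[of _ 0], simp)
  then have N: "?c \<in> X.\<N>" unfolding X.coset_eq_iff by simp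
  \<comment> \<open>The evaluation map from the tensor product with the ring to \<open>M\<close>;
    the induction below checks that it kills the relations.\<close>
  define \<psi> where "\<psi> p = g (snd p) \<odot>\<^bsub>M\<^esub> fst p" for p
  have gc: "g x \<in> carrier R" if "x \<in> carrier X" for x using hom_closed[OF g that] by simp
  have "\<exists>P. free_hom X.\<S> M \<psi> P"
    by (rule free_hom_exists[OF M]) (use gc in \<open>auto simp: \<psi>_def\<close>)
  then obtain P where P: "free_hom X.\<S> M \<psi> P" by blast
  have ks: "Poly_Mapping.keys (frag_of p - frag_of q) \<subseteq> X.\<S>" if "p \<in> X.\<S>" "q \<in> X.\<S>" for p q
    using that keys_diff[of "frag_of p" "frag_of q"] by (auto simp: keys_frag_of)
  have P2: "P (frag_of p - frag_of q) = \<psi> p \<oplus>\<^bsub>M\<^esub> \<ominus>\<^bsub>M\<^esub> \<psi> q" if "p \<in> X.\<S>" "q \<in> X.\<S>" for p q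
    using that by (simp add: free_hom_diff[OF P] free_hom_of[OF P] keys_frag_of)
  have P3: "P (frag_of p - frag_of q - frag_of s) = \<psi> p \<oplus>\<^bsub>M\<^esub> \<ominus>\<^bsub>M\<^esub> \<psi> q \<oplus>\<^bsub>M\<^esub> \<ominus>\<^bsub>M\<^esub> \<psi> s" if "p \<in> X.\<S>" "q \<in> X.\<S>" "s \<in> X.\<S>" for p q s
    using that ks[OF that(1,2)] P2[OF that(1,2)] by (simp add: free_hom_diff[OF P ks[OF that(1,2)]] free_hom_of[OF P] keys_frag_of)
  have "P c = \<zero>\<^bsub>M\<^esub>" if "c \<in> X.\<N>" for c
    using that
  proof (induction rule: X.rel_induct)
    case (add_left n n' x)
    then show ?case using gc[of x] by (simp add: P3 \<psi>_def M.smult_r_distr M.a_ac M.r_neg M.r_neg1 M.r_neg2)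
  next
    case (add_right n x x')
    then show ?case using gc[of x] gc[of x'] by (simp add: P3 \<psi>_def hom_add[OF g] M.smult_l_distr M.a_ac M.r_neg M.r_neg1 M.r_neg2)
  next
    case (smult r n x)
    have "g x \<odot>\<^bsub>M\<^esub> (r \<odot>\<^bsub>M\<^esub> n) = (r \<otimes>\<^bsub>R\<^esub> g x) \<odot>\<^bsub>M\<^esub> n"
      using smult gc[of x] by (simp add: M.smult_assoc1[symmetric] M.R.m_comm)
    then show ?case using smult gc[of x] by (simp add: P2 \<psi>_def hom_smult[OF g] M.r_neg)
  next
    case (minus c)
    then show ?case using free_hom_minus[OF P] by simp
  next
    case (add c d)
    then show ?case using free_hom_add[OF P] by simp
  qed (use free_hom_zero[OF P] in simp)
  then have "P ?c = \<zero>\<^bsub>M\<^esub>" using N by blast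
  then show ?thesis using free_hom_of[OF P, of "(m, \<phi> \<one>\<^bsub>R\<^esub>)"] m p1 g\<phi>[of "\<one>\<^bsub>R\<^esub>"] by (simp add: \<psi>_def)
qed

section \<open>Injective and projective modules\<close>

lemma hom_comb:
  assumes M: "Module.module hahn_ring M" and N: "Module.module hahn_ring N" and f: "f \<in> module_homs hahn_ring M N"
    and H: "homs_on M S J h" and x: "x \<in> tuples S J"
  shows "f (comb M S h x) = comb N S (\<lambda>i a. f (h i a)) x" "homs_on N S J (\<lambda>i a. f (h i a))"
proof -
  interpret M: hmodule M by (rule hmoduleI[OF M])
  interpret N: hmodule N by (rule hmoduleI[OF N])
  have HN: "homs_on N S J (\<lambda>i a. f (h i a))" if "homs_on M S J h" for S
    using that hahn_hom_comp[OF _ f] by (auto simp: homs_on_def)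
  show "homs_on N S J (\<lambda>i a. f (h i a))" by (rule HN[OF H])
  have "finite S" using homs_onD(1)[OF H] .
  then show "f (comb M S h x) = comb N S (\<lambda>i a. f (h i a)) x"
    using H x
  proof (induction S rule: finite_induct)
    case empty
    then show ?case using hom_zero[OF f M N] by simp
  next
    case (insert k S)
    have S: "homs_on M S J h" by (rule homs_on_subset[OF insert.prems(1)]) auto
    have xS: "x \<in> tuples S J" using insert.prems(2) by (auto simp: tuples_def)
    have c: "h k (x k) \<in> carrier M" using M.comb_terms_closed[OF insert.prems, of k] by simp
    show ?case
      unfolding M.comb_insert[OF insert.prems insert.hyps(2)] N.comb_insert[OF HN[OF insert.prems(1)] insert.prems(2) insert.hyps(2)]
      using hom_add[OF f c M.comb_closed[OF S xS]] insert.IH[OF S xS] by simp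
  qed
qed

subsection \<open>Products of submodules of the Hahn field\<close>

text \<open>Coordinates outside \<open>S\<close> are set to 0 so that a tuple is determined by those
  in \<open>S\<close> and \<open>comb\<close> can be a bijection. Scalars arrive as coefficient
  functions, hence the conversion by \<open>Hahn\<close>.\<close>

definition tuple_module :: "nat set \<Rightarrow> (nat \<Rightarrow> hahn set) \<Rightarrow> (real \<Rightarrow> bit, nat \<Rightarrow> hahn) module" where
  "tuple_module S J = \<lparr>carrier = {x \<in> tuples S J. \<forall>i. i \<notin> S \<longrightarrow> x i = 0}, monoid.mult = undefined, one = undefined,
    ring.zero = (\<lambda>_. 0), ring.add = (\<lambda>x y i. x i + y i), smult = (\<lambda>r x i. Hahn r * x i)\<rparr>"

lemma tuple_module_simps [simp]:
  "carrier (tuple_module S J) = {x \<in> tuples S J. \<forall>i. i \<notin> S \<longrightarrow> x i = 0}"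
  "\<zero>\<^bsub>tuple_module S J\<^esub> = (\<lambda>_. 0)"
  "x \<oplus>\<^bsub>tuple_module S J\<^esub> y = (\<lambda>i. x i + y i)"
  "coeff a \<odot>\<^bsub>tuple_module S J\<^esub> x = (\<lambda>i. a * x i)"
  by (simp_all add: tuple_module_def coeff_inverse)

definition single :: "nat \<Rightarrow> hahn \<Rightarrow> nat \<Rightarrow> hahn" where
  "single i a = (\<lambda>k. if k = i then a else 0)"

context
  fixes S :: "nat set" and J :: "nat \<Rightarrow> hahn set"
  assumes S: "finite S" and J: "\<And>i. i \<in> S \<Longrightarrow> osub (J i)"
begin

lemma module_tuple: "Module.module hahn_ring (tuple_module S J)"
proof (rule moduleI[OF cring_hahn_ring])
  show "abelian_group (tuple_module S J)"
  proof (rule abelian_groupI)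
    show "\<exists>y\<in>carrier (tuple_module S J). y \<oplus>\<^bsub>tuple_module S J\<^esub> x = \<zero>\<^bsub>tuple_module S J\<^esub>"
      if "x \<in> carrier (tuple_module S J)" for x
      using that by (intro bexI[of _ x]) auto
  qed (use J in \<open>auto simp: tuples_def osub_add osub_0 ac_simps\<close>)
qed (use J in \<open>auto simp: tuples_def osub_smult carrier_hahn_ring hahn_ring_simps algebra_simps\<close>)

interpretation T: hmodule "tuple_module S J" by (rule hmoduleI[OF module_tuple])

lemma homs_on_single: "homs_on (tuple_module S J) S J single"
  unfolding homs_on_def
proof (intro conjI ballI S J)
  fix i assume "i \<in> S"
  then show "hahn_hom (tuple_module S J) (J i) (single i)"
    using J osub_0 by (intro hahn_homI) (auto simp: tuples_def single_def fun_eq_iff)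
qed

lemma comb_single:
  assumes x: "x \<in> tuples S J"
  shows "comb (tuple_module S J) S single x = (\<lambda>k. if k \<in> S then x k else 0)"
proof -
  have "comb (tuple_module S J) S' single x = (\<lambda>k. if k \<in> S' then x k else 0)" if "S' \<subseteq> S" for S'
    using finite_subset[OF that S] that
  proof (induction S' rule: finite_induct)
    case (insert k S')
    have "homs_on (tuple_module S J) (insert k S') J single" by (rule homs_on_subset[OF homs_on_single insert.prems])
    moreover have "x \<in> tuples (insert k S') J" using x insert.prems by (auto simp: tuples_def)
    ultimately have "comb (tuple_module S J) (insert k S') single x
      = single k (x k) \<oplus>\<^bsub>tuple_module S J\<^esub> comb (tuple_module S J) S' single x"
      using insert.hyps by (intro T.comb_insert) auto
    moreover have "comb (tuple_module S J) S' single x = (\<lambda>k. if k \<in> S' then x k else 0)"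
      using insert.IH insert.prems by blast
    ultimately have "comb (tuple_module S J) (insert k S') single x
      = (\<lambda>i. single k (x k) i + (if i \<in> S' then x i else 0))" by simp
    also have "\<dots> = (\<lambda>i. if i \<in> insert k S' then x i else 0)"
      using insert.hyps(2) by (auto simp: single_def fun_eq_iff)
    finally show ?case .
  qed simp
  then show ?thesis by blast
qed

lemma multibasic_tuple: "multibasic_module hahn_ring (tuple_module S J)"
proof (rule T.multibasic_if_presented)
  have "carrier (tuple_module S J) \<subseteq> comb (tuple_module S J) S single ` tuples S J"
  proof
    fix x assume x: "x \<in> carrier (tuple_module S J)"
    then have t: "x \<in> tuples S J" by simp
    have "x = comb (tuple_module S J) S single x" unfolding comb_single[OF t] using x by auto
    then show "x \<in> comb (tuple_module S J) S single ` tuples S J" using t by (rule image_eqI)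
  qed
  then have "carrier (tuple_module S J) = comb (tuple_module S J) S single ` tuples S J"
    using T.comb_closed[OF homs_on_single] by blast
  then show "presented (tuple_module S J) (carrier (tuple_module S J))"
    unfolding presented_def using homs_on_single by blast
qed

lemma comb_hom:
  assumes M: "Module.module hahn_ring M" and H: "homs_on M S J h"
  shows "comb M S h \<in> module_homs hahn_ring (tuple_module S J) M"
proof -
  interpret M: hmodule M by (rule hmoduleI[OF M])
  show ?thesis
  proof (rule module_homsI)
    fix r x assume "r \<in> carrier hahn_ring" "x \<in> carrier (tuple_module S J)"
    then obtain a where "integral a" "r = coeff a" "x \<in> tuples S J" using hahn_ring_elem by auto
    then show "comb M S h (r \<odot>\<^bsub>tuple_module S J\<^esub> x) = r \<odot>\<^bsub>M\<^esub> comb M S h x"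
      using M.comb_smult[OF H] by simp
  qed (use M.comb_closed[OF H] M.comb_add[OF H] in auto)
qed

end

lemma (in hmodule) comb_surj_tuple:
  assumes H: "homs_on M S J h" and T: "T = comb M S h ` tuples S J"
  shows "comb M S h ` carrier (tuple_module S J) = T"
proof (intro Set.set_eqI iffI)
  fix y assume "y \<in> comb M S h ` carrier (tuple_module S J)"
  then show "y \<in> T" using T by auto
next
  fix y assume "y \<in> T"
  then obtain x where x: "x \<in> tuples S J" "y = comb M S h x" using T by auto
  let ?x = "\<lambda>i. if i \<in> S then x i else 0"
  have "comb M S h x = comb M S h ?x" by (rule comb_cong[OF H x(1)]) simp
  moreover have "?x \<in> carrier (tuple_module S J)" using x(1) by (auto simp: tuples_def)
  ultimately show "y \<in> comb M S h ` carrier (tuple_module S J)" using x(2) by blast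
qed

section \<open>Torsion-free multibasic modules: structure, lifting and flatness\<close>

definition torsion_free :: "(real \<Rightarrow> bit, 'b) module \<Rightarrow> bool" where
  "torsion_free M \<longleftrightarrow> (\<forall>a x. integral a \<longrightarrow> a \<noteq> 0 \<longrightarrow> x \<in> carrier M \<longrightarrow> coeff a \<odot>\<^bsub>M\<^esub> x = \<zero>\<^bsub>M\<^esub> \<longrightarrow> x = \<zero>\<^bsub>M\<^esub>)"

lemma torsion_free_tuple: "torsion_free (tuple_module S J)"
  by (auto simp: torsion_free_def fun_eq_iff)

lemma torsion_free_injective:
  assumes f: "f \<in> module_homs hahn_ring M N" "inj_on f (carrier M)"
    and M: "Module.module hahn_ring M" and N: "Module.module hahn_ring N" and "torsion_free N"
  shows "torsion_free M"
  unfolding torsion_free_def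
proof (intro allI impI)
  fix a x assume a: "integral a" "a \<noteq> 0" "x \<in> carrier M" "coeff a \<odot>\<^bsub>M\<^esub> x = \<zero>\<^bsub>M\<^esub>"
  have "coeff a \<odot>\<^bsub>N\<^esub> f x = \<zero>\<^bsub>N\<^esub>" using hom_smult[OF f(1), of "coeff a" x] a hom_zero[OF f(1) M N] by simp
  then have "f x = \<zero>\<^bsub>N\<^esub>" using assms(5) a hom_closed[OF f(1)] unfolding torsion_free_def by blast
  then show "x = \<zero>\<^bsub>M\<^esub>" using f(2) a(3) unfolding hom_inj_iff[OF f(1) M N] by blast
qed

text \<open>A homomorphism from a submodule of K to a torsion-free module is zero or injective: if a
  nonzero \<open>a\<close> is killed and \<open>b\<close> is not, then either \<open>b\<close> is a
  multiple of \<open>a\<close>, hence killed, or \<open>a\<close> is a multiple of \<open>b\<close>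
  and the image of \<open>b\<close> is torsion.\<close>

lemma torsion_free_is_product:
  assumes mb: "multibasic_module hahn_ring M" and tf: "torsion_free M"
  shows "\<exists>(n::nat) J h. homs_on M {..<n} J h \<and>
    bij_betw (comb M {..<n} h) (carrier (tuple_module {..<n} J)) (carrier M)"
proof -
  interpret M: hmodule M by (rule hmoduleI[OF multibasic_module_module[OF mb]])
  obtain n :: nat and J h where H: "homs_on M {..<n} J h"
    and ex: "\<forall>x\<in>carrier M. \<exists>!c. c \<in> (\<Pi>\<^sub>E i\<in>{..<n}. h i ` J i) \<and> x = (\<Oplus>\<^bsub>M\<^esub>i\<in>{..<n}. c i)"
    using M.multibasic_summands[OF mb] by blast
  \<comment> \<open>The parametrised summands are not recorded as nonzero; where the image is zero,
    \<open>J i\<close> is replaced by zero to make the map injective.\<close>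
  define J' where "J' i = (if h i ` J i = {\<zero>\<^bsub>M\<^esub>} then {0} else J i)" for i
  have J: "osub (J i)" and h: "hahn_hom M (J i) (h i)" if "i \<in> {..<n}" for i
    using homs_onD(2,3)[OF H that] by auto
  have J'J: "J' i \<subseteq> J i" if "i \<in> {..<n}" for i using osub_0[OF J[OF that]] by (simp add: J'_def)
  have H': "homs_on M {..<n} J' h"
    unfolding homs_on_def
  proof (intro conjI ballI)
    fix i assume i: "i \<in> {..<n}"
    show "osub (J' i)" using J[OF i] osub_zero by (simp add: J'_def)
    show "hahn_hom M (J' i) (h i)" using h[OF i] J'J[OF i] unfolding hahn_hom_def by blast
  qed simp
  have ker: "a = 0" if i: "i \<in> {..<n}" and a: "a \<in> J' i" "h i a = \<zero>\<^bsub>M\<^esub>" for i a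
  proof (rule ccontr)
    assume a0: "a \<noteq> 0"
    then have ne: "h i ` J i \<noteq> {\<zero>\<^bsub>M\<^esub>}" and aJ: "a \<in> J i" using a(1) by (auto simp: J'_def split: if_splits)
    have "\<zero>\<^bsub>M\<^esub> \<in> h i ` J i" using aJ a(2) by force
    then obtain b where b: "b \<in> J i" "h i b \<noteq> \<zero>\<^bsub>M\<^esub>" using ne by blast
    have b0: "b \<noteq> 0" using M.hahn_hom_zero[OF h[OF i] J[OF i]] b by auto
    from integral_divide_total[OF a0 b0] show False
    proof
      assume i': "integral (a / b)"
      have "coeff (a / b) \<odot>\<^bsub>M\<^esub> h i b = \<zero>\<^bsub>M\<^esub>" using hahn_hom_smult[OF h[OF i] i' b(1)] b0 a(2) by simp
      then show False
        using tf i' a0 b0 b hahn_hom_closed[OF h[OF i] b(1)] unfolding torsion_free_def by (metis divide_eq_0_iff)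
    next
      assume i': "integral (b / a)"
      show False using hahn_hom_smult[OF h[OF i] i' aJ] a0 a(2) b(2) i' by simp
    qed
  qed
  have "bij_betw (comb M {..<n} h) (carrier (tuple_module {..<n} J')) (carrier M)"
  proof (rule bij_betw_imageI)
    show "inj_on (comb M {..<n} h) (carrier (tuple_module {..<n} J'))"
    proof (rule inj_onI)
      fix x y assume x: "x \<in> carrier (tuple_module {..<n} J')" and y: "y \<in> carrier (tuple_module {..<n} J')"
        and eq: "comb M {..<n} h x = comb M {..<n} h y"
      have tx: "x \<in> tuples {..<n} J'" and ty: "y \<in> tuples {..<n} J'" using x y by auto
      let ?c = "\<lambda>x. \<lambda>i\<in>{..<n}. h i (x i)"
      have c: "?c x \<in> (\<Pi>\<^sub>E i\<in>{..<n}. h i ` J i)" if "x \<in> tuples {..<n} J'" for x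
        using that J'J by (intro restrict_PiE_iff[THEN iffD2] ballI imageI) (auto simp: tuples_def)
      have s: "comb M {..<n} h x = (\<Oplus>\<^bsub>M\<^esub>i\<in>{..<n}. ?c x i)" if "x \<in> tuples {..<n} J'" for x
        unfolding comb_def by (rule M.finsum_cong') (use M.comb_terms_closed[OF H' that] in auto)
      have "\<exists>!c. c \<in> (\<Pi>\<^sub>E i\<in>{..<n}. h i ` J i) \<and> comb M {..<n} h x = (\<Oplus>\<^bsub>M\<^esub>i\<in>{..<n}. c i)"
        using ex M.comb_closed[OF H' tx] by blast
      then have cc: "?c x = ?c y" using c[OF tx] c[OF ty] s[OF tx] s[OF ty] eq by (metis (no_types, lifting))
      show "x = y"
      proof
        fix i
        show "x i = y i"
        proof (cases "i \<in> {..<n}")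
          case True
          have xi: "x i \<in> J' i" "y i \<in> J' i" using tx ty True by (auto simp: tuples_def)
          have hi: "hahn_hom M (J' i) (h i)" "osub (J' i)" using homs_onD(2,3)[OF H' True] by auto
          have "h i (x i) = h i (y i)" using fun_cong[OF cc, of i] True by simp
          then have "h i (x i + y i) = \<zero>\<^bsub>M\<^esub>"
            using hahn_hom_add[OF hi(1) xi] hahn_hom_closed[OF hi(1) xi(2)] by simp
          then have "x i + y i = 0" by (rule ker[OF True osub_add[OF hi(2) xi]])
          then show ?thesis by (metis add_eq_0_iff hahn_uminus)
        qed (use x y in auto)
      qed
    qed
    show "comb M {..<n} h ` carrier (tuple_module {..<n} J') = carrier M"
    proof (intro Set.set_eqI iffI)
      fix y assume "y \<in> comb M {..<n} h ` carrier (tuple_module {..<n} J')"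
      then show "y \<in> carrier M" using M.comb_closed[OF H'] by auto
    next
      fix y assume y: "y \<in> carrier M"
      then obtain c where c: "c \<in> (\<Pi>\<^sub>E i\<in>{..<n}. h i ` J i)" "y = (\<Oplus>\<^bsub>M\<^esub>i\<in>{..<n}. c i)" using ex by blast
      have "\<exists>a. a \<in> J' i \<and> c i = h i a" if i: "i \<in> {..<n}" for i
      proof (cases "h i ` J i = {\<zero>\<^bsub>M\<^esub>}")
        case True
        then have "c i = h i 0" using PiE_mem[OF c(1) i] M.hahn_hom_zero[OF h[OF i] J[OF i]] by simp
        then show ?thesis using True by (auto simp: J'_def)
      next
        case False
        then show ?thesis using PiE_mem[OF c(1) i] by (auto simp: J'_def)
      qed
      then obtain a where a: "\<And>i. i \<in> {..<n} \<Longrightarrow> a i \<in> J' i \<and> c i = h i (a i)" by metis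
      define x where "x i = (if i \<in> {..<n} then a i else 0)" for i
      have x: "x \<in> carrier (tuple_module {..<n} J')" using a by (auto simp: x_def tuples_def)
      then have tx: "x \<in> tuples {..<n} J'" by simp
      have "y = comb M {..<n} h x"
        unfolding c(2) comb_def
        by (rule M.finsum_cong') (use a M.comb_terms_closed[OF H' tx] in \<open>auto simp: x_def\<close>)
      then show "y \<in> comb M {..<n} h ` carrier (tuple_module {..<n} J')" using x by (rule image_eqI)
    qed
  qed
  then show ?thesis using H' by blast
qed

text \<open>On a product of submodules of K a lift can be found one factor at a time; the kernel of
  \<open>e\<close> is linearly compact as a submodule of a multibasic module.\<close>

lemma torsion_free_lift:
  fixes X :: "(real \<Rightarrow> bit, 'b) module" and Y :: "(real \<Rightarrow> bit, 'c) module"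
  assumes P: "multibasic_module hahn_ring P" "torsion_free P"
    and X: "multibasic_module hahn_ring X" and Y: "Module.module hahn_ring Y"
    and e: "e \<in> module_homs hahn_ring X Y" "e ` carrier X = carrier Y"
    and f: "f \<in> module_homs hahn_ring P Y"
  shows "\<exists>g\<in>module_homs hahn_ring P X. \<forall>x\<in>carrier P. e (g x) = f x"
proof -
  note mP = multibasic_module_module[OF P(1)] and mX = multibasic_module_module[OF X]
  interpret P: hmodule P by (rule hmoduleI[OF mP])
  interpret X: hmodule X by (rule hmoduleI[OF mX])
  interpret Y: hmodule Y by (rule hmoduleI[OF Y])
  obtain n :: nat and J h where H: "homs_on P {..<n} J h"
    and bij: "bij_betw (comb P {..<n} h) (carrier (tuple_module {..<n} J)) (carrier P)"
    using torsion_free_is_product[OF P] by blast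
  let ?S = "{..<n}" and ?T = "tuple_module {..<n} J"
  note J = homs_onD(2)[OF H]
  have mT: "Module.module hahn_ring ?T" by (rule module_tuple) (use J in auto)
  have \<phi>: "comb P ?S h \<in> module_homs hahn_ring ?T P" by (rule comb_hom[OF _ J mP H]) auto
  define \<psi> where "\<psi> = inv_into (carrier ?T) (comb P ?S h)"
  have \<psi>: "\<psi> \<in> module_homs hahn_ring P ?T" unfolding \<psi>_def by (rule hom_inverse[OF \<phi> mT bij])
  have \<phi>\<psi>: "comb P ?S h (\<psi> x) = x" if "x \<in> carrier P" for x
    unfolding \<psi>_def using that bij_betw_imp_surj_on[OF bij] f_inv_into_f[of x "comb P ?S h" "carrier ?T"] by simp
  have K: "presented X {x \<in> carrier X. e x = \<zero>\<^bsub>Y\<^esub>}"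
    by (rule X.presented_sub[OF X.presented_if_multibasic[OF X] kernel_submodule[OF e(1) mX Y]]) auto
  have "\<exists>q. hahn_hom X (J i) q \<and> (\<forall>a\<in>J i. e (q a) = f (h i a))" if i: "i \<in> ?S" for i
    by (rule lift_along_surjection[OF mX Y e X.presented_lin_compact[OF K] J[OF i]
          hahn_hom_comp[OF homs_onD(3)[OF H i] f]])
  then obtain q where q: "\<And>i. i \<in> ?S \<Longrightarrow> hahn_hom X (J i) (q i)" "\<And>i a. i \<in> ?S \<Longrightarrow> a \<in> J i \<Longrightarrow> e (q i a) = f (h i a)"
    by metis
  have HX: "homs_on X ?S J q" using q(1) J by (simp add: homs_on_def)
  have g: "comb X ?S q \<in> module_homs hahn_ring ?T X" by (rule comb_hom[OF _ J mX HX]) auto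
  have "e (comb X ?S q (\<psi> x)) = f x" if x: "x \<in> carrier P" for x
  proof -
    have t: "\<psi> x \<in> tuples ?S J" using hom_closed[OF \<psi> x] by simp
    have "e (comb X ?S q (\<psi> x)) = comb Y ?S (\<lambda>i a. e (q i a)) (\<psi> x)" by (rule hom_comb(1)[OF mX Y e(1) HX t])
    also have "\<dots> = comb Y ?S (\<lambda>i a. f (h i a)) (\<psi> x)"
      unfolding comb_def
    proof (rule Y.finsum_cong')
      show "(\<lambda>i. f (h i (\<psi> x i))) \<in> ?S \<rightarrow> carrier Y"
        using Y.comb_terms_closed[OF hom_comb(2)[OF mP Y f H t] t] by blast
    qed (use q(2) t in \<open>auto simp: tuples_def\<close>)
    also have "\<dots> = f (comb P ?S h (\<psi> x))" by (rule hom_comb(1)[OF mP Y f H t, symmetric])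
    finally show ?thesis using \<phi>\<psi>[OF x] by simp
  qed
  then show ?thesis using hom_comp[OF \<psi> g] by (intro bexI[of _ "\<lambda>x. comb X ?S q (\<psi> x)"]) auto
qed

text \<open>Of two elements of K one is an integral multiple of the other, so a generator is
  replaced only when the new element is not a multiple of it, and then it is a multiple of the new
  element.\<close>

lemma osub_finite_cyclic:
  assumes "finite F" "F \<subseteq> J" "osub J"
  shows "\<exists>e\<in>J. \<forall>x\<in>F. \<exists>r. integral r \<and> x = r * e"
  using assms(1,2)
proof (induction F rule: finite_induct)
  case empty
  then show ?case using osub_0[OF assms(3)] by blast
next
  case (insert y F)
  then obtain e where e: "e \<in> J" "\<And>x. x \<in> F \<Longrightarrow> \<exists>r. integral r \<and> x = r * e" by blast
  show ?case
  proof (cases "\<exists>r. integral r \<and> y = r * e")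
    case True
    then show ?thesis using e by blast
  next
    case False
    have y0: "y \<noteq> 0" using False integral_0 by fastforce
    have "\<exists>s. integral s \<and> e = s * y"
    proof (cases "e = 0")
      case True
      then show ?thesis by (intro exI[of _ 0]) simp
    next
      case e0: False
      have "\<not> integral (y / e)" using False e0 by (metis nonzero_divide_eq_eq)
      then have "integral (e / y)" using integral_divide_total[OF y0 e0] by blast
      then show ?thesis using y0 by (intro exI[of _ "e / y"]) simp
    qed
    then obtain s where s: "integral s" "e = s * y" by blast
    have "\<exists>r. integral r \<and> x = r * y" if x: "x \<in> F" for x
    proof -
      obtain r where "integral r" "x = r * e" using e(2)[OF x] by blast
      then show ?thesis using s by (intro exI[of _ "r * s"]) (simp add: integral_mult mult.assoc)
    qed
    moreover have "\<exists>r. integral r \<and> y = r * y" by (intro exI[of _ 1]) simp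
    ultimately show ?thesis using insert.prems by (intro bexI[of _ y]) auto
  qed
qed

text \<open>Finitely many elements of a product of submodules of K have their coordinates in cyclic
  submodules A \<epsilon>_i; division by \<epsilon>_i turns these into linear coordinates with
  values in A.\<close>

lemma torsion_free_flat:
  assumes P: "multibasic_module hahn_ring P" "torsion_free P"
  shows "flat_module TYPE('v) hahn_ring P"
proof -
  note mP = multibasic_module_module[OF P(1)]
  interpret P: hmodule P by (rule hmoduleI[OF mP])
  obtain n :: nat and J h where H: "homs_on P {..<n} J h"
    and bij: "bij_betw (comb P {..<n} h) (carrier (tuple_module {..<n} J)) (carrier P)"
    using torsion_free_is_product[OF P] by blast
  let ?S = "{..<n}" and ?T = "tuple_module {..<n} J"
  note J = homs_onD(2)[OF H]
  have mT: "Module.module hahn_ring ?T" by (rule module_tuple) (use J in auto)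
  have \<phi>: "comb P ?S h \<in> module_homs hahn_ring ?T P" by (rule comb_hom[OF _ J mP H]) auto
  define \<psi> where "\<psi> = inv_into (carrier ?T) (comb P ?S h)"
  have \<psi>: "\<psi> \<in> module_homs hahn_ring P ?T" unfolding \<psi>_def by (rule hom_inverse[OF \<phi> mT bij])
  have \<phi>\<psi>: "comb P ?S h (\<psi> x) = x" if "x \<in> carrier P" for x
    unfolding \<psi>_def using that bij_betw_imp_surj_on[OF bij] f_inv_into_f[of x "comb P ?S h" "carrier ?T"] by simp
  have t: "\<psi> x \<in> tuples ?S J" if "x \<in> carrier P" for x using hom_closed[OF \<psi> that] by simp
  show ?thesis
  proof (rule flat_if_locally_free[where 'i = nat, OF mP])
    fix T assume T: "finite T" "T \<subseteq> carrier P"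
    have "\<exists>\<epsilon>\<in>J i. \<forall>x\<in>(\<lambda>x. \<psi> x i) ` T. \<exists>r. integral r \<and> x = r * \<epsilon>" if i: "i \<in> ?S" for i
      by (rule osub_finite_cyclic[OF _ _ J[OF i]]) (use T t i in \<open>auto simp: tuples_def\<close>)
    then obtain \<epsilon> where \<epsilon>: "\<And>i. i \<in> ?S \<Longrightarrow> \<epsilon> i \<in> J i"
      "\<And>i x. i \<in> ?S \<Longrightarrow> x \<in> T \<Longrightarrow> \<exists>r. integral r \<and> \<psi> x i = r * \<epsilon> i" by (metis imageI)
    define M' where "M' = {x \<in> carrier P. \<forall>i\<in>?S. \<exists>r. integral r \<and> \<psi> x i = r * \<epsilon> i}"
    \<comment> \<open>If \<epsilon>_i = 0 the quotient is 0, the right coordinate because the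
      component at \<open>i\<close> then vanishes on M'.\<close>
    define l where "l i x = coeff (\<psi> x i / \<epsilon> i)" for i x
    have li: "integral (\<psi> x i / \<epsilon> i)" and le: "\<psi> x i / \<epsilon> i * \<epsilon> i = \<psi> x i" if x: "x \<in> M'" "i \<in> ?S" for x i
    proof -
      obtain r where "integral r" "\<psi> x i = r * \<epsilon> i" using x unfolding M'_def by blast
      then show "integral (\<psi> x i / \<epsilon> i)" "\<psi> x i / \<epsilon> i * \<epsilon> i = \<psi> x i" by (cases "\<epsilon> i = 0"; simp)+
    qed
    show "\<exists>(S :: nat set) e l M'. finite S \<and> T \<subseteq> M' \<and> M' \<subseteq> carrier P \<and>
      (\<forall>i\<in>S. e i \<in> carrier P \<and> linear_on hahn_ring P M' (l i)) \<and> (\<forall>m\<in>M'. m = (\<Oplus>\<^bsub>P\<^esub>i\<in>S. l i m \<odot>\<^bsub>P\<^esub> e i))"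
    proof (intro exI[of _ ?S] exI[of _ "\<lambda>i. h i (\<epsilon> i)"] exI[of _ l] exI[of _ M'] conjI ballI)
      show "T \<subseteq> M'" using T(2) \<epsilon>(2) by (auto simp: M'_def)
      fix i assume i: "i \<in> ?S"
      show "h i (\<epsilon> i) \<in> carrier P" using hahn_hom_closed[OF homs_onD(3)[OF H i] \<epsilon>(1)[OF i]] .
      show "linear_on hahn_ring P M' (l i)"
        unfolding linear_on_def
      proof (intro conjI ballI impI)
        show "l i m \<in> carrier hahn_ring" if "m \<in> M'" for m using li[OF that i] by (simp add: l_def)
        show "l i (m \<oplus>\<^bsub>P\<^esub> m') = l i m \<oplus>\<^bsub>hahn_ring\<^esub> l i m'" if "m \<in> M'" "m' \<in> M'" for m m'
          using that hom_add[OF \<psi>, of m m'] by (simp add: l_def M'_def hahn_ring_simps add_divide_distrib)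
        fix r m assume r: "r \<in> carrier hahn_ring" and m: "m \<in> M'"
        then obtain a where a: "integral a" "r = coeff a" using hahn_ring_elem by blast
        show "l i (r \<odot>\<^bsub>P\<^esub> m) = r \<otimes>\<^bsub>hahn_ring\<^esub> l i m"
          using hom_smult[OF \<psi> r, of m] m unfolding a(2) by (simp add: l_def M'_def hahn_ring_simps)
      qed
    next
      fix m assume m: "m \<in> M'"
      then have mc: "m \<in> carrier P" by (simp add: M'_def)
      have "(\<Oplus>\<^bsub>P\<^esub>i\<in>?S. l i m \<odot>\<^bsub>P\<^esub> h i (\<epsilon> i)) = comb P ?S h (\<psi> m)"
        unfolding comb_def
      proof (rule P.finsum_cong')
        show "(\<lambda>i. h i (\<psi> m i)) \<in> ?S \<rightarrow> carrier P" using P.comb_terms_closed[OF H t[OF mc]] by blast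
        show "l i m \<odot>\<^bsub>P\<^esub> h i (\<epsilon> i) = h i (\<psi> m i)" if "i \<in> ?S" for i
          using hahn_hom_smult[OF homs_onD(3)[OF H that] li[OF m that] \<epsilon>(1)[OF that]] le[OF m that] by (simp add: l_def)
      qed simp
      then show "m = (\<Oplus>\<^bsub>P\<^esub>i\<in>?S. l i m \<odot>\<^bsub>P\<^esub> h i (\<epsilon> i))" using \<phi>\<psi>[OF mc] by simp
    qed (auto simp: M'_def)
  qed
qed

lemma flat_iff_torsion_free:
  assumes P: "multibasic_module hahn_ring P" and small: "carrier hahn_ring \<lesssim> (UNIV :: 'v set)"
  shows "flat_module TYPE('v) hahn_ring P \<longleftrightarrow> torsion_free P"
proof
  assume flat: "flat_module TYPE('v) hahn_ring P"
  show "torsion_free P"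
    unfolding torsion_free_def
  proof (intro allI impI)
    fix a x assume a: "integral a" "a \<noteq> 0" and x: "x \<in> carrier P" "coeff a \<odot>\<^bsub>P\<^esub> x = \<zero>\<^bsub>P\<^esub>"
    show "x = \<zero>\<^bsub>P\<^esub>"
    proof (rule flat_torsion_free[OF flat small _ _ x])
      show "r = \<zero>\<^bsub>hahn_ring\<^esub>" if "r \<in> carrier hahn_ring" "coeff a \<otimes>\<^bsub>hahn_ring\<^esub> r = \<zero>\<^bsub>hahn_ring\<^esub>" for r
        using hahn_ring_elem[OF that(1)] that(2) a(2) by (auto simp: hahn_ring_simps coeff_inject)
    qed (use a in simp)
  qed
qed (rule torsion_free_flat[OF P])

subsection \<open>Injective modules\<close>

text \<open>A homomorphism from an ideal to K^S / L lifts to K^S because \<open>L\<close> is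
  linearly compact. In K^S it is multiplication of a fixed vector, whose class is the element that
  Baer's criterion asks for.\<close>

lemma injective_tuple_quotient:
  assumes S: "finite S" and L: "submodule L hahn_ring (tuple_module S (\<lambda>_. UNIV))"
  shows "injective_module TYPE('v) hahn_ring (quotient_module (tuple_module S (\<lambda>_. UNIV)) L)"
proof -
  let ?V = "tuple_module S (\<lambda>_. UNIV)" and ?E = "quotient_module (tuple_module S (\<lambda>_. UNIV)) L"
  have mbV: "multibasic_module hahn_ring ?V" by (rule multibasic_tuple[OF S]) (simp add: osub_UNIV)
  note mV = multibasic_module_module[OF mbV]
  note mE = module_quotient[OF mV L] and p = quotient_hom[OF mV L] and surj = quotient_surj[OF mV L]
  interpret V: hmodule ?V by (rule hmoduleI[OF mV])
  interpret E: hmodule ?E by (rule hmoduleI[OF mE])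
  let ?p = "\<lambda>x. L +>\<^bsub>?V\<^esub> x"
  have "{x \<in> carrier ?V. ?p x = \<zero>\<^bsub>?E\<^esub>} = L"
    using quotient_zero_iff[OF mV L] V.submodule_facts(1)[OF L] by blast
  then have K: "lin_compact ?V {x \<in> carrier ?V. ?p x = \<zero>\<^bsub>?E\<^esub>}"
    using V.presented_lin_compact[OF V.presented_sub[OF V.presented_if_multibasic[OF mbV] L V.submodule_facts(1)[OF L]]] by simp
  show ?thesis
  proof (rule Baer_criterion[OF mE])
    fix I f assume I: "ideal I hahn_ring" and fc: "f \<in> I \<rightarrow> carrier ?E"
      and fa: "\<And>a b. a \<in> I \<Longrightarrow> b \<in> I \<Longrightarrow> f (a \<oplus>\<^bsub>hahn_ring\<^esub> b) = f a \<oplus>\<^bsub>?E\<^esub> f b"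
      and fs: "\<And>r a. r \<in> carrier hahn_ring \<Longrightarrow> a \<in> I \<Longrightarrow> f (r \<otimes>\<^bsub>hahn_ring\<^esub> a) = r \<odot>\<^bsub>?E\<^esub> f a"
    interpret I: ideal I hahn_ring by (rule I)
    define J where "J = {a. coeff a \<in> I}"
    have Ji: "integral a" if "a \<in> J" for a using that I.a_subset by (auto simp: J_def)
    have J: "osub J"
      unfolding osub_def
    proof (intro conjI ballI allI impI)
      show "0 \<in> J" using I.zero_closed by (simp add: J_def hahn_ring_simps)
      show "x + y \<in> J" if "x \<in> J" "y \<in> J" for x y
        using I.a_closed[of "coeff x" "coeff y"] that by (simp add: J_def hahn_ring_simps)
      show "r * x \<in> J" if "integral r" "x \<in> J" for r x
        using I.I_l_closed[of "coeff x" "coeff r"] that by (simp add: J_def hahn_ring_simps)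
    qed
    have h: "hahn_hom ?E J (\<lambda>a. f (coeff a))"
    proof (rule hahn_homI)
      show "f (coeff x) \<in> carrier ?E" if "x \<in> J" for x using fc that by (auto simp: J_def)
      show "f (coeff (x + y)) = f (coeff x) \<oplus>\<^bsub>?E\<^esub> f (coeff y)" if "x \<in> J" "y \<in> J" for x y
        using fa[of "coeff x" "coeff y"] that by (simp add: J_def hahn_ring_simps)
      show "f (coeff (r * x)) = coeff r \<odot>\<^bsub>?E\<^esub> f (coeff x)" if "integral r" "x \<in> J" for r x
        using fs[of "coeff r" "coeff x"] that by (simp add: J_def hahn_ring_simps)
    qed
    obtain q where q: "hahn_hom ?V J q" and pq: "\<And>a. a \<in> J \<Longrightarrow> ?p (q a) = f (coeff a)"
      using lift_along_surjection[OF mV mE p surj K J h] by blast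
    have "\<exists>c\<in>carrier ?V. \<forall>a\<in>J. q a = (\<lambda>i. a * c i)"
    proof (cases "J = {0}")
      case True
      then show ?thesis using V.hahn_hom_zero[OF q J] by (intro bexI[of _ "\<lambda>_. 0"]) (auto simp: tuples_def)
    next
      case False
      then obtain e where e: "e \<in> J" "e \<noteq> 0" using osub_0[OF J] by blast
      \<comment> \<open>Any two elements of \<open>J\<close> are comparable by division, so a
        homomorphism into a K-vector space is determined by its value at one nonzero
        \<open>e\<close>.\<close>
      define c where "c i = q e i / e" for i
      have "q a = (\<lambda>i. a * c i)" if a: "a \<in> J" for a
      proof (cases "a = 0")
        case True
        then show ?thesis using V.hahn_hom_zero[OF q J] by simp
      next
        case a0: False
        from integral_divide_total[OF a0 e(2)] show ?thesis
        proof
          assume i: "integral (a / e)"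
          have "q a = (\<lambda>i. a / e * q e i)" using hahn_hom_smult[OF q i e(1)] e(2) by simp
          then show ?thesis by (simp add: c_def)
        next
          assume i: "integral (e / a)"
          have "q e = (\<lambda>i. e / a * q a i)" using hahn_hom_smult[OF q i a] a0 by simp
          then show ?thesis using e(2) a0 by (simp add: c_def)
        qed
      qed
      moreover have "c \<in> carrier ?V" using hahn_hom_closed[OF q e(1)] by (auto simp: c_def tuples_def)
      ultimately show ?thesis by blast
    qed
    then obtain c where c: "c \<in> carrier ?V" "\<And>a. a \<in> J \<Longrightarrow> q a = (\<lambda>i. a * c i)" by blast
    have "f r = r \<odot>\<^bsub>?E\<^esub> ?p c" if r: "r \<in> I" for r
    proof -
      obtain a where a: "integral a" "r = coeff a" using hahn_ring_elem r I.a_subset by blast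
      then have "a \<in> J" using r by (simp add: J_def)
      then have "f r = ?p (coeff a \<odot>\<^bsub>?V\<^esub> c)" using pq[of a] c(2)[of a] a(2) by simp
      also have "\<dots> = coeff a \<odot>\<^bsub>?E\<^esub> ?p c" by (rule hom_smult[OF p]) (use a c(1) in simp_all)
      finally show ?thesis using a(2) by simp
    qed
    then show "\<exists>e\<in>carrier ?E. \<forall>a\<in>I. f a = a \<odot>\<^bsub>?E\<^esub> e"
      by (intro bexI[of _ "?p c"] ballI) (use hom_closed[OF p c(1)] in auto)
  qed
qed

text \<open>\<open>L\<close> consists of the relations among the generators. It is a submodule of
  the product of the J_i and equally of K^S, so enlarging the numerator embeds \<open>X\<close> in
  K^S / L.\<close>

lemma multibasic_embeds_injective:
  assumes X: "multibasic_module hahn_ring X"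
  shows "\<exists>(S :: nat set) L g. finite S \<and> submodule L hahn_ring (tuple_module S (\<lambda>_. UNIV)) \<and>
    g \<in> module_homs hahn_ring X (quotient_module (tuple_module S (\<lambda>_. UNIV)) L) \<and> inj_on g (carrier X)"
proof -
  note mX = multibasic_module_module[OF X]
  interpret X: hmodule X by (rule hmoduleI[OF mX])
  obtain S :: "nat set" and J h where H: "homs_on X S J h" and XX: "carrier X = comb X S h ` tuples S J"
    using X.presented_if_multibasic[OF X] unfolding presented_def by blast
  note S = homs_onD(1)[OF H] and J = homs_onD(2)[OF H]
  let ?V = "tuple_module S (\<lambda>_. UNIV)" and ?F = "tuple_module S J"
  have mV: "Module.module hahn_ring ?V" by (rule module_tuple[OF S]) (simp add: osub_UNIV)
  have mF: "Module.module hahn_ring ?F" by (rule module_tuple[OF S J])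
  interpret V: hmodule ?V by (rule hmoduleI[OF mV])
  interpret F: hmodule ?F by (rule hmoduleI[OF mF])
  have \<phi>: "comb X S h \<in> module_homs hahn_ring ?F X" by (rule comb_hom[OF S J mX H])
  define L where "L = {x \<in> carrier ?F. comb X S h x = \<zero>\<^bsub>X\<^esub>}"
  note LF = F.submodule_facts[OF kernel_submodule[OF \<phi> mF mX, folded L_def]]
  have FV: "carrier ?F \<subseteq> carrier ?V" by (auto simp: tuples_def)
  have L: "submodule L hahn_ring ?V"
    by (rule V.hsubmoduleI) (use LF FV in auto)
  let ?E = "quotient_module ?V L"
  note mE = module_quotient[OF mV L] and p = quotient_hom[OF mV L]
  let ?p = "\<lambda>x. L +>\<^bsub>?V\<^esub> x"
  have sF: "r \<odot>\<^bsub>?F\<^esub> x = r \<odot>\<^bsub>?V\<^esub> x" for r x by (simp add: tuple_module_def)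
  have pF: "?p \<in> module_homs hahn_ring ?F ?E"
  proof (rule module_homsI)
    show "?p x \<in> carrier ?E" if "x \<in> carrier ?F" for x by (rule hom_closed[OF p subsetD[OF FV that]])
    show "?p (x \<oplus>\<^bsub>?F\<^esub> y) = ?p x \<oplus>\<^bsub>?E\<^esub> ?p y" if "x \<in> carrier ?F" "y \<in> carrier ?F" for x y
      using hom_add[OF p subsetD[OF FV that(1)] subsetD[OF FV that(2)]] by simp
    show "?p (r \<odot>\<^bsub>?F\<^esub> x) = r \<odot>\<^bsub>?E\<^esub> ?p x" if "r \<in> carrier hahn_ring" "x \<in> carrier ?F" for r x
      using hom_smult[OF p that(1) subsetD[OF FV that(2)]] unfolding sF .
  qed
  have surj: "comb X S h ` carrier ?F = carrier X" by (rule X.comb_surj_tuple[OF H XX])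
  have "\<exists>g\<in>module_homs hahn_ring X ?E. \<forall>x\<in>carrier ?F. g (comb X S h x) = ?p x"
  proof (rule factor_through_surjection[OF mF mX mE \<phi> surj pF])
    fix x assume x: "x \<in> carrier ?F" "comb X S h x = \<zero>\<^bsub>X\<^esub>"
    then have "x \<in> L" by (simp add: L_def)
    then show "?p x = \<zero>\<^bsub>?E\<^esub>" using quotient_zero_iff[OF mV L subsetD[OF FV x(1)]] by blast
  qed
  then obtain g where g: "g \<in> module_homs hahn_ring X ?E" "\<And>x. x \<in> carrier ?F \<Longrightarrow> g (comb X S h x) = ?p x" by blast
  have "inj_on g (carrier X)"
    unfolding hom_inj_iff[OF g(1) mX mE]
  proof (intro ballI impI)
    fix y assume y: "y \<in> carrier X" "g y = \<zero>\<^bsub>?E\<^esub>"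
    then have "y \<in> comb X S h ` carrier ?F" using surj by simp
    then obtain x where x: "x \<in> carrier ?F" "y = comb X S h x" by (rule imageE)
    then have "x \<in> L" using quotient_zero_iff[OF mV L subsetD[OF FV x(1)]] g(2)[OF x(1)] y(2) by simp
    then show "y = \<zero>\<^bsub>X\<^esub>" using x(2) by (simp add: L_def)
  qed
  then show ?thesis using S L g(1) by blast
qed

lemma injective_retract:
  assumes E: "injective_module TYPE('v) R E" and I: "Module.module R I"
    and i: "i \<in> module_homs R I E" and r: "r \<in> module_homs R E I" and ri: "\<And>x. x \<in> carrier I \<Longrightarrow> r (i x) = x"
  shows "injective_module TYPE('v) R I"
  unfolding injective_module_def
proof (intro conjI allI impI I)
  fix X Y :: "('a, 'v) module" and j f
  assume a: "Module.module R X \<and> Module.module R Y \<and> j \<in> module_homs R X Y \<and> inj_on j (carrier X) \<and> f \<in> module_homs R X I"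
  then have f: "f \<in> module_homs R X I" by blast
  have "\<exists>g\<in>module_homs R Y E. \<forall>x\<in>carrier X. g (j x) = i (f x)"
    using E a hom_comp[OF f i] unfolding injective_module_def by blast
  then obtain g where g: "g \<in> module_homs R Y E" "\<And>x. x \<in> carrier X \<Longrightarrow> g (j x) = i (f x)" by blast
  have "r (g (j x)) = f x" if "x \<in> carrier X" for x using g(2)[OF that] ri hom_closed[OF f that] by simp
  then show "\<exists>g\<in>module_homs R Y I. \<forall>x\<in>carrier X. g (j x) = f x"
    using hom_comp[OF g(1) r] by (intro bexI[of _ "\<lambda>y. r (g y)"]) auto
qed

text \<open>Injectivity is tested on modules with elements in \<open>'v\<close>; transport carries
  the extension property to modules of other types whose carriers fit into
  \<open>'v\<close>.\<close>

lemma injective_extend: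
  fixes X :: "('a, 'b) module" and Y :: "('a, 'c) module" and I :: "('a, 'd) module"
  assumes I: "injective_module TYPE('v) R I" and X: "Module.module R X" and Y: "Module.module R Y"
    and small: "carrier X \<lesssim> (UNIV :: 'v set)" "carrier Y \<lesssim> (UNIV :: 'v set)"
    and i: "i \<in> module_homs R X Y" "inj_on i (carrier X)" and f: "f \<in> module_homs R X I"
  shows "\<exists>g\<in>module_homs R Y I. \<forall>x\<in>carrier X. g (i x) = f x"
proof -
  obtain X' :: "('a, 'v) module" and \<phi> where X': "Module.module R X'" and \<phi>: "\<phi> \<in> module_homs R X X'"
    and b: "bij_betw \<phi> (carrier X) (carrier X')" using transport_module[OF X small(1)] by blast
  obtain Y' :: "('a, 'v) module" and \<psi> where Y': "Module.module R Y'" and \<psi>: "\<psi> \<in> module_homs R Y Y'"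
    and b': "bij_betw \<psi> (carrier Y) (carrier Y')" using transport_module[OF Y small(2)] by blast
  define \<phi>' where "\<phi>' = inv_into (carrier X) \<phi>"
  have \<phi>': "\<phi>' \<in> module_homs R X' X" unfolding \<phi>'_def by (rule hom_inverse[OF \<phi> X b])
  have inv: "\<phi>' (\<phi> x) = x" if "x \<in> carrier X" for x
    unfolding \<phi>'_def by (rule inv_into_f_f[OF bij_betw_imp_inj_on[OF b] that])
  let ?j = "\<lambda>x. \<psi> (i (\<phi>' x))"
  have j: "?j \<in> module_homs R X' Y'" using hom_comp[OF hom_comp[OF \<phi>' i(1)] \<psi>] .
  have "inj_on ?j (carrier X')"
  proof (rule inj_onI)
    fix x y assume xy: "x \<in> carrier X'" "y \<in> carrier X'" and eq: "?j x = ?j y"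
    have "i (\<phi>' x) = i (\<phi>' y)"
      by (rule inj_onD[OF bij_betw_imp_inj_on[OF b'] eq]) (use xy hom_closed[OF \<phi>'] hom_closed[OF i(1)] in auto)
    then have "\<phi>' x = \<phi>' y" by (rule inj_onD[OF i(2)]) (use xy hom_closed[OF \<phi>'] in auto)
    then show "x = y" using inj_on_inv_into[of "carrier X'" \<phi> "carrier X"] b xy
      unfolding \<phi>'_def bij_betw_def by (metis inj_onD order_refl)
  qed
  then have "\<exists>g\<in>module_homs R Y' I. \<forall>x\<in>carrier X'. g (?j x) = f (\<phi>' x)"
    using I X' Y' j hom_comp[OF \<phi>' f] unfolding injective_module_def by blast
  then obtain g where g: "g \<in> module_homs R Y' I" "\<And>x. x \<in> carrier X' \<Longrightarrow> g (?j x) = f (\<phi>' x)" by blast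
  have "g (\<psi> (i x)) = f x" if "x \<in> carrier X" for x
    using g(2)[OF hom_closed[OF \<phi> that]] inv[OF that] by simp
  then show ?thesis using hom_comp[OF \<psi> g(1)] by (intro bexI[of _ "\<lambda>y. g (\<psi> y)"]) auto
qed

subsection \<open>Cardinalities\<close>

lemma infinite_square_lepoll: "infinite A \<Longrightarrow> A \<times> A \<lesssim> A"
  using card_of_Times_same_infinite[of A] eqpoll_iff_card_of_ordIso[of "A \<times> A" A] eqpoll_imp_lepoll by blast

lemma nat_lepoll_hahn_ring: "(UNIV :: nat set) \<lesssim> carrier hahn_ring"
proof -
  have "inj (\<lambda>n::nat. coeff (tpow (real n)))"
    by (rule injI) (metis coeff_inject val_tpow of_nat_eq_iff)
  moreover have "range (\<lambda>n::nat. coeff (tpow (real n))) \<subseteq> carrier hahn_ring" by (auto simp: integral_def)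
  ultimately show ?thesis unfolding lepoll_def by blast
qed

lemma infinite_hahn_ring: "infinite (carrier hahn_ring)"
  using nat_lepoll_hahn_ring by (simp add: infinite_le_lepoll)

lemma lepoll_hahn_ring_times: "A \<lesssim> carrier hahn_ring \<Longrightarrow> B \<lesssim> carrier hahn_ring \<Longrightarrow> A \<times> B \<lesssim> carrier hahn_ring"
  using times_lepoll_mono infinite_square_lepoll[OF infinite_hahn_ring] lepoll_trans by blast

text \<open>Multiplication by t^n with n at least - val a makes \<open>a\<close> integral, and the
  pair of \<open>n\<close> and the product determines \<open>a\<close>; so K is no larger than
  countably many copies of A.\<close>

lemma hahn_lepoll_hahn_ring: "(A :: hahn set) \<lesssim> carrier hahn_ring"
proof -
  define f where "f a = (nat \<lceil>- val a\<rceil>, coeff (tpow (nat \<lceil>- val a\<rceil>) * a))" for a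
  have "inj f"
    by (rule injI) (auto simp: f_def coeff_inject)
  moreover have "integral (tpow (nat \<lceil>- val a\<rceil>) * a)" for a
  proof (cases "a = 0")
    case False
    have "- val a \<le> nat \<lceil>- val a\<rceil>" by (rule real_nat_ceiling_ge)
    then show ?thesis using False by (simp add: integral_def val_mult)
  qed simp
  ultimately have "A \<lesssim> (UNIV :: nat set) \<times> carrier hahn_ring"
    unfolding lepoll_def by (intro exI[of _ f]) (auto simp: f_def inj_on_def)
  then show ?thesis using lepoll_hahn_ring_times[OF nat_lepoll_hahn_ring lepoll_refl] lepoll_trans by blast
qed

text \<open>A sum of two sets of at most the size of A is again at most that large, since A is
  infinite. Hence every universe that contains A has a copy of each multibasic module.\<close>

lemma multibasic_lepoll:
  assumes "multibasic_module hahn_ring M"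
  shows "carrier M \<lesssim> carrier hahn_ring"
proof -
  interpret M: hmodule M by (rule hmoduleI[OF multibasic_module_module[OF assms]])
  show ?thesis
    using M.presented_if_multibasic[OF assms]
  proof (induction rule: M.presented_induct)
    case zero
    have "{\<zero>\<^bsub>M\<^esub>} \<lesssim> carrier hahn_ring" unfolding lepoll_def
      by (intro exI[of _ "\<lambda>_. \<zero>\<^bsub>hahn_ring\<^esub>"]) (simp add: hahn_ring_simps)
    then show ?case .
  next
    case (add T J h)
    have "{t \<oplus>\<^bsub>M\<^esub> h a | t a. t \<in> T \<and> a \<in> J} = (\<lambda>(t, a). t \<oplus>\<^bsub>M\<^esub> h a) ` (T \<times> J)" by auto
    then have "{t \<oplus>\<^bsub>M\<^esub> h a | t a. t \<in> T \<and> a \<in> J} \<lesssim> T \<times> J" by (simp add: image_lepoll)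
    then show ?case using lepoll_hahn_ring_times[OF add.IH hahn_lepoll_hahn_ring] lepoll_trans by blast
  qed
qed

section \<open>Full subcategories of a module category\<close>

lemma restrict_hom:
  assumes "f \<in> module_homs R M N" "Module.module R M"
  shows "restrict f (carrier M) \<in> module_homs R M N"
proof -
  interpret M: Module.module R M by fact
  show ?thesis
    by (rule module_homsI) (auto simp: hom_closed[OF assms(1)] hom_add[OF assms(1)] hom_smult[OF assms(1)])
qed

lemma
  assumes N: "Module.module R N"
  shows zero_hom: "(\<lambda>x. \<zero>\<^bsub>N\<^esub>) \<in> module_homs R M N"
    and add_hom: "f \<in> module_homs R M N \<Longrightarrow> g \<in> module_homs R M N \<Longrightarrow> (\<lambda>x. f x \<oplus>\<^bsub>N\<^esub> g x) \<in> module_homs R M N"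
    and minus_hom: "Module.module R M \<Longrightarrow> f \<in> module_homs R M N \<Longrightarrow> (\<lambda>x. \<ominus>\<^bsub>N\<^esub> f x) \<in> module_homs R M N"
proof -
  interpret N: Module.module R N by fact
  show "(\<lambda>x. \<zero>\<^bsub>N\<^esub>) \<in> module_homs R M N" by (rule module_homsI) auto
  show "(\<lambda>x. f x \<oplus>\<^bsub>N\<^esub> g x) \<in> module_homs R M N" if "f \<in> module_homs R M N" "g \<in> module_homs R M N"
    by (rule module_homsI)
      (simp_all add: hom_closed[OF that(1)] hom_closed[OF that(2)] hom_add[OF that(1)] hom_add[OF that(2)]
        hom_smult[OF that(1)] hom_smult[OF that(2)] N.smult_r_distr N.a_ac)
  show "(\<lambda>x. \<ominus>\<^bsub>N\<^esub> f x) \<in> module_homs R M N" if "Module.module R M" "f \<in> module_homs R M N"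
    by (rule module_homsI)
      (simp_all add: hom_closed[OF that(2)] hom_add[OF that(2)] hom_smult[OF that(2)] N.minus_add N.smult_r_minus)
qed

text \<open>Quotients and products are required only up to isomorphism, since their usual
  constructions have elements of another type than \<open>'u\<close>; submodules stay within the
  type.\<close>

locale module_subcategory =
  fixes R :: "('a, 'r) ring_scheme" and P :: "('a, 'u) module \<Rightarrow> bool"
  assumes P_module: "P M \<Longrightarrow> Module.module R M"
    and P_nonempty: "\<exists>M. P M"
    and P_sub: "P M \<Longrightarrow> submodule N R M \<Longrightarrow> P (submodule_as_module M N)"
    and P_quot: "P M \<Longrightarrow> submodule N R M \<Longrightarrow> \<exists>Q p. P Q \<and> p \<in> module_homs R M Q \<and>
      p ` carrier M = carrier Q \<and> (\<forall>x\<in>carrier M. p x = \<zero>\<^bsub>Q\<^esub> \<longleftrightarrow> x \<in> N)"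
    and P_prod: "P M \<Longrightarrow> P M' \<Longrightarrow> \<exists>B \<phi>. P B \<and> \<phi> \<in> module_homs R (prod_module M M') B \<and>
      bij_betw \<phi> (carrier M \<times> carrier M') (carrier B)"
begin

definition C :: "(('a, 'u) module, 'u \<Rightarrow> 'u) preadd_category" where
  "C = full_subcategory (module_category TYPE('u) R) P"

lemma C_simps [simp]:
  "X \<in> obj C \<longleftrightarrow> P X"
  "f \<in> arr C X Y \<longleftrightarrow> f \<in> module_homs R X Y \<and> f \<in> extensional (carrier X)"
  "idn C X = (\<lambda>x\<in>carrier X. x)"
  "cmp C X Y Z g f = (\<lambda>x\<in>carrier X. g (f x))"
  "arr_add C X Y f f' = (\<lambda>x\<in>carrier X. f x \<oplus>\<^bsub>Y\<^esub> f' x)"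
  "arr_zero C X Y = (\<lambda>x\<in>carrier X. \<zero>\<^bsub>Y\<^esub>)"
  using P_module by (auto simp: C_def full_subcategory_def module_category_def compose_def)

lemma arr_restrict: "P X \<Longrightarrow> f \<in> module_homs R X Y \<Longrightarrow> restrict f (carrier X) \<in> arr C X Y"
  by (simp add: restrict_hom P_module)

lemma arr_eqI: "f \<in> arr C X Y \<Longrightarrow> g \<in> arr C X Y \<Longrightarrow> (\<And>x. x \<in> carrier X \<Longrightarrow> f x = g x) \<Longrightarrow> f = g"
  by (auto intro: extensionalityI)

lemma arr_hom: "f \<in> arr C X Y \<Longrightarrow> f \<in> module_homs R X Y"
  by simp

lemma arr_closed: "f \<in> arr C X Y \<Longrightarrow> x \<in> carrier X \<Longrightarrow> f x \<in> carrier Y"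
  using hom_closed by (metis arr_hom)

lemma arr_zero_closed: "P X \<Longrightarrow> f \<in> arr C X Y \<Longrightarrow> P Y \<Longrightarrow> f \<zero>\<^bsub>X\<^esub> = \<zero>\<^bsub>Y\<^esub>"
  using hom_zero[OF arr_hom] P_module by blast

lemma restrict_eq_iff: "(\<lambda>x\<in>A. f x) = (\<lambda>x\<in>A. g x) \<longleftrightarrow> (\<forall>x\<in>A. f x = g x)"
  by (metis restrict_apply' restrict_ext)

lemma is_preadditive: "preadditive_category C"
proof (intro preadditive_category.intro category.intro preadditive_category_axioms.intro)
  fix X Y Z assume obj: "X \<in> obj C" "Y \<in> obj C" "Z \<in> obj C"
  fix f g assume f: "f \<in> arr C X Y" and g: "g \<in> arr C Y Z"
  have "(\<lambda>x. g (f x)) \<in> module_homs R X Z" by (rule hom_comp[OF arr_hom[OF f] arr_hom[OF g]])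
  then show "cmp C X Y Z g f \<in> arr C X Z" unfolding C_simps(4) using arr_restrict obj by simp
next
  fix X assume "X \<in> obj C"
  moreover have "(\<lambda>x. x) \<in> module_homs R X X" by (rule module_homsI) auto
  ultimately show "idn C X \<in> arr C X X" unfolding C_simps(3) using arr_restrict by simp
next
  fix X Y f assume "f \<in> arr C X Y"
  then show "cmp C X X Y f (idn C X) = f"
    by (intro extensionalityI[of _ "carrier X"]) auto
next
  fix X Y f assume f: "f \<in> arr C X Y"
  then show "cmp C X Y Y (idn C Y) f = f"
    by (intro extensionalityI[of _ "carrier X"]) (auto dest: arr_closed[OF f])
next
  fix W X Y Z f g h assume "f \<in> arr C W X" "g \<in> arr C X Y" "h \<in> arr C Y Z"
  then show "cmp C W X Z (cmp C X Y Z h g) f = cmp C W Y Z h (cmp C W X Y g f)"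
    using arr_closed[of f W X] by (auto simp: restrict_eq_iff)
next
  fix X Y assume "X \<in> obj C" "Y \<in> obj C"
  then have PX: "P X" and X: "Module.module R X" and Y: "Module.module R Y" using P_module by auto
  interpret Y: Module.module R Y by fact
  have cl: "f x \<in> carrier Y" if "f \<in> arr C X Y" "x \<in> carrier X" for f x using arr_closed that .
  show "comm_group (arr_group C X Y)"
  proof (rule comm_groupI)
    show "x \<otimes>\<^bsub>arr_group C X Y\<^esub> y \<in> carrier (arr_group C X Y)"
      if "x \<in> carrier (arr_group C X Y)" "y \<in> carrier (arr_group C X Y)" for x y
      using arr_restrict[OF PX add_hom[OF Y arr_hom arr_hom]] that by (simp add: arr_group_def)
    show "\<one>\<^bsub>arr_group C X Y\<^esub> \<in> carrier (arr_group C X Y)"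
      using arr_restrict[OF PX zero_hom[OF Y]] by (simp add: arr_group_def)
    show "x \<otimes>\<^bsub>arr_group C X Y\<^esub> y \<otimes>\<^bsub>arr_group C X Y\<^esub> z = x \<otimes>\<^bsub>arr_group C X Y\<^esub> (y \<otimes>\<^bsub>arr_group C X Y\<^esub> z)"
      if "x \<in> carrier (arr_group C X Y)" "y \<in> carrier (arr_group C X Y)" "z \<in> carrier (arr_group C X Y)" for x y z
      using that cl[of x] cl[of y] cl[of z] by (simp add: arr_group_def restrict_eq_iff Y.a_assoc)
    show "x \<otimes>\<^bsub>arr_group C X Y\<^esub> y = y \<otimes>\<^bsub>arr_group C X Y\<^esub> x"
      if "x \<in> carrier (arr_group C X Y)" "y \<in> carrier (arr_group C X Y)" for x y
      using that cl[of x] cl[of y] by (simp add: arr_group_def restrict_eq_iff Y.a_comm)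
    show "\<one>\<^bsub>arr_group C X Y\<^esub> \<otimes>\<^bsub>arr_group C X Y\<^esub> x = x" if "x \<in> carrier (arr_group C X Y)" for x
      using that cl[of x] by (intro extensionalityI[of _ "carrier X"]) (auto simp: arr_group_def)
    show "\<exists>y\<in>carrier (arr_group C X Y). y \<otimes>\<^bsub>arr_group C X Y\<^esub> x = \<one>\<^bsub>arr_group C X Y\<^esub>"
      if x: "x \<in> carrier (arr_group C X Y)" for x
    proof (rule bexI)
      have xa: "x \<in> arr C X Y" using x by (simp add: arr_group_def)
      show "restrict (\<lambda>z. \<ominus>\<^bsub>Y\<^esub> x z) (carrier X) \<in> carrier (arr_group C X Y)"
        using arr_restrict[OF PX minus_hom[OF Y X arr_hom[OF xa]]] by (simp add: arr_group_def)
      show "restrict (\<lambda>z. \<ominus>\<^bsub>Y\<^esub> x z) (carrier X) \<otimes>\<^bsub>arr_group C X Y\<^esub> x = \<one>\<^bsub>arr_group C X Y\<^esub>"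
        using cl[OF xa] by (simp add: arr_group_def restrict_eq_iff Y.l_neg)
    qed
  qed
next
  fix X Y Z f f' g assume "f \<in> arr C X Y" "f' \<in> arr C X Y" and g: "g \<in> arr C Y Z"
  then show "cmp C X Y Z g (arr_add C X Y f f') = arr_add C X Z (cmp C X Y Z g f) (cmp C X Y Z g f')"
    using arr_closed[of f X Y] arr_closed[of f' X Y] by (simp add: restrict_eq_iff hom_add[OF arr_hom[OF g]])
next
  fix X Y Z f g g' assume "f \<in> arr C X Y" "g \<in> arr C Y Z" "g' \<in> arr C Y Z"
  then show "cmp C X Y Z (arr_add C Y Z g g') f = arr_add C X Z (cmp C X Y Z g f) (cmp C X Y Z g' f)"
    using arr_closed[of f X Y] by (simp add: restrict_eq_iff)
qed

section \<open>Kernels, cokernels, monomorphisms and epimorphisms\<close>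

lemma kernel_inclusion:
  assumes X: "P X" and Y: "P Y" and f: "f \<in> arr C X Y"
  defines "K \<equiv> submodule_as_module X {x \<in> carrier X. f x = \<zero>\<^bsub>Y\<^esub>}"
  shows "P K" "(\<lambda>x\<in>carrier K. x) \<in> arr C K X" "is_kernel C X Y f K (\<lambda>x\<in>carrier K. x)"
proof -
  note mX = P_module[OF X] and mY = P_module[OF Y]
  interpret X: Module.module R X by (rule mX)
  have sub: "submodule {x \<in> carrier X. f x = \<zero>\<^bsub>Y\<^esub>} R X" by (rule kernel_submodule[OF arr_hom[OF f] mX mY])
  show K: "P K" unfolding K_def by (rule P_sub[OF X sub])
  have cK: "carrier K = {x \<in> carrier X. f x = \<zero>\<^bsub>Y\<^esub>}" by (simp add: K_def)
  have "(\<lambda>x. x) \<in> module_homs R K X" by (rule module_homsI) (auto simp: K_def)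
  then show k: "(\<lambda>x\<in>carrier K. x) \<in> arr C K X" by (rule arr_restrict[OF K])
  show "is_kernel C X Y f K (\<lambda>x\<in>carrier K. x)"
    unfolding is_kernel_def
  proof (intro conjI ballI impI)
    show "K \<in> obj C" using K by simp
    show "cmp C K X Y f (\<lambda>x\<in>carrier K. x) = arr_zero C K Y" by (auto simp: restrict_eq_iff cK)
    fix W h assume W: "W \<in> obj C" and h: "h \<in> arr C W X" and z: "cmp C W X Y f h = arr_zero C W Y"
    have hK: "h w \<in> carrier K" if "w \<in> carrier W" for w
      using z that arr_closed[OF h that] by (simp add: restrict_eq_iff cK)
    have hh: "h \<in> arr C W K"
    proof -
      have "h \<in> module_homs R W K"
        by (rule module_homsI) (use hK hom_add[OF arr_hom[OF h]] hom_smult[OF arr_hom[OF h]] in \<open>auto simp: K_def\<close>)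
      then show ?thesis using h by simp
    qed
    show "\<exists>!u. u \<in> arr C W K \<and> cmp C W K X (\<lambda>x\<in>carrier K. x) u = h"
    proof (rule ex1I[of _ h])
      have "cmp C W K X (\<lambda>x\<in>carrier K. x) h = h"
        by (rule extensionalityI[of _ "carrier W"]) (use h hK in auto)
      then show "h \<in> arr C W K \<and> cmp C W K X (\<lambda>x\<in>carrier K. x) h = h" using hh by blast
      fix u assume u: "u \<in> arr C W K \<and> cmp C W K X (\<lambda>x\<in>carrier K. x) u = h"
      then have "u \<in> arr C W K" by blast
      then show "u = h"
      proof (rule arr_eqI[OF _ hh])
        fix w assume w: "w \<in> carrier W"
        have "h w = cmp C W K X (\<lambda>x\<in>carrier K. x) u w" using u by simp
        then show "u w = h w" using w arr_closed[OF \<open>u \<in> arr C W K\<close> w] by simp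
      qed
    qed
  qed (rule k)
qed

text \<open>A monomorphism cannot distinguish the inclusion of its kernel from the zero map, and the
  kernel is an object because submodules stay in the category.\<close>

lemma mono_iff_inj:
  assumes X: "P X" and Y: "P Y"
  shows "mono_arr C X Y f \<longleftrightarrow> f \<in> arr C X Y \<and> inj_on f (carrier X)"
proof
  assume m: "mono_arr C X Y f"
  then have f: "f \<in> arr C X Y" by (simp add: mono_arr_def)
  note mX = P_module[OF X] and mY = P_module[OF Y]
  interpret X: Module.module R X by (rule mX)
  define K where "K = submodule_as_module X {x \<in> carrier X. f x = \<zero>\<^bsub>Y\<^esub>}"
  note ker = kernel_inclusion[OF X Y f, folded K_def]
  have z: "(\<lambda>x\<in>carrier K. \<zero>\<^bsub>X\<^esub>) \<in> arr C K X" by (rule arr_restrict[OF ker(1) zero_hom[OF mX]])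
  have "cmp C K X Y f (\<lambda>x\<in>carrier K. x) = cmp C K X Y f (\<lambda>x\<in>carrier K. \<zero>\<^bsub>X\<^esub>)"
    using arr_zero_closed[OF X f Y] by (auto simp: restrict_eq_iff K_def)
  then have "(\<lambda>x\<in>carrier K. x) = (\<lambda>x\<in>carrier K. \<zero>\<^bsub>X\<^esub>)"
    using m ker(1,2) z unfolding mono_arr_def by (metis C_simps(1))
  then have "\<forall>x\<in>carrier X. f x = \<zero>\<^bsub>Y\<^esub> \<longrightarrow> x = \<zero>\<^bsub>X\<^esub>" by (simp add: restrict_eq_iff K_def)
  then show "f \<in> arr C X Y \<and> inj_on f (carrier X)" using f hom_inj_iff[OF arr_hom[OF f] mX mY] by blast
next
  assume f: "f \<in> arr C X Y \<and> inj_on f (carrier X)"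
  show "mono_arr C X Y f"
    unfolding mono_arr_def
  proof (intro conjI ballI impI)
    fix W g h assume "g \<in> arr C W X" "h \<in> arr C W X" and eq: "cmp C W X Y f g = cmp C W X Y f h"
    then show "g = h"
    proof (intro arr_eqI[of g W X h])
      fix w assume w: "w \<in> carrier W"
      then have "f (g w) = f (h w)" using eq by (simp add: restrict_eq_iff)
      then show "g w = h w"
        using f arr_closed[OF \<open>g \<in> arr C W X\<close> w] arr_closed[OF \<open>h \<in> arr C W X\<close> w] by (auto dest: inj_onD)
    qed
  qed (use f in blast)
qed

lemma quotient_of_image:
  assumes X: "P X" and Y: "P Y" and f: "f \<in> arr C X Y"
  shows "\<exists>Q p. P Q \<and> p \<in> arr C Y Q \<and> p ` carrier Y = carrier Q \<and>
    (\<forall>y\<in>carrier Y. p y = \<zero>\<^bsub>Q\<^esub> \<longleftrightarrow> y \<in> f ` carrier X)"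
proof -
  note sub = image_submodule[OF arr_hom[OF f] P_module[OF X] P_module[OF Y]]
  obtain Q p where "P Q" "p \<in> module_homs R Y Q" "p ` carrier Y = carrier Q"
    "\<forall>y\<in>carrier Y. p y = \<zero>\<^bsub>Q\<^esub> \<longleftrightarrow> y \<in> f ` carrier X" using P_quot[OF Y sub] by metis
  moreover from this have "restrict p (carrier Y) \<in> arr C Y Q" using arr_restrict[OF Y] by blast
  ultimately show ?thesis by (intro exI[of _ Q] exI[of _ "restrict p (carrier Y)"]) auto
qed

text \<open>Dually, an epimorphism is tested on the projection to the quotient by its image and the
  zero map.\<close>

lemma epi_iff_surj:
  assumes X: "P X" and Y: "P Y"
  shows "epi_arr C X Y f \<longleftrightarrow> f \<in> arr C X Y \<and> f ` carrier X = carrier Y"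
proof
  assume e: "epi_arr C X Y f"
  then have f: "f \<in> arr C X Y" by (simp add: epi_arr_def)
  obtain Q p where Q: "P Q" "p \<in> arr C Y Q" "\<forall>y\<in>carrier Y. p y = \<zero>\<^bsub>Q\<^esub> \<longleftrightarrow> y \<in> f ` carrier X"
    using quotient_of_image[OF X Y f] by metis
  have z: "(\<lambda>x\<in>carrier Y. \<zero>\<^bsub>Q\<^esub>) \<in> arr C Y Q" by (rule arr_restrict[OF Y zero_hom[OF P_module[OF Q(1)]]])
  have "cmp C X Y Q p f = cmp C X Y Q (\<lambda>x\<in>carrier Y. \<zero>\<^bsub>Q\<^esub>) f"
    using arr_closed[OF f] Q(3) by (simp add: restrict_eq_iff)
  then have "p = (\<lambda>x\<in>carrier Y. \<zero>\<^bsub>Q\<^esub>)" using e Q(1,2) z unfolding epi_arr_def by (metis C_simps(1))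
  then have "carrier Y \<subseteq> f ` carrier X" using Q(3) by auto
  then show "f \<in> arr C X Y \<and> f ` carrier X = carrier Y" using f arr_closed[OF f] by blast
next
  assume f: "f \<in> arr C X Y \<and> f ` carrier X = carrier Y"
  show "epi_arr C X Y f"
    unfolding epi_arr_def
  proof (intro conjI ballI impI)
    fix Z g h assume gh: "g \<in> arr C Y Z" "h \<in> arr C Y Z" and eq: "cmp C X Y Z g f = cmp C X Y Z h f"
    show "g = h"
    proof (rule arr_eqI[OF gh])
      fix y assume "y \<in> carrier Y"
      then have "y \<in> f ` carrier X" using f by simp
      then obtain x where "x \<in> carrier X" "y = f x" by (rule imageE)
      then show "g y = h y" using eq by (simp add: restrict_eq_iff)
    qed
  qed (use f in blast)
qed

text \<open>Stated for any exact pair with \<open>p\<close> surjective, so that it gives both the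
  existence of cokernels and the fact that an epimorphism is the cokernel of its kernel.\<close>

lemma cokernel_of_surjection:
  assumes X: "P X" and Y: "P Y" and Q: "P Q" and f: "f \<in> arr C X Y" and p: "p \<in> arr C Y Q" "p ` carrier Y = carrier Q"
    and ker: "\<And>y. y \<in> carrier Y \<Longrightarrow> p y = \<zero>\<^bsub>Q\<^esub> \<longleftrightarrow> y \<in> f ` carrier X"
  shows "is_cokernel C X Y f Q p"
  unfolding is_cokernel_def
proof (intro conjI ballI impI)
  show "Q \<in> obj C" using Q by simp
  show "cmp C X Y Q p f = arr_zero C X Q" using ker arr_closed[OF f] by (simp add: restrict_eq_iff)
  fix W h assume W: "W \<in> obj C" and h: "h \<in> arr C Y W" and z: "cmp C X Y W h f = arr_zero C X W"
  have hz: "h (f x) = \<zero>\<^bsub>W\<^esub>" if "x \<in> carrier X" for x using z that by (simp add: restrict_eq_iff)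
  have "\<exists>g\<in>module_homs R Q W. \<forall>y\<in>carrier Y. g (p y) = h y"
  proof (rule factor_through_surjection[OF _ _ _ arr_hom[OF p(1)] p(2) arr_hom[OF h]])
    show "h y = \<zero>\<^bsub>W\<^esub>" if "y \<in> carrier Y" "p y = \<zero>\<^bsub>Q\<^esub>" for y
    proof -
      have "y \<in> f ` carrier X" using ker that by blast
      then show ?thesis using hz by auto
    qed
  qed (use P_module Y Q W in auto)
  then obtain g where g: "g \<in> module_homs R Q W" "\<And>y. y \<in> carrier Y \<Longrightarrow> g (p y) = h y" by blast
  let ?g = "restrict g (carrier Q)"
  have ga: "?g \<in> arr C Q W" by (rule arr_restrict[OF Q g(1)])
  show "\<exists>!u. u \<in> arr C Q W \<and> cmp C Y Q W u p = h"
  proof (rule ex1I[of _ ?g])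
    have "cmp C Y Q W ?g p = h"
      by (rule extensionalityI[of _ "carrier Y"]) (use h g(2) arr_closed[OF p(1)] in auto)
    then show "?g \<in> arr C Q W \<and> cmp C Y Q W ?g p = h" using ga by blast
    fix u assume u: "u \<in> arr C Q W \<and> cmp C Y Q W u p = h"
    then have ua: "u \<in> arr C Q W" by blast
    show "u = ?g"
    proof (rule arr_eqI[OF ua ga])
      fix q assume q: "q \<in> carrier Q"
      then have "q \<in> p ` carrier Y" using p(2) by simp
      then obtain y where y: "y \<in> carrier Y" "q = p y" by (rule imageE)
      have "h y = cmp C Y Q W u p y" using u by simp
      then show "u q = ?g q" using y q g(2)[OF y(1)] by simp
    qed
  qed
qed (use p in blast)

text \<open>As \<open>h\<close> lands in the image of the injective \<open>f\<close>, the
  factorisation must be \<open>h\<close> followed by the inverse of \<open>f\<close>; its linearity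
  is checked after applying \<open>f\<close>.\<close>

lemma kernel_of_injection:
  assumes X: "P X" and Y: "P Y" and Q: "P Q" and f: "f \<in> arr C X Y" "inj_on f (carrier X)" and p: "p \<in> arr C Y Q"
    and ker: "\<And>y. y \<in> carrier Y \<Longrightarrow> p y = \<zero>\<^bsub>Q\<^esub> \<longleftrightarrow> y \<in> f ` carrier X"
  shows "is_kernel C Y Q p X f"
  unfolding is_kernel_def
proof (intro conjI ballI impI)
  interpret X: Module.module R X by (rule P_module[OF X])
  show "X \<in> obj C" using X by simp
  show "cmp C X Y Q p f = arr_zero C X Q" using ker arr_closed[OF f(1)] by (simp add: restrict_eq_iff)
  fix W h assume W: "W \<in> obj C" and h: "h \<in> arr C W Y" and z: "cmp C W Y Q p h = arr_zero C W Q"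
  interpret W: Module.module R W using W P_module by simp
  let ?u = "\<lambda>w\<in>carrier W. inv_into (carrier X) f (h w)"
  have u: "?u w \<in> carrier X" "f (?u w) = h w" if w: "w \<in> carrier W" for w
  proof -
    have "p (h w) = \<zero>\<^bsub>Q\<^esub>" using z w by (simp add: restrict_eq_iff)
    then have "h w \<in> f ` carrier X" using ker arr_closed[OF h w] by blast
    then show "?u w \<in> carrier X" "f (?u w) = h w" using w by (auto simp: inv_into_into f_inv_into_f)
  qed
  have inj: "x = y" if "x \<in> carrier X" "y \<in> carrier X" "f x = f y" for x y
    using inj_onD[OF f(2) that(3,1,2)] .
  have "?u \<in> module_homs R W X"
  proof (rule module_homsI)
    show "?u w \<in> carrier X" if "w \<in> carrier W" for w using u(1)[OF that] .
    show "?u (v \<oplus>\<^bsub>W\<^esub> w) = ?u v \<oplus>\<^bsub>X\<^esub> ?u w" if vw: "v \<in> carrier W" "w \<in> carrier W" for v w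
    proof (rule inj)
      show "?u (v \<oplus>\<^bsub>W\<^esub> w) \<in> carrier X" using vw by (intro u(1)) simp
      show "?u v \<oplus>\<^bsub>X\<^esub> ?u w \<in> carrier X" using u(1)[OF vw(1)] u(1)[OF vw(2)] by (rule X.a_closed)
      have "f (?u v \<oplus>\<^bsub>X\<^esub> ?u w) = h v \<oplus>\<^bsub>Y\<^esub> h w"
        using hom_add[OF arr_hom[OF f(1)] u(1)[OF vw(1)] u(1)[OF vw(2)]] u(2)[OF vw(1)] u(2)[OF vw(2)] by metis
      also have "\<dots> = f (?u (v \<oplus>\<^bsub>W\<^esub> w))"
        using u(2)[of "v \<oplus>\<^bsub>W\<^esub> w"] hom_add[OF arr_hom[OF h] vw] W.a_closed[OF vw] by metis
      finally show "f (?u (v \<oplus>\<^bsub>W\<^esub> w)) = f (?u v \<oplus>\<^bsub>X\<^esub> ?u w)" ..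
    qed
    show "?u (r \<odot>\<^bsub>W\<^esub> w) = r \<odot>\<^bsub>X\<^esub> ?u w" if r: "r \<in> carrier R" and w: "w \<in> carrier W" for r w
    proof (rule inj)
      show "?u (r \<odot>\<^bsub>W\<^esub> w) \<in> carrier X" using r w by (intro u(1)) simp
      show "r \<odot>\<^bsub>X\<^esub> ?u w \<in> carrier X" using r u(1)[OF w] by (rule X.smult_closed)
      have "f (r \<odot>\<^bsub>X\<^esub> ?u w) = r \<odot>\<^bsub>Y\<^esub> h w"
        using hom_smult[OF arr_hom[OF f(1)] r u(1)[OF w]] u(2)[OF w] by metis
      also have "\<dots> = f (?u (r \<odot>\<^bsub>W\<^esub> w))"
        using u(2)[of "r \<odot>\<^bsub>W\<^esub> w"] hom_smult[OF arr_hom[OF h] r w] W.smult_closed[OF r w] by metis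
      finally show "f (?u (r \<odot>\<^bsub>W\<^esub> w)) = f (r \<odot>\<^bsub>X\<^esub> ?u w)" ..
    qed
  qed
  then have ua: "?u \<in> arr C W X" by simp
  show "\<exists>!u. u \<in> arr C W X \<and> cmp C W X Y f u = h"
  proof (rule ex1I[of _ ?u])
    have "cmp C W X Y f ?u = h"
      by (rule extensionalityI[of _ "carrier W"]) (use h u(2) in auto)
    then show "?u \<in> arr C W X \<and> cmp C W X Y f ?u = h" using ua by blast
    fix v assume v: "v \<in> arr C W X \<and> cmp C W X Y f v = h"
    then have va: "v \<in> arr C W X" by blast
    show "v = ?u"
    proof (rule arr_eqI[OF va ua])
      fix w assume w: "w \<in> carrier W"
      have "h w = cmp C W X Y f v w" using v by simp
      then have "f (v w) = f (?u w)" using w u(2)[OF w] by simp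
      then show "v w = ?u w" by (rule inj[OF arr_closed[OF va w] u(1)[OF w]])
    qed
  qed
qed (use f in blast)

lemma exists_biproduct:
  assumes X: "P X" and Y: "P Y"
  shows "\<exists>B i j p q. is_biproduct C X Y B i j p q"
proof -
  interpret X: Module.module R X by (rule P_module[OF X])
  interpret Y: Module.module R Y by (rule P_module[OF Y])
  let ?D = "prod_module X Y"
  have mD: "Module.module R ?D" by (rule module_prod[OF P_module[OF X] P_module[OF Y]])
  obtain B \<phi> where B: "P B" and \<phi>: "\<phi> \<in> module_homs R ?D B" and bij: "bij_betw \<phi> (carrier ?D) (carrier B)"
    using P_prod[OF X Y] by auto
  define \<psi> where "\<psi> = inv_into (carrier ?D) \<phi>"
  have \<psi>: "\<psi> \<in> module_homs R B ?D" unfolding \<psi>_def by (rule hom_inverse[OF \<phi> mD bij])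
  have \<psi>\<phi>: "\<psi> (\<phi> d) = d" if "d \<in> carrier ?D" for d
    unfolding \<psi>_def by (rule inv_into_f_f[OF bij_betw_imp_inj_on[OF bij] that])
  have \<phi>\<psi>: "\<phi> (\<psi> b) = b" if "b \<in> carrier B" for b
    unfolding \<psi>_def using that bij_betw_imp_surj_on[OF bij] f_inv_into_f[of b \<phi> "carrier ?D"] by simp
  have "(\<lambda>x. (x, \<zero>\<^bsub>Y\<^esub>)) \<in> module_homs R X ?D" by (rule module_homsI) auto
  note i = arr_restrict[OF X hom_comp[OF this \<phi>]]
  have "(\<lambda>y. (\<zero>\<^bsub>X\<^esub>, y)) \<in> module_homs R Y ?D" by (rule module_homsI) auto
  note j = arr_restrict[OF Y hom_comp[OF this \<phi>]]
  have "fst \<in> module_homs R ?D X" by (rule module_homsI) auto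
  note p = arr_restrict[OF B hom_comp[OF \<psi> this]]
  have "snd \<in> module_homs R ?D Y" by (rule module_homsI) auto
  note q = arr_restrict[OF B hom_comp[OF \<psi> this]]
  have \<phi>c: "\<phi> (x, y) \<in> carrier B" if "x \<in> carrier X" "y \<in> carrier Y" for x y using hom_closed[OF \<phi>] that by simp
  have \<psi>c: "fst (\<psi> b) \<in> carrier X" "snd (\<psi> b) \<in> carrier Y" if "b \<in> carrier B" for b
    using hom_closed[OF \<psi> that] by auto
  have sum: "\<phi> (fst (\<psi> b), \<zero>\<^bsub>Y\<^esub>) \<oplus>\<^bsub>B\<^esub> \<phi> (\<zero>\<^bsub>X\<^esub>, snd (\<psi> b)) = b" if b: "b \<in> carrier B" for b
    using hom_add[OF \<phi>, of "(fst (\<psi> b), \<zero>\<^bsub>Y\<^esub>)" "(\<zero>\<^bsub>X\<^esub>, snd (\<psi> b))"] \<psi>c[OF b] \<phi>\<psi>[OF b] by simp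
  have "is_biproduct C X Y B (\<lambda>x\<in>carrier X. \<phi> (x, \<zero>\<^bsub>Y\<^esub>)) (\<lambda>y\<in>carrier Y. \<phi> (\<zero>\<^bsub>X\<^esub>, y))
    (\<lambda>b\<in>carrier B. fst (\<psi> b)) (\<lambda>b\<in>carrier B. snd (\<psi> b))"
    unfolding is_biproduct_def
    by (intro conjI i j p q) (simp_all add: B restrict_eq_iff \<phi>c \<psi>c \<psi>\<phi> sum)
  then show ?thesis by blast
qed

lemma is_abelian: "abelian_category C"
proof (intro abelian_category.intro is_preadditive abelian_category_axioms.intro)
  obtain M where M: "P M" using P_nonempty by blast
  interpret M: Module.module R M by (rule P_module[OF M])
  define Z where "Z = submodule_as_module M {\<zero>\<^bsub>M\<^esub>}"
  have "submodule {\<zero>\<^bsub>M\<^esub>} R M" by (rule M.submoduleI) auto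
  then have Z: "P Z" unfolding Z_def by (rule P_sub[OF M])
  have cZ: "carrier Z = {\<zero>\<^bsub>Z\<^esub>}" by (simp add: Z_def)
  have "zero_object C Z"
    unfolding zero_object_def
  proof (intro conjI ballI)
    fix X assume "X \<in> obj C"
    then have X: "P X" by simp
    have a: "(\<lambda>x\<in>carrier X. \<zero>\<^bsub>Z\<^esub>) \<in> arr C X Z" by (rule arr_restrict[OF X zero_hom[OF P_module[OF Z]]])
    show "\<exists>!f. f \<in> arr C X Z"
    proof (rule ex1I[of "\<lambda>f. f \<in> arr C X Z", OF a])
      fix f assume f: "f \<in> arr C X Z"
      show "f = (\<lambda>x\<in>carrier X. \<zero>\<^bsub>Z\<^esub>)"
        by (rule arr_eqI[OF f a]) (use arr_closed[OF f] cZ in auto)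
    qed
    have b: "(\<lambda>x\<in>carrier Z. \<zero>\<^bsub>X\<^esub>) \<in> arr C Z X" by (rule arr_restrict[OF Z zero_hom[OF P_module[OF X]]])
    show "\<exists>!f. f \<in> arr C Z X"
    proof (rule ex1I[of "\<lambda>f. f \<in> arr C Z X", OF b])
      fix f assume f: "f \<in> arr C Z X"
      show "f = (\<lambda>x\<in>carrier Z. \<zero>\<^bsub>X\<^esub>)"
        by (rule arr_eqI[OF f b]) (use arr_zero_closed[OF Z f X] cZ in auto)
    qed
  qed (use Z in simp)
  then show "\<exists>Z. zero_object C Z" by blast
next
  fix X Y assume "X \<in> obj C" "Y \<in> obj C"
  then show "\<exists>B i j p q. is_biproduct C X Y B i j p q" using exists_biproduct by simp
next
  fix X Y f assume "X \<in> obj C" "Y \<in> obj C" and f: "f \<in> arr C X Y"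
  then have X: "P X" and Y: "P Y" by auto
  show "\<exists>K k. is_kernel C X Y f K k" using kernel_inclusion(3)[OF X Y f] by blast
  obtain Q p where Q: "P Q" and p: "p \<in> arr C Y Q" "p ` carrier Y = carrier Q"
    and ker: "\<forall>y\<in>carrier Y. p y = \<zero>\<^bsub>Q\<^esub> \<longleftrightarrow> y \<in> f ` carrier X"
    using quotient_of_image[OF X Y f] by metis
  have "is_cokernel C X Y f Q p" by (rule cokernel_of_surjection[OF X Y Q f p ker[rule_format]])
  then show "\<exists>Q q. is_cokernel C X Y f Q q" by blast
next
  fix X Y f assume "X \<in> obj C" "Y \<in> obj C" and m: "mono_arr C X Y f"
  then have X: "P X" and Y: "P Y" by auto
  have f: "f \<in> arr C X Y" "inj_on f (carrier X)" using m mono_iff_inj[OF X Y] by auto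
  obtain Q p where Q: "P Q" and p: "p \<in> arr C Y Q" "\<forall>y\<in>carrier Y. p y = \<zero>\<^bsub>Q\<^esub> \<longleftrightarrow> y \<in> f ` carrier X"
    using quotient_of_image[OF X Y f(1)] by metis
  have "is_kernel C Y Q p X f" by (rule kernel_of_injection[OF X Y Q f p(1) p(2)[rule_format]])
  then show "\<exists>Z\<in>obj C. \<exists>g\<in>arr C Y Z. is_kernel C Y Z g X f" using Q p(1) C_simps(1) by blast
next
  fix X Y f assume "X \<in> obj C" "Y \<in> obj C" and e: "epi_arr C X Y f"
  then have X: "P X" and Y: "P Y" by auto
  have f: "f \<in> arr C X Y" "f ` carrier X = carrier Y" using e epi_iff_surj[OF X Y] by auto
  define K where "K = submodule_as_module X {x \<in> carrier X. f x = \<zero>\<^bsub>Y\<^esub>}"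
  note ker = kernel_inclusion[OF X Y f(1), folded K_def]
  have "is_cokernel C K X (\<lambda>x\<in>carrier K. x) Y f"
    by (rule cokernel_of_surjection[OF ker(1) X Y ker(2) f]) (auto simp: K_def)
  then show "\<exists>W\<in>obj C. \<exists>g\<in>arr C W X. is_cokernel C W X g Y f" using ker(1,2) C_simps(1) by blast
qed

text \<open>Arrows are extensional, module homomorphisms in general are not; restriction to the
  carrier translates the lifting property into one about arbitrary homomorphisms.\<close>

lemma projective_object_iff:
  "projective_object C M \<longleftrightarrow> P M \<and> (\<forall>X Y e f. P X \<longrightarrow> P Y \<longrightarrow> e \<in> module_homs R X Y \<longrightarrow>
    e ` carrier X = carrier Y \<longrightarrow> f \<in> module_homs R M Y \<longrightarrow> (\<exists>g\<in>module_homs R M X. \<forall>x\<in>carrier M. e (g x) = f x))"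
    (is "_ \<longleftrightarrow> P M \<and> ?lift")
proof
  assume p: "projective_object C M"
  then have M: "P M" by (simp add: projective_object_def)
  have ?lift
  proof (intro allI impI)
    fix X Y e f assume X: "P X" and Y: "P Y" and e: "e \<in> module_homs R X Y" "e ` carrier X = carrier Y"
      and f: "f \<in> module_homs R M Y"
    have "epi_arr C X Y (restrict e (carrier X))"
      unfolding epi_iff_surj[OF X Y] using arr_restrict[OF X e(1)] e(2) by simp
    moreover note arr_restrict[OF M f]
    ultimately obtain g where g: "g \<in> arr C M X" "cmp C M X Y (restrict e (carrier X)) g = restrict f (carrier M)"
      using p X Y unfolding projective_object_def by (metis C_simps(1))
    have "e (g x) = f x" if x: "x \<in> carrier M" for x
    proof -
      have "cmp C M X Y (restrict e (carrier X)) g x = f x" using g(2) x by simp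
      then show ?thesis using x arr_closed[OF g(1) x] by simp
    qed
    then show "\<exists>g\<in>module_homs R M X. \<forall>x\<in>carrier M. e (g x) = f x" using arr_hom[OF g(1)] by blast
  qed
  then show "P M \<and> ?lift" using M by blast
next
  assume a: "P M \<and> ?lift"
  then have M: "P M" ..
  show "projective_object C M"
    unfolding projective_object_def
  proof (intro conjI ballI allI impI)
    fix X Y e f assume "X \<in> obj C" "Y \<in> obj C" and "epi_arr C X Y e \<and> f \<in> arr C M Y"
    then have X: "P X" and Y: "P Y" and e: "epi_arr C X Y e" and f: "f \<in> arr C M Y" by auto
    have e': "e \<in> arr C X Y" "e ` carrier X = carrier Y" using e epi_iff_surj[OF X Y] by auto
    obtain g where g: "g \<in> module_homs R M X" "\<forall>x\<in>carrier M. e (g x) = f x"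
      using a X Y arr_hom[OF e'(1)] e'(2) arr_hom[OF f] by blast
    have "cmp C M X Y e (restrict g (carrier M)) = f"
      by (rule extensionalityI[of _ "carrier M"]) (use f g(2) in auto)
    then show "\<exists>g\<in>arr C M X. cmp C M X Y e g = f" using arr_restrict[OF M g(1)] by blast
  qed (use M in simp)
qed

lemmas projective_objectD = projective_object_iff[THEN iffD1, THEN conjunct2, rule_format]

lemma injective_object_iff:
  "injective_object C M \<longleftrightarrow> P M \<and> (\<forall>X Y i f. P X \<longrightarrow> P Y \<longrightarrow> i \<in> module_homs R X Y \<longrightarrow>
    inj_on i (carrier X) \<longrightarrow> f \<in> module_homs R X M \<longrightarrow> (\<exists>g\<in>module_homs R Y M. \<forall>x\<in>carrier X. g (i x) = f x))"
    (is "_ \<longleftrightarrow> P M \<and> ?ext")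
proof
  assume p: "injective_object C M"
  then have M: "P M" by (simp add: injective_object_def)
  have ?ext
  proof (intro allI impI)
    fix X Y i f assume X: "P X" and Y: "P Y" and i: "i \<in> module_homs R X Y" "inj_on i (carrier X)"
      and f: "f \<in> module_homs R X M"
    have "mono_arr C X Y (restrict i (carrier X))"
      unfolding mono_iff_inj[OF X Y] using arr_restrict[OF X i(1)] i(2) by (simp add: inj_on_restrict_eq)
    moreover note arr_restrict[OF X f]
    ultimately obtain g where g: "g \<in> arr C Y M" "cmp C X Y M g (restrict i (carrier X)) = restrict f (carrier X)"
      using p X Y unfolding injective_object_def by (metis C_simps(1))
    have "g (i x) = f x" if x: "x \<in> carrier X" for x
    proof -
      have "cmp C X Y M g (restrict i (carrier X)) x = f x" using g(2) x by simp
      then show ?thesis using x by simp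
    qed
    then show "\<exists>g\<in>module_homs R Y M. \<forall>x\<in>carrier X. g (i x) = f x" using arr_hom[OF g(1)] by blast
  qed
  then show "P M \<and> ?ext" using M by blast
next
  assume a: "P M \<and> ?ext"
  then have M: "P M" ..
  show "injective_object C M"
    unfolding injective_object_def
  proof (intro conjI ballI allI impI)
    fix X Y i f assume "X \<in> obj C" "Y \<in> obj C" and "mono_arr C X Y i \<and> f \<in> arr C X M"
    then have X: "P X" and Y: "P Y" and i: "mono_arr C X Y i" and f: "f \<in> arr C X M" by auto
    have i': "i \<in> arr C X Y" "inj_on i (carrier X)" using i mono_iff_inj[OF X Y] by auto
    obtain g where g: "g \<in> module_homs R Y M" "\<forall>x\<in>carrier X. g (i x) = f x"
      using a X Y arr_hom[OF i'(1)] i'(2) arr_hom[OF f] by blast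
    have "cmp C X Y M (restrict g (carrier Y)) i = f"
      by (rule extensionalityI[of _ "carrier X"]) (use f g(2) arr_closed[OF i'(1)] in auto)
    then show "\<exists>g\<in>arr C Y M. cmp C X Y M g i = f" using arr_restrict[OF Y g(1)] by blast
  qed (use M in simp)
qed

lemmas injective_objectD = injective_object_iff[THEN iffD1, THEN conjunct2, rule_format]

end

section \<open>The category of multibasic modules\<close>

lemma multibasic_transport:
  fixes M :: "(real \<Rightarrow> bit, 'b) module"
  assumes M: "multibasic_module hahn_ring M" and small: "carrier hahn_ring \<lesssim> (UNIV :: 'u set)"
  shows "\<exists>(M' :: (real \<Rightarrow> bit, 'u) module) \<phi>. multibasic_module hahn_ring M' \<and>
    \<phi> \<in> module_homs hahn_ring M M' \<and> bij_betw \<phi> (carrier M) (carrier M')"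
proof -
  have "carrier M \<lesssim> (UNIV :: 'u set)" using multibasic_lepoll[OF M] small lepoll_trans by blast
  then obtain M' :: "(real \<Rightarrow> bit, 'u) module" and \<phi> where *: "Module.module hahn_ring M'"
    "\<phi> \<in> module_homs hahn_ring M M'" "bij_betw \<phi> (carrier M) (carrier M')"
    using transport_module[OF multibasic_module_module[OF M]] by blast
  have "multibasic_module hahn_ring M'"
    by (rule multibasic_surjective_image[OF M *(1,2) bij_betw_imp_surj_on[OF *(3)]])
  then show ?thesis using * by blast
qed

lemma multibasic_prod:
  assumes M: "multibasic_module hahn_ring M" and N: "multibasic_module hahn_ring N"
  shows "multibasic_module hahn_ring (prod_module M N)"
proof -
  note mM = multibasic_module_module[OF M] and mN = multibasic_module_module[OF N]
  interpret M: hmodule M by (rule hmoduleI[OF mM])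
  interpret N: hmodule N by (rule hmoduleI[OF mN])
  have "short_exact hahn_ring M (\<lambda>x. (x, \<zero>\<^bsub>N\<^esub>)) (prod_module M N) snd N"
    unfolding short_exact_def
  proof (intro conjI mM mN module_prod)
    show "(\<lambda>x. (x, \<zero>\<^bsub>N\<^esub>)) \<in> module_homs hahn_ring M (prod_module M N)"
      by (rule module_homsI) auto
    show "snd \<in> module_homs hahn_ring (prod_module M N) N" by (rule module_homsI) auto
    show "snd ` carrier (prod_module M N) = carrier N" using M.zero_closed by force
  qed (auto simp: inj_on_def)
  then show ?thesis by (rule multibasic_extension[OF _ M N])
qed

lemma torsion_free_transport:
  assumes "multibasic_module hahn_ring M" "torsion_free M" "multibasic_module hahn_ring M'"
    and \<phi>: "\<phi> \<in> module_homs hahn_ring M M'" "bij_betw \<phi> (carrier M) (carrier M')"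
  shows "torsion_free M'"
proof (rule torsion_free_injective[OF _ _ _ _ assms(2)])
  show "inv_into (carrier M) \<phi> \<in> module_homs hahn_ring M' M"
    by (rule hom_inverse[OF \<phi>(1) multibasic_module_module[OF assms(1)] \<phi>(2)])
  show "inj_on (inv_into (carrier M) \<phi>) (carrier M')"
    by (rule inj_on_inv_into) (use \<phi>(2) in \<open>simp add: bij_betw_def\<close>)
qed (use assms multibasic_module_module in auto)

context
  assumes smallu: "carrier hahn_ring \<lesssim> (UNIV :: 'u set)"
    and smallv: "carrier hahn_ring \<lesssim> (UNIV :: 'v set)"
begin

interpretation B: module_subcategory hahn_ring "multibasic_module hahn_ring :: (real \<Rightarrow> bit, 'u) module \<Rightarrow> bool"
proof (rule module_subcategory.intro)
  fix M N :: "(real \<Rightarrow> bit, 'u) module"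
  assume M: "multibasic_module hahn_ring M" and N: "multibasic_module hahn_ring N"
  show "\<exists>B \<phi>. multibasic_module hahn_ring B \<and> \<phi> \<in> module_homs hahn_ring (prod_module M N) (B :: (real \<Rightarrow> bit, 'u) module) \<and>
      bij_betw \<phi> (carrier M \<times> carrier N) (carrier B)"
    using multibasic_transport[OF multibasic_prod[OF M N] smallu] by simp
next
  fix M :: "(real \<Rightarrow> bit, 'u) module" and N
  assume M: "multibasic_module hahn_ring M" and N: "submodule N hahn_ring M"
  show "multibasic_module hahn_ring (submodule_as_module M N)" by (rule multibasic_submodule[OF M N])
  note mM = multibasic_module_module[OF M]
  obtain Q :: "(real \<Rightarrow> bit, 'u) module" and \<phi> where Q: "multibasic_module hahn_ring Q"
    and \<phi>: "\<phi> \<in> module_homs hahn_ring (quotient_module M N) Q" "bij_betw \<phi> (carrier (quotient_module M N)) (carrier Q)"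
    using multibasic_transport[OF multibasic_quotient[OF M N] smallu] by blast
  note mQ = module_quotient[OF mM N] and p = quotient_hom[OF mM N]
  let ?p = "\<lambda>x. \<phi> (N +>\<^bsub>M\<^esub> x)"
  have "?p ` carrier M = \<phi> ` ((\<lambda>x. N +>\<^bsub>M\<^esub> x) ` carrier M)" by (simp add: image_image)
  also have "\<dots> = carrier Q" using quotient_surj[OF mM N] bij_betw_imp_surj_on[OF \<phi>(2)] by simp
  finally have surj: "?p ` carrier M = carrier Q" .
  have "?p x = \<zero>\<^bsub>Q\<^esub> \<longleftrightarrow> x \<in> N" if x: "x \<in> carrier M" for x
  proof -
    have "?p x = \<zero>\<^bsub>Q\<^esub> \<longleftrightarrow> N +>\<^bsub>M\<^esub> x = \<zero>\<^bsub>quotient_module M N\<^esub>"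
      using bij_betw_imp_inj_on[OF \<phi>(2)] hom_closed[OF p x] hom_zero[OF \<phi>(1) mQ multibasic_module_module[OF Q]]
      unfolding hom_inj_iff[OF \<phi>(1) mQ multibasic_module_module[OF Q]] by auto
    then show ?thesis using quotient_zero_iff[OF mM N x] by simp
  qed
  then show "\<exists>Q p. multibasic_module hahn_ring Q \<and> p \<in> module_homs hahn_ring M (Q :: (real \<Rightarrow> bit, 'u) module) \<and>
      p ` carrier M = carrier Q \<and> (\<forall>x\<in>carrier M. p x = \<zero>\<^bsub>Q\<^esub> \<longleftrightarrow> x \<in> N)"
    using Q surj hom_comp[OF p \<phi>(1)] by (intro exI[of _ Q] exI[of _ ?p]) simp
next
  have "multibasic_module hahn_ring (tuple_module {} (\<lambda>_. UNIV))" by (rule multibasic_tuple) auto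
  from multibasic_transport[OF this smallu] show "\<exists>M :: (real \<Rightarrow> bit, 'u) module. multibasic_module hahn_ring M" by blast
qed (rule multibasic_module_module)

lemma B_category: "B.C = multibasic_category TYPE('u) hahn_ring"
  by (simp add: B.C_def multibasic_category_def)

lemma torsion_free_cover:
  fixes X :: "(real \<Rightarrow> bit, 'u) module"
  assumes X: "multibasic_module hahn_ring X"
  shows "\<exists>(F :: (real \<Rightarrow> bit, 'u) module) e. multibasic_module hahn_ring F \<and> torsion_free F \<and>
    e \<in> module_homs hahn_ring F X \<and> e ` carrier F = carrier X"
proof -
  note mX = multibasic_module_module[OF X]
  interpret X: hmodule X by (rule hmoduleI[OF mX])
  obtain S :: "nat set" and J h where H: "homs_on X S J h" and XX: "carrier X = comb X S h ` tuples S J"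
    using X.presented_if_multibasic[OF X] unfolding presented_def by blast
  note S = homs_onD(1)[OF H] and J = homs_onD(2)[OF H]
  let ?F = "tuple_module S J"
  have mbF: "multibasic_module hahn_ring ?F" by (rule multibasic_tuple[OF S J])
  have \<phi>: "comb X S h \<in> module_homs hahn_ring ?F X" by (rule comb_hom[OF S J mX H])
  have surj: "comb X S h ` carrier ?F = carrier X" by (rule X.comb_surj_tuple[OF H XX])
  obtain F :: "(real \<Rightarrow> bit, 'u) module" and t where F: "multibasic_module hahn_ring F"
    and t: "t \<in> module_homs hahn_ring ?F F" "bij_betw t (carrier ?F) (carrier F)"
    using multibasic_transport[OF mbF smallu] by blast
  let ?e = "\<lambda>x. comb X S h (inv_into (carrier ?F) t x)"
  have e: "?e \<in> module_homs hahn_ring F X"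
    by (rule hom_comp[OF hom_inverse[OF t(1) multibasic_module_module[OF mbF] t(2)] \<phi>])
  have "?e ` carrier F = comb X S h ` (inv_into (carrier ?F) t ` carrier F)" by (simp only: image_image)
  also have "\<dots> = carrier X" using bij_betw_imp_surj_on[OF bij_betw_inv_into[OF t(2)]] surj by simp
  finally show ?thesis using F e torsion_free_transport[OF mbF torsion_free_tuple F t] by blast
qed

text \<open>A projective object is a retract of its torsion-free cover and hence embeds in a
  torsion-free module; the converse is the lifting property of products of submodules of K.\<close>

lemma projective_iff_torsion_free:
  fixes X :: "(real \<Rightarrow> bit, 'u) module"
  shows "projective_object B.C X \<longleftrightarrow> multibasic_module hahn_ring X \<and> torsion_free X"
proof
  assume p: "projective_object B.C X"
  then have X: "multibasic_module hahn_ring X" by (simp add: projective_object_def)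
  obtain F :: "(real \<Rightarrow> bit, 'u) module" and e where F: "multibasic_module hahn_ring F" "torsion_free F"
    and e: "e \<in> module_homs hahn_ring F X" "e ` carrier F = carrier X" using torsion_free_cover[OF X] by blast
  have "(\<lambda>x. x) \<in> module_homs hahn_ring X X" by (rule module_homsI) auto
  then obtain g where g: "g \<in> module_homs hahn_ring X F" "\<forall>x\<in>carrier X. e (g x) = x" using B.projective_objectD[OF p F(1) X e] by blast
  have "inj_on g (carrier X)" by (rule inj_on_inverseI[of _ e]) (use g(2) in blast)
  then have "torsion_free X"
    using torsion_free_injective[OF g(1) _ multibasic_module_module[OF X] multibasic_module_module[OF F(1)] F(2)] by blast
  then show "multibasic_module hahn_ring X \<and> torsion_free X" using X by blast
next
  assume X: "multibasic_module hahn_ring X \<and> torsion_free X"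
  show "projective_object B.C X"
    unfolding B.projective_object_iff
  proof (intro conjI allI impI)
    fix Y Z :: "(real \<Rightarrow> bit, 'u) module" and e f
    assume "multibasic_module hahn_ring Y" "multibasic_module hahn_ring Z" "e \<in> module_homs hahn_ring Y Z"
      "e ` carrier Y = carrier Z" "f \<in> module_homs hahn_ring X Z"
    then show "\<exists>g\<in>module_homs hahn_ring X Y. \<forall>x\<in>carrier X. e (g x) = f x"
      by (intro torsion_free_lift multibasic_module_module) (use X in blast)+
  qed (use X in blast)
qed

text \<open>K^S / L is injective over A and multibasic as a quotient of K^S; its copy in the
  universe is a retract of it and therefore still injective.\<close>

lemma injective_cover:
  fixes X :: "(real \<Rightarrow> bit, 'u) module"
  assumes X: "multibasic_module hahn_ring X"
  shows "\<exists>(E :: (real \<Rightarrow> bit, 'u) module) i. multibasic_module hahn_ring E \<and> injective_module TYPE('v) hahn_ring E \<and>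
    i \<in> module_homs hahn_ring X E \<and> inj_on i (carrier X)"
proof -
  obtain S :: "nat set" and L g where S: "finite S" and L: "submodule L hahn_ring (tuple_module S (\<lambda>_. UNIV))"
    and g: "g \<in> module_homs hahn_ring X (quotient_module (tuple_module S (\<lambda>_. UNIV)) L)" "inj_on g (carrier X)"
    using multibasic_embeds_injective[OF X] by blast
  let ?E = "quotient_module (tuple_module S (\<lambda>_. UNIV)) L"
  have mbE: "multibasic_module hahn_ring ?E"
    by (rule multibasic_quotient[OF multibasic_tuple[OF S] L]) (rule osub_UNIV)
  note mE = multibasic_module_module[OF mbE]
  obtain E :: "(real \<Rightarrow> bit, 'u) module" and t where E: "multibasic_module hahn_ring E"
    and t: "t \<in> module_homs hahn_ring ?E E" "bij_betw t (carrier ?E) (carrier E)"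
    using multibasic_transport[OF mbE smallu] by blast
  have "injective_module TYPE('v) hahn_ring E"
  proof (rule injective_retract[OF injective_tuple_quotient[OF S L] multibasic_module_module[OF E] hom_inverse[OF t(1) mE t(2)] t(1)])
    show "t (inv_into (carrier ?E) t x) = x" if "x \<in> carrier E" for x
      using f_inv_into_f[of x t "carrier ?E"] that bij_betw_imp_surj_on[OF t(2)] by simp
  qed
  moreover have "inj_on (\<lambda>x. t (g x)) (carrier X)"
  proof (rule inj_onI)
    fix x y assume xy: "x \<in> carrier X" "y \<in> carrier X" "t (g x) = t (g y)"
    then have "g x = g y" using bij_betw_imp_inj_on[OF t(2)] hom_closed[OF g(1)] by (metis inj_onD)
    then show "x = y" using g(2) xy by (metis inj_onD)
  qed
  ultimately show ?thesis using E hom_comp[OF g(1) t(1)] by blast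
qed

text \<open>An injective object is a retract of an object that is injective over A, hence itself
  injective over A. Conversely, all objects of the category fit into \<open>'v\<close>, where
  injectivity of modules is tested.\<close>

lemma injective_iff_injective_module:
  fixes I :: "(real \<Rightarrow> bit, 'u) module"
  shows "injective_object B.C I \<longleftrightarrow> multibasic_module hahn_ring I \<and> injective_module TYPE('v) hahn_ring I"
proof
  assume p: "injective_object B.C I"
  then have I: "multibasic_module hahn_ring I" by (simp add: injective_object_def)
  obtain E :: "(real \<Rightarrow> bit, 'u) module" and i where E: "multibasic_module hahn_ring E" "injective_module TYPE('v) hahn_ring E"
    and i: "i \<in> module_homs hahn_ring I E" "inj_on i (carrier I)" using injective_cover[OF I] by blast
  have "(\<lambda>x. x) \<in> module_homs hahn_ring I I" by (rule module_homsI) auto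
  then obtain r where r: "r \<in> module_homs hahn_ring E I" "\<forall>x\<in>carrier I. r (i x) = x" using B.injective_objectD[OF p I E(1) i] by blast
  have "injective_module TYPE('v) hahn_ring I"
    by (rule injective_retract[OF E(2) multibasic_module_module[OF I] i(1) r(1)]) (use r(2) in blast)
  then show "multibasic_module hahn_ring I \<and> injective_module TYPE('v) hahn_ring I" using I by blast
next
  assume I: "multibasic_module hahn_ring I \<and> injective_module TYPE('v) hahn_ring I"
  have small: "carrier X \<lesssim> (UNIV :: 'v set)" if "multibasic_module hahn_ring X" for X :: "(real \<Rightarrow> bit, 'u) module"
    using multibasic_lepoll[OF that] smallv lepoll_trans by blast
  show "injective_object B.C I"
    unfolding B.injective_object_iff
  proof (intro conjI allI impI)
    fix X Y :: "(real \<Rightarrow> bit, 'u) module" and i f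
    assume X: "multibasic_module hahn_ring X" and Y: "multibasic_module hahn_ring Y"
      and i: "i \<in> module_homs hahn_ring X Y" "inj_on i (carrier X)" and f: "f \<in> module_homs hahn_ring X I"
    show "\<exists>g\<in>module_homs hahn_ring Y I. \<forall>x\<in>carrier X. g (i x) = f x"
      by (rule injective_extend[OF _ multibasic_module_module[OF X] multibasic_module_module[OF Y] small[OF X] small[OF Y] i f])
        (use I in blast)
  qed (use I in blast)
qed

lemma multibasic_enough_projectives: "enough_projectives B.C"
  unfolding enough_projectives_def
proof
  fix X assume "X \<in> obj B.C"
  then have X: "multibasic_module hahn_ring X" by simp
  obtain F :: "(real \<Rightarrow> bit, 'u) module" and e where F: "multibasic_module hahn_ring F" "torsion_free F"
    and e: "e \<in> module_homs hahn_ring F X" "e ` carrier F = carrier X" using torsion_free_cover[OF X] by blast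
  have "epi_arr B.C F X (restrict e (carrier F))"
    unfolding B.epi_iff_surj[OF F(1) X] using B.arr_restrict[OF F(1) e(1)] e(2) by simp
  then show "\<exists>P e. projective_object B.C P \<and> epi_arr B.C P X e"
    using F projective_iff_torsion_free by blast
qed

lemma multibasic_enough_injectives: "enough_injectives B.C"
  unfolding enough_injectives_def
proof
  fix X assume "X \<in> obj B.C"
  then have X: "multibasic_module hahn_ring X" by simp
  obtain E :: "(real \<Rightarrow> bit, 'u) module" and i where E: "multibasic_module hahn_ring E" "injective_module TYPE('v) hahn_ring E"
    and i: "i \<in> module_homs hahn_ring X E" "inj_on i (carrier X)" using injective_cover[OF X] by blast
  have "mono_arr B.C X E (restrict i (carrier X))"
    unfolding B.mono_iff_inj[OF X E(1)] using B.arr_restrict[OF X i(1)] i(2) by (simp add: inj_on_restrict_eq)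
  then show "\<exists>I i. injective_object B.C I \<and> mono_arr B.C X I i"
    using E injective_iff_injective_module by blast
qed

text \<open>The ring itself is projective, but multiplication by \<open>t\<close> on it has no left inverse.\<close>

lemma multibasic_not_frobenius: "\<not> frobenius_category B.C"
proof
  assume frob: "frobenius_category B.C"
  \<comment> \<open>The ring A itself, as tuples with one coordinate.\<close>
  let ?T = "tuple_module {0} (\<lambda>_. {a. integral a})"
  have "osub {a. integral a}" by (auto simp: osub_def integral_add integral_mult)
  then have mbT: "multibasic_module hahn_ring ?T" by (intro multibasic_tuple) auto
  note mT = multibasic_module_module[OF mbT]
  obtain A :: "(real \<Rightarrow> bit, 'u) module" and t where A: "multibasic_module hahn_ring A"
    and t: "t \<in> module_homs hahn_ring ?T A" "bij_betw t (carrier ?T) (carrier A)"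
    using multibasic_transport[OF mbT smallu] by blast
  note mA = multibasic_module_module[OF A]
  interpret A: hmodule A by (rule hmoduleI[OF mA])
  have tfA: "torsion_free A" by (rule torsion_free_transport[OF mbT torsion_free_tuple A t])
  then have "projective_object B.C A" using A projective_iff_torsion_free by blast
  then have inj_A: "injective_object B.C A" using frob A unfolding frobenius_category_def by (metis B.C_simps(1))
  have i1: "integral (tpow 1)" by (simp add: integral_def)
  let ?i = "\<lambda>x. coeff (tpow 1) \<odot>\<^bsub>A\<^esub> x"
  have i: "?i \<in> module_homs hahn_ring A A"
  proof (rule module_homsI)
    show "?i (r \<odot>\<^bsub>A\<^esub> x) = r \<odot>\<^bsub>A\<^esub> ?i x" if r: "r \<in> carrier hahn_ring" and x: "x \<in> carrier A" for r x
    proof -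
      obtain a where a: "integral a" "r = coeff a" using hahn_ring_elem[OF r] by blast
      show ?thesis using A.hs_mult[OF a(1) i1 x] A.hs_mult[OF i1 a(1) x] a(2) by (simp add: mult.commute)
    qed
  qed (use i1 in \<open>auto simp: A.hs_radd\<close>)
  have inj: "inj_on ?i (carrier A)"
    unfolding hom_inj_iff[OF i mA mA]
    using tfA[unfolded torsion_free_def, rule_format, OF i1 tpow_nonzero] by (intro ballI impI)
  have "(\<lambda>x. x) \<in> module_homs hahn_ring A A" by (rule module_homsI) auto
  then obtain g where g: "g \<in> module_homs hahn_ring A A" "\<And>x. x \<in> carrier A \<Longrightarrow> g (?i x) = x"
    using B.injective_objectD[OF inj_A A A i inj] by blast
  have s: "single 0 1 \<in> carrier ?T" by (auto simp: tuples_def single_def)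
  have ts: "t (single 0 1) \<in> carrier A" by (rule hom_closed[OF t(1) s])
  have gc: "g (t (single 0 1)) \<in> carrier A" by (rule hom_closed[OF g(1) ts])
  then have "g (t (single 0 1)) \<in> t ` carrier ?T" by (simp only: bij_betw_imp_surj_on[OF t(2)])
  then obtain y where y: "g (t (single 0 1)) = t y" "y \<in> carrier ?T" by (rule imageE)
  \<comment> \<open>For w the copy of 1, a left inverse \<open>g\<close> of multiplication by the
    monomial gives w = g (tpow 1 w) = tpow 1 (g w). So 1 would be the product of
    \<open>tpow 1\<close> and an integral element, which the valuations exclude.\<close>
  have "t (single 0 1) = g (?i (t (single 0 1)))" using g(2)[OF ts] by simp
  also have "\<dots> = coeff (tpow 1) \<odot>\<^bsub>A\<^esub> t y" using hom_smult[OF g(1) _ ts, of "coeff (tpow 1)"] i1 y(1) by simp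
  also have "\<dots> = t (coeff (tpow 1) \<odot>\<^bsub>?T\<^esub> y)" using hom_smult[OF t(1) _ y(2), of "coeff (tpow 1)"] i1 by simp
  finally have "single 0 1 = coeff (tpow 1) \<odot>\<^bsub>?T\<^esub> y"
  proof (rule inj_onD[OF bij_betw_imp_inj_on[OF t(2)] _ s])
    show "coeff (tpow 1) \<odot>\<^bsub>?T\<^esub> y \<in> carrier ?T" using y(2) i1 by (auto simp: tuples_def integral_mult)
  qed
  from fun_cong[OF this, of 0] have "1 = tpow 1 * y 0" by (simp add: single_def)
  moreover from this have "y 0 \<noteq> 0" by auto
  moreover have "integral (y 0)" using y(2) by (simp add: tuples_def)
  ultimately show False using val_mult[of "tpow 1" "y 0"] by (simp add: integral_def)
qed

lemma multibasic_category_summary: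
  "abelian_category (multibasic_category TYPE('u) hahn_ring)"
  "enough_projectives (multibasic_category TYPE('u) hahn_ring)"
  "enough_injectives (multibasic_category TYPE('u) hahn_ring)"
  "projective_object (multibasic_category TYPE('u) hahn_ring) X \<longleftrightarrow>
    multibasic_module hahn_ring X \<and> flat_module TYPE('v) hahn_ring X"
  "injective_object (multibasic_category TYPE('u) hahn_ring) X \<longleftrightarrow>
    multibasic_module hahn_ring X \<and> injective_module TYPE('v) hahn_ring X"
  "\<not> frobenius_category (multibasic_category TYPE('u) hahn_ring)"
  using B.is_abelian multibasic_enough_projectives multibasic_enough_injectives projective_iff_torsion_free[of X]
    flat_iff_torsion_free[OF _ smallv, of X] injective_iff_injective_module[of X] multibasic_not_frobenius
  unfolding B_category by auto

end

theorem corollary2p1p15: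
  assumes "carrier hahn_ring \<lesssim> (UNIV :: 'u set)"
    and "carrier hahn_ring \<lesssim> (UNIV :: 'v set)"
  shows
    "abelian_category (multibasic_category TYPE('u) hahn_ring) \<and>
     enough_projectives (multibasic_category TYPE('u) hahn_ring) \<and>
     enough_injectives (multibasic_category TYPE('u) hahn_ring) \<and>
     {P. projective_object (multibasic_category TYPE('u) hahn_ring) P} =
       {P. multibasic_module hahn_ring P \<and> flat_module TYPE('v) hahn_ring P} \<and>
     {I. injective_object (multibasic_category TYPE('u) hahn_ring) I} =
       {I. multibasic_module hahn_ring I \<and> injective_module TYPE('v) hahn_ring I} \<and>
     \<not> frobenius_category (multibasic_category TYPE('u) hahn_ring) \<and>
     (\<forall>(M :: (real \<Rightarrow> bit, 'w) module) N.
        multibasic_module hahn_ring M \<and> submodule N hahn_ring M \<longrightarrow>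
        multibasic_module hahn_ring (submodule_as_module M N)) \<and>
     (\<forall>(M :: (real \<Rightarrow> bit, 'w) module) N.
        multibasic_module hahn_ring M \<and> submodule N hahn_ring M \<longrightarrow>
        multibasic_module hahn_ring (quotient_module M N)) \<and>
     (\<forall>(X :: (real \<Rightarrow> bit, 'x) module) (Y :: (real \<Rightarrow> bit, 'y) module)
        (Z :: (real \<Rightarrow> bit, 'z) module) f g.
        short_exact hahn_ring X f Y g Z \<and>
        multibasic_module hahn_ring X \<and> multibasic_module hahn_ring Z \<longrightarrow>
        multibasic_module hahn_ring Y)"
proof (intro conjI allI impI)
  note summary = multibasic_category_summary[OF assms]
  show "abelian_category (multibasic_category TYPE('u) hahn_ring)"
    "enough_projectives (multibasic_category TYPE('u) hahn_ring)"
    "enough_injectives (multibasic_category TYPE('u) hahn_ring)"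
    "\<not> frobenius_category (multibasic_category TYPE('u) hahn_ring)"
    by (rule summary)+
  show "{P. projective_object (multibasic_category TYPE('u) hahn_ring) P} =
      {P. multibasic_module hahn_ring P \<and> flat_module TYPE('v) hahn_ring P}"
    "{I. injective_object (multibasic_category TYPE('u) hahn_ring) I} =
      {I. multibasic_module hahn_ring I \<and> injective_module TYPE('v) hahn_ring I}"
    by (simp_all only: summary)
qed (blast intro: multibasic_submodule multibasic_quotient multibasic_extension)+

end
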